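(* For each prime $p$, there exist $p$ subgroups $\mathcal{G}_{p,0},\mathcal{G}_{p,1},\dots,\mathcal{G}_{p,p-1}$ (called type groups) of the quaternionic group $\mathcal{Q}_p$ satisfying the following properties. (1) For each integer $r$ with $0\le r\le p-1$, each nontrivial element of $\mathcal{G}_{p,r}$ has type $r$. (2) $\mathcal{Q}_p$ is the (internal) free product of the $p$ subgroups $\{\mathcal{G}_{p,r}\}_{0\le r\le p-1}$. (3) If $r^4+r^2+1\not\equiv 0 \pmod p$, then $\mathcal{G}_{p,r}$ is an infinite cyclic group generated by the elementary generator $\overline{g_p}[r]$. In particular, if $p\equiv 2,5\pmod 6$, then $\mathcal{Q}_p$ is freely generated by the $p$ elementary generators. (4) Suppose $p=3$. For $\tau\in\mathbb{F}_3^\times$, the set of upper additive generators $\overline{a_{3,\tau,u}}[f]$ (resp. the set of lower additive generators $\overline{a_{3,\tau,l}}[f]$), $f\in\mathbb{F}_3[x]$, generates an abelian group isomorphic to the additive group $\mathbb{F}_3[x]$. The group $\mathcal{G}_{3,\tau}$ is the free product of the subgroup generated by the upper additive generators $\overline{a_{3,\tau,u}}[f]$ and the subgroup generated by the lower additive generators $\overline{a_{3,\tau,l}}[f]$. In particular $\mathcal{G}_{3,\tau}\cong\mathbb{F}_3[x]*\mathbb{F}_3[x]$. (5) Suppose $p\equiv 1\pmod 6$ and $\tau\in\mathbb{F}_p$ satisfies $\tau^4+\tau^2+1=0$. Then: (a) the set of upper additive generators $\overline{a_{p,\tau,u}}[f]$ (resp. of lower additive generators $\overline{a_{p,\tau,l}}[f]$),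 $f\in\mathbb{F}_p[x]$, generates an abelian group isomorphic to the additive group $\mathbb{F}_p[x]$; (b) the set of upper multiplicative generators $\overline{m_{p,\tau,u}}[a]$ (resp. of lower multiplicative generators $\overline{m_{p,\tau,l}}[a]$) generates an abelian group isomorphic to the unit group $\mathbb{F}_p^\times$; (c) the set of upper (resp. lower) affine generators generates a semidirect product isomorphic to $\mathbb{F}_p[x]\rtimes\mathbb{F}_p^\times$; (d) for $a\in\mathbb{F}_p\setminus\{3\tau+\tau^{-1}\}$, the stable generator $\overline{s_{p,\tau}}[a]$ generates an infinite cyclic group; (e) the group $\mathcal{G}_{p,\tau}$ is generated by a stable generator (for $\tau$) and the set of affine generators (for $\tau$), and is an internal HNN extension in which the upper affine generators and the lower affine generators generate the free product of the two subgroups they respectively generate (this is the base group), and the stable generator plays the role of the stable letter. Concretely, $$\mathcal{G}_{p,\tau}\cong\big(\mathrm{Aff}(\mathbb{F}_p[x])*\mathrm{Aff}(\mathbb{F}_p[x])\big)*_{\alpha_\tau},$$ where the two factors $\mathrm{Aff}(\mathbb{F}_p[x])\cong\mathbb{F}_p[x]\rtimes\mathbb{F}_p^\times$ correspond to the subgroups generated by the upper, respectively lower, affine generators, $\alpha_\tau:(\mathbb{F}_p^\times)_u\to(\mathbb{F}_p^\times)_l$ corresponds to the isomorphism from the group generated by the upper multiplicative generators to the group generated by the lower multiplicative generators, and $*_{\alpha_\tau}$ denotes the HNN extension by $\alpha_\tau$. For $p=3$ there are two isomorphic factors $\mathcal{G}_{3,\tau}$ with $\tau\neq0$. For $p\equiv1\pmod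 6$ there are exactly four isomorphic factors $\mathcal{G}_{p,\tau}$ with $\tau^4+\tau^2+1=0$.
   Context: Let $p$ be a prime. For $f\in\mathbb{F}_p[t,t^{-1}]$ write $\overline f(t)=f(t^{-1})$; $\Phi=1+t+t^{-1}$; square brackets around a matrix denote its class in $\mathrm{PGL}(2,\mathbb{F}_p[t,t^{-1}])=\mathrm{GL}(2,\mathbb{F}_p[t,t^{-1}])/(\text{scalar units})$. The quaternionic group is $$\mathcal{Q}_p=\Big\{M\in\mathrm{PGL}(2,\mathbb{F}_p[t,t^{-1}]): M=\begin{bmatrix}g_1&g_2\\-\Phi\overline{g_2}&\overline{g_1}\end{bmatrix},\ g_1,g_2\in\mathbb{F}_p[t,t^{-1}]\Big\}.$$ A bar over the name of a matrix below ($\overline{g_p}[r]$, $\overline{a_{p,\tau,u}}[f]$, etc.) denotes its class in $\mathrm{PGL}$. Define $\begin{pmatrix}g_1&g_2\\-\Phi\overline{g_2}&\overline{g_1}\end{pmatrix}^\dagger=\begin{pmatrix}\overline{g_1}&-g_2\\\Phi\overline{g_2}&g_1\end{pmatrix}$. Integers $0,\dots,p-1$ are identified with elements of $\mathbb{F}_p$. $\mathbb{F}_p[x]$ is regarded as an additive group, and $\mathrm{Aff}(\mathbb{F}_p[x])\cong\mathbb{F}_p[x]\rtimes\mathbb{F}_p^\times$ is the affine group of the ring $\mathbb{F}_p[x]$. Type. Let $M\in\mathcal{Q}_p$ have a representative $B=\begin{pmatrix}g_1&g_2\\-\Phi\overline{g_2}&\overline{g_1}\end{pmatrix}$ (unique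 up to a nonzero constant). If $g_2\ne0$, write $g_1=a_0t^{m_1}+\dots+a_{n_1-m_1}t^{n_1}$, $g_2=b_0t^{m_2}+\dots+b_{n_2-m_2}t^{n_2}$ with nonzero extreme coefficients. $M$ is upper-balanced if $m_1=m_2$ and $n_1=n_2+1$; lower-balanced if $m_1=m_2-1$ and $n_1=n_2$; balanced if one of these holds; unbalanced otherwise (in particular if $g_2=0$). The type of $M$ is $-a_0b_0^{-1}$ if $M$ is upper-balanced, $-a_0^{-1}b_0$ if $M$ is lower-balanced, and $0$ if $M$ is unbalanced. Elementary generators. For $r\in\mathbb{F}_p$, $g_p[r]=\begin{pmatrix}t-r^2&r\\-r\Phi&t^{-1}-r^2\end{pmatrix}$, of determinant $1+r^2+r^4$. When $1+r^2+r^4\ne0$, $\overline{g_p}[r]$ is the elementary generator. Additive generators, $p=3$. For $\tau\in\mathbb{F}_3^\times$ and $f\in\mathbb{F}_3[x]$: $a_{3,\tau,u}[f]=I+f(t+t^{-1})\begin{pmatrix}1+t^{-1}&0\\0&1+t\end{pmatrix}g_3[\tau]$ (upper), $a_{3,\tau,l}[f]=I+f(t+t^{-1})\begin{pmatrix}1+t&0\\0&1+t^{-1}\end{pmatrix}g_3[\tau]^\dagger$ (lower). For $p\equiv1\pmod 6$ and $\tau\in\mathbb{F}_p$ with $\tau^4+\tau^2+1=0$: Additive generators, for $f\in\mathbb{F}_p[x]$: $a_{p,\tau,u}[f]=I+f(t+t^{-1})\,g_p[\tau]^\dagger\begin{pmatrix}t-t^{-1}&0\\0&0\end{pmatrix}g_p[\tau]$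 (upper), $a_{p,\tau,l}[f]=I+f(t+t^{-1})\,g_p[\tau]\begin{pmatrix}t-t^{-1}&0\\0&0\end{pmatrix}g_p[\tau]^\dagger$ (lower). Multiplicative generators, for $a\in\mathbb{F}_p\setminus\{\pm(\tau+2\tau^{-1})\}$ (equivalently, the determinant $a^2+3\tau^2$ is nonzero): $m_{p,\tau,u}[a]=\begin{pmatrix}\frac{-\tau+at+\tau t^2}{t}&\frac{1+\tau^2t}{t}\\-\Phi(\tau^2+t)&\frac{\tau+at-\tau t^2}{t}\end{pmatrix}$ (upper), $m_{p,\tau,l}[a]=\begin{pmatrix}\frac{-\tau+at+\tau t^2}{t}&\tau^2+t\\-\Phi\frac{1+\tau^2t}{t}&\frac{\tau+at-\tau t^2}{t}\end{pmatrix}$ (lower). Upper (resp. lower) affine generators are the upper (resp. lower) additive and multiplicative generators for $\tau$. Stable generators, for $a\in\mathbb{F}_p\setminus\{3\tau+\tau^{-1}\}$: $$\overline{s_{p,\tau}}[a]=\begin{bmatrix}\frac{-\tau+a_1t+at^2+\tau^{-1}t^3}{t}&\frac{1+a_3t+t^2}{t}\\-\Phi\frac{1+a_3t+t^2}{t}&\frac{\tau^{-1}+at+a_1t^2-\tau t^3}{t^2}\end{bmatrix},\quad a_1=\tau(3-a\tau+6\tau^2),\ a_3=-3\tau^2+\tau a-2.$$ *)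

theory Defs
  imports
    "HOL-Analysis.Analysis"
    "HOL-Algebra.Algebra"
    "HOL-Library.Poly_Mapping"
    "Berlekamp_Zassenhaus.Finite_Field"
begin

section \<open>Groups given by generators and relations\<close>

inductive word_cong :: "('a list \<times> 'a list) set \<Rightarrow> 'a list \<Rightarrow> 'a list \<Rightarrow> bool"
  for R :: "('a list \<times> 'a list) set" where
  rel: "(u, v) \<in> R \<Longrightarrow> word_cong R u v"
| refl: "word_cong R u u"
| sym: "word_cong R u v \<Longrightarrow> word_cong R v u"
| trans: "word_cong R u v \<Longrightarrow> word_cong R v w \<Longrightarrow> word_cong R u w"
| ctxt: "word_cong R u v \<Longrightarrow> word_cong R (x @ u @ y) (x @ v @ y)"

definition word_class :: "('a list \<times> 'a list) set \<Rightarrow> 'a list \<Rightarrow> 'a list set" where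
  "word_class R w = {v. word_cong R w v}"

text \<open>This is the monoid presented by the letters \<open>L\<close> and the relations \<open>R\<close>. In the three uses below
  every letter has an inverse letter modulo \<open>R\<close>, so that the presented monoid is the presented group.\<close>

definition presented :: "'a set \<Rightarrow> ('a list \<times> 'a list) set \<Rightarrow> 'a list set monoid" where
  "presented L R =
     \<lparr>carrier = word_class R ` lists L,
      monoid.mult = (\<lambda>U V. \<Union>u\<in>U. \<Union>v\<in>V. word_class R (u @ v)),
      one = word_class R []\<rparr>"

text \<open>The letters \<open>(i, True)\<close> and \<open>(i, False)\<close> are the \<open>i\<close>-th generator and its inverse.\<close>

definition free_group_rels :: "'i set \<Rightarrow> (('i \<times> bool) list \<times> ('i \<times> bool) list) set" where
  "free_group_rels I = {([(i, b), (i, \<not> b)], []) | i b. i \<in> I}"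

definition free_group :: "'i set \<Rightarrow> ('i \<times> bool) list set monoid" where
  "free_group I = presented (I \<times> UNIV) (free_group_rels I)"

definition free_group_gen :: "'i set \<Rightarrow> 'i \<Rightarrow> ('i \<times> bool) list set" where
  "free_group_gen I i = word_class (free_group_rels I) [(i, True)]"

definition freely_generated_by :: "('a, 'c) monoid_scheme \<Rightarrow> 'i set \<Rightarrow> ('i \<Rightarrow> 'a) \<Rightarrow> bool" where
  "freely_generated_by G I x \<longleftrightarrow>
     (\<exists>\<phi> \<in> iso (free_group I) G. \<forall>i\<in>I. \<phi> (free_group_gen I i) = x i)"

definition free_product_rels ::
    "'i set \<Rightarrow> ('i \<Rightarrow> ('a, 'c) monoid_scheme) \<Rightarrow> (('i \<times> 'a) list \<times> ('i \<times> 'a) list) set" where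
  "free_product_rels I G =
     {([(i, x), (i, y)], [(i, x \<otimes>\<^bsub>G i\<^esub> y)]) | i x y. i \<in> I \<and> x \<in> carrier (G i) \<and> y \<in> carrier (G i)}
     \<union> {([(i, \<one>\<^bsub>G i\<^esub>)], []) | i. i \<in> I}"

definition free_product ::
    "'i set \<Rightarrow> ('i \<Rightarrow> ('a, 'c) monoid_scheme) \<Rightarrow> ('i \<times> 'a) list set monoid" where
  "free_product I G = presented (SIGMA i:I. carrier (G i)) (free_product_rels I G)"

definition free_product_incl ::
    "'i set \<Rightarrow> ('i \<Rightarrow> ('a, 'c) monoid_scheme) \<Rightarrow> 'i \<Rightarrow> 'a \<Rightarrow> ('i \<times> 'a) list set" where
  "free_product_incl I G i x = word_class (free_product_rels I G) [(i, x)]"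

definition internal_free_product ::
    "('a, 'c) monoid_scheme \<Rightarrow> 'i set \<Rightarrow> ('i \<Rightarrow> 'a set) \<Rightarrow> bool" where
  "internal_free_product G I H \<longleftrightarrow>
     (\<forall>i\<in>I. subgroup (H i) G) \<and>
     (\<exists>\<phi> \<in> iso (free_product I (\<lambda>i. G\<lparr>carrier := H i\<rparr>)) G.
        \<forall>i\<in>I. \<forall>x \<in> H i. \<phi> (free_product_incl I (\<lambda>i. G\<lparr>carrier := H i\<rparr>) i x) = x)"

datatype 'a hnn_letter = Base 'a | Stable | Stable_Inv

text \<open>The convention for the stable letter \<open>s\<close> is \<open>s a s\<inverse> = \<alpha> a\<close> for \<open>a\<close> in the associated
  subgroup \<open>A\<close>.\<close>

definition hnn_rels ::
    "('a, 'c) monoid_scheme \<Rightarrow> 'a set \<Rightarrow> ('a \<Rightarrow> 'a) \<Rightarrow> ('a hnn_letter list \<times> 'a hnn_letter list) set" where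
  "hnn_rels G A \<alpha> =
     {([Base x, Base y], [Base (x \<otimes>\<^bsub>G\<^esub> y)]) | x y. x \<in> carrier G \<and> y \<in> carrier G}
     \<union> {([Base \<one>\<^bsub>G\<^esub>], []), ([Stable, Stable_Inv], []), ([Stable_Inv, Stable], [])}
     \<union> {([Stable, Base a, Stable_Inv], [Base (\<alpha> a)]) | a. a \<in> A}"

definition hnn_extension ::
    "('a, 'c) monoid_scheme \<Rightarrow> 'a set \<Rightarrow> ('a \<Rightarrow> 'a) \<Rightarrow> 'a hnn_letter list set monoid" where
  "hnn_extension G A \<alpha> =
     presented (Base ` carrier G \<union> {Stable, Stable_Inv}) (hnn_rels G A \<alpha>)"

definition hnn_incl ::
    "('a, 'c) monoid_scheme \<Rightarrow> 'a set \<Rightarrow> ('a \<Rightarrow> 'a) \<Rightarrow> 'a \<Rightarrow> 'a hnn_letter list set" where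
  "hnn_incl G A \<alpha> x = word_class (hnn_rels G A \<alpha>) [Base x]"

definition hnn_stable ::
    "('a, 'c) monoid_scheme \<Rightarrow> 'a set \<Rightarrow> ('a \<Rightarrow> 'a) \<Rightarrow> 'a hnn_letter list set" where
  "hnn_stable G A \<alpha> = word_class (hnn_rels G A \<alpha>) [Stable]"

text \<open>\<open>G\<close> is the HNN extension of its subgroup \<open>B\<close> with associated subgroups \<open>A\<close> and \<open>C\<close> of \<open>B\<close>,
  associated isomorphism \<open>\<alpha>\<close> from \<open>A\<close> to \<open>C\<close>, and stable letter \<open>s\<close>.\<close>

definition internal_hnn_extension ::
    "('a, 'c) monoid_scheme \<Rightarrow> 'a set \<Rightarrow> 'a set \<Rightarrow> 'a set \<Rightarrow> ('a \<Rightarrow> 'a) \<Rightarrow> 'a \<Rightarrow> bool" where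
  "internal_hnn_extension G B A C \<alpha> s \<longleftrightarrow>
     subgroup B G \<and> subgroup A (G\<lparr>carrier := B\<rparr>) \<and> subgroup C (G\<lparr>carrier := B\<rparr>) \<and>
     \<alpha> \<in> iso (G\<lparr>carrier := A\<rparr>) (G\<lparr>carrier := C\<rparr>) \<and>
     (\<exists>\<phi> \<in> iso (hnn_extension (G\<lparr>carrier := B\<rparr>) A \<alpha>) G.
        (\<forall>b\<in>B. \<phi> (hnn_incl (G\<lparr>carrier := B\<rparr>) A \<alpha> b) = b) \<and>
        \<phi> (hnn_stable (G\<lparr>carrier := B\<rparr>) A \<alpha>) = s)"


section \<open>The groups \<open>k[x]\<close>, \<open>k\<^sup>\<times>\<close> and \<open>Aff(k[x])\<close>\<close>

definition poly_add_group :: "'k::field poly monoid" where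
  "poly_add_group = \<lparr>carrier = UNIV, monoid.mult = (+), one = 0\<rparr>"

definition unit_group :: "'k::field monoid" where
  "unit_group = \<lparr>carrier = UNIV - {0}, monoid.mult = (*), one = 1\<rparr>"

text \<open>The pair \<open>(f, c)\<close> stands for the affine map \<open>z \<mapsto> c z + f\<close>; the units of \<open>k[x]\<close> are the nonzero
  constants.\<close>

definition aff_group :: "('k::field poly \<times> 'k) monoid" where
  "aff_group =
     \<lparr>carrier = UNIV \<times> (UNIV - {0}),
      monoid.mult = (\<lambda>(f, c) (g, d). (f + Polynomial.smult c g, c * d)),
      one = (0, 1)\<rparr>"

definition aff_translations :: "('k::field poly \<times> 'k) set" where
  "aff_translations = {(f, 1) | f. True}"

definition aff_dilations :: "('k::field poly \<times> 'k) set" where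
  "aff_dilations = {(0, c) | c. c \<noteq> 0}"


section \<open>Laurent polynomials and \<open>PGL(2, k[t, t\<inverse>])\<close>\<close>

text \<open>\<open>k[t, t\<inverse>]\<close> is the group ring of the additive group of integers: finitely supported functions
  under convolution.\<close>

type_synonym 'k laurent = "int \<Rightarrow>\<^sub>0 'k"

definition lconst :: "'k::field \<Rightarrow> 'k laurent" where
  "lconst c = Poly_Mapping.single 0 c"

definition lt :: "'k::field laurent" where
  "lt = Poly_Mapping.single 1 1"

definition lti :: "'k::field laurent" where
  "lti = Poly_Mapping.single (- 1) 1"

definition lbar :: "'k::field laurent \<Rightarrow> 'k laurent" where
  "lbar f = Poly_Mapping.map_key uminus f"

definition lPhi :: "'k::field laurent" where
  "lPhi = 1 + lt + lti"

definition lsubst :: "'k::field poly \<Rightarrow> 'k laurent" where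
  "lsubst f = poly (map_poly lconst f) (lt + lti)"

definition mat22 :: "'r \<Rightarrow> 'r \<Rightarrow> 'r \<Rightarrow> 'r \<Rightarrow> 'r::zero ^ 2 ^ 2" where
  "mat22 a b c d = vector [vector [a, b], vector [c, d]]"

definition GL2 :: "('r::comm_ring_1 ^ 2 ^ 2) monoid" where
  "GL2 = \<lparr>carrier = {A. invertible A}, monoid.mult = (**), one = mat 1\<rparr>"

definition unit_scalars :: "('r::comm_ring_1 ^ 2 ^ 2) set" where
  "unit_scalars = {mat u | u. u dvd 1}"

definition PGL2 :: "('r::comm_ring_1 ^ 2 ^ 2) set monoid" where
  "PGL2 = GL2 Mod unit_scalars"

definition pclass :: "'r::comm_ring_1 ^ 2 ^ 2 \<Rightarrow> ('r ^ 2 ^ 2) set" where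
  "pclass A = unit_scalars #>\<^bsub>GL2\<^esub> A"


section \<open>The quaternionic group and types\<close>

definition quat :: "'k::field laurent \<Rightarrow> 'k laurent \<Rightarrow> 'k laurent ^ 2 ^ 2" where
  "quat g1 g2 = mat22 g1 g2 (- (lPhi * lbar g2)) (lbar g1)"

definition quat_group :: "('k::field laurent ^ 2 ^ 2) set monoid" where
  "quat_group = PGL2\<lparr>carrier := {pclass (quat g1 g2) | g1 g2. invertible (quat g1 g2)}\<rparr>"

abbreviation subgrp :: "('k::field laurent ^ 2 ^ 2) set set \<Rightarrow> ('k laurent ^ 2 ^ 2) set monoid" where
  "subgrp H \<equiv> quat_group\<lparr>carrier := H\<rparr>"

definition low_deg :: "'k::field laurent \<Rightarrow> int" where
  "low_deg f = Min (Poly_Mapping.keys f)"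

definition high_deg :: "'k::field laurent \<Rightarrow> int" where
  "high_deg f = Max (Poly_Mapping.keys f)"

definition low_coeff :: "'k::field laurent \<Rightarrow> 'k" where
  "low_coeff f = Poly_Mapping.lookup f (low_deg f)"

text \<open>The guard \<open>g1 \<noteq> 0\<close> is harmless: \<open>quat 0 g2\<close> has determinant \<open>\<Phi> g2 (lbar g2)\<close>, which is not a
  unit.\<close>

definition upper_balanced :: "'k::field laurent \<Rightarrow> 'k laurent \<Rightarrow> bool" where
  "upper_balanced g1 g2 \<longleftrightarrow>
     g1 \<noteq> 0 \<and> g2 \<noteq> 0 \<and> low_deg g1 = low_deg g2 \<and> high_deg g1 = high_deg g2 + 1"

definition lower_balanced :: "'k::field laurent \<Rightarrow> 'k laurent \<Rightarrow> bool" where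
  "lower_balanced g1 g2 \<longleftrightarrow>
     g1 \<noteq> 0 \<and> g2 \<noteq> 0 \<and> low_deg g1 = low_deg g2 - 1 \<and> high_deg g1 = high_deg g2"

definition rep_type :: "'k::field laurent \<Rightarrow> 'k laurent \<Rightarrow> 'k" where
  "rep_type g1 g2 =
     (if upper_balanced g1 g2 then - low_coeff g1 * inverse (low_coeff g2)
      else if lower_balanced g1 g2 then - inverse (low_coeff g1) * low_coeff g2
      else 0)"

text \<open>Quaternionic representatives of an element of the quaternionic group differ by a nonzero
  constant factor, which does not affect \<open>rep_type\<close>.\<close>

definition quat_type :: "('k::field laurent ^ 2 ^ 2) set \<Rightarrow> 'k" where
  "quat_type M = (THE r. \<exists>g1 g2. M = pclass (quat g1 g2) \<and> rep_type g1 g2 = r)"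


section \<open>Generators\<close>

definition elem_mat :: "'k::field \<Rightarrow> 'k laurent ^ 2 ^ 2" where
  "elem_mat r = mat22 (lt - lconst (r ^ 2)) (lconst r) (- (lconst r * lPhi)) (lti - lconst (r ^ 2))"

text \<open>For a matrix of the form \<open>quat g1 g2\<close>, whose first row is \<open>g1, g2\<close>.\<close>

definition dagger :: "'k::field laurent ^ 2 ^ 2 \<Rightarrow> 'k laurent ^ 2 ^ 2" where
  "dagger A = mat22 (lbar (A $ 1 $ 1)) (- (A $ 1 $ 2)) (lPhi * lbar (A $ 1 $ 2)) (A $ 1 $ 1)"

text \<open>Multiplication by \<open>mat c\<close> is multiplication by the scalar \<open>c\<close>. The generators \<open>add3_*\<close>
  are those for \<open>p = 3\<close>, and \<open>add_*\<close> those for \<open>p \<equiv> 1 (mod 6)\<close>.\<close>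

definition add3_upper :: "'k::field \<Rightarrow> 'k poly \<Rightarrow> 'k laurent ^ 2 ^ 2" where
  "add3_upper \<tau> f = mat 1 + mat (lsubst f) ** mat22 (1 + lti) 0 0 (1 + lt) ** elem_mat \<tau>"

definition add3_lower :: "'k::field \<Rightarrow> 'k poly \<Rightarrow> 'k laurent ^ 2 ^ 2" where
  "add3_lower \<tau> f = mat 1 + mat (lsubst f) ** mat22 (1 + lt) 0 0 (1 + lti) ** dagger (elem_mat \<tau>)"

definition add_upper :: "'k::field \<Rightarrow> 'k poly \<Rightarrow> 'k laurent ^ 2 ^ 2" where
  "add_upper \<tau> f =
     mat 1 + mat (lsubst f) ** (dagger (elem_mat \<tau>) ** mat22 (lt - lti) 0 0 0 ** elem_mat \<tau>)"

definition add_lower :: "'k::field \<Rightarrow> 'k poly \<Rightarrow> 'k laurent ^ 2 ^ 2" where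
  "add_lower \<tau> f =
     mat 1 + mat (lsubst f) ** (elem_mat \<tau> ** mat22 (lt - lti) 0 0 0 ** dagger (elem_mat \<tau>))"

definition mult_upper :: "'k::field \<Rightarrow> 'k \<Rightarrow> 'k laurent ^ 2 ^ 2" where
  "mult_upper \<tau> a =
     mat22 (lti * (- lconst \<tau> + lconst a * lt + lconst \<tau> * lt ^ 2))
           (lti * (1 + lconst (\<tau> ^ 2) * lt))
           (- lPhi * (lconst (\<tau> ^ 2) + lt))
           (lti * (lconst \<tau> + lconst a * lt - lconst \<tau> * lt ^ 2))"

definition mult_lower :: "'k::field \<Rightarrow> 'k \<Rightarrow> 'k laurent ^ 2 ^ 2" where
  "mult_lower \<tau> a =
     mat22 (lti * (- lconst \<tau> + lconst a * lt + lconst \<tau> * lt ^ 2))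
           (lconst (\<tau> ^ 2) + lt)
           (- lPhi * (lti * (1 + lconst (\<tau> ^ 2) * lt)))
           (lti * (lconst \<tau> + lconst a * lt - lconst \<tau> * lt ^ 2))"

definition mult_params :: "'k::field \<Rightarrow> 'k set" where
  "mult_params \<tau> = UNIV - {\<tau> + 2 * inverse \<tau>, - (\<tau> + 2 * inverse \<tau>)}"

definition stable_mat :: "'k::field \<Rightarrow> 'k \<Rightarrow> 'k laurent ^ 2 ^ 2" where
  "stable_mat \<tau> a =
     (let a1 = \<tau> * (3 - a * \<tau> + 6 * \<tau> ^ 2); a3 = - 3 * \<tau> ^ 2 + \<tau> * a - 2 in
      mat22 (lti * (- lconst \<tau> + lconst a1 * lt + lconst a * lt ^ 2 + lconst (inverse \<tau>) * lt ^ 3))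
            (lti * (1 + lconst a3 * lt + lt ^ 2))
            (- lPhi * (lti * (1 + lconst a3 * lt + lt ^ 2)))
            (lti ^ 2 * (lconst (inverse \<tau>) + lconst a * lt + lconst a1 * lt ^ 2 - lconst \<tau> * lt ^ 3)))"

definition stable_params :: "'k::field \<Rightarrow> 'k set" where
  "stable_params \<tau> = UNIV - {3 * \<tau> + inverse \<tau>}"

definition add3_upper_gens :: "'k::field \<Rightarrow> ('k laurent ^ 2 ^ 2) set set" where
  "add3_upper_gens \<tau> = {pclass (add3_upper \<tau> f) | f. True}"

definition add3_lower_gens :: "'k::field \<Rightarrow> ('k laurent ^ 2 ^ 2) set set" where
  "add3_lower_gens \<tau> = {pclass (add3_lower \<tau> f) | f. True}"

definition add_upper_gens :: "'k::field \<Rightarrow> ('k laurent ^ 2 ^ 2) set set" where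
  "add_upper_gens \<tau> = {pclass (add_upper \<tau> f) | f. True}"

definition add_lower_gens :: "'k::field \<Rightarrow> ('k laurent ^ 2 ^ 2) set set" where
  "add_lower_gens \<tau> = {pclass (add_lower \<tau> f) | f. True}"

definition mult_upper_gens :: "'k::field \<Rightarrow> ('k laurent ^ 2 ^ 2) set set" where
  "mult_upper_gens \<tau> = {pclass (mult_upper \<tau> a) | a. a \<in> mult_params \<tau>}"

definition mult_lower_gens :: "'k::field \<Rightarrow> ('k laurent ^ 2 ^ 2) set set" where
  "mult_lower_gens \<tau> = {pclass (mult_lower \<tau> a) | a. a \<in> mult_params \<tau>}"

definition aff_upper_gens :: "'k::field \<Rightarrow> ('k laurent ^ 2 ^ 2) set set" where
  "aff_upper_gens \<tau> = add_upper_gens \<tau> \<union> mult_upper_gens \<tau>"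

definition aff_lower_gens :: "'k::field \<Rightarrow> ('k laurent ^ 2 ^ 2) set set" where
  "aff_lower_gens \<tau> = add_lower_gens \<tau> \<union> mult_lower_gens \<tau>"

abbreviation gen :: "('k::field laurent ^ 2 ^ 2) set set \<Rightarrow> ('k laurent ^ 2 ^ 2) set set" where
  "gen S \<equiv> generate quat_group S"

text \<open>\<open>S\<close> generates the semidirect product of the subgroups generated by \<open>N\<close> and \<open>H\<close>, and \<open>\<phi>\<close>
  identifies it with \<open>Aff(k[x]) = k[x] \<rtimes> k\<^sup>\<times>\<close>.\<close>

definition aff_identification ::
    "('k::field laurent ^ 2 ^ 2) set set \<Rightarrow> ('k laurent ^ 2 ^ 2) set set \<Rightarrow> ('k laurent ^ 2 ^ 2) set set \<Rightarrow>
     ('k poly \<times> 'k \<Rightarrow> ('k laurent ^ 2 ^ 2) set) \<Rightarrow> bool" where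
  "aff_identification S N H \<phi> \<longleftrightarrow>
     \<phi> \<in> iso aff_group (subgrp (gen S)) \<and>
     \<phi> ` aff_translations = gen N \<and> \<phi> ` aff_dilations = gen H"

end

theory Submission
  imports Defs
begin

text \<open>The matrices in question form a ring of quaternions, in which an element of the quaternionic group is a
  quaternion of constant norm up to a constant factor. Its type can be read off the lowest coefficients
  of its two entries. Right multiplication by a nontrivial element of the group generated by the generators of type
  \<open>r\<close> turns every quaternion that is not of type \<open>r\<close> into one of type \<open>r\<close>; by ping-pong the type groups
  generate their free product. Conversely, a quaternion of type \<open>r\<close> is made smaller by a generator of type
  \<open>r\<close>, where the size is the number of exponents spanned by the second entry (and for \<open>r = 0\<close> a measure of
  imbalance); descent shows that the type groups generate.

  The structure of a single type group is ping-pong as well. For elementary \<open>r\<close> and in characteristic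
  \<open>3\<close> the zones are the upper and the lower quaternions of type \<open>r\<close>. Otherwise each of them is divided
  once more, into the quaternions that are produced by the stable generator (or its inverse) and the rest:
  an affine generator preserves the first part if it is multiplicative and moves it into the rest if
  it is not, which is Britton's lemma for the HNN extension. All computations with the exceptional
  generators are polynomial identities modulo \<open>\<tau>\<^sup>4 + \<tau>\<^sup>2 + 1\<close> and \<open>t t\<inverse> = 1\<close>.\<close>

section \<open>Presented groups and ping-pong\<close>

text \<open>The points of the ping-pong are the group elements themselves, moved by right
  multiplication; the identity has no type, so it can always serve as the starting point. Elementary
  types work because the lowest coefficients of \<open>x * elem r\<close> depend on those of
  \<open>x\<close> through a single linear form, which vanishes only in the zone of the inverse
  letter. The constant norm ties the highest exponents to the lowest ones, so that one end of a
  quaternion suffices to recognise its type.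

  If \<tau>^4 + \<tau>^2 + 1 = 0, then \<open>elem \<tau>\<close> has norm 0 and leaves the group.
  This zero divisor is the source of the exceptional generators: its conjugate is a common
  eigenvector of the upper affine generators, and it gives coordinates in which they are triangular
  with a constant diagonal and an off-diagonal entry proportional to f(t + 1/t). Types and stable
  zones become comparisons of the lowest exponents of two coordinates, and these comparisons are
  what the stable generator exchanges. The squared difference of the eigenvalues is -12 \<tau>^2; in
  characteristic 3 it vanishes, which leaves only unipotent generators and no stable letter.\<close>

definition evalw :: "('g, 'c) monoid_scheme \<Rightarrow> ('a \<Rightarrow> 'g) \<Rightarrow> 'a list \<Rightarrow> 'g" where
  "evalw G e w = foldr (\<lambda>x y. e x \<otimes>\<^bsub>G\<^esub> y) w \<one>\<^bsub>G\<^esub>"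

lemma evalw_simps [simp]:
  "evalw G e [] = \<one>\<^bsub>G\<^esub>"
  "evalw G e (x # w) = e x \<otimes>\<^bsub>G\<^esub> evalw G e w"
  by (simp_all add: evalw_def)

lemma evalw_closed:
  assumes "group G" "\<And>x. x \<in> L \<Longrightarrow> e x \<in> carrier G" "w \<in> lists L"
  shows "evalw G e w \<in> carrier G"
proof -
  interpret group G by fact
  show ?thesis using assms(3) by (induction w) (auto simp: assms(2))
qed

lemma evalw_append:
  assumes "group G" "\<And>x. x \<in> L \<Longrightarrow> e x \<in> carrier G" "v \<in> lists L" "w \<in> lists L"
  shows "evalw G e (v @ w) = evalw G e v \<otimes>\<^bsub>G\<^esub> evalw G e w"
proof -
  interpret group G by fact
  have cl: "u \<in> lists L \<Longrightarrow> evalw G e u \<in> carrier G" for u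
    using evalw_closed[OF assms(1)] assms(2) by blast
  show ?thesis
    using assms(3) by (induction v) (auto simp: assms(2,4) cl m_assoc)
qed

lemma hd_last_lists: "w \<in> lists A \<Longrightarrow> w \<noteq> [] \<Longrightarrow> hd w \<in> A \<and> last w \<in> A"
  by (simp add: in_lists_conv_set)

section \<open>Word classes and evaluation of words\<close>

lemma word_class_eq_iff: "word_class R u = word_class R v \<longleftrightarrow> word_cong R u v"
  unfolding word_class_def
  by (auto intro: word_cong.refl word_cong.sym word_cong.trans)

lemma word_cong_append:
  assumes "word_cong R u u'" "word_cong R v v'"
  shows "word_cong R (u @ v) (u' @ v')"
  using word_cong.ctxt[OF assms(1), of "[]" v] word_cong.ctxt[OF assms(2), of u' "[]"]
  by (auto intro: word_cong.trans)

lemma word_cong_Cons: "word_cong R u v \<Longrightarrow> word_cong R (x # u) (x # v)"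
  using word_cong.ctxt[of R u v "[x]" "[]"] by simp

lemma word_class_mult:
  "(\<Union>u\<in>word_class R a. \<Union>v\<in>word_class R b. word_class R (u @ v)) = word_class R (a @ b)"
proof -
  have "word_class R (u @ v) = word_class R (a @ b)" if "u \<in> word_class R a" "v \<in> word_class R b" for u v
    using that word_cong_append word_cong.sym unfolding word_class_eq_iff
    by (fastforce simp: word_class_def)
  moreover have "a \<in> word_class R a" "b \<in> word_class R b"
    by (auto simp: word_class_def word_cong.refl)
  ultimately show ?thesis by blast
qed

lemma presented_mult:
  "word_class R a \<otimes>\<^bsub>presented L R\<^esub> word_class R b = word_class R (a @ b)"
  by (simp add: presented_def word_class_mult)

lemma presented_carrier: "carrier (presented L R) = word_class R ` lists L"
  by (simp add: presented_def)

lemma presented_one: "\<one>\<^bsub>presented L R\<^esub> = word_class R []"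
  by (simp add: presented_def)

text \<open>Contexts in \<open>word_cong\<close> are arbitrary words, possibly with letters outside
  \<open>L\<close>, whereas the value is known to be multiplicative only over \<open>L\<close>. The
  induction therefore carries along that congruent words lie in \<open>lists L\<close>
  together.\<close>

lemma evalw_word_cong:
  assumes "group G" and e: "\<And>x. x \<in> L \<Longrightarrow> e x \<in> carrier G"
    and R: "\<And>u v. (u, v) \<in> R \<Longrightarrow> u \<in> lists L \<and> v \<in> lists L"
    and ev: "\<And>u v. (u, v) \<in> R \<Longrightarrow> evalw G e u = evalw G e v"
    and "word_cong R u v"
  shows "(u \<in> lists L \<longleftrightarrow> v \<in> lists L) \<and> (u \<in> lists L \<longrightarrow> evalw G e u = evalw G e v)"
  using assms(5)
proof induction
  case (rel u v)
  then show ?case using R ev by blast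
next
  case (ctxt u v x y)
  have *: "evalw G e (a @ b) = evalw G e a \<otimes>\<^bsub>G\<^esub> evalw G e b" if "a \<in> lists L" "b \<in> lists L" for a b
    using evalw_append[OF assms(1)] e that by blast
  show ?case using ctxt.IH by (auto simp: *)
qed auto

text \<open>\<open>presented\<close> is a priori only a monoid. Inverse letters make it a group and
  reduce injectivity of the evaluation to a trivial kernel, the form in which ping-pong supplies
  it.\<close>

locale presentation = group G for G (structure) +
  fixes L :: "'l set" and R :: "('l list \<times> 'l list) set" and e :: "'l \<Rightarrow> 'a"
  assumes e_closed: "x \<in> L \<Longrightarrow> e x \<in> carrier G"
    and R_words: "(u, v) \<in> R \<Longrightarrow> u \<in> lists L \<and> v \<in> lists L"
    and R_eval: "(u, v) \<in> R \<Longrightarrow> evalw G e u = evalw G e v"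
    and letter_inv: "x \<in> L \<Longrightarrow> \<exists>y\<in>L. word_cong R [x, y] [] \<and> word_cong R [y, x] []"
begin

lemma ev_closed: "w \<in> lists L \<Longrightarrow> evalw G e w \<in> carrier G"
  using evalw_closed[OF is_group] e_closed by blast

lemma ev_append:
  "v \<in> lists L \<Longrightarrow> w \<in> lists L \<Longrightarrow> evalw G e (v @ w) = evalw G e v \<otimes> evalw G e w"
  using evalw_append[OF is_group] e_closed by blast

lemma ev_cong: "word_cong R u v \<Longrightarrow> u \<in> lists L \<Longrightarrow> evalw G e u = evalw G e v"
  using evalw_word_cong[OF is_group] e_closed R_words R_eval by blast

lemma word_inv: "w \<in> lists L \<Longrightarrow> \<exists>v\<in>lists L. word_cong R (w @ v) [] \<and> word_cong R (v @ w) []"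
proof (induction w)
  case Nil
  then show ?case by (auto intro: word_cong.refl)
next
  case (Cons x w)
  then obtain v where v: "v \<in> lists L" "word_cong R (w @ v) []" "word_cong R (v @ w) []" by auto
  obtain y where y: "y \<in> L" "word_cong R [x, y] []" "word_cong R [y, x] []"
    using letter_inv Cons.prems by auto
  have "word_cong R ([x] @ (w @ v) @ [y]) ([x] @ [] @ [y])" by (rule word_cong.ctxt[OF v(2)])
  moreover have "word_cong R (v @ [y, x] @ w) (v @ [] @ w)" by (rule word_cong.ctxt[OF y(3)])
  ultimately show ?case
    using v y by (intro bexI[of _ "v @ [y]"]) (auto intro: word_cong.trans)
qed

lemma group_presented: "group (presented L R)"
proof (rule groupI)
  fix x assume "x \<in> carrier (presented L R)"
  then obtain w where w: "w \<in> lists L" "x = word_class R w" by (auto simp: presented_carrier)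
  then obtain v where "v \<in> lists L" "word_cong R (v @ w) []" using word_inv by blast
  then show "\<exists>y\<in>carrier (presented L R). y \<otimes>\<^bsub>presented L R\<^esub> x = \<one>\<^bsub>presented L R\<^esub>"
    using w by (auto simp: presented_carrier presented_one presented_mult word_class_eq_iff)
qed (auto simp: presented_carrier presented_one presented_mult simp del: in_lists_conv_set
    intro!: imageI)

lemma presented_iso:
  assumes ker: "\<And>w. w \<in> lists L \<Longrightarrow> evalw G e w = \<one> \<Longrightarrow> word_cong R w []"
    and K: "K = evalw G e ` lists L"
  shows "\<exists>\<phi> \<in> iso (presented L R) (G\<lparr>carrier := K\<rparr>). \<forall>w\<in>lists L. \<phi> (word_class R w) = evalw G e w"
proof -
  \<comment> \<open>The choice of the representative is harmless: by \<open>ev_cong\<close> all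
    words of a class have the same value.\<close>
  define \<phi> where "\<phi> U = evalw G e (SOME w. w \<in> U)" for U
  have phi: "\<phi> (word_class R w) = evalw G e w" if "w \<in> lists L" for w
  proof -
    have "(SOME v. v \<in> word_class R w) \<in> word_class R w"
      by (rule someI[of _ w]) (simp add: word_class_def word_cong.refl)
    then show ?thesis using ev_cong that by (simp add: \<phi>_def word_class_def)
  qed
  have inj: "word_class R v = word_class R w"
    if vw: "v \<in> lists L" "w \<in> lists L" "evalw G e v = evalw G e w" for v w
  proof -
    obtain w' where w': "w' \<in> lists L" "word_cong R (w @ w') []" "word_cong R (w' @ w) []"
      using word_inv vw by blast
    have "evalw G e (v @ w') = evalw G e (w @ w')" using vw w' by (simp add: ev_append)
    also have "\<dots> = \<one>" using ev_cong[OF w'(2)] vw w' by simp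
    \<comment> \<open>Since \<open>v @ w'\<close> and \<open>w' @ w\<close> are both trivial,
      \<open>v @ w' @ w\<close> is congruent to \<open>w\<close> and to \<open>v\<close>.\<close>
    finally have "word_cong R (v @ w') []" using ker vw w' by simp
    then have "word_cong R (v @ w' @ w) w" using word_cong.ctxt[of R "v @ w'" "[]" "[]" w] by simp
    moreover have "word_cong R (v @ w' @ w) v" using word_cong.ctxt[OF w'(3), of v "[]"] by simp
    ultimately show ?thesis unfolding word_class_eq_iff
      by (blast intro: word_cong.trans word_cong.sym)
  qed
  have "\<phi> \<in> hom (presented L R) (G\<lparr>carrier := K\<rparr>)"
  proof (rule homI)
    fix U assume "U \<in> carrier (presented L R)"
    then show "\<phi> U \<in> carrier (G\<lparr>carrier := K\<rparr>)"
      unfolding presented_carrier K using phi by fastforce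
  next
    fix U V assume "U \<in> carrier (presented L R)" "V \<in> carrier (presented L R)"
    then obtain u v where uv: "u \<in> lists L" "v \<in> lists L" "U = word_class R u" "V = word_class R v"
      unfolding presented_carrier by blast
    then have "u @ v \<in> lists L" by auto
    then show "\<phi> (U \<otimes>\<^bsub>presented L R\<^esub> V) = \<phi> U \<otimes>\<^bsub>G\<lparr>carrier := K\<rparr>\<^esub> \<phi> V"
      unfolding uv presented_mult phi[OF uv(1)] phi[OF uv(2)] using phi ev_append[OF uv(1,2)] by simp
  qed
  moreover have "inj_on \<phi> (carrier (presented L R))"
  proof (rule inj_onI)
    fix U V assume UV: "U \<in> carrier (presented L R)" "V \<in> carrier (presented L R)" "\<phi> U = \<phi> V"
    then obtain u v where uv: "u \<in> lists L" "v \<in> lists L" "U = word_class R u" "V = word_class R v"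
      unfolding presented_carrier by blast
    then show "U = V" using inj[OF uv(1,2)] UV(3) unfolding uv phi[OF uv(1)] phi[OF uv(2)] by blast
  qed
  moreover have "\<phi> ` carrier (presented L R) = K"
    unfolding presented_carrier K image_image by (rule image_cong[OF HOL.refl]) (rule phi)
  ultimately have "\<phi> \<in> iso (presented L R) (G\<lparr>carrier := K\<rparr>)"
    unfolding iso_def bij_betw_def by simp
  then show ?thesis using phi by blast
qed

end

subsection \<open>Free groups\<close>

text \<open>\<open>T i b\<close> is meant to catch the elements whose reduced word ends in the
  letter \<open>(i, b)\<close>. Multiplication by a letter leads into its zone from everywhere
  except from the zone of the inverse letter, where cancellation could happen.\<close>

locale free_pingpong = group G for G (structure) +
  fixes I :: "'i set" and x :: "'i \<Rightarrow> 'a" and T :: "'i \<Rightarrow> bool \<Rightarrow> 'a \<Rightarrow> bool"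
  assumes x_closed: "i \<in> I \<Longrightarrow> x i \<in> carrier G"
    and T_disj: "\<lbrakk>i \<in> I; j \<in> I; M \<in> carrier G; T i b M; T j c M\<rbrakk> \<Longrightarrow> i = j \<and> b = c"
    and T_step: "\<lbrakk>i \<in> I; M \<in> carrier G; \<not> T i (\<not> b) M\<rbrakk> \<Longrightarrow> T i b (M \<otimes> (if b then x i else inv (x i)))"
    and T_one: "i \<in> I \<Longrightarrow> \<not> T i b \<one>"
begin

definition e :: "'i \<times> bool \<Rightarrow> 'a" where
  "e = (\<lambda>(i, b). if b then x i else inv (x i))"

lemma e_in: "p \<in> I \<times> UNIV \<Longrightarrow> e p \<in> carrier G"
  using x_closed by (auto simp: e_def split: prod.splits)

lemma presentation: "presentation G (I \<times> UNIV) (free_group_rels I) e"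
proof (intro presentation.intro presentation_axioms.intro is_group)
  show "\<exists>q\<in>I \<times> UNIV. word_cong (free_group_rels I) [p, q] [] \<and> word_cong (free_group_rels I) [q, p] []"
    if mem: "p \<in> I \<times> UNIV" for p :: "'i \<times> bool"
  proof -
    obtain i b where p: "p = (i, b)" "i \<in> I" using mem by auto
    have "([(i, c), (i, \<not> c)], []) \<in> free_group_rels I" for c
      using p by (auto simp: free_group_rels_def)
    from word_cong.rel[OF this[of b]] word_cong.rel[OF this[of "\<not> b"]] show ?thesis
      using p by (auto intro!: bexI[of _ "(i, \<not> b)"])
  qed
  show "evalw G e u = evalw G e v" if "(u, v) \<in> free_group_rels I" for u v
    using that by (auto simp: e_def free_group_rels_def x_closed)
  show "u \<in> lists (I \<times> UNIV) \<and> v \<in> lists (I \<times> UNIV)" if "(u, v) \<in> free_group_rels I" for u v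
    using that by (auto simp: free_group_rels_def)
qed (rule e_in)

lemmas ev_closed = presentation.ev_closed[OF presentation]
  and ev_append = presentation.ev_append[OF presentation]
  and ev_cong = presentation.ev_cong[OF presentation]

fun reduced :: "('i \<times> bool) list \<Rightarrow> bool" where
  "reduced [] = True"
| "reduced [p] = (fst p \<in> I)"
| "reduced (p # q # w) = (fst p \<in> I \<and> q \<noteq> (fst p, \<not> snd p) \<and> reduced (q # w))"

lemma reduced_lists: "reduced w \<Longrightarrow> w \<in> lists (I \<times> UNIV)"
  by (induction w rule: reduced.induct) (auto simp: mem_Times_iff)

lemma reduced_exists: "w \<in> lists (I \<times> UNIV) \<Longrightarrow> \<exists>v. reduced v \<and> word_cong (free_group_rels I) w v"
proof (induction w)
  case Nil
  then show ?case by (auto intro: word_cong.refl exI[of _ "[]"])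
next
  case (Cons p w)
  then obtain v where v: "reduced v" "word_cong (free_group_rels I) w v" by auto
  have pv: "word_cong (free_group_rels I) (p # w) (p # v)" by (rule word_cong_Cons[OF v(2)])
  show ?case
  proof (cases "v \<noteq> [] \<and> hd v = (fst p, \<not> snd p)")
    case True
    then obtain v' where v': "v = (fst p, \<not> snd p) # v'" by (cases v) auto
    have "([p, (fst p, \<not> snd p)], []) \<in> free_group_rels I"
      using Cons.prems by (cases p) (auto simp: free_group_rels_def)
    from word_cong.ctxt[OF word_cong.rel[OF this], of "[]" v']
    have "word_cong (free_group_rels I) (p # v) v'" by (simp add: v')
    moreover have "reduced v'" using v(1) v' by (cases v') auto
    ultimately show ?thesis using pv word_cong.trans by blast
  next
    case False
    then have "reduced (p # v)" using v(1) Cons.prems by (cases v) (auto simp: mem_Times_iff)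
    then show ?thesis using pv by blast
  qed
qed

text \<open>Each letter leads into its own zone. By disjointness this is not the zone of the inverse
  of the next letter, which is a different one because the word is reduced; so the argument never
  gets stuck.\<close>

lemma T_reduced:
  assumes "reduced w" "w \<noteq> []" "M \<in> carrier G" "\<not> T (fst (hd w)) (\<not> snd (hd w)) M"
  shows "T (fst (last w)) (snd (last w)) (M \<otimes> evalw G e w)"
  using assms
proof (induction w arbitrary: M rule: reduced.induct)
  case (2 p)
  then show ?case using T_step[of "fst p" M "snd p"] x_closed by (auto simp: e_def split: prod.splits)
next
  case (3 p q w)
  have p: "e p \<in> carrier G" using 3 e_in by (auto simp: mem_Times_iff)
  have "T (fst p) (snd p) (M \<otimes> e p)"
    using 3 T_step[of "fst p" M "snd p"] by (auto simp: e_def split: prod.splits)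
  moreover have "fst p \<in> I" "fst q \<in> I" "q \<noteq> (fst p, \<not> snd p)" "M \<otimes> e p \<in> carrier G"
    using 3 p reduced_lists[of "q # w"] by (auto simp: mem_Times_iff)
  ultimately have "\<not> T (fst q) (\<not> snd q) (M \<otimes> e p)"
    using T_disj[of "fst p" "fst q" "M \<otimes> e p" "snd p" "\<not> snd q"] by (auto simp: prod_eq_iff)
  then have "T (fst (last (q # w))) (snd (last (q # w))) ((M \<otimes> e p) \<otimes> evalw G e (q # w))"
    using 3 p by (intro "3.IH") auto
  then show ?case using p 3 ev_closed[OF reduced_lists[of "q # w"]] by (simp add: m_assoc)
qed auto

lemma free_kernel:
  assumes "w \<in> lists (I \<times> UNIV)" "evalw G e w = \<one>"
  shows "word_cong (free_group_rels I) w []"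
proof -
  obtain v where v: "reduced v" "word_cong (free_group_rels I) w v" using reduced_exists assms by blast
  have "v = []"
  proof (rule ccontr)
    assume "v \<noteq> []"
    then have *: "fst (hd v) \<in> I" "fst (last v) \<in> I" 
    using hd_last_lists[OF reduced_lists[OF v(1)]] by (auto simp: mem_Times_iff)
    have "T (fst (last v)) (snd (last v)) (\<one> \<otimes> evalw G e v)"
      using T_reduced[OF v(1) \<open>v \<noteq> []\<close>, of \<one>] T_one * by simp
    moreover have "evalw G e v = \<one>" using ev_cong[OF v(2)] assms by simp
    ultimately show False using T_one * by simp
  qed
  then show ?thesis using v by simp
qed

lemma eval_words: "evalw G e ` lists (I \<times> UNIV) = generate G (x ` I)"
proof
  have "evalw G e w \<in> generate G (x ` I)" if "w \<in> lists (I \<times> UNIV)" for w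
    using that
  proof (induction w)
    case (Cons p w)
    then have "e p \<in> generate G (x ` I)"
      using generate.incl[of "x (fst p)" "x ` I" G] generate.inv[of "x (fst p)" "x ` I" G]
      by (auto simp: e_def)
    then show ?case using Cons by (auto intro: generate.eng)
  qed (auto intro: generate.one)
  then show "evalw G e ` lists (I \<times> UNIV) \<subseteq> generate G (x ` I)" by blast
  have "g \<in> evalw G e ` lists (I \<times> UNIV)" if "g \<in> generate G (x ` I)" for g
    using that
  proof induction
    case one
    show ?case by (rule image_eqI[of _ _ "[]"]) auto
  next
    case (incl h)
    then obtain i where "i \<in> I" "h = x i" by auto
    then show ?case by (intro image_eqI[of _ _ "[(i, True)]"]) (auto simp: e_def x_closed)
  next
    case (inv h)
    then obtain i where "i \<in> I" "h = x i" by auto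
    then show ?case by (intro image_eqI[of _ _ "[(i, False)]"]) (auto simp: e_def x_closed)
  next
    case (eng h1 h2)
    then obtain v w where "v \<in> lists (I \<times> UNIV)" "w \<in> lists (I \<times> UNIV)" "h1 = evalw G e v" "h2 = evalw G e w"
      by auto
    then show ?case by (intro image_eqI[of _ _ "v @ w"]) (auto simp: ev_append)
  qed
  then show "generate G (x ` I) \<subseteq> evalw G e ` lists (I \<times> UNIV)" by blast
qed

text \<open>The starting point \<open>M\<close> is arbitrary outside the zones, not just the
  identity: in this form a whole cyclic group can act as one factor in the ping-pong between the
  type groups.\<close>

lemma T_generate:
  assumes "M \<in> carrier G" "\<And>i b. i \<in> I \<Longrightarrow> \<not> T i b M" "g \<in> generate G (x ` I)" "g \<noteq> \<one>"
  shows "\<exists>i\<in>I. \<exists>b. T i b (M \<otimes> g)"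
proof -
  obtain w where w: "w \<in> lists (I \<times> UNIV)" "g = evalw G e w" using eval_words assms(3) by blast
  then obtain v where v: "reduced v" "word_cong (free_group_rels I) w v" using reduced_exists by blast
  have g: "g = evalw G e v" using ev_cong[OF v(2)] w by simp
  then have "v \<noteq> []" using assms(4) by auto
  then have *: "fst (hd v) \<in> I" "fst (last v) \<in> I" 
    using hd_last_lists[OF reduced_lists[OF v(1)]] by (auto simp: mem_Times_iff)
  then show ?thesis using T_reduced[OF v(1) \<open>v \<noteq> []\<close> assms(1)] assms(2) g by blast
qed

lemma freely_generated:
  assumes "generate G (x ` I) = carrier G"
  shows "freely_generated_by G I x"
proof -
  obtain \<phi> where "\<phi> \<in> iso (presented (I \<times> UNIV) (free_group_rels I)) (G\<lparr>carrier := carrier G\<rparr>)"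
      and phi: "\<And>w. w \<in> lists (I \<times> UNIV) \<Longrightarrow> \<phi> (word_class (free_group_rels I) w) = evalw G e w"
    using presentation.presented_iso[OF presentation free_kernel HOL.refl] eval_words assms by auto
  then have "\<phi> \<in> iso (free_group I) G" by (simp add: free_group_def)
  moreover have "\<phi> (free_group_gen I i) = x i" if "i \<in> I" for i
    using phi[of "[(i, True)]"] that by (simp add: free_group_gen_def e_def x_closed)
  ultimately show ?thesis unfolding freely_generated_by_def by blast
qed

end

text \<open>If two integer powers agree, then the power with the positive difference as exponent is
  trivial; so nontriviality of the positive powers is enough.\<close>

lemma (in group) cyclic_iso_integer_group:
  assumes "x \<in> carrier G" "\<And>n. x [^] Suc n \<noteq> \<one>"
  shows "G\<lparr>carrier := generate G {x}\<rparr> \<cong> integer_group"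
proof -
  have gen: "generate G {x} = range (\<lambda>k::int. x [^] k)"
    using generate_pow[OF assms(1)] by auto
  have nz: "x [^] k \<noteq> \<one>" if "k > 0" for k :: int
  proof -
    have "x [^] k = x [^] Suc (nat k - 1)" using that int_pow_int[of G x "Suc (nat k - 1)"] by simp
    then show ?thesis using assms(2) by metis
  qed
  have inj: "k = l" if "x [^] k = x [^] l" for k l :: int
  proof (rule ccontr)
    have *: False if "x [^] k = x [^] l" "k < l" for k l :: int
    proof -
      have "x [^] (l - k) = \<one>" using that assms(1) by (simp add: int_pow_diff)
      then show False using nz[of "l - k"] that by simp
    qed
    assume "k \<noteq> l"
    then have "k < l \<or> l < k" by linarith
    then show False using *[OF that] *[OF that[symmetric]] by blast
  qed
  have "(\<lambda>k. x [^] k) \<in> iso integer_group (G\<lparr>carrier := generate G {x}\<rparr>)"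
    unfolding iso_def bij_betw_def hom_def gen
    using assms(1) inj by (auto simp: int_pow_mult inj_on_def integer_group_def)
  then show ?thesis
    using group.iso_sym[OF group_integer_group] by (auto simp: is_iso_def)
qed

subsection \<open>Free products\<close>

text \<open>A nontrivial letter of the \<open>i\<close>-th factor sends everything outside \<open>T i\<close> into \<open>T' i\<close>. The zone \<open>T i\<close> may
  be larger than \<open>T' i\<close>, to leave room for the zones of a stable letter.\<close>

locale fp_pingpong = group G for G :: "('a, 'c) monoid_scheme" (structure) +
  fixes I :: "'i set" and Gs :: "'i \<Rightarrow> ('b, 'd) monoid_scheme" and \<iota> :: "'i \<Rightarrow> 'b \<Rightarrow> 'a"
    and T T' :: "'i \<Rightarrow> 'a \<Rightarrow> bool"
  assumes Gs_group: "i \<in> I \<Longrightarrow> group (Gs i)"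
    and Gs_hom: "i \<in> I \<Longrightarrow> \<iota> i \<in> hom (Gs i) G"
    and T'_imp_T: "T' i M \<Longrightarrow> T i M"
    and T_disj: "\<lbrakk>i \<in> I; j \<in> I; M \<in> carrier G; T i M; T j M\<rbrakk> \<Longrightarrow> i = j"
    and T_step: "\<lbrakk>i \<in> I; M \<in> carrier G; \<not> T i M; x \<in> carrier (Gs i); x \<noteq> \<one>\<^bsub>Gs i\<^esub>\<rbrakk>
      \<Longrightarrow> T' i (M \<otimes> \<iota> i x)"
    and T_one: "i \<in> I \<Longrightarrow> \<not> T i \<one>"
begin

definition L :: "('i \<times> 'b) set" where
  "L = (SIGMA i:I. carrier (Gs i))"

definition e :: "'i \<times> 'b \<Rightarrow> 'a" where
  "e p = \<iota> (fst p) (snd p)"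

abbreviation R :: "(('i \<times> 'b) list \<times> ('i \<times> 'b) list) set" where
  "R \<equiv> free_product_rels I Gs"

lemma Gs_group_hom: "i \<in> I \<Longrightarrow> group_hom (Gs i) G (\<iota> i)"
  by (intro group_hom.intro group_hom_axioms.intro Gs_group Gs_hom is_group)

lemma \<iota>_closed: "i \<in> I \<Longrightarrow> x \<in> carrier (Gs i) \<Longrightarrow> \<iota> i x \<in> carrier G"
  using Gs_hom[of i] by (auto simp: hom_def)

lemma \<iota>_mult:
  "i \<in> I \<Longrightarrow> x \<in> carrier (Gs i) \<Longrightarrow> y \<in> carrier (Gs i) \<Longrightarrow> \<iota> i (x \<otimes>\<^bsub>Gs i\<^esub> y) = \<iota> i x \<otimes> \<iota> i y"
  using Gs_hom[of i] by (auto simp: hom_def)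

lemma \<iota>_one: "i \<in> I \<Longrightarrow> \<iota> i \<one>\<^bsub>Gs i\<^esub> = \<one>"
  using group_hom.hom_one[OF Gs_group_hom] .

lemma \<iota>_inv: "i \<in> I \<Longrightarrow> x \<in> carrier (Gs i) \<Longrightarrow> \<iota> i (inv\<^bsub>Gs i\<^esub> x) = inv (\<iota> i x)"
  using group_hom.hom_inv[OF Gs_group_hom] .

lemma e_in: "p \<in> L \<Longrightarrow> e p \<in> carrier G"
  by (auto simp: e_def L_def \<iota>_closed)

lemma rel_mult:
  "i \<in> I \<Longrightarrow> x \<in> carrier (Gs i) \<Longrightarrow> y \<in> carrier (Gs i) \<Longrightarrow>
    word_cong R ((i, x) # (i, y) # w) ((i, x \<otimes>\<^bsub>Gs i\<^esub> y) # w)"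
  using word_cong.ctxt[OF word_cong.rel, of "[(i, x), (i, y)]" "[(i, x \<otimes>\<^bsub>Gs i\<^esub> y)]" R "[]" w]
  by (auto simp: free_product_rels_def)

lemma rel_one: "i \<in> I \<Longrightarrow> word_cong R ((i, \<one>\<^bsub>Gs i\<^esub>) # w) w"
  using word_cong.ctxt[OF word_cong.rel, of "[(i, \<one>\<^bsub>Gs i\<^esub>)]" "[]" R "[]" w]
  by (auto simp: free_product_rels_def)

lemma presentation: "presentation G L R e"
proof (intro presentation.intro presentation_axioms.intro is_group)
  show "\<exists>q\<in>L. word_cong R [p, q] [] \<and> word_cong R [q, p] []" if pL: "p \<in> L" for p
  proof -
    obtain i x where p: "p = (i, x)" "i \<in> I" "x \<in> carrier (Gs i)" using pL by (auto simp: L_def)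
    interpret Gi: group "Gs i" by (rule Gs_group[OF p(2)])
    have "word_cong R [(i, x), (i, inv\<^bsub>Gs i\<^esub> x)] []" "word_cong R [(i, inv\<^bsub>Gs i\<^esub> x), (i, x)] []"
      using rel_mult[OF p(2), of x "inv\<^bsub>Gs i\<^esub> x" "[]"] rel_mult[OF p(2), of "inv\<^bsub>Gs i\<^esub> x" x "[]"]
        rel_one[OF p(2), of "[]"] p word_cong.trans by (force, force)
    then show ?thesis using p by (intro bexI[of _ "(i, inv\<^bsub>Gs i\<^esub> x)"]) (auto simp: L_def)
  qed
  show "u \<in> lists L \<and> v \<in> lists L" if "(u, v) \<in> R" for u v
    using that Gs_group by (auto simp: free_product_rels_def L_def group.is_monoid intro!: monoid.m_closed)
  show "evalw G e u = evalw G e v" if "(u, v) \<in> R" for u v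
    using that by (auto simp: free_product_rels_def e_def \<iota>_mult \<iota>_one \<iota>_closed)
qed (rule e_in)

lemmas ev_closed = presentation.ev_closed[OF presentation]
  and ev_append = presentation.ev_append[OF presentation]
  and ev_cong = presentation.ev_cong[OF presentation]

fun reduced :: "('i \<times> 'b) list \<Rightarrow> bool" where
  "reduced [] = True"
| "reduced (p # w) = (p \<in> L \<and> snd p \<noteq> \<one>\<^bsub>Gs (fst p)\<^esub> \<and> reduced w \<and> (w \<noteq> [] \<longrightarrow> fst (hd w) \<noteq> fst p))"

lemma reduced_lists: "reduced w \<Longrightarrow> w \<in> lists L"
  by (induction w) auto

lemma reduced_exists: "w \<in> lists L \<Longrightarrow> \<exists>v. reduced v \<and> word_cong R w v"
proof (induction w)
  case Nil
  then show ?case by (auto intro: word_cong.refl exI[of _ "[]"])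
next
  case (Cons p w)
  then obtain v where v: "reduced v" "word_cong R w v" by auto
  obtain i x where p: "p = (i, x)" "i \<in> I" "x \<in> carrier (Gs i)" using Cons.prems by (auto simp: L_def)
  interpret Gi: group "Gs i" by (rule Gs_group[OF p(2)])
  have pv: "word_cong R (p # w) ((i, x) # v)" using word_cong_Cons[OF v(2)] p by simp
  show ?case
  proof (cases "x = \<one>\<^bsub>Gs i\<^esub>")
    case True
    then show ?thesis using pv rel_one[OF p(2), of v] v word_cong.trans by blast
  next
    case x: False
    show ?thesis
    proof (cases "v \<noteq> [] \<and> fst (hd v) = i")
      case True
      then obtain y v' where v': "v = (i, y) # v'" by (cases v) auto
      then have y: "y \<in> carrier (Gs i)" using v(1) by (auto simp: L_def)
      have *: "word_cong R (p # w) ((i, x \<otimes>\<^bsub>Gs i\<^esub> y) # v')"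
        using pv rel_mult[OF p(2,3) y, of v'] v' word_cong.trans by blast
      show ?thesis
      proof (cases "x \<otimes>\<^bsub>Gs i\<^esub> y = \<one>\<^bsub>Gs i\<^esub>")
        case True
        then have "word_cong R (p # w) v'" using * rel_one[OF p(2), of v'] word_cong.trans by metis
        then show ?thesis using v(1) v' by auto
      next
        case False
        then have "reduced ((i, x \<otimes>\<^bsub>Gs i\<^esub> y) # v')" using v(1) v' p y by (auto simp: L_def)
        then show ?thesis using * by blast
      qed
    next
      case False
      then have "reduced ((i, x) # v)" using v(1) p x by (auto simp: L_def)
      then show ?thesis using pv by blast
    qed
  qed
qed

text \<open>After each letter the point lies in \<open>T'\<close> of its factor, hence in
  \<open>T\<close> of that factor and, by disjointness, outside \<open>T\<close> of the next one.
  The conclusion gives the smaller zone \<open>T'\<close> of the last factor.\<close>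

lemma T_reduced:
  assumes "reduced w" "w \<noteq> []" "M \<in> carrier G" "\<not> T (fst (hd w)) M"
  shows "T' (fst (last w)) (M \<otimes> evalw G e w)"
  using assms
proof (induction w arbitrary: M)
  case (Cons p w)
  then have p: "fst p \<in> I" "snd p \<in> carrier (Gs (fst p))" "e p \<in> carrier G" using e_in by (auto simp: L_def)
  have T': "T' (fst p) (M \<otimes> e p)" using T_step[of "fst p" M "snd p"] Cons.prems p by (simp add: e_def)
  show ?case
  proof (cases "w = []")
    case True
    then show ?thesis using T' p by simp
  next
    case False
    then have "hd w \<in> L" using hd_last_lists[OF reduced_lists] Cons.prems by auto
    then have "\<not> T (fst (hd w)) (M \<otimes> e p)"
      using T_disj[of "fst p" "fst (hd w)" "M \<otimes> e p"] T'_imp_T[OF T'] Cons.prems p False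
      by (auto simp: L_def)
    then have "T' (fst (last w)) ((M \<otimes> e p) \<otimes> evalw G e w)"
      using Cons.prems p False by (intro Cons.IH) auto
    then show ?thesis using p Cons.prems False ev_closed[OF reduced_lists, of w] by (simp add: m_assoc)
  qed
qed simp

lemma fp_kernel:
  assumes "w \<in> lists L" "evalw G e w = \<one>"
  shows "word_cong R w []"
proof -
  obtain v where v: "reduced v" "word_cong R w v" using reduced_exists assms by blast
  have "v = []"
  proof (rule ccontr)
    assume "v \<noteq> []"
    then have *: "fst (hd v) \<in> I" "fst (last v) \<in> I"
      using hd_last_lists[OF reduced_lists[OF v(1)]] by (auto simp: L_def)
    have "T (fst (last v)) (\<one> \<otimes> evalw G e v)"
      using T_reduced[OF v(1) \<open>v \<noteq> []\<close>, of \<one>] T_one * T'_imp_T by simp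
    moreover have "evalw G e v = \<one>" using ev_cong[OF v(2)] assms by simp
    ultimately show False using T_one * by simp
  qed
  then show ?thesis using v by simp
qed

definition K :: "'a set" where
  "K = generate G (\<Union>i\<in>I. \<iota> i ` carrier (Gs i))"

lemma eval_words: "K = evalw G e ` lists L"
proof
  let ?S = "\<Union>i\<in>I. \<iota> i ` carrier (Gs i)"
  have "evalw G e w \<in> K" if "w \<in> lists L" for w
    using that
  proof (induction w)
    case (Cons p w)
    then have "e p \<in> generate G ?S"
      by (intro generate.incl) (force simp: e_def L_def)
    then show ?case using Cons by (auto intro: generate.eng simp: K_def)
  qed (auto intro: generate.one simp: K_def)
  then show "evalw G e ` lists L \<subseteq> K" by blast
  have "g \<in> evalw G e ` lists L" if "g \<in> generate G ?S" for g
    using that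
  proof induction
    case one
    show ?case by (rule image_eqI[of _ _ "[]"]) auto
  next
    case (incl h)
    then obtain i x where "i \<in> I" "x \<in> carrier (Gs i)" "h = \<iota> i x" by auto
    then show ?case by (intro image_eqI[of _ _ "[(i, x)]"]) (auto simp: e_def L_def \<iota>_closed)
  next
    case (inv h)
    then obtain i x where "i \<in> I" "x \<in> carrier (Gs i)" "h = \<iota> i x" by auto
    moreover from this have "inv\<^bsub>Gs i\<^esub> x \<in> carrier (Gs i)" using Gs_group group.inv_closed by metis
    ultimately show ?case
      by (intro image_eqI[of _ _ "[(i, inv\<^bsub>Gs i\<^esub> x)]"]) (auto simp: e_def L_def \<iota>_inv \<iota>_closed)
  next
    case (eng h1 h2)
    then obtain v w where "v \<in> lists L" "w \<in> lists L" "h1 = evalw G e v" "h2 = evalw G e w"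
      by auto
    then show ?case by (intro image_eqI[of _ _ "v @ w"]) (auto simp: ev_append)
  qed
  then show "K \<subseteq> evalw G e ` lists L" by (auto simp: K_def)
qed

lemma reduced_eval: "g \<in> K \<Longrightarrow> \<exists>w. reduced w \<and> g = evalw G e w"
  unfolding eval_words using reduced_exists ev_cong by fastforce

lemma T_generate:
  assumes "M \<in> carrier G" "\<And>i. i \<in> I \<Longrightarrow> \<not> T i M" "g \<in> K" "g \<noteq> \<one>"
  shows "\<exists>i\<in>I. T' i (M \<otimes> g)"
proof -
  obtain v where v: "reduced v" "g = evalw G e v" using reduced_eval[OF assms(3)] by blast
  then have "v \<noteq> []" using assms(4) by auto
  then have *: "fst (hd v) \<in> I" "fst (last v) \<in> I"
    using hd_last_lists[OF reduced_lists[OF v(1)]] by (auto simp: L_def)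
  then show ?thesis using T_reduced[OF v(1) \<open>v \<noteq> []\<close> assms(1)] assms(2) v by blast
qed

lemma fp_iso:
  "\<exists>\<phi> \<in> iso (free_product I Gs) (G\<lparr>carrier := K\<rparr>).
     \<forall>i\<in>I. \<forall>x\<in>carrier (Gs i). \<phi> (free_product_incl I Gs i x) = \<iota> i x"
proof -
  obtain \<phi> where "\<phi> \<in> iso (presented L R) (G\<lparr>carrier := K\<rparr>)"
      and phi: "\<And>w. w \<in> lists L \<Longrightarrow> \<phi> (word_class R w) = evalw G e w"
    using presentation.presented_iso[OF presentation fp_kernel eval_words] by auto
  then have "\<phi> \<in> iso (free_product I Gs) (G\<lparr>carrier := K\<rparr>)" by (simp add: free_product_def L_def)
  moreover have "\<phi> (free_product_incl I Gs i x) = \<iota> i x" if "i \<in> I" "x \<in> carrier (Gs i)" for i x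
    using phi[of "[(i, x)]"] that by (simp add: free_product_incl_def e_def L_def \<iota>_closed)
  ultimately show ?thesis by blast
qed

lemma group_free_product: "group (free_product I Gs)"
  using presentation.group_presented[OF presentation] by (simp add: free_product_def L_def)

lemma incl_closed: "i \<in> I \<Longrightarrow> x \<in> carrier (Gs i) \<Longrightarrow> free_product_incl I Gs i x \<in> carrier (free_product I Gs)"
  by (auto simp: free_product_incl_def free_product_def presented_carrier)

lemma incl_hom:
  assumes "i \<in> I"
  shows "free_product_incl I Gs i \<in> hom (Gs i) (free_product I Gs)"
  using assms rel_mult[OF assms, of _ _ "[]"] incl_closed word_cong.sym
  by (fastforce simp: hom_def free_product_incl_def free_product_def presented_mult word_class_eq_iff)

text \<open>Injectivity of \<open>\<iota> i\<close> is not assumed but is itself a consequence of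
  ping-pong: a nontrivial letter moves the identity into a zone, so its image cannot be
  trivial.\<close>

lemma incl_inj: "i \<in> I \<Longrightarrow> inj_on (free_product_incl I Gs i) (carrier (Gs i))"
proof (rule inj_onI)
  fix x y assume i: "i \<in> I" and xy: "x \<in> carrier (Gs i)" "y \<in> carrier (Gs i)"
    "free_product_incl I Gs i x = free_product_incl I Gs i y"
  interpret Gi: group "Gs i" by (rule Gs_group[OF i])
  have eq: "\<iota> i x = \<iota> i y" using fp_iso i xy by metis
  have "x \<otimes>\<^bsub>Gs i\<^esub> inv\<^bsub>Gs i\<^esub> y = \<one>\<^bsub>Gs i\<^esub>"
  proof (rule ccontr)
    assume "x \<otimes>\<^bsub>Gs i\<^esub> inv\<^bsub>Gs i\<^esub> y \<noteq> \<one>\<^bsub>Gs i\<^esub>"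
    then have "T' i (\<one> \<otimes> \<iota> i (x \<otimes>\<^bsub>Gs i\<^esub> inv\<^bsub>Gs i\<^esub> y))" using i xy by (intro T_step T_one) auto
    moreover have "\<one> \<otimes> \<iota> i (x \<otimes>\<^bsub>Gs i\<^esub> inv\<^bsub>Gs i\<^esub> y) = \<one>"
      using i xy by (simp add: \<iota>_mult \<iota>_inv \<iota>_closed eq)
    ultimately show False using T_one[OF i] T'_imp_T by metis
  qed
  then show "x = y" using xy by (metis Gi.inv_closed Gi.inv_equality Gi.inv_inv)
qed

end

subsection \<open>HNN extensions\<close>

text \<open>\<open>Z True\<close> and \<open>Z False\<close> are the zones of the stable letter and of its inverse; a base element keeps the
  zone \<open>Z \<delta>\<close> only if it is in the associated subgroup \<open>A \<delta>\<close>.\<close>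

locale hnn_pingpong = group G + B0: group B0
  for G :: "('a, 'c) monoid_scheme" (structure) and B0 :: "('b, 'd) monoid_scheme" +
  fixes \<iota> :: "'b \<Rightarrow> 'a" and A :: "bool \<Rightarrow> 'b set" and \<alpha> :: "'b \<Rightarrow> 'b" and s :: 'a and Z :: "bool \<Rightarrow> 'a \<Rightarrow> bool"
  assumes \<iota>_hom: "\<iota> \<in> hom B0 G" and \<iota>_inj: "inj_on \<iota> (carrier B0)"
    and A_sub: "A \<delta> \<subseteq> carrier B0"
    and \<alpha>_image: "\<alpha> ` A True = A False"
    and s_closed: "s \<in> carrier G"
    and conj: "a \<in> A True \<Longrightarrow> s \<otimes> \<iota> a = \<iota> (\<alpha> a) \<otimes> s"
    and Z_base: "b \<in> carrier B0 \<Longrightarrow> \<not> Z \<delta> (\<iota> b)"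
    and Z_other: "\<lbrakk>W \<in> carrier G; Z \<delta> W; b \<in> carrier B0\<rbrakk> \<Longrightarrow> \<not> Z (\<not> \<delta>) (W \<otimes> \<iota> b)"
    and Z_same: "\<lbrakk>W \<in> carrier G; Z \<delta> W; b \<in> carrier B0; b \<notin> A \<delta>\<rbrakk> \<Longrightarrow> \<not> Z \<delta> (W \<otimes> \<iota> b)"
    and Z_step: "\<lbrakk>W \<in> carrier G; \<not> Z (\<not> \<delta>) W\<rbrakk> \<Longrightarrow> Z \<delta> (W \<otimes> (if \<delta> then s else inv s))"
begin

definition L :: "'b hnn_letter set" where
  "L = Base ` carrier B0 \<union> {Stable, Stable_Inv}"

abbreviation R :: "('b hnn_letter list \<times> 'b hnn_letter list) set" where
  "R \<equiv> hnn_rels B0 (A True) \<alpha>"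

fun e :: "'b hnn_letter \<Rightarrow> 'a" where
  "e (Base b) = \<iota> b"
| "e Stable = s"
| "e Stable_Inv = inv s"

definition st :: "bool \<Rightarrow> 'b hnn_letter" where
  "st \<delta> = (if \<delta> then Stable else Stable_Inv)"

lemma st_in: "st \<delta> \<in> L"
  by (simp add: st_def L_def)

lemma \<iota>_closed: "x \<in> carrier B0 \<Longrightarrow> \<iota> x \<in> carrier G"
  using \<iota>_hom by (auto simp: hom_def)

lemma \<iota>_mult: "x \<in> carrier B0 \<Longrightarrow> y \<in> carrier B0 \<Longrightarrow> \<iota> (x \<otimes>\<^bsub>B0\<^esub> y) = \<iota> x \<otimes> \<iota> y"
  using \<iota>_hom by (auto simp: hom_def)

lemma \<iota>_group_hom: "group_hom B0 G \<iota>"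
  by (intro group_hom.intro group_hom_axioms.intro B0.is_group \<iota>_hom is_group)

lemma \<iota>_one: "\<iota> \<one>\<^bsub>B0\<^esub> = \<one>"
  using group_hom.hom_one[OF \<iota>_group_hom] .

lemma e_in: "p \<in> L \<Longrightarrow> e p \<in> carrier G"
  by (auto simp: L_def \<iota>_closed s_closed)

lemma \<alpha>_closed: "a \<in> A True \<Longrightarrow> \<alpha> a \<in> A False"
  using \<alpha>_image by blast

lemma rel_mult:
  "x \<in> carrier B0 \<Longrightarrow> y \<in> carrier B0 \<Longrightarrow> word_cong R (Base x # Base y # w) (Base (x \<otimes>\<^bsub>B0\<^esub> y) # w)"
  using word_cong.ctxt[OF word_cong.rel, of "[Base x, Base y]" "[Base (x \<otimes>\<^bsub>B0\<^esub> y)]" R "[]" w]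
  by (auto simp: hnn_rels_def)

lemma rel_one: "word_cong R (Base \<one>\<^bsub>B0\<^esub> # w) w"
  using word_cong.ctxt[OF word_cong.rel, of "[Base \<one>\<^bsub>B0\<^esub>]" "[]" R "[]" w]
  by (auto simp: hnn_rels_def)

lemma rel_stable: "word_cong R (st \<delta> # st (\<not> \<delta>) # w) w"
  using word_cong.ctxt[OF word_cong.rel, of "[st \<delta>, st (\<not> \<delta>)]" "[]" R "[]" w]
  by (cases \<delta>) (auto simp: hnn_rels_def st_def)

lemma rel_conj_True: "a \<in> A True \<Longrightarrow> word_cong R (st True # Base a # st False # w) (Base (\<alpha> a) # w)"
  using word_cong.ctxt[OF word_cong.rel, of "[Stable, Base a, Stable_Inv]" "[Base (\<alpha> a)]" R "[]" w]
  by (auto simp: hnn_rels_def st_def)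

text \<open>The presentation contains the conjugation relation in one direction only. For the other
  direction, \<open>\<alpha> b\<close> is expanded back into a conjugate of \<open>b\<close> and the
  stable letters cancel.\<close>

lemma rel_conj:
  assumes "a \<in> A \<delta>"
  shows "\<exists>b\<in>carrier B0. word_cong R (st \<delta> # Base a # st (\<not> \<delta>) # w) (Base b # w)"
proof (cases \<delta>)
  case True
  then show ?thesis using rel_conj_True[of a w] \<alpha>_closed[of a] A_sub[of False] assms by auto
next
  case False
  then obtain b where b: "b \<in> A True" "a = \<alpha> b" using assms \<alpha>_image by auto
  have 1: "word_cong R (Base a # st True # w) (st True # Base b # st False # st True # w)"
    using rel_conj_True[OF b(1), of "st True # w"] b word_cong.sym by metis
  have 2: "word_cong R (st True # Base b # st False # st True # w) (st True # Base b # w)"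
    using rel_stable[of False w] by (auto intro: word_cong_Cons)
  have "word_cong R (st False # Base a # st True # w) (st False # st True # Base b # w)"
    by (rule word_cong_Cons) (rule word_cong.trans[OF 1 2])
  then have "word_cong R (st False # Base a # st True # w) (Base b # w)"
    using rel_stable[of False "Base b # w"] word_cong.trans by fastforce
  then show ?thesis using False b A_sub[of True] by auto
qed

lemma presentation: "presentation G L R e"
proof (intro presentation.intro presentation_axioms.intro is_group)
  show "\<exists>q\<in>L. word_cong R [p, q] [] \<and> word_cong R [q, p] []" if pL: "p \<in> L" for p
  proof (cases p)
    case (Base x)
    then have x: "x \<in> carrier B0" using pL by (auto simp: L_def)
    have "word_cong R [Base x, Base (inv\<^bsub>B0\<^esub> x)] []" "word_cong R [Base (inv\<^bsub>B0\<^esub> x), Base x] []"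
      using rel_mult[of x "inv\<^bsub>B0\<^esub> x" "[]"] rel_mult[of "inv\<^bsub>B0\<^esub> x" x "[]"]
        rel_one[of "[]"] x word_cong.trans by (force, force)
    then show ?thesis using x Base by (intro bexI[of _ "Base (inv\<^bsub>B0\<^esub> x)"]) (auto simp: L_def)
  next
    case Stable
    then show ?thesis using rel_stable[of True "[]"] rel_stable[of False "[]"]
      by (intro bexI[of _ Stable_Inv]) (auto simp: L_def st_def)
  next
    case Stable_Inv
    then show ?thesis using rel_stable[of True "[]"] rel_stable[of False "[]"]
      by (intro bexI[of _ Stable]) (auto simp: L_def st_def)
  qed
  show "u \<in> lists L \<and> v \<in> lists L" if "(u, v) \<in> R" for u v
    using that A_sub \<alpha>_closed by (fastforce simp: hnn_rels_def L_def)
  show "evalw G e u = evalw G e v" if "(u, v) \<in> R" for u v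
  proof -
    have "s \<otimes> (\<iota> a \<otimes> inv s) = \<iota> (\<alpha> a)" if "a \<in> A True" for a
    proof -
      have "\<iota> a \<in> carrier G" "\<iota> (\<alpha> a) \<in> carrier G" using that A_sub \<alpha>_closed \<iota>_closed by blast+
      then show ?thesis using conj[OF that] s_closed by (metis inv_closed m_assoc r_inv r_one)
    qed
    then show ?thesis using that A_sub[of True] \<alpha>_closed A_sub[of False]
      by (fastforce simp: hnn_rels_def \<iota>_mult \<iota>_one \<iota>_closed s_closed)
  qed
qed (rule e_in)

lemmas ev_closed = presentation.ev_closed[OF presentation]
  and ev_append = presentation.ev_append[OF presentation]
  and ev_cong = presentation.ev_cong[OF presentation]

text \<open>The list holds pairs of a base element and the stable letter after it; the final base
  element is kept apart. Base letters equal to the identity fill the gaps between adjacent stable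
  letters.\<close>

fun hw :: "('b \<times> bool) list \<Rightarrow> 'b \<Rightarrow> 'b hnn_letter list" where
  "hw [] b = [Base b]"
| "hw (p # ps) b = Base (fst p) # st (snd p) # hw ps b"

text \<open>This is Britton's condition: between two opposite stable letters there is no element of
  the associated subgroup. The first base element is subject to no condition.\<close>

fun reduced :: "('b \<times> bool) list \<Rightarrow> bool" where
  "reduced [] = True"
| "reduced [p] = (fst p \<in> carrier B0)"
| "reduced (p # q # ps) = (fst p \<in> carrier B0 \<and> (snd q = (\<not> snd p) \<longrightarrow> fst q \<notin> A (snd p)) \<and> reduced (q # ps))"

lemma hw_lists: "reduced ps \<Longrightarrow> b \<in> carrier B0 \<Longrightarrow> hw ps b \<in> lists L"
  by (induction ps rule: reduced.induct) (auto simp: st_in, auto simp: L_def)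

text \<open>A base letter is absorbed into the first base element, which the pinch condition does
  not mention, so the word stays reduced.\<close>

lemma reduced_prepend:
  assumes "reduced ps" "b \<in> carrier B0" "c \<in> carrier B0"
  shows "\<exists>ps' b'. reduced ps' \<and> b' \<in> carrier B0 \<and> word_cong R (Base c # hw ps b) (hw ps' b')"
proof (cases ps)
  case Nil
  then show ?thesis using rel_mult[OF assms(3,2), of "[]"] assms
    by (intro exI[of _ "[]"] exI[of _ "c \<otimes>\<^bsub>B0\<^esub> b"]) auto
next
  case (Cons p ps')
  have p: "fst p \<in> carrier B0" using assms(1) Cons by (cases ps') auto
  have "reduced ((c \<otimes>\<^bsub>B0\<^esub> fst p, snd p) # ps')" using assms Cons p by (cases ps') auto
  then show ?thesis using rel_mult[OF assms(3) p] Cons assms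
    by (intro exI[of _ "(c \<otimes>\<^bsub>B0\<^esub> fst p, snd p) # ps'"] exI[of _ b]) auto
qed

lemma reduced_exists:
  "w \<in> lists L \<Longrightarrow> \<exists>ps b. reduced ps \<and> b \<in> carrier B0 \<and> word_cong R w (hw ps b)"
proof (induction w)
  case Nil
  then show ?case using rel_one[of "[]"] word_cong.sym
    by (intro exI[of _ "[]"] exI[of _ "\<one>\<^bsub>B0\<^esub>"]) auto
next
  case (Cons l w)
  then obtain ps b where ps: "reduced ps" "b \<in> carrier B0" "word_cong R w (hw ps b)" by auto
  have lw: "word_cong R (l # w) (l # hw ps b)" by (rule word_cong_Cons[OF ps(3)])
  show ?case
  proof (cases "\<exists>c. l = Base c")
    case True
    then obtain c where "l = Base c" "c \<in> carrier B0" using Cons.prems by (auto simp: L_def)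
    then show ?thesis using reduced_prepend[OF ps(1,2), of c] lw word_cong.trans by metis
  next
    case False
    then obtain \<delta> where l: "l = st \<delta>" using Cons.prems
      by (cases l) (auto simp: st_def L_def intro: that[of True] that[of False])
    show ?thesis
    proof (cases "\<exists>a ps'. a \<in> A \<delta> \<and> ps = (a, \<not> \<delta>) # ps'")
      case True
      then obtain a ps' where a: "a \<in> A \<delta>" "ps = (a, \<not> \<delta>) # ps'" by blast
      then have ps': "reduced ps'" using ps(1) by (cases ps') auto
      obtain c where c: "c \<in> carrier B0" "word_cong R (st \<delta> # Base a # st (\<not> \<delta>) # hw ps' b) (Base c # hw ps' b)"
        using rel_conj[OF a(1)] by blast
      \<comment> \<open>The new stable letter forms a pinch with the head of the list; the pinch
        collapses to one base element, which the rest absorbs.\<close>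
      have "word_cong R (l # w) (Base c # hw ps' b)" using word_cong.trans[OF lw] c(2) a l by simp
      then show ?thesis using reduced_prepend[OF ps' ps(2) c(1)] word_cong.trans by metis
    next
      case False
      then have "reduced ((\<one>\<^bsub>B0\<^esub>, \<delta>) # ps)" using ps(1) by (cases ps) (auto simp: prod_eq_iff)
      moreover have "word_cong R (l # hw ps b) (hw ((\<one>\<^bsub>B0\<^esub>, \<delta>) # ps) b)"
        using rel_one[of "l # hw ps b"] word_cong.sym l by auto
      ultimately show ?thesis using ps(2) lw word_cong.trans by blast
    qed
  qed
qed

text \<open>The last base element \<open>b\<close> is split off, because it need not preserve the
  zone that the last stable letter has reached. At an inner step, \<open>Z_other\<close> handles two
  equal stable letters in a row and \<open>Z_same\<close>, with the absence of pinches, two opposite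
  ones.\<close>

lemma Z_reduced:
  assumes "reduced ps" "ps \<noteq> []" "b \<in> carrier B0" "M \<in> carrier G"
    "\<not> Z (\<not> snd (hd ps)) (M \<otimes> \<iota> (fst (hd ps)))"
  shows "\<exists>W\<in>carrier G. \<exists>\<delta>. Z \<delta> W \<and> M \<otimes> evalw G e (hw ps b) = W \<otimes> \<iota> b"
  using assms
proof (induction ps arbitrary: M)
  case (Cons p ps)
  define W where "W = M \<otimes> \<iota> (fst p) \<otimes> e (st (snd p))"
  have p: "\<iota> (fst p) \<in> carrier G" "e (st (snd p)) \<in> carrier G"
    using Cons.prems e_in st_in \<iota>_closed by (cases ps; auto)+
  have W: "W \<in> carrier G" "Z (snd p) W"
    using Z_step[of "M \<otimes> \<iota> (fst p)" "snd p"] Cons.prems p by (auto simp: W_def st_def)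
  have red: "reduced ps" using Cons.prems by (cases ps) auto
  have ev: "M \<otimes> evalw G e (hw (p # ps) b) = W \<otimes> evalw G e (hw ps b)"
    using Cons.prems p ev_closed[OF hw_lists[OF red Cons.prems(3)]] by (simp add: W_def m_assoc)
  show ?case
  proof (cases ps)
    case Nil
    then show ?thesis using W ev Cons.prems by (auto simp: \<iota>_closed)
  next
    case (Cons q qs)
    have q: "fst q \<in> carrier B0" using red Cons by (cases qs) auto
    have "\<not> Z (\<not> snd q) (W \<otimes> \<iota> (fst q))"
    proof (cases "snd q = snd p")
      case True
      then show ?thesis using Z_other[OF W q] by simp
    next
      case False
      then have "fst q \<notin> A (snd p)" using Cons.prems Cons by auto
      then show ?thesis using Z_same[OF W q] False by (cases "snd q"; cases "snd p") auto
    qed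
    then show ?thesis using Cons.IH[of W] red Cons.prems Cons W ev by auto
  qed
qed simp

lemma hnn_kernel:
  assumes "w \<in> lists L" "evalw G e w = \<one>"
  shows "word_cong R w []"
proof -
  obtain ps b where ps: "reduced ps" "b \<in> carrier B0" "word_cong R w (hw ps b)"
    using reduced_exists assms by blast
  have one: "evalw G e (hw ps b) = \<one>" using ev_cong[OF ps(3)] assms by simp
  have Nil: "ps = []"
  proof (rule ccontr)
    assume "ps \<noteq> []"
    then have "fst (hd ps) \<in> carrier B0" using ps(1) by (cases ps rule: reduced.cases) auto
    then obtain W \<delta> where W: "W \<in> carrier G" "Z \<delta> W" "\<one> \<otimes> evalw G e (hw ps b) = W \<otimes> \<iota> b"
      using Z_reduced[OF ps(1) \<open>ps \<noteq> []\<close> ps(2) one_closed] Z_base \<iota>_closed by auto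
    \<comment> \<open>If a word with stable letters were trivial, then the point \<open>W\<close> of
      a stable zone would be a base element, which \<open>Z_base\<close> excludes.\<close>
    then have "W = \<iota> (inv\<^bsub>B0\<^esub> b)"
      using one ps(2) group_hom.hom_inv[OF \<iota>_group_hom ps(2)] \<iota>_closed
      by (metis inv_equality inv_inv one_closed r_one)
    then show False using W Z_base ps(2) by auto
  qed
  then have "\<iota> b = \<iota> \<one>\<^bsub>B0\<^esub>" using one ps(2) by (simp add: \<iota>_closed \<iota>_one)
  then have "b = \<one>\<^bsub>B0\<^esub>" using \<iota>_inj ps(2) by (auto dest: inj_onD)
  then show ?thesis using ps(3) Nil rel_one[of "[]"] word_cong.trans by fastforce
qed

definition K :: "'a set" where
  "K = generate G (insert s (\<iota> ` carrier B0))"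

lemma eval_words: "K = evalw G e ` lists L"
proof
  have "evalw G e w \<in> K" if "w \<in> lists L" for w
    using that
  proof (induction w)
    case (Cons p w)
    then have "e p \<in> K"
      using generate.inv[of s "insert s (\<iota> ` carrier B0)" G]
      by (auto simp: L_def K_def intro: generate.incl)
    then show ?case using Cons by (auto intro: generate.eng simp: K_def)
  qed (auto intro: generate.one simp: K_def)
  then show "evalw G e ` lists L \<subseteq> K" by blast
  have "g \<in> evalw G e ` lists L" if "g \<in> generate G (insert s (\<iota> ` carrier B0))" for g
    using that
  proof induction
    case one
    show ?case by (rule image_eqI[of _ _ "[]"]) auto
  next
    case (incl h)
    then consider "h = s" | b where "b \<in> carrier B0" "h = \<iota> b" by auto
    then show ?case
    proof cases
      case 1
      then show ?thesis by (intro image_eqI[of _ _ "[Stable]"]) (auto simp: L_def s_closed)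
    next
      case 2
      then show ?thesis by (intro image_eqI[of _ _ "[Base b]"]) (auto simp: L_def \<iota>_closed)
    qed
  next
    case (inv h)
    then consider "h = s" | b where "b \<in> carrier B0" "h = \<iota> b" by auto
    then show ?case
    proof cases
      case 1
      then show ?thesis by (intro image_eqI[of _ _ "[Stable_Inv]"]) (auto simp: L_def s_closed)
    next
      case 2
      then show ?thesis
        by (intro image_eqI[of _ _ "[Base (inv\<^bsub>B0\<^esub> b)]"])
          (auto simp: L_def \<iota>_closed group_hom.hom_inv[OF \<iota>_group_hom])
    qed
  next
    case (eng h1 h2)
    then obtain v w where "v \<in> lists L" "w \<in> lists L" "h1 = evalw G e v" "h2 = evalw G e w"
      by auto
    then show ?case by (intro image_eqI[of _ _ "v @ w"]) (auto simp: ev_append)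
  qed
  then show "K \<subseteq> evalw G e ` lists L" by (auto simp: K_def)
qed

text \<open>Every element is either in the base or ends, up to a final base factor, in a stable
  zone. This is what remains of the normal form for ping-pong with other groups.\<close>

lemma Z_generate:
  assumes "M \<in> carrier G" "\<And>b \<delta>. b \<in> carrier B0 \<Longrightarrow> \<not> Z \<delta> (M \<otimes> \<iota> b)" "g \<in> K"
  shows "(\<exists>b\<in>carrier B0. g = \<iota> b) \<or> (\<exists>W\<in>carrier G. \<exists>\<delta>. \<exists>b\<in>carrier B0. Z \<delta> W \<and> M \<otimes> g = W \<otimes> \<iota> b)"
proof -
  obtain w where w: "w \<in> lists L" "g = evalw G e w" using assms(3) eval_words by blast
  obtain ps b where ps: "reduced ps" "b \<in> carrier B0" "word_cong R w (hw ps b)"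
    using reduced_exists[OF w(1)] by blast
  have g: "g = evalw G e (hw ps b)" using ev_cong[OF ps(3) w(1)] w by simp
  show ?thesis
  proof (cases "ps = []")
    case True
    then show ?thesis using g ps by (auto simp: \<iota>_closed)
  next
    case False
    then have "fst (hd ps) \<in> carrier B0" using ps(1) by (cases ps rule: reduced.cases) auto
    then show ?thesis using Z_reduced[OF ps(1) False ps(2) assms(1)] assms(2) g ps(2) by metis
  qed
qed

lemma hnn_iso:
  "\<exists>\<phi> \<in> iso (hnn_extension B0 (A True) \<alpha>) (G\<lparr>carrier := K\<rparr>).
     (\<forall>b\<in>carrier B0. \<phi> (hnn_incl B0 (A True) \<alpha> b) = \<iota> b) \<and> \<phi> (hnn_stable B0 (A True) \<alpha>) = s"
proof -
  obtain \<phi> where "\<phi> \<in> iso (presented L R) (G\<lparr>carrier := K\<rparr>)"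
      and phi: "\<And>w. w \<in> lists L \<Longrightarrow> \<phi> (word_class R w) = evalw G e w"
    using presentation.presented_iso[OF presentation hnn_kernel eval_words] by auto
  then have "\<phi> \<in> iso (hnn_extension B0 (A True) \<alpha>) (G\<lparr>carrier := K\<rparr>)" by (simp add: hnn_extension_def L_def)
  moreover have "\<phi> (hnn_incl B0 (A True) \<alpha> b) = \<iota> b" if "b \<in> carrier B0" for b
    using phi[of "[Base b]"] that by (simp add: hnn_incl_def L_def \<iota>_closed)
  moreover have "\<phi> (hnn_stable B0 (A True) \<alpha>) = s"
    using phi[of "[Stable]"] by (simp add: hnn_stable_def L_def s_closed)
  ultimately show ?thesis by blast
qed

end

lemma (in hnn_pingpong) group_hnn_extension: "group (hnn_extension B0 (A True) \<alpha>)"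
  using presentation.group_presented[OF presentation] by (simp add: hnn_extension_def L_def)

section \<open>Powers and generated subgroups\<close>

lemma (in group) power_nontrivial:
  assumes x: "x \<in> carrier G" and one: "\<not> P \<one>" "\<not> P' \<one>"
    and step: "\<And>M. M \<in> carrier G \<Longrightarrow> \<not> P' M \<Longrightarrow> P (M \<otimes> x)"
    and disj: "\<And>M. M \<in> carrier G \<Longrightarrow> P M \<Longrightarrow> \<not> P' M"
  shows "x [^] Suc n \<noteq> \<one>"
proof -
  \<comment> \<open>\<open>P\<close> is the zone of \<open>x\<close> and \<open>P'\<close> that of
    its inverse: a positive power is in \<open>P\<close>, hence outside \<open>P'\<close>, and the
    next factor leads back into \<open>P\<close>.\<close>
  have "P (x [^] Suc n)"
  proof (induction n)
    case 0
    then show ?case using step[of \<one>] one x by simp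
  next
    case (Suc n)
    then show ?case using step[of "x [^] Suc n"] disj[of "x [^] Suc n"] x by simp
  qed
  then show ?thesis using one by auto
qed

lemma (in group) generate_Un_generate:
  assumes "S \<subseteq> carrier G" "A \<subseteq> carrier G"
  shows "generate G (S \<union> generate G A) = generate G (S \<union> A)"
proof (rule subset_antisym)
  show "generate G (S \<union> A) \<subseteq> generate G (S \<union> generate G A)"
    by (rule mono_generate) (auto intro: generate.incl)
  have "S \<union> generate G A \<subseteq> generate G (S \<union> A)"
    using mono_generate[of A "S \<union> A"] by (auto intro: generate.incl)
  then show "generate G (S \<union> generate G A) \<subseteq> generate G (S \<union> A)"
    by (rule generate_subgroup_incl) (rule generate_is_subgroup, use assms in blast)
qed

lemma (in group) internal_free_product_generate:
  assumes "fp_pingpong G I (\<lambda>i. G\<lparr>carrier := H i\<rparr>) (\<lambda>_ x. x) T T'" and H: "\<And>i. i \<in> I \<Longrightarrow> subgroup (H i) G"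
  shows "internal_free_product (G\<lparr>carrier := generate G (\<Union>i\<in>I. H i)\<rparr>) I H"
proof -
  interpret fp: fp_pingpong G I "\<lambda>i. G\<lparr>carrier := H i\<rparr>" "\<lambda>_ x. x" T T' by fact
  have K: "fp.K = generate G (\<Union>i\<in>I. H i)" by (simp add: fp.K_def)
  have "(\<Union>i\<in>I. H i) \<subseteq> carrier G" using subgroup.subset[OF H] by blast
  then have "subgroup (generate G (\<Union>i\<in>I. H i)) G" by (rule generate_is_subgroup)
  then have "subgroup (H i) (G\<lparr>carrier := generate G (\<Union>i\<in>I. H i)\<rparr>)" if "i \<in> I" for i
    using that H by (intro subgroup_incl) (auto intro: generate.incl)
  then show ?thesis unfolding internal_free_product_def using fp.fp_iso unfolding K by simp
qed

subsection \<open>Free products with marked subgroups and their HNN extensions\<close>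

text \<open>The zone \<open>T b\<close> of a factor contains two disjoint parts:
  \<open>T' b\<close>, reached by letters of the factor from outside, and \<open>Z b\<close>,
  reserved for the stable letter. A letter acting on \<open>Z b\<close> stays there if it is in
  \<open>D b\<close> and otherwise falls into \<open>T' b\<close>; so \<open>D b\<close> is the
  future associated subgroup.\<close>

locale fp_zones = fp_pingpong G "UNIV :: bool set" Gs \<iota> T T'
  for G :: "('a, 'c) monoid_scheme" (structure) and Gs :: "bool \<Rightarrow> ('b, 'd) monoid_scheme" and \<iota> :: "bool \<Rightarrow> 'b \<Rightarrow> 'a"
    and T T' :: "bool \<Rightarrow> 'a \<Rightarrow> bool" +
  fixes Z :: "bool \<Rightarrow> 'a \<Rightarrow> bool" and D :: "bool \<Rightarrow> 'b set"
  assumes Z_T: "Z b M \<Longrightarrow> T b M"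
    and T'_Z: "T' b M \<Longrightarrow> \<not> Z b M"
    and Z_D: "\<lbrakk>M \<in> carrier G; Z b M; x \<in> carrier (Gs b); x \<in> D b\<rbrakk> \<Longrightarrow> Z b (M \<otimes> \<iota> b x)"
    and Z_not_D: "\<lbrakk>M \<in> carrier G; Z b M; x \<in> carrier (Gs b); x \<notin> D b\<rbrakk> \<Longrightarrow> T' b (M \<otimes> \<iota> b x)"
    and D_sub: "D b \<subseteq> carrier (Gs b)"
    and D_one: "\<one>\<^bsub>Gs b\<^esub> \<in> D b"
begin

lemma not_Z: "M \<in> carrier G \<Longrightarrow> T' c M \<Longrightarrow> \<not> Z b M"
  using T_disj[of b c M] Z_T T'_imp_T T'_Z by blast

text \<open>Only the first letter of the reduced word of \<open>g\<close> needs care. If it belongs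
  to the other factor, ping-pong starts at once since \<open>W\<close> is in \<open>T b\<close>. If
  it belongs to factor \<open>b\<close>, the point remains in \<open>T b\<close>, and the second
  letter belongs to the other factor.\<close>

lemma Z_K:
  assumes W: "W \<in> carrier G" "Z b W" and g: "g \<in> K" "g \<notin> \<iota> b ` D b"
  shows "\<exists>c. T' c (W \<otimes> g)"
proof -
  obtain v where v: "reduced v" "g = evalw G e v" using reduced_eval[OF g(1)] by blast
  have "v \<noteq> []"
  proof
    assume "v = []"
    then have "g = \<iota> b \<one>\<^bsub>Gs b\<^esub>" using v \<iota>_one by simp
    then show False using g(2) D_one by blast
  qed
  then obtain p w where p: "v = p # w" by (cases v) auto
  have ep: "e p \<in> carrier G" and snd_p: "snd p \<in> carrier (Gs (fst p))"
    using v(1) p e_in by (auto simp: L_def)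
  show ?thesis
  proof (cases "fst p = b")
    case False
    then have "\<not> T (fst (hd v)) W" using T_disj[of "fst p" b W] Z_T[OF W(2)] W(1) p by auto
    then show ?thesis using T_reduced[OF v(1) \<open>v \<noteq> []\<close> W(1)] v(2) by blast
  next
    case True
    have ev: "e p = \<iota> b (snd p)" using True by (simp add: e_def)
    show ?thesis
    proof (cases "w = []")
      case True
      then have g': "g = \<iota> b (snd p)" using v p ep ev by simp
      then have "snd p \<notin> D b" using g(2) by blast
      then show ?thesis using Z_not_D[OF W] snd_p \<open>fst p = b\<close> g' by blast
    next
      case w: False
      \<comment> \<open>Whether the first letter preserves \<open>Z b\<close> or moves the point to
        \<open>T' b\<close> is irrelevant here; both are inside \<open>T b\<close>.\<close>
      have "T b (W \<otimes> e p)"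
      proof (cases "snd p \<in> D b")
        case True
        then show ?thesis using Z_T[OF Z_D[OF W, of "snd p"]] snd_p \<open>fst p = b\<close> ev by simp
      next
        case False
        then show ?thesis using T'_imp_T[OF Z_not_D[OF W, of "snd p"]] snd_p \<open>fst p = b\<close> ev by simp
      qed
      moreover have "fst (hd w) \<noteq> b" "reduced w" using v(1) p w True by auto
      ultimately have "\<not> T (fst (hd w)) (W \<otimes> e p)"
        using T_disj[of "fst (hd w)" b "W \<otimes> e p"] W(1) ep by auto
      then have "T' (fst (last w)) (W \<otimes> e p \<otimes> evalw G e w)"
        using T_reduced[OF \<open>reduced w\<close> w] W(1) ep by auto
      moreover have "W \<otimes> g = W \<otimes> e p \<otimes> evalw G e w"
        using v(2) p W(1) ep ev_closed[OF reduced_lists[OF \<open>reduced w\<close>]] by (simp add: m_assoc)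
      ultimately show ?thesis by auto
    qed
  qed
qed

lemma Z_K_T:
  assumes "W \<in> carrier G" "Z b W" "g \<in> K"
  shows "\<exists>c. T c (W \<otimes> g)"
proof (cases "g \<in> \<iota> b ` D b")
  case True
  then obtain x where "x \<in> D b" "g = \<iota> b x" by blast
  then show ?thesis using Z_D[OF assms(1,2), of x] D_sub Z_T by blast
next
  case False
  then show ?thesis using Z_K[OF assms] T'_imp_T by blast
qed

lemma hnn_pingpong:
  assumes B0: "group B0" and \<iota>0: "\<iota>0 \<in> iso B0 (G\<lparr>carrier := K\<rparr>)"
    and A: "\<And>\<delta>. A \<delta> \<subseteq> carrier B0" "\<And>\<delta>. \<iota>0 ` A \<delta> = \<iota> \<delta> ` D \<delta>"
    and \<alpha>: "\<alpha> ` A True = A False"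
    and s: "s \<in> carrier G" "\<And>a. a \<in> A True \<Longrightarrow> s \<otimes> \<iota>0 a = \<iota>0 (\<alpha> a) \<otimes> s"
      "\<And>W \<delta>. W \<in> carrier G \<Longrightarrow> \<not> Z (\<not> \<delta>) W \<Longrightarrow> Z \<delta> (W \<otimes> (if \<delta> then s else inv s))"
  shows "hnn_pingpong G B0 \<iota>0 A \<alpha> s Z"
proof -
  interpret B0: group B0 by fact
  have Kc: "K \<subseteq> carrier G" unfolding eval_words using ev_closed by blast
  have bij: "bij_betw \<iota>0 (carrier B0) K" and hom: "\<iota>0 \<in> hom B0 (G\<lparr>carrier := K\<rparr>)"
    using \<iota>0 by (auto simp: iso_def)
  have \<iota>0K: "\<iota>0 b \<in> K" if "b \<in> carrier B0" for b using that bij by (auto simp: bij_betw_def)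
  show ?thesis
  proof (intro hnn_pingpong.intro hnn_pingpong_axioms.intro is_group B0.is_group)
    show "\<iota>0 \<in> hom B0 G" using hom Kc by (auto simp: hom_def)
    show "inj_on \<iota>0 (carrier B0)" using bij by (simp add: bij_betw_def)
    show "A \<delta> \<subseteq> carrier B0" for \<delta> by (rule A)
    show "\<alpha> ` A True = A False" by (rule \<alpha>)
    show "s \<in> carrier G" by (rule s)
    show "s \<otimes> \<iota>0 a = \<iota>0 (\<alpha> a) \<otimes> s" if "a \<in> A True" for a by (rule s(2)[OF that])
    show "Z \<delta> (W \<otimes> (if \<delta> then s else inv s))" if "W \<in> carrier G" "\<not> Z (\<not> \<delta>) W" for W \<delta>
      by (rule s(3)[OF that])
    show "\<not> Z \<delta> (\<iota>0 b)" if b: "b \<in> carrier B0" for b \<delta>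
    proof (cases "\<iota>0 b = \<one>")
      case True
      then show ?thesis using T_one[of \<delta>] Z_T by auto
    next
      case False
      then obtain c where "T' c (\<one> \<otimes> \<iota>0 b)" using T_generate[of \<one> "\<iota>0 b"] T_one \<iota>0K[OF b] by auto
      moreover have "\<iota>0 b \<in> carrier G" using \<iota>0K[OF b] Kc by blast
      ultimately show ?thesis using not_Z[of "\<iota>0 b" c \<delta>] by simp
    qed
    fix W \<delta> b assume W: "W \<in> carrier G" "Z \<delta> W" and b: "b \<in> carrier B0"
    have c: "W \<otimes> \<iota>0 b \<in> carrier G" using W \<iota>0K[OF b] Kc by blast
    show "\<not> Z (\<not> \<delta>) (W \<otimes> \<iota>0 b)"
    proof (cases "\<iota>0 b \<in> \<iota> \<delta> ` D \<delta>")
      case True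
      then obtain x where "x \<in> D \<delta>" "\<iota>0 b = \<iota> \<delta> x" by blast
      then have "Z \<delta> (W \<otimes> \<iota>0 b)" using Z_D[OF W, of x] D_sub by auto
      then show ?thesis using T_disj[OF _ _ c, of \<delta> "\<not> \<delta>"] Z_T by auto
    next
      case False
      then show ?thesis using Z_K[OF W \<iota>0K[OF b]] not_Z[OF c] by blast
    qed
    assume "b \<notin> A \<delta>"
    then have "\<iota>0 b \<notin> \<iota>0 ` A \<delta>" using bij A(1)[of \<delta>] b by (auto simp: bij_betw_def inj_on_def)
    then show "\<not> Z \<delta> (W \<otimes> \<iota>0 b)" using Z_K[OF W \<iota>0K[OF b]] not_Z[OF c] unfolding A(2) by blast
  qed
qed

text \<open>This makes the whole HNN extension usable as one factor in a further ping-pong: a base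
  element acts as in the free product, and any other element first reaches a stable zone, from which
  the final base factor leads to some \<open>T c\<close>.\<close>

lemma T_hnn:
  assumes h: "hnn_pingpong G B0 \<iota>0 A \<alpha> s Z" and \<iota>0: "\<iota>0 ` carrier B0 = K"
    and M: "M \<in> carrier G" "\<And>b. \<not> T b M" and g: "g \<in> hnn_pingpong.K G B0 \<iota>0 s" "g \<noteq> \<one>"
  shows "\<exists>b. T b (M \<otimes> g)"
proof -
  have Kc: "K \<subseteq> carrier G" unfolding eval_words using ev_closed by blast
  have \<iota>0K: "\<iota>0 b \<in> K" if "b \<in> carrier B0" for b using that \<iota>0 by blast
  have "\<not> Z \<delta> (M \<otimes> \<iota>0 b)" if b: "b \<in> carrier B0" for b \<delta>
  proof (cases "\<iota>0 b = \<one>")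
    case True
    then show ?thesis using M Z_T by auto
  next
    case False
    then obtain c where "T' c (M \<otimes> \<iota>0 b)" using T_generate[OF M(1) M(2) \<iota>0K[OF b]] by auto
    moreover have "M \<otimes> \<iota>0 b \<in> carrier G" using \<iota>0K[OF b] Kc M(1) by blast
    ultimately show ?thesis using not_Z by blast
  qed
  from hnn_pingpong.Z_generate[OF h M(1) this g(1)] show ?thesis
  proof
    assume "\<exists>b\<in>carrier B0. g = \<iota>0 b"
    then have "g \<in> K" using \<iota>0K by blast
    then show ?thesis using T_generate[OF M(1) M(2) _ g(2)] T'_imp_T by blast
  next
    assume "\<exists>W\<in>carrier G. \<exists>\<delta>. \<exists>b\<in>carrier B0. Z \<delta> W \<and> M \<otimes> g = W \<otimes> \<iota>0 b"
    then obtain W \<delta> b where "W \<in> carrier G" "Z \<delta> W" "b \<in> carrier B0" "M \<otimes> g = W \<otimes> \<iota>0 b" by blast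
    then show ?thesis using Z_K_T[of W \<delta> "\<iota>0 b"] \<iota>0K by auto
  qed
qed

end

section \<open>Laurent polynomials\<close>

abbreviation co :: "'k::zero laurent \<Rightarrow> int \<Rightarrow> 'k" where
  "co \<equiv> Poly_Mapping.lookup"

text \<open>A lower bound for the t-adic valuation. Unlike \<open>low_deg\<close> it also makes
  sense for 0 and is stable under sums.\<close>

definition vanish :: "int \<Rightarrow> 'k::zero laurent \<Rightarrow> bool" where
  "vanish m f \<longleftrightarrow> (\<forall>k<m. co f k = 0)"

lemma vanishD: "vanish m f \<Longrightarrow> k < m \<Longrightarrow> co f k = 0"
  by (simp add: vanish_def)

lemma vanish_mono: "vanish m f \<Longrightarrow> n \<le> m \<Longrightarrow> vanish n f"
  by (simp add: vanish_def)

lemma vanish_Suc: "vanish m f \<Longrightarrow> co f m = 0 \<Longrightarrow> vanish (m + 1) f"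
  by (auto simp: vanish_def order_le_less)

lemma co_mult: "co (f * g) n = (\<Sum>k\<in>Poly_Mapping.keys f. co f k * co g (n - k))" for f g :: "'k::field laurent"
proof -
  have "(\<Sum>q. co g q when n = l + q) = co g (n - l)" for l :: int
  proof -
    have "(\<lambda>q. co g q when n = l + q) = (\<lambda>q. co g q when q = n - l)" by (auto simp: when_def)
    then show ?thesis by (simp only: Sum_any_when_equal)
  qed
  then have "co (f * g) n = (\<Sum>l. co f l * co g (n - l))" by (simp add: lookup_mult)
  also have "\<dots> = (\<Sum>k\<in>Poly_Mapping.keys f. co f k * co g (n - k))"
    by (rule Sum_any.expand_superset) (auto simp: in_keys_iff)
  finally show ?thesis .
qed

lemma co_mult_superset:
  fixes f g :: "'k::field laurent"
  assumes "finite S" "Poly_Mapping.keys f \<subseteq> S"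
  shows "co (f * g) n = (\<Sum>k\<in>S. co f k * co g (n - k))"
  unfolding co_mult using assms by (intro sum.mono_neutral_left) (auto simp: in_keys_iff)

lemma co_single_mult: "co (Poly_Mapping.single k c * f) n = c * co f (n - k)" for f :: "'k::field laurent"
  by (subst co_mult_superset[of "{k}"]) auto

lemma co_shift [simp]:
  fixes f :: "'k::field laurent"
  shows "co (lt * f) n = co f (n - 1)" "co (f * lt) n = co f (n - 1)"
    "co (lti * f) n = co f (n + 1)" "co (f * lti) n = co f (n + 1)"
    "co (lconst c * f) n = c * co f n" "co (f * lconst c) n = c * co f n"
  by (simp_all add: lt_def lti_def lconst_def co_single_mult mult.commute[of f])

lemma co_add [simp]: "co (f + g) n = co f n + co g n" for f g :: "'k::field laurent"
  by (rule lookup_add)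

lemma co_diff [simp]: "co (f - g) n = co f n - co g n" for f g :: "'k::field laurent"
  by (rule lookup_minus)

lemma co_uminus [simp]: "co (- f) n = - co f n" for f :: "'k::field laurent"
  by (rule lookup_uminus)

lemma co_base [simp]:
  "co (lconst c) n = (if n = 0 then c else 0)" "co (1 :: 'k::field laurent) n = (if n = 0 then 1 else 0)"
  "co (lt :: 'k laurent) n = (if n = 1 then 1 else 0)" "co (lti :: 'k laurent) n = (if n = -1 then 1 else 0)"
  by (auto simp: lconst_def lt_def lti_def lookup_single lookup_one when_def)

lemma co_bar [simp]: "co (lbar f) n = co f (- n)"
  unfolding lbar_def by (subst map_key.rep_eq) auto

lemma laurent_eqI: "(\<And>n. co f n = co g n) \<Longrightarrow> f = g"
  by (rule poly_mapping_eqI)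

lemma lt_lti [simp]: "lt * lti = (1 :: 'k::field laurent)" "lti * lt = (1 :: 'k::field laurent)"
  by (simp_all add: lt_def lti_def mult_single)

lemma lconst_simps [simp]:
  "lconst 0 = (0 :: 'k::field laurent)" "lconst 1 = (1 :: 'k::field laurent)"
  by (auto intro: laurent_eqI)

lemma lconst_hom:
  "lconst (a + b) = lconst a + lconst b" "lconst (a - b) = lconst a - lconst b"
  "lconst (- a) = - lconst a" "lconst (a * b) = lconst a * lconst b"
  by (auto intro!: laurent_eqI)

lemma lconst_power: "lconst (a ^ n) = lconst a ^ n"
  by (induction n) (auto simp: lconst_hom)

lemma lconst_numeral: "lconst (numeral n :: 'k::field) = numeral n"
proof -
  have "lconst (of_nat m :: 'k) = of_nat m" for m by (induction m) (auto simp: lconst_hom)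
  from this[of "numeral n"] show ?thesis by simp
qed

lemma lconst_eq_iff [simp]: "lconst a = lconst b \<longleftrightarrow> a = b"
proof
  assume "lconst a = lconst b"
  then have "co (lconst a) 0 = co (lconst b) 0" by simp
  then show "a = b" by simp
qed simp

lemma lconst_eq_0_iff [simp]: "lconst a = 0 \<longleftrightarrow> a = 0"
  using lconst_eq_iff[of a 0] by simp

lemma lbar_bar [simp]: "lbar (lbar f) = f"
  by (rule laurent_eqI) simp

lemma lbar_simps [simp]:
  "lbar (f + g) = lbar f + lbar g" "lbar (f - g) = lbar f - lbar g" "lbar (- f) = - lbar f"
  "lbar 0 = 0" "lbar 1 = (1 :: 'k::field laurent)" "lbar (lconst c) = lconst c"
  "lbar lt = (lti :: 'k laurent)" "lbar lti = (lt :: 'k laurent)"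
  for f g :: "'k::field laurent"
  by (auto intro!: laurent_eqI)

lemma lbar_mult [simp]: "lbar (f * g) = lbar f * lbar g" for f g :: "'k::field laurent"
proof (rule laurent_eqI)
  fix n
  have fin: "finite (uminus ` Poly_Mapping.keys f)" "Poly_Mapping.keys (lbar f) \<subseteq> uminus ` Poly_Mapping.keys f"
    by (auto simp: in_keys_iff image_iff intro!: bexI[of _ "- x" for x])
  have "co (lbar f * lbar g) n = (\<Sum>k\<in>Poly_Mapping.keys f. co f k * co g (- n - k))"
    by (subst co_mult_superset[OF fin]) (simp add: sum.reindex inj_on_def minus_diff_commute)
  then show "co (lbar (f * g)) n = co (lbar f * lbar g) n" by (simp add: co_mult)
qed

lemma lbar_power [simp]: "lbar (f ^ n) = lbar f ^ n" for f :: "'k::field laurent"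
  by (induction n) auto

lemma lbar_Phi [simp]: "lbar lPhi = lPhi"
  by (simp add: lPhi_def algebra_simps)

lemma lbar_eq_0_iff [simp]: "lbar f = 0 \<longleftrightarrow> f = 0" for f :: "'k::field laurent"
proof
  assume "lbar f = 0"
  then have "lbar (lbar f) = lbar 0" by simp
  then show "f = 0" unfolding lbar_bar by simp
qed simp

text \<open>Additivity of the valuation: in degree \<open>i + j\<close> only the product of the two
  lowest coefficients survives.\<close>

lemma vanish_mult:
  fixes f g :: "'k::field laurent"
  assumes "vanish i f" "vanish j g"
  shows "vanish (i + j) (f * g)" "co (f * g) (i + j) = co f i * co g j"
proof -
  have le: "k \<ge> i" if "k \<in> Poly_Mapping.keys f" for k
    using vanishD[OF assms(1), of k] that by (force simp: in_keys_iff not_less)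
  have "co f k * co g (n - k) = 0" if "k \<in> Poly_Mapping.keys f" "n < i + j" for k n
    using le[OF that(1)] that(2) vanishD[OF assms(2), of "n - k"] by simp
  then show "vanish (i + j) (f * g)" unfolding vanish_def co_mult by (intro allI impI sum.neutral) blast
  have "co (f * g) (i + j) = (\<Sum>k\<in>insert i (Poly_Mapping.keys f). co f k * co g (i + j - k))"
    by (rule co_mult_superset) auto
  also have "\<dots> = (\<Sum>k\<in>{i}. co f k * co g (i + j - k))"
  proof (rule sum.mono_neutral_right)
    show "\<forall>k\<in>insert i (Poly_Mapping.keys f) - {i}. co f k * co g (i + j - k) = 0"
    proof
      fix k assume "k \<in> insert i (Poly_Mapping.keys f) - {i}"
      then have "i + j - k < j" using le[of k] by auto
      then show "co f k * co g (i + j - k) = 0" using vanishD[OF assms(2)] by simp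
    qed
  qed auto
  finally show "co (f * g) (i + j) = co f i * co g j" by simp
qed

lemma vanish_add: "vanish m f \<Longrightarrow> vanish m g \<Longrightarrow> vanish m (f + g)" for f g :: "'k::field laurent"
  by (simp add: vanish_def)

lemma vanish_0 [simp]: "vanish m 0"
  by (simp add: vanish_def)

lemma lowest_exists:
  assumes "f \<noteq> 0"
  shows "\<exists>m. vanish m f \<and> co f m \<noteq> 0"
proof -
  have ne: "Poly_Mapping.keys f \<noteq> {}" using assms by simp
  then have "Min (Poly_Mapping.keys f) \<in> Poly_Mapping.keys f" by (intro Min_in) auto
  then have "co f (Min (Poly_Mapping.keys f)) \<noteq> 0" by (simp add: in_keys_iff)
  moreover have "vanish (Min (Poly_Mapping.keys f)) f"
    unfolding vanish_def
  proof (intro allI impI)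
    fix k assume "k < Min (Poly_Mapping.keys f)"
    then have "k \<notin> Poly_Mapping.keys f" using Min_le[OF finite_keys, of k f] by linarith
    then show "co f k = 0" by (simp add: in_keys_iff)
  qed
  ultimately show ?thesis by blast
qed

lemma vanish_unique: "vanish m f \<Longrightarrow> co f m \<noteq> 0 \<Longrightarrow> vanish n f \<Longrightarrow> co f n \<noteq> 0 \<Longrightarrow> m = n"
  by (cases m n rule: linorder_cases) (auto dest: vanishD)

lemma low_deg_eqI: "vanish m f \<Longrightarrow> co f m \<noteq> 0 \<Longrightarrow> low_deg f = m"
  unfolding low_deg_def
proof (rule Min_eqI)
  show "m \<le> y" if "vanish m f" "y \<in> Poly_Mapping.keys f" for y
    using that vanishD[OF that(1), of y] by (force simp: in_keys_iff)
qed (auto simp: in_keys_iff)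

text \<open>Highest exponents are always treated as lowest exponents of the conjugate
  \<open>lbar f\<close>, with the sign reversed, so that one notion of vanishing serves both
  ends.\<close>

lemma high_deg_eqI:
  assumes "vanish m (lbar f)" "co (lbar f) m \<noteq> 0"
  shows "high_deg f = - m"
  unfolding high_deg_def
proof (rule Max_eqI)
  show "y \<le> - m" if "y \<in> Poly_Mapping.keys f" for y
    using that vanishD[OF assms(1), of "- y"] by (force simp: in_keys_iff)
qed (use assms in \<open>auto simp: in_keys_iff\<close>)

lemma lsubst_simps [simp]:
  "lsubst 0 = (0 :: 'k::field laurent)"
  "lsubst (pCons a p) = lconst a + (lt + lti) * (lsubst p :: 'k::field laurent)"
  by (cases "a = 0 \<and> p = 0"; auto simp: lsubst_def map_poly_pCons)+

lemma lsubst_add: "lsubst (p + q) = lsubst p + (lsubst q :: 'k::field laurent)"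
  by (induction p q rule: poly_induct2) (auto simp: lconst_hom algebra_simps)

lemma lsubst_smult: "lsubst (Polynomial.smult c p) = lconst c * (lsubst p :: 'k::field laurent)"
  by (induction p) (auto simp: lconst_hom algebra_simps)

lemma lsubst_uminus: "lsubst (- p) = - (lsubst p :: 'k::field laurent)"
  using lsubst_smult[of "- 1" p] by (simp add: lconst_hom)

lemma lbar_lsubst [simp]: "lbar (lsubst p) = (lsubst p :: 'k::field laurent)"
  by (induction p) (auto simp: algebra_simps)

text \<open>The lowest term of f(t + 1/t) comes from the leading term of f and the summand 1/t
  alone; each step of the recursion lowers the exponent by one.\<close>

lemma lsubst_lowest:
  fixes p :: "'k::field poly"
  shows "vanish (- int (Polynomial.degree p)) (lsubst p)" "co (lsubst p) (- int (Polynomial.degree p)) = Polynomial.lead_coeff p"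
proof -
  have "vanish (- int (Polynomial.degree p)) (lsubst p) \<and> co (lsubst p) (- int (Polynomial.degree p)) = Polynomial.lead_coeff p"
  proof (induction p)
    case (pCons a p)
    show ?case
    proof (cases "p = 0")
      case False
      have "vanish (- int (Polynomial.degree p)) (lsubst p)" using pCons by simp
      then have "co (lsubst p) n = 0" if "n < - int (Polynomial.degree p)" for n using that vanishD by blast
      then show ?thesis using False pCons by (auto simp: vanish_def distrib_right)
    qed (auto simp: vanish_def)
  qed auto
  then show "vanish (- int (Polynomial.degree p)) (lsubst p)" "co (lsubst p) (- int (Polynomial.degree p)) = Polynomial.lead_coeff p" by auto
qed

lemma lsubst_eq_0_iff [simp]: "lsubst p = (0 :: 'k::field laurent) \<longleftrightarrow> p = 0"
proof
  assume "lsubst p = (0 :: 'k laurent)"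
  then show "p = 0" using lsubst_lowest(2)[of p] by simp
qed simp

section \<open>The quaternion ring\<close>

text \<open>The quaternion \<open>Qn g1 g2\<close> stands for the matrix \<open>quat g1 g2\<close>.\<close>

typedef (overloaded) 'k qn = "UNIV :: ('k::zero laurent \<times> 'k laurent) set"
  by simp

definition Qn :: "'k::zero laurent \<Rightarrow> 'k laurent \<Rightarrow> 'k qn" where
  "Qn a b = Abs_qn (a, b)"

definition q1 :: "'k::zero qn \<Rightarrow> 'k laurent" where
  "q1 x = fst (Rep_qn x)"

definition q2 :: "'k::zero qn \<Rightarrow> 'k laurent" where
  "q2 x = snd (Rep_qn x)"

lemma q_Qn [simp]: "q1 (Qn a b) = a" "q2 (Qn a b) = b"
  by (simp_all add: q1_def q2_def Qn_def Abs_qn_inverse)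

lemma qn_eqI: "q1 x = q1 y \<Longrightarrow> q2 x = q2 y \<Longrightarrow> x = y"
  by (simp add: q1_def q2_def prod_eq_iff flip: Rep_qn_inject)

lemma qn_eq_iff: "x = y \<longleftrightarrow> q1 x = q1 y \<and> q2 x = q2 y"
  using qn_eqI by blast

instantiation qn :: (field) ring_1
begin

definition zero_qn :: "'a qn" where "0 = Qn 0 0"
definition one_qn :: "'a qn" where "1 = Qn 1 0"
definition plus_qn :: "'a qn \<Rightarrow> 'a qn \<Rightarrow> 'a qn" where "x + y = Qn (q1 x + q1 y) (q2 x + q2 y)"
definition uminus_qn :: "'a qn \<Rightarrow> 'a qn" where "- x = Qn (- q1 x) (- q2 x)"
definition minus_qn :: "'a qn \<Rightarrow> 'a qn \<Rightarrow> 'a qn" where "x - y = Qn (q1 x - q1 y) (q2 x - q2 y)"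
definition times_qn :: "'a qn \<Rightarrow> 'a qn \<Rightarrow> 'a qn" where
  "x * y = Qn (q1 x * q1 y - q2 x * (lPhi * lbar (q2 y))) (q1 x * q2 y + q2 x * lbar (q1 y))"

lemma qn_defs: "(0 :: 'a qn) = Qn 0 0" "(1 :: 'a qn) = Qn 1 0" "x + y = Qn (q1 x + q1 y) (q2 x + q2 y)"
  "- x = Qn (- q1 x) (- q2 x)" "x - y = Qn (q1 x - q1 y) (q2 x - q2 y)"
  "x * y = Qn (q1 x * q1 y - q2 x * (lPhi * lbar (q2 y))) (q1 x * q2 y + q2 x * lbar (q1 y))"
  for x y :: "'a qn"
  by (rule zero_qn_def one_qn_def plus_qn_def uminus_qn_def minus_qn_def times_qn_def)+

instance
proof
  fix a b c :: "'a qn"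
  show "a * b * c = a * (b * c)"
    by (rule qn_eqI) (simp_all add: qn_defs algebra_simps)
  show "(a + b) * c = a * c + b * c" "a * (b + c) = a * b + a * c"
    by (rule qn_eqI; simp add: qn_defs algebra_simps)+
  show "a + b + c = a + (b + c)" "a + b = b + a" "0 + a = a" "- a + a = 0" "a - b = a + - b" "1 * a = a" "a * 1 = a"
    by (rule qn_eqI; simp add: qn_defs)+
  show "(0 :: 'a qn) \<noteq> 1"
    by (simp add: qn_eq_iff qn_defs)
qed

end

lemma q_simps [simp]:
  "q1 0 = 0" "q2 0 = 0" "q1 1 = 1" "q2 1 = 0"
  "q1 (x + y) = q1 x + q1 y" "q2 (x + y) = q2 x + q2 y"
  "q1 (x - y) = q1 x - q1 y" "q2 (x - y) = q2 x - q2 y"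
  "q1 (- x) = - q1 x" "q2 (- x) = - q2 x"
  for x y :: "'k::field qn"
  by (simp_all add: qn_defs)

lemma q1_mult: "q1 (x * y) = q1 x * q1 y - q2 x * (lPhi * lbar (q2 y))"
  and q2_mult: "q2 (x * y) = q1 x * q2 y + q2 x * lbar (q1 y)"
  for x y :: "'k::field qn"
  by (simp_all add: qn_defs)

definition dag :: "'k::field qn \<Rightarrow> 'k qn" where
  "dag x = Qn (lbar (q1 x)) (- q2 x)"

text \<open>Conjugation by \<open>diag(1, -1)\<close> after \<open>t \<mapsto> t\<inverse>\<close>: this automorphism exchanges upper and lower.\<close>

definition qflip :: "'k::field qn \<Rightarrow> 'k qn" where
  "qflip x = Qn (lbar (q1 x)) (- lbar (q2 x))"

text \<open>The determinant of the matrix of \<open>x\<close>; as a reduced norm it is invariant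
  under \<open>lbar\<close>.\<close>

definition qnorm :: "'k::field qn \<Rightarrow> 'k laurent" where
  "qnorm x = q1 x * lbar (q1 x) + lPhi * (q2 x * lbar (q2 x))"

definition ql :: "'k::field laurent \<Rightarrow> 'k qn" where
  "ql f = Qn f 0"

abbreviation qc :: "'k::field \<Rightarrow> 'k qn" where
  "qc c \<equiv> ql (lconst c)"

lemma ql_simps [simp]:
  "q1 (ql f) = f" "q2 (ql f) = 0" "q1 (dag x) = lbar (q1 x)" "q2 (dag x) = - q2 x"
  "q1 (qflip x) = lbar (q1 x)" "q2 (qflip x) = - lbar (q2 x)"
  by (simp_all add: ql_def dag_def qflip_def)

lemma q_ql_mult [simp]: "q1 (ql f * x) = f * q1 x" "q2 (ql f * x) = f * q2 x"
  by (simp_all add: q1_mult q2_mult)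

lemma ql_comm: "lbar f = f \<Longrightarrow> x * ql f = ql f * x"
  by (rule qn_eqI) (simp_all add: q1_mult q2_mult algebra_simps)

lemma dag_mult: "dag (x * y) = dag y * dag x"
  by (rule qn_eqI) (simp_all add: q1_mult q2_mult algebra_simps)

lemma dag_simps [simp]: "dag (x + y) = dag x + dag y" "dag (- x) = - dag x" "dag (x - y) = dag x - dag y"
    "dag (dag x) = x" "dag 1 = 1" "dag (ql f) = ql (lbar f)"
  by (rule qn_eqI; simp)+

lemma qflip_simps [simp]: "qflip (x + y) = qflip x + qflip y" "qflip (- x) = - qflip x"
    "qflip (x - y) = qflip x - qflip y" "qflip (qflip x) = x" "qflip 1 = 1" "qflip (ql f) = ql (lbar f)"
  by (rule qn_eqI; simp)+

lemma qflip_mult: "qflip (x * y) = qflip x * qflip y"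
  by (rule qn_eqI) (simp_all add: q1_mult q2_mult algebra_simps)

lemma mult_dag: "x * dag x = ql (qnorm x)"
  by (rule qn_eqI) (simp_all add: q1_mult q2_mult qnorm_def algebra_simps)

lemma dag_mult_self: "dag x * x = ql (qnorm x)"
  by (rule qn_eqI) (simp_all add: q1_mult q2_mult qnorm_def algebra_simps)

lemma qnorm_mult: "qnorm (x * y) = qnorm x * qnorm y"
  by (simp add: qnorm_def q1_mult q2_mult algebra_simps)

lemma qnorm_simps [simp]: "qnorm (dag x) = qnorm x" "qnorm (ql f) = f * lbar f" "qnorm 1 = 1" "qnorm (qflip x) = qnorm x"
    "qnorm (- x) = qnorm x" "lbar (qnorm x) = qnorm x"
  by (simp_all add: qnorm_def algebra_simps)

text \<open>A constant norm is demanded instead of a unit norm. The two agree, because the norm is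
  symmetric and a symmetric unit of the Laurent ring is constant.\<close>

definition qunit :: "'k::field qn \<Rightarrow> bool" where
  "qunit x \<longleftrightarrow> (\<exists>c. c \<noteq> 0 \<and> qnorm x = lconst c)"

lemma qunit_mult: "qunit x \<Longrightarrow> qunit y \<Longrightarrow> qunit (x * y)"
  unfolding qunit_def qnorm_mult by (metis lconst_hom(4) mult_eq_0_iff)

lemma qunit_simps [simp]: "qunit (dag x) = qunit x" "qunit (qflip x) = qunit x" "qunit 1" "c \<noteq> 0 \<Longrightarrow> qunit (qc c)"
    "qunit (- x) = qunit x"
  by (auto simp: qunit_def lconst_hom(4)[symmetric] intro: exI[of _ 1])

section \<open>The quaternionic group as a quotient of quaternions\<close>

lemma mat22_nth [simp]:
  "mat22 a b c d $ 1 $ 1 = a" "mat22 a b c d $ 1 $ 2 = b"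
  "mat22 a b c d $ 2 $ 1 = c" "mat22 a b c d $ 2 $ 2 = d"
  by (simp_all add: mat22_def)

lemma mat22_eqI:
  "A $ 1 $ 1 = B $ 1 $ 1 \<Longrightarrow> A $ 1 $ 2 = B $ 1 $ 2 \<Longrightarrow> A $ 2 $ 1 = B $ 2 $ 1 \<Longrightarrow> A $ 2 $ 2 = B $ 2 $ 2 \<Longrightarrow> A = B"
  for A B :: "'r ^ 2 ^ 2"
  by (simp add: vec_eq_iff forall_2)

lemma mat22_mult: "mat22 a b c d ** mat22 a' b' c' d' =
    mat22 (a * a' + b * c') (a * b' + b * d') (c * a' + d * c') (c * b' + d * d')"
  by (rule mat22_eqI) (simp_all add: matrix_matrix_mult_def sum_2)

lemma mat_eq_mat22: "mat u = mat22 u 0 0 u"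
  by (rule mat22_eqI) (simp_all add: mat_def)

lemma mat22_collapse: "A = mat22 (A $ 1 $ 1) (A $ 1 $ 2) (A $ 2 $ 1) (A $ 2 $ 2)"
  by (rule mat22_eqI) simp_all

lemma mat22_add: "mat22 a b c d + mat22 a' b' c' d' = mat22 (a + a') (b + b') (c + c') (d + d')"
  for a :: "'r::comm_ring_1"
  by (rule mat22_eqI) simp_all

lemma mat_mult_mat22: "mat u ** mat22 a b c d = mat22 (u * a) (u * b) (u * c) (u * d)"
  for a :: "'r::comm_ring_1"
  by (simp add: mat_eq_mat22 mat22_mult)

lemma mat_mult_mat: "mat u ** mat v = (mat (u * v) :: 'r::comm_ring_1 ^ 2 ^ 2)"
  by (simp add: mat_eq_mat22 mat22_mult)

lemma mat_commute: "mat u ** A = A ** mat u" for A :: "'r::comm_ring_1 ^ 2 ^ 2"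
  by (subst (1 2) mat22_collapse[of A]) (simp add: mat_eq_mat22 mat22_mult mult.commute)

section \<open>The projective group as a quotient by scalars\<close>

lemma group_GL2: "group (GL2 :: ('r::comm_ring_1 ^ 2 ^ 2) monoid)"
proof (rule groupI)
  fix A B :: "'r ^ 2 ^ 2"
  assume "A \<in> carrier GL2" "B \<in> carrier GL2"
  then obtain A' B' where "A ** A' = mat 1" "A' ** A = mat 1" "B ** B' = mat 1" "B' ** B = mat 1"
    by (auto simp: GL2_def invertible_def)
  moreover from this have "(A ** B) ** (B' ** A') = mat 1" "(B' ** A') ** (A ** B) = mat 1"
    by (metis matrix_mul_assoc matrix_mul_rid)+
  ultimately show "A \<otimes>\<^bsub>GL2\<^esub> B \<in> carrier GL2"
    by (auto simp: GL2_def invertible_def)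
next
  fix A :: "'r ^ 2 ^ 2"
  assume "A \<in> carrier GL2"
  then show "\<exists>B\<in>carrier GL2. B \<otimes>\<^bsub>GL2\<^esub> A = \<one>\<^bsub>GL2\<^esub>"
    by (auto simp: GL2_def invertible_def)
qed (auto simp: GL2_def matrix_mul_assoc invertible_def intro: exI[of _ "mat 1"])

lemma mat_unit_in_GL2:
  fixes u :: "'r::comm_ring_1"
  assumes "u dvd 1"
  shows "mat u \<in> carrier GL2"
proof -
  obtain v where v: "u * v = 1" using assms by (metis dvdE)
  then have "v * u = 1" by (simp add: mult.commute)
  then show ?thesis using v by (auto simp: GL2_def invertible_def mat_mult_mat intro!: exI[of _ "mat v"])
qed

lemma subgroup_unit_scalars: "subgroup (unit_scalars :: ('r::comm_ring_1 ^ 2 ^ 2) set) GL2"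
proof (rule group.subgroupI[OF group_GL2])
  show "unit_scalars \<subseteq> carrier GL2"
    using mat_unit_in_GL2 by (auto simp: unit_scalars_def)
  show "(unit_scalars :: ('r ^ 2 ^ 2) set) \<noteq> {}"
    by (auto simp: unit_scalars_def intro: exI[of _ 1])
next
  fix A :: "'r ^ 2 ^ 2"
  assume "A \<in> unit_scalars"
  then obtain u where u: "A = mat u" "u dvd 1" by (auto simp: unit_scalars_def)
  obtain v where v: "1 = u * v" using u(2) by (metis dvdE)
  then have "v dvd 1" by (metis dvd_triv_right)
  moreover have "inv\<^bsub>GL2\<^esub> A = mat v"
    using mat_unit_in_GL2[OF \<open>v dvd 1\<close>] mat_unit_in_GL2[OF u(2)] v u
    by (intro group.inv_equality[OF group_GL2]) (auto simp: GL2_def mat_mult_mat mult.commute)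
  ultimately show "inv\<^bsub>GL2\<^esub> A \<in> unit_scalars"
    by (auto simp: unit_scalars_def)
next
  fix A B :: "'r ^ 2 ^ 2"
  assume "A \<in> unit_scalars" "B \<in> unit_scalars"
  then obtain u v where "A = mat u" "u dvd 1" "B = mat v" "v dvd 1" by (auto simp: unit_scalars_def)
  moreover from this have "u * v dvd 1" by (metis mult_dvd_mono mult_1)
  ultimately show "A \<otimes>\<^bsub>GL2\<^esub> B \<in> unit_scalars"
    by (auto simp: unit_scalars_def GL2_def mat_mult_mat)
qed

lemma normal_unit_scalars: "unit_scalars \<lhd> (GL2 :: ('r::comm_ring_1 ^ 2 ^ 2) monoid)"
proof (rule group.normalI[OF group_GL2 subgroup_unit_scalars], rule ballI)
  fix A :: "'r ^ 2 ^ 2"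
  show "unit_scalars #>\<^bsub>GL2\<^esub> A = A <#\<^bsub>GL2\<^esub> unit_scalars"
    unfolding r_coset_def l_coset_def by (rule SUP_cong) (auto simp: unit_scalars_def GL2_def mat_commute)
qed

lemma PGL2_mult:
  fixes A B :: "'r::comm_ring_1 ^ 2 ^ 2"
  assumes "A \<in> carrier GL2" "B \<in> carrier GL2"
  shows "pclass A \<otimes>\<^bsub>PGL2\<^esub> pclass B = pclass (A ** B)"
  using normal.rcos_sum[OF normal_unit_scalars assms] by (simp add: PGL2_def FactGroup_def pclass_def GL2_def)

lemma PGL2_one: "\<one>\<^bsub>PGL2\<^esub> = pclass (mat 1 :: 'r::comm_ring_1 ^ 2 ^ 2)"
  by (auto simp: PGL2_def FactGroup_def pclass_def r_coset_def GL2_def)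

lemma mem_pclass: "B \<in> pclass A \<longleftrightarrow> (\<exists>u. u dvd 1 \<and> B = mat u ** A)" for A :: "'r::comm_ring_1 ^ 2 ^ 2"
  by (auto simp: pclass_def r_coset_def unit_scalars_def GL2_def)

lemma self_mem_pclass: "A \<in> pclass A" for A :: "'r::comm_ring_1 ^ 2 ^ 2"
  unfolding mem_pclass by (intro exI[of _ 1]) simp

lemma pclass_eqI:
  fixes A B :: "'r::comm_ring_1 ^ 2 ^ 2"
  assumes "u dvd 1" "B = mat u ** A"
  shows "pclass A = pclass B"
proof -
  obtain v where v: "1 = u * v" using assms(1) by (metis dvdE)
  have vd: "v dvd 1" using v by (metis dvd_triv_right)
  have A: "A = mat v ** B" using v assms(2) by (simp add: matrix_mul_assoc mat_mult_mat mult.commute)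
  show ?thesis
  proof (rule Set.set_eqI)
    fix C
    show "C \<in> pclass A \<longleftrightarrow> C \<in> pclass B"
    proof
      assume "C \<in> pclass A"
      then obtain w where "w dvd 1" "C = mat w ** A" by (auto simp: mem_pclass)
      then have "C = mat (w * v) ** B" "w * v dvd 1"
        using A vd mult_dvd_mono[of w 1 v 1] by (simp_all add: matrix_mul_assoc mat_mult_mat)
      then show "C \<in> pclass B" unfolding mem_pclass by blast
    next
      assume "C \<in> pclass B"
      then obtain w where "w dvd 1" "C = mat w ** B" by (auto simp: mem_pclass)
      then have "C = mat (w * u) ** A" "w * u dvd 1"
        using assms mult_dvd_mono[of w 1 u 1] by (simp_all add: matrix_mul_assoc mat_mult_mat)
      then show "C \<in> pclass A" unfolding mem_pclass by blast
    qed
  qed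
qed

definition qmat :: "'k::field qn \<Rightarrow> 'k laurent ^ 2 ^ 2" where
  "qmat x = quat (q1 x) (q2 x)"

lemma qmat_mult: "qmat (x * y) = qmat x ** qmat y"
  unfolding qmat_def quat_def mat22_mult by (rule mat22_eqI) (simp_all add: q1_mult q2_mult algebra_simps)

lemma qmat_ql: "lbar u = u \<Longrightarrow> qmat (ql u * x) = mat u ** qmat x"
  unfolding qmat_def quat_def mat_mult_mat22 by (rule mat22_eqI) (simp_all add: algebra_simps)

lemma qmat_one: "qmat 1 = mat 1"
  by (simp add: qmat_def quat_def mat_eq_mat22)

text \<open>The inverse of a symmetric unit is symmetric as well, so neither has a positive lowest
  exponent; since the lowest exponents add up to 0, both vanish, and by symmetry nothing lies above
  exponent 0 either.\<close>

lemma lbar_unit_const: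
  fixes u :: "'k::field laurent"
  assumes "u dvd 1" "lbar u = u"
  shows "\<exists>c. c \<noteq> 0 \<and> u = lconst c"
proof -
  obtain v where v: "1 = u * v" using assms(1) by (metis dvdE)
  have "u \<noteq> 0" "v \<noteq> 0" using v by auto
  have "u * lbar v = lbar (u * v)" using assms(2) by simp
  then have "u * lbar v = u * v" by (simp add: v[symmetric])
  then have bv: "lbar v = v" using \<open>u \<noteq> 0\<close> by simp
  obtain m where m: "vanish m u" "co u m \<noteq> 0" using lowest_exists[OF \<open>u \<noteq> 0\<close>] by blast
  obtain n where n: "vanish n v" "co v n \<noteq> 0" using lowest_exists[OF \<open>v \<noteq> 0\<close>] by blast
  have "co u (- m) \<noteq> 0" "co v (- n) \<noteq> 0"
    using m(2) n(2) assms(2) bv co_bar[of u m] co_bar[of v n] by auto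
  \<comment> \<open>By symmetry the coefficient at \<open>- m\<close> is nonzero too, so
    \<open>- m\<close> is not below the lowest exponent \<open>m\<close>.\<close>
  then have "m \<le> 0" "n \<le> 0" using vanishD[OF m(1), of "- m"] vanishD[OF n(1), of "- n"] by force+
  moreover have "co (1 :: 'k laurent) (m + n) \<noteq> 0" unfolding v using vanish_mult(2)[OF m(1) n(1)] m(2) n(2) by simp
  ultimately have "m = 0" by (simp split: if_splits)
  have "u = lconst (co u 0)"
  proof (rule laurent_eqI)
    fix k
    have "k < 0 \<Longrightarrow> co u k = 0" for k using vanishD[OF m(1)] \<open>m = 0\<close> by simp
    from this[of k] this[of "- k"] show "co u k = co (lconst (co u 0)) k"
      using co_bar[of u k] assms(2) by (cases k "0 :: int" rule: linorder_cases) auto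
  qed
  then show ?thesis using m(2) \<open>m = 0\<close> by auto
qed

lemma const_dvd_1: "c \<noteq> 0 \<Longrightarrow> lconst c dvd (1 :: 'k::field laurent)"
  by (rule dvdI[of _ _ "lconst (inverse c)"]) (simp flip: lconst_hom(4))

lemma qmat_in_GL2: "qmat x \<in> carrier GL2 \<longleftrightarrow> qunit x"
proof
  assume "qmat x \<in> carrier GL2"
  then obtain B where "qmat x ** B = mat 1" by (auto simp: GL2_def invertible_def)
  then have "det (qmat x) * det B = 1" using det_mul[of "qmat x" B] by (simp add: det_I)
  moreover have "det (qmat x) = qnorm x"
    by (simp add: det_2 qmat_def quat_def qnorm_def algebra_simps)
  ultimately have "qnorm x dvd 1" by (metis dvd_triv_left)
  then show "qunit x" using lbar_unit_const[of "qnorm x"] by (simp add: qunit_def)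
next
  assume "qunit x"
  then obtain c where c: "c \<noteq> 0" "qnorm x = lconst c" by (auto simp: qunit_def)
  have 1: "qc (inverse c) * ql (qnorm x) = 1"
    using c by (intro qn_eqI) (simp_all add: lconst_hom(4)[symmetric])
  have "x * (qc (inverse c) * dag x) = qc (inverse c) * (x * dag x)"
    using ql_comm[of "lconst (inverse c)" x] by (simp add: mult.assoc[symmetric])
  then have "x * (qc (inverse c) * dag x) = 1" by (simp add: mult_dag 1)
  moreover have "(qc (inverse c) * dag x) * x = 1" by (simp add: mult.assoc dag_mult_self 1)
  ultimately have "qmat x ** qmat (qc (inverse c) * dag x) = mat 1" "qmat (qc (inverse c) * dag x) ** qmat x = mat 1"
    by (simp_all only: qmat_mult[symmetric] qmat_one)
  then show "qmat x \<in> carrier GL2"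
    unfolding GL2_def invertible_def by auto
qed

definition cls :: "'k::field qn \<Rightarrow> ('k laurent ^ 2 ^ 2) set" where
  "cls x = pclass (qmat x)"

lemma lPhi_nonzero: "(lPhi :: 'k::field laurent) \<noteq> 0"
proof
  assume "(lPhi :: 'k laurent) = 0"
  then have "co (lPhi :: 'k laurent) 1 = 0" by simp
  then show False by (simp add: lPhi_def)
qed

text \<open>The second row of a quaternion matrix is determined by conjugating the first. A scalar
  that respects this shape is therefore fixed by \<open>lbar\<close>, hence constant.\<close>

lemma qmat_scale_const:
  assumes x: "qunit x" and "u dvd 1" "qmat y = mat u ** qmat x"
  shows "\<exists>c. c \<noteq> 0 \<and> y = qc c * x"
proof -
  have y: "q1 y = u * q1 x" "q2 y = u * q2 x"
    and "lbar (q1 y) = u * lbar (q1 x)" "lPhi * lbar (q2 y) = u * (lPhi * lbar (q2 x))"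
    using arg_cong[OF assms(3), of "\<lambda>A. A $ 1 $ 1"] arg_cong[OF assms(3), of "\<lambda>A. A $ 1 $ 2"]
      arg_cong[OF assms(3), of "\<lambda>A. A $ 2 $ 1"] arg_cong[OF assms(3), of "\<lambda>A. A $ 2 $ 2"]
    unfolding qmat_def quat_def mat_mult_mat22 by simp_all
  then have "(lbar u - u) * lbar (q1 x) = 0" "(lbar u - u) * (lPhi * lbar (q2 x)) = 0"
    by (simp_all add: algebra_simps)
  moreover have "q1 x \<noteq> 0 \<or> q2 x \<noteq> 0" using x by (auto simp: qunit_def qnorm_def)
  ultimately have "lbar u = u" using lPhi_nonzero[where 'k = 'a] by auto
  then obtain c where "c \<noteq> 0" "u = lconst c" using lbar_unit_const assms(2) by blast
  then show ?thesis using y by (intro exI[of _ c] conjI qn_eqI) simp_all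
qed

lemma cls_eq_iff:
  assumes "qunit x"
  shows "cls x = cls y \<longleftrightarrow> (\<exists>c. c \<noteq> 0 \<and> y = qc c * x)"
proof
  assume "cls x = cls y"
  then have "qmat y \<in> pclass (qmat x)" using self_mem_pclass[of "qmat y"] by (simp add: cls_def)
  then obtain u where "u dvd 1" "qmat y = mat u ** qmat x" by (auto simp: mem_pclass)
  then show "\<exists>c. c \<noteq> 0 \<and> y = qc c * x" using qmat_scale_const[OF assms] by blast
next
  assume "\<exists>c. c \<noteq> 0 \<and> y = qc c * x"
  then obtain c where c: "c \<noteq> 0" "y = qc c * x" by blast
  then show "cls x = cls y" unfolding cls_def
    by (intro pclass_eqI[of "lconst c"]) (auto simp: qmat_ql const_dvd_1)
qed

lemma cls_scale: "c \<noteq> 0 \<Longrightarrow> cls (qc c * x) = cls x"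
  unfolding cls_def by (rule pclass_eqI[of "lconst c", symmetric]) (auto simp: qmat_ql const_dvd_1)

lemma quat_carrier: "carrier quat_group = cls ` Collect qunit"
proof -
  have "invertible (quat g1 g2) \<longleftrightarrow> qunit (Qn g1 g2)" for g1 g2 :: "'a laurent"
    using qmat_in_GL2[of "Qn g1 g2"] by (simp add: GL2_def qmat_def)
  then have "{pclass (quat g1 g2) |g1 g2. invertible (quat g1 g2)} = {cls (Qn g1 g2) |g1 g2 :: 'a laurent. qunit (Qn g1 g2)}"
    by (auto simp: cls_def qmat_def)
  also have "\<dots> = cls ` Collect qunit"
  proof (intro Set.set_eqI iffI)
    fix M assume "M \<in> cls ` Collect (qunit :: 'a qn \<Rightarrow> bool)"
    then obtain x :: "'a qn" where "qunit x" "M = cls x" by auto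
    moreover have "x = Qn (q1 x) (q2 x)" by (rule qn_eqI) simp_all
    ultimately show "M \<in> {cls (Qn g1 g2) |g1 g2. qunit (Qn g1 g2)}" by (metis (mono_tags, lifting) mem_Collect_eq)
  qed auto
  finally show ?thesis by (simp add: quat_group_def)
qed

lemma cls_in [simp, intro]: "qunit x \<Longrightarrow> cls x \<in> carrier quat_group"
  by (auto simp: quat_carrier)

lemma cls_mult: "qunit x \<Longrightarrow> qunit y \<Longrightarrow> cls x \<otimes>\<^bsub>quat_group\<^esub> cls y = cls (x * y)"
  using PGL2_mult[of "qmat x" "qmat y"] by (simp add: quat_group_def cls_def qmat_mult qmat_in_GL2)

lemma cls_one: "\<one>\<^bsub>quat_group\<^esub> = cls 1"
  by (simp add: quat_group_def cls_def qmat_one PGL2_one)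

lemma cls_dag_mult: "qunit x \<Longrightarrow> cls (dag x) \<otimes>\<^bsub>quat_group\<^esub> cls x = \<one>\<^bsub>quat_group\<^esub>"
proof -
  assume x: "qunit x"
  then obtain c where c: "c \<noteq> 0" "qnorm x = lconst c" by (auto simp: qunit_def)
  have "cls (dag x * x) = cls (qc c * 1)" using c by (simp add: dag_mult_self)
  then show ?thesis using x c by (simp add: cls_mult cls_one cls_scale del: mult_1_right)
qed

lemma group_quat_group: "group quat_group"
proof (rule groupI)
  fix M :: "('a laurent ^ 2 ^ 2) set" assume "M \<in> carrier quat_group"
  then obtain x where x: "qunit x" "M = cls x" by (auto simp: quat_carrier)
  then show "\<exists>y\<in>carrier quat_group. y \<otimes>\<^bsub>quat_group\<^esub> M = \<one>\<^bsub>quat_group\<^esub>"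
    using cls_dag_mult by (intro bexI[of _ "cls (dag x)"]) auto
qed (auto simp: quat_carrier cls_mult cls_one qunit_mult mult.assoc)

lemma cls_inv: "qunit x \<Longrightarrow> inv\<^bsub>quat_group\<^esub> (cls x) = cls (dag x)"
  by (rule group.inv_equality[OF group_quat_group cls_dag_mult]) auto

lemma cls_eq_one_iff: "qunit x \<Longrightarrow> cls x = \<one>\<^bsub>quat_group\<^esub> \<longleftrightarrow> (\<exists>c. c \<noteq> 0 \<and> x = qc c)"
  unfolding cls_one by (subst eq_commute, subst cls_eq_iff) auto

lemma rep_type_scale:
  assumes "c \<noteq> 0"
  shows "rep_type (lconst c * f) (lconst c * g) = rep_type f g"
proof -
  have keys: "Poly_Mapping.keys (lconst c * f) = Poly_Mapping.keys f" for f :: "'a laurent"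
    using assms by (auto simp: in_keys_iff)
  have deg: "low_deg (lconst c * f) = low_deg f" "high_deg (lconst c * f) = high_deg f"
    "low_coeff (lconst c * f) = c * low_coeff f" for f :: "'a laurent"
    by (simp_all add: low_coeff_def low_deg_def high_deg_def keys)
  have "- (c * a) * inverse (c * b) = - a * inverse b" "- inverse (c * a) * (c * b) = - inverse a * b" for a b
    using assms by simp_all
  then show ?thesis using assms
    by (simp only: rep_type_def upper_balanced_def lower_balanced_def deg mult_eq_0_iff lconst_eq_0_iff) simp
qed

lemma quat_type_cls:
  assumes "qunit x"
  shows "quat_type (cls x) = rep_type (q1 x) (q2 x)"
  unfolding quat_type_def
proof (rule the_equality)
  show "\<exists>g1 g2. cls x = pclass (quat g1 g2) \<and> rep_type g1 g2 = rep_type (q1 x) (q2 x)"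
    by (auto simp: cls_def qmat_def)
next
  fix r assume "\<exists>g1 g2. cls x = pclass (quat g1 g2) \<and> rep_type g1 g2 = r"
  then obtain g1 g2 where g: "cls x = cls (Qn g1 g2)" "rep_type g1 g2 = r"
    by (auto simp: cls_def qmat_def)
  then obtain c where c: "c \<noteq> 0" "Qn g1 g2 = qc c * x" using cls_eq_iff[OF assms] by blast
  have "g1 = lconst c * q1 x" "g2 = lconst c * q2 x"
    using arg_cong[OF c(2), of q1] arg_cong[OF c(2), of q2] by simp_all
  then show "r = rep_type (q1 x) (q2 x)" using g(2) c(1) rep_type_scale by metis
qed

section \<open>Types of quaternions\<close>

text \<open>For \<open>r \<noteq> 0\<close>, \<open>Up r\<close> and \<open>Lo r\<close> are the upper- and lower-balanced quaternions of type \<open>r\<close>, read off the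
  lowest coefficients alone; for \<open>r = 0\<close> they split the unbalanced ones by the sign of the offset
  between the two lowest exponents.\<close>

definition Up :: "'k::field \<Rightarrow> 'k qn \<Rightarrow> bool" where
  "Up r x \<longleftrightarrow> (\<exists>m. vanish m (q1 x) \<and> vanish m (q2 x) \<and> co (q2 x) m \<noteq> 0 \<and> co (q1 x) m = - r * co (q2 x) m)
     \<or> (q2 x = 0 \<and> r = 0 \<and> vanish 1 (q1 x))"

definition Lo :: "'k::field \<Rightarrow> 'k qn \<Rightarrow> bool" where
  "Lo r x \<longleftrightarrow> (q2 x \<noteq> 0 \<and> (\<exists>m. vanish m (q1 x) \<and> vanish (m + 1) (q2 x) \<and> co (q1 x) m \<noteq> 0
       \<and> co (q2 x) (m + 1) = - r * co (q1 x) m))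
     \<or> (q2 x = 0 \<and> r = 0 \<and> \<not> vanish 0 (q1 x))"

definition qtype :: "'k::field \<Rightarrow> bool \<Rightarrow> 'k qn \<Rightarrow> bool" where
  "qtype r b x = (if b then Up r x else Lo r x)"

definition elem :: "'k::field \<Rightarrow> 'k qn" where
  "elem r = Qn (lt - lconst (r ^ 2)) (lconst r)"

lemma elem_simps [simp]: "q1 (elem r) = lt - lconst (r ^ 2)" "q2 (elem r) = lconst r"
  by (simp_all add: elem_def)

lemma qmat_elem: "qmat (elem r) = elem_mat r"
  by (simp add: qmat_def quat_def elem_mat_def mult.commute)

lemma qnorm_elem: "qnorm (elem r) = lconst (1 + r ^ 2 + r ^ 4)"
  by (simp add: qnorm_def lPhi_def lconst_hom lconst_power power2_eq_square power4_eq_xxxx algebra_simps)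

lemma qunit_elem: "r ^ 4 + r ^ 2 + 1 \<noteq> 0 \<Longrightarrow> qunit (elem r)"
  unfolding qunit_def qnorm_elem by (intro exI[of _ "1 + r ^ 2 + r ^ 4"]) (simp add: algebra_simps)

lemma lt_nonzero: "(lt :: 'k::field laurent) \<noteq> 0"
proof
  assume "(lt :: 'k laurent) = 0"
  then have "co (lt :: 'k laurent) 1 = 0" by simp
  then show False by simp
qed

text \<open>The level is the smaller of the two lowest exponents after a shift by \<open>k\<close>.
  It avoids a case distinction on which entry is lower: both lowest coefficients are read at the
  level, and one of them may be 0.\<close>

lemma level_exists:
  assumes "f \<noteq> 0 \<or> g \<noteq> 0"
  shows "\<exists>i. vanish i f \<and> vanish (i + k) g \<and> (co f i \<noteq> 0 \<or> co g (i + k) \<noteq> 0)"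
proof (cases "f = 0")
  case True
  then obtain m where "vanish m g" "co g m \<noteq> 0" using lowest_exists[of g] assms by blast
  then show ?thesis using True by (intro exI[of _ "m - k"]) simp
next
  case f: False
  then obtain m where m: "vanish m f" "co f m \<noteq> 0" using lowest_exists[of f] by blast
  show ?thesis
  proof (cases "vanish (m + k) g")
    case True
    then show ?thesis using m by blast
  next
    case False
    then have "g \<noteq> 0" by auto
    then obtain n where n: "vanish n g" "co g n \<noteq> 0" using lowest_exists[of g] by blast
    then have "n < m + k" using False vanish_mono[OF n(1), of "m + k"] by linarith
    then have "vanish (n - k) f" using vanish_mono[OF m(1), of "n - k"] by simp
    then show ?thesis using n by (intro exI[of _ "n - k"]) simp
  qed
qed

lemma qunit_nonzero: "qunit x \<Longrightarrow> q1 x \<noteq> 0 \<or> q2 x \<noteq> 0"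
  by (auto simp: qunit_def qnorm_def)

text \<open>At the level with shift 1, the lowest coefficients of both new entries are multiples of
  the same form r a + b in the lowest coefficients a, b of \<open>x\<close>, with quotient - r. The
  form vanishes only if \<open>x\<close> is in \<open>Lo r\<close>. For \<open>r = 0\<close> the
  factor is diag(t, 1/t), and exponents have to be compared directly.\<close>

lemma Up_elem:
  assumes x: "q1 x \<noteq> 0 \<or> q2 x \<noteq> 0" and "\<not> Lo r x"
  shows "Up r (x * elem r)"
proof (cases "r = 0")
  case True
  then have eq: "q1 (x * elem r) = q1 x * lt" "q2 (x * elem r) = q2 x * lti"
    by (simp_all add: q1_mult q2_mult)
  show ?thesis
  proof (cases "q2 x = 0")
    case q2: True
    then have "vanish 0 (q1 x)" using assms True by (simp add: Lo_def)
    then show ?thesis using q2 True unfolding Up_def eq by (auto simp: vanish_def)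
  next
    case False
    then obtain m where m: "vanish m (q2 x)" "co (q2 x) m \<noteq> 0" using lowest_exists by blast
    have "vanish (m - 1) (q1 x)"
    proof (cases "q1 x = 0")
      case q1: False
      then obtain a where a: "vanish a (q1 x)" "co (q1 x) a \<noteq> 0" using lowest_exists by blast
      have "a \<ge> m - 1"
      proof (rule ccontr)
        assume "\<not> a \<ge> m - 1"
        then have "vanish (a + 1) (q2 x)" "co (q2 x) (a + 1) = 0" using vanish_mono[OF m(1)] vanishD[OF m(1)] by auto
        then show False using assms(2) a True False by (auto simp: Lo_def)
      qed
      then show ?thesis using vanish_mono[OF a(1)] by simp
    qed simp
    then show ?thesis using m True unfolding Up_def eq
      by (intro disjI1 exI[of _ "m - 1"]) (auto simp: vanish_def)
  qed
next
  case False
  obtain i where i: "vanish i (q1 x)" "vanish (i + 1) (q2 x)" "co (q1 x) i \<noteq> 0 \<or> co (q2 x) (i + 1) \<noteq> 0"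
    using level_exists[OF x, of 1] by blast
  \<comment> \<open>The linear form in the lowest coefficients; its vanishing is literally the
    condition in \<open>Lo r\<close>.\<close>
  have ne: "r * co (q1 x) i + co (q2 x) (i + 1) \<noteq> 0"
  proof
    assume *: "r * co (q1 x) i + co (q2 x) (i + 1) = 0"
    then have "co (q1 x) i \<noteq> 0" using i(3) by auto
    moreover have **: "co (q2 x) (i + 1) = - r * co (q1 x) i" using * by (simp add: eq_neg_iff_add_eq_0 add.commute)
    moreover have "q2 x \<noteq> 0" using \<open>co (q1 x) i \<noteq> 0\<close> ** False by auto
    ultimately have "Lo r x" using i by (auto simp: Lo_def)
    then show False using assms by blast
  qed
  have [simp]: "co (q1 x) k = 0" if "k < i" for k using vanishD[OF i(1) that] .
  have [simp]: "co (q2 x) k = 0" if "k < i + 1" for k using vanishD[OF i(2) that] .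
  have eq: "q1 (x * elem r) = q1 x * lt - q1 x * lconst (r ^ 2) - q2 x * lconst r - (q2 x * lt) * lconst r - (q2 x * lti) * lconst r"
    "q2 (x * elem r) = q1 x * lconst r + q2 x * lti - q2 x * lconst (r ^ 2)"
    by (simp_all add: q1_mult q2_mult lPhi_def algebra_simps)
  have "vanish i (q1 (x * elem r))" "vanish i (q2 (x * elem r))"
    by (auto simp: vanish_def eq)
  moreover have "co (q2 (x * elem r)) i \<noteq> 0" "co (q1 (x * elem r)) i = - r * co (q2 (x * elem r)) i"
    using ne by (simp_all add: eq power2_eq_square algebra_simps)
  ultimately show ?thesis unfolding Up_def by blast
qed

text \<open>The same mechanism with shift 0 and the form a + r b, whose vanishing is the condition
  in \<open>Up r\<close>.\<close>

lemma Lo_elem: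
  assumes x: "q1 x \<noteq> 0 \<or> q2 x \<noteq> 0" and "\<not> Up r x"
  shows "Lo r (x * dag (elem r))"
proof (cases "r = 0")
  case True
  then have eq: "q1 (x * dag (elem r)) = q1 x * lti" "q2 (x * dag (elem r)) = q2 x * lt"
    by (simp_all add: q1_mult q2_mult)
  have q2: "q2 (x * dag (elem r)) = 0 \<longleftrightarrow> q2 x = 0" unfolding eq
    by (simp add: lt_nonzero)
  show ?thesis
  proof (cases "q2 x = 0")
    case q2: True
    then have "\<not> vanish 1 (q1 x)" using assms True by (simp add: Up_def)
    then obtain k where "k < 1" "co (q1 x) k \<noteq> 0" by (auto simp: vanish_def)
    then have "\<not> vanish 0 (q1 x * lti)" using vanishD[of 0 "q1 x * lti" "k - 1"] by auto
    then show ?thesis using q2 True unfolding Lo_def eq by simp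
  next
    case False
    then obtain m where m: "vanish m (q2 x)" "co (q2 x) m \<noteq> 0" using lowest_exists by blast
    have nv: "\<not> vanish (m + 1) (q1 x)"
    proof
      assume "vanish (m + 1) (q1 x)"
      then have "vanish m (q1 x)" "co (q1 x) m = 0" by (auto simp: vanish_def)
      then show False using assms(2) m True by (auto simp: Up_def)
    qed
    then have "q1 x \<noteq> 0" by auto
    then obtain a where a: "vanish a (q1 x)" "co (q1 x) a \<noteq> 0" using lowest_exists by blast
    have "a \<le> m" using nv vanish_mono[OF a(1), of "m + 1"] by linarith
    then have "vanish (a + 1) (q2 x * lt)" "vanish (a - 1) (q1 x * lti)" "vanish a (q2 x * lt)" "co (q2 x * lt) a = 0"
      using vanishD[OF m(1)] vanishD[OF a(1)] by (auto simp: vanish_def)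
    then have "\<exists>m. vanish m (q1 x * lti) \<and> vanish (m + 1) (q2 x * lt) \<and> co (q1 x * lti) m \<noteq> 0 \<and> co (q2 x * lt) (m + 1) = - r * co (q1 x * lti) m"
      using a True by (intro exI[of _ "a - 1"]) simp
    then show ?thesis using False q2 unfolding Lo_def eq by blast
  qed
next
  case False
  obtain i where i: "vanish i (q1 x)" "vanish i (q2 x)" "co (q1 x) i \<noteq> 0 \<or> co (q2 x) i \<noteq> 0"
    using level_exists[OF x, of 0] by auto
  have ne: "co (q1 x) i + r * co (q2 x) i \<noteq> 0"
  proof
    assume *: "co (q1 x) i + r * co (q2 x) i = 0"
    then have "co (q2 x) i \<noteq> 0" using i(3) by auto
    moreover have "co (q1 x) i = - r * co (q2 x) i" using * by (simp add: eq_neg_iff_add_eq_0)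
    ultimately have "Up r x" using i by (auto simp: Up_def)
    then show False using assms by blast
  qed
  have [simp]: "co (q1 x) k = 0" if "k < i" for k using vanishD[OF i(1) that] .
  have [simp]: "co (q2 x) k = 0" if "k < i" for k using vanishD[OF i(2) that] .
  have eq: "q1 (x * dag (elem r)) = q1 x * lti - q1 x * lconst (r ^ 2) + q2 x * lconst r + (q2 x * lt) * lconst r + (q2 x * lti) * lconst r"
    "q2 (x * dag (elem r)) = - (q1 x * lconst r) + q2 x * lt - q2 x * lconst (r ^ 2)"
    by (simp_all add: q1_mult q2_mult lPhi_def algebra_simps)
  have c: "co (q2 (x * dag (elem r))) i = - r * co (q1 (x * dag (elem r))) (i - 1)"
    "co (q1 (x * dag (elem r))) (i - 1) \<noteq> 0"
    using ne by (simp_all add: eq power2_eq_square algebra_simps)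
  then have "q2 (x * dag (elem r)) \<noteq> 0" using False by auto
  moreover have "vanish (i - 1) (q1 (x * dag (elem r)))" "vanish i (q2 (x * dag (elem r)))"
    by (auto simp: vanish_def eq)
  ultimately show ?thesis using c unfolding Lo_def by (intro disjI1 conjI exI[of _ "i - 1"]) auto
qed

lemma qtype_step:
  "q1 x \<noteq> 0 \<or> q2 x \<noteq> 0 \<Longrightarrow> \<not> qtype r (\<not> b) x \<Longrightarrow> qtype r b (x * (if b then elem r else dag (elem r)))"
  unfolding qtype_def using Up_elem[of x r] Lo_elem[of x r] by (cases b) metis+

lemma Up_level:
  assumes "Up r x" "q2 x \<noteq> 0" "vanish m (q2 x)" "co (q2 x) m \<noteq> 0"
  shows "vanish m (q1 x) \<and> co (q1 x) m = - r * co (q2 x) m"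
proof -
  obtain n where n: "vanish n (q1 x)" "vanish n (q2 x)" "co (q2 x) n \<noteq> 0" "co (q1 x) n = - r * co (q2 x) n"
    using assms by (auto simp: Up_def)
  then have "n = m" using vanish_unique assms by blast
  then show ?thesis using n by blast
qed

lemma Lo_level:
  assumes "Lo r x" "q2 x \<noteq> 0" "vanish m (q1 x)" "co (q1 x) m \<noteq> 0"
  shows "vanish (m + 1) (q2 x) \<and> co (q2 x) (m + 1) = - r * co (q1 x) m"
proof -
  obtain n where n: "vanish n (q1 x)" "vanish (n + 1) (q2 x)" "co (q1 x) n \<noteq> 0" "co (q2 x) (n + 1) = - r * co (q1 x) n"
    using assms by (auto simp: Lo_def)
  then have "n = m" using vanish_unique assms by blast
  then show ?thesis using n by blast
qed

lemma Lo_q1_nonzero: "Lo r x \<Longrightarrow> q1 x \<noteq> 0"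
  by (auto simp: Lo_def)

text \<open>In \<open>Up\<close> the first entry starts no lower than the second, in
  \<open>Lo\<close> it starts strictly lower; this holds for all types simultaneously.\<close>

lemma Up_Lo_disjoint: "Up r x \<Longrightarrow> \<not> Lo r' x"
proof (cases "q2 x = 0")
  case True
  then show "Up r x \<Longrightarrow> \<not> Lo r' x"
    using vanish_mono[of 1 "q1 x" 0] by (auto simp: Up_def Lo_def)
next
  case False
  assume U: "Up r x"
  obtain m where m: "vanish m (q2 x)" "co (q2 x) m \<noteq> 0" using lowest_exists[OF False] by blast
  show "\<not> Lo r' x"
  proof
    assume L: "Lo r' x"
    obtain a where a: "vanish a (q1 x)" "co (q1 x) a \<noteq> 0" using lowest_exists[OF Lo_q1_nonzero[OF L]] by blast
    have "a \<ge> m" using Up_level[OF U False m] a(2) vanishD[of m "q1 x" a] by force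
    moreover have "m \<ge> a + 1" using Lo_level[OF L False a] m(2) vanishD[of "a + 1" "q2 x" m] by force
    ultimately show False by simp
  qed
qed

lemma Up_unique: "Up r x \<Longrightarrow> Up r' x \<Longrightarrow> r = r'"
proof (cases "q2 x = 0")
  case False
  assume U: "Up r x" "Up r' x"
  obtain m where m: "vanish m (q2 x)" "co (q2 x) m \<noteq> 0" using lowest_exists[OF False] by blast
  show ?thesis using Up_level[OF U(1) False m] Up_level[OF U(2) False m] m(2) by auto
qed (auto simp: Up_def)

lemma Lo_unique: "Lo r x \<Longrightarrow> Lo r' x \<Longrightarrow> r = r'"
proof (cases "q2 x = 0")
  case False
  assume L: "Lo r x" "Lo r' x"
  obtain m where m: "vanish m (q1 x)" "co (q1 x) m \<noteq> 0" using lowest_exists[OF Lo_q1_nonzero[OF L(1)]] by blast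
  show ?thesis using Lo_level[OF L(1) False m] Lo_level[OF L(2) False m] m(2) by auto
qed (auto simp: Lo_def)

lemma qtype_unique: "qtype r b x \<Longrightarrow> qtype r' b' x \<Longrightarrow> r = r' \<and> b = b'"
  using Up_Lo_disjoint Up_unique Lo_unique by (auto simp: qtype_def split: if_splits)

lemma qtype_const: "c \<noteq> 0 \<Longrightarrow> \<not> qtype r b (qc c)"
  by (cases b) (auto simp: qtype_def Up_def Lo_def vanish_def split: if_splits)

lemma qtype_scale: "c \<noteq> 0 \<Longrightarrow> qtype r b (qc c * x) \<longleftrightarrow> qtype r b x"
proof -
  assume c: "c \<noteq> 0"
  have "c * a = - (c * d) \<longleftrightarrow> a = - d" for a d
    using c by (metis mult_minus_right mult_left_cancel)
  then show ?thesis using c by (cases b) (simp_all add: qtype_def Up_def Lo_def vanish_def mult.left_commute[of r c])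
qed

text \<open>The lowest term of \<Phi> times \<open>q2 x * lbar (q2 x)\<close> has a negative
  exponent, one less than \<open>b + b'\<close> because of the summand 1/t of \<Phi>. The constant
  norm does not reach down there, so the lowest term of \<open>q1 x * lbar (q1 x)\<close> must
  cancel it: this yields both the sum of the exponents and the relation between the four extreme
  coefficients.\<close>

lemma qunit_lowest:
  assumes "qunit x" "q2 x \<noteq> 0"
    and "vanish b (q2 x)" "co (q2 x) b \<noteq> 0" "vanish b' (lbar (q2 x))" "co (lbar (q2 x)) b' \<noteq> 0"
  shows "\<exists>a a'. vanish a (q1 x) \<and> co (q1 x) a \<noteq> 0 \<and> vanish a' (lbar (q1 x)) \<and> co (lbar (q1 x)) a' \<noteq> 0
    \<and> a + a' = b + b' - 1 \<and> co (q1 x) a * co (lbar (q1 x)) a' + co (q2 x) b * co (lbar (q2 x)) b' = 0"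
proof -
  obtain c where c: "qnorm x = lconst c" using assms(1) by (auto simp: qunit_def)
  define P where "P = q2 x * lbar (q2 x)"
  define S where "S = q1 x * lbar (q1 x)"
  have N: "S + (P + lt * P + lti * P) = lconst c"
    using c by (simp add: P_def S_def qnorm_def lPhi_def algebra_simps)
  have vP: "vanish (b + b') P" "co P (b + b') = co (q2 x) b * co (lbar (q2 x)) b'"
    unfolding P_def by (rule vanish_mult[OF assms(3,5)])+
  have X0: "co P (b + b') \<noteq> 0" using vP(2) assms by simp
  \<comment> \<open>The highest exponent \<open>- b'\<close> of \<open>q2 x\<close> is not below the
    lowest one, \<open>b\<close>.\<close>
  have "b' \<le> - b" using vanishD[OF assms(5), of "- b"] assms(4) by force
  have neg: "b + b' - 1 < 0" using \<open>b' \<le> - b\<close> by simp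
  have NX: "co (P + lt * P + lti * P) k = (if k = b + b' - 1 then co P (b + b') else 0)" if "k \<le> b + b' - 1" for k
    using that vanishD[OF vP(1)] by auto
  have Nk: "co S k + (if k = b + b' - 1 then co P (b + b') else 0) = 0" if "k \<le> b + b' - 1" for k
  proof -
    have "co (S + (P + lt * P + lti * P)) k = 0" unfolding N using that neg by simp
    then show ?thesis using NX[OF that] by simp
  qed
  have "q1 x \<noteq> 0" using Nk[of "b + b' - 1"] X0 by (auto simp: S_def)
  then obtain a where a: "vanish a (q1 x)" "co (q1 x) a \<noteq> 0" using lowest_exists by blast
  obtain a' where a': "vanish a' (lbar (q1 x))" "co (lbar (q1 x)) a' \<noteq> 0"
    using lowest_exists[of "lbar (q1 x)"] \<open>q1 x \<noteq> 0\<close> by auto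
  have vS: "vanish (a + a') S" "co S (a + a') = co (q1 x) a * co (lbar (q1 x)) a'"
    unfolding S_def by (rule vanish_mult[OF a(1) a'(1)])+
  have Y0: "co S (a + a') \<noteq> 0" using vS(2) a a' by simp
  have "a + a' = b + b' - 1"
  proof (rule ccontr)
    assume ne: "a + a' \<noteq> b + b' - 1"
    show False
    proof (cases "a + a' < b + b' - 1")
      case True
      then show False using Nk[of "a + a'"] Y0 by simp
    next
      case False
      then show False using Nk[of "b + b' - 1"] X0 vanishD[OF vS(1), of "b + b' - 1"] ne by simp
    qed
  qed
  moreover from this have "co (q1 x) a * co (lbar (q1 x)) a' + co (q2 x) b * co (lbar (q2 x)) b' = 0"
    using Nk[of "b + b' - 1"] vP(2) vS(2) by simp
  ultimately show ?thesis using a a' by blast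
qed

text \<open>Balancedness is defined through both ends, \<open>qtype\<close> only through the lower
  one. The relation \<open>a + a' = m + m' - 1\<close> makes the two conditions on the degrees
  equivalent.\<close>

lemma quat_type_qtype:
  assumes x: "qunit x" and "qtype r b x"
  shows "quat_type (cls x) = r"
proof (cases "q2 x = 0")
  case True
  then have "r = 0" using assms by (auto simp: qtype_def Up_def Lo_def split: if_splits)
  then show ?thesis using True by (simp add: quat_type_cls[OF x] rep_type_def upper_balanced_def lower_balanced_def)
next
  case False
  obtain m where m: "vanish m (q2 x)" "co (q2 x) m \<noteq> 0" using lowest_exists[OF False] by blast
  obtain m' where m': "vanish m' (lbar (q2 x))" "co (lbar (q2 x)) m' \<noteq> 0"
    using lowest_exists[of "lbar (q2 x)"] False by auto
  obtain a a' where a: "vanish a (q1 x)" "co (q1 x) a \<noteq> 0" "vanish a' (lbar (q1 x))" "co (lbar (q1 x)) a' \<noteq> 0"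
      "a + a' = m + m' - 1"
    using qunit_lowest[OF x False m m'] by blast
  have nz: "q1 x \<noteq> 0" using a(2) by auto
  have deg: "low_deg (q1 x) = a" "low_deg (q2 x) = m" "high_deg (q1 x) = - a'" "high_deg (q2 x) = - m'"
    using low_deg_eqI[OF a(1,2)] low_deg_eqI[OF m] high_deg_eqI[OF a(3,4)] high_deg_eqI[OF m'] by simp_all
  have ub: "upper_balanced (q1 x) (q2 x) \<longleftrightarrow> a = m" and lb: "lower_balanced (q1 x) (q2 x) \<longleftrightarrow> a = m - 1"
    unfolding upper_balanced_def lower_balanced_def deg using a(5) nz False by auto
  have rt: "quat_type (cls x) = (if a = m then - co (q1 x) a * inverse (co (q2 x) m)
      else if a = m - 1 then - inverse (co (q1 x) a) * co (q2 x) m else 0)"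
    by (simp add: quat_type_cls[OF x] rep_type_def ub lb low_coeff_def deg)
  show ?thesis
  proof (cases b)
    case True
    then have "Up r x" using assms by (simp add: qtype_def)
    then have U: "vanish m (q1 x)" "co (q1 x) m = - r * co (q2 x) m" using Up_level[OF _ False m] by blast+
    show ?thesis
    proof (cases "r = 0")
      case True
      then have "a > m" using U a(2) vanishD[OF U(1), of a] by (cases a m rule: linorder_cases) auto
      then show ?thesis using rt True by simp
    next
      case False
      then have "co (q1 x) m \<noteq> 0" using U m by simp
      then have "a = m" using vanish_unique U(1) a by blast
      then show ?thesis using rt U m by simp
    qed
  next
    case b: False
    then have "Lo r x" using assms by (simp add: qtype_def)
    then have L: "vanish (a + 1) (q2 x)" "co (q2 x) (a + 1) = - r * co (q1 x) a" using Lo_level[OF _ False a(1,2)] by blast+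
    show ?thesis
    proof (cases "r = 0")
      case True
      then have "m > a + 1" using L m(2) vanishD[OF L(1), of m] by (cases m "a + 1" rule: linorder_cases) auto
      then show ?thesis using rt True by simp
    next
      case False
      then have "co (q2 x) (a + 1) \<noteq> 0" using L a by simp
      then have "a + 1 = m" using vanish_unique L(1) m by blast
      then show ?thesis using rt L a by auto
    qed
  qed
qed

text \<open>The flip turns highest exponents into lowest ones. The norm relation between the extreme
  coefficients converts the ratio at the lower end into the one at the upper end, and the type
  \<open>r\<close> is the same. Thus descent needs to treat \<open>Up\<close> only.\<close>

lemma Lo_flip:
  assumes x: "qunit x" and r: "r \<noteq> 0" and "Lo r x"
  shows "Up r (qflip x)"
proof -
  have q2: "q2 x \<noteq> 0" using assms by (auto simp: Lo_def)
  obtain m where m: "vanish m (q2 x)" "co (q2 x) m \<noteq> 0" using lowest_exists[OF q2] by blast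
  obtain m' where m': "vanish m' (lbar (q2 x))" "co (lbar (q2 x)) m' \<noteq> 0"
    using lowest_exists[of "lbar (q2 x)"] q2 by auto
  obtain a a' where a: "vanish a (q1 x)" "co (q1 x) a \<noteq> 0" "vanish a' (lbar (q1 x))" "co (lbar (q1 x)) a' \<noteq> 0"
      "a + a' = m + m' - 1" "co (q1 x) a * co (lbar (q1 x)) a' + co (q2 x) m * co (lbar (q2 x)) m' = 0"
    using qunit_lowest[OF x q2 m m'] by blast
  have L: "vanish (a + 1) (q2 x)" "co (q2 x) (a + 1) = - r * co (q1 x) a" using Lo_level[OF assms(3) q2 a(1,2)] by blast+
  then have "a + 1 = m" using vanish_unique m a r by (metis mult_eq_0_iff neg_equal_0_iff_equal)
  then have eq: "a' = m'" using a(5) by simp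
  have "co (q1 x) a * (co (lbar (q1 x)) m' - r * co (lbar (q2 x)) m') = 0"
    using a(6) L(2) \<open>a + 1 = m\<close> eq by (simp add: algebra_simps)
  then have "co (lbar (q1 x)) m' = r * co (lbar (q2 x)) m'" using a(2) by simp
  then show ?thesis unfolding Up_def using m' a(3) eq by (intro disjI1 exI[of _ m']) (auto simp: vanish_def)
qed

text \<open>If \<open>q2 x\<close> is nonzero, the quotient of lowest coefficients itself is the
  type. If it is zero, then the norm forces \<open>q1 x\<close> to be a monomial, and exponent 0 is
  the constant case that is excluded.\<close>

lemma qtype_exists:
  assumes x: "qunit x" and "\<nexists>c. c \<noteq> 0 \<and> x = qc c"
  shows "\<exists>r b. qtype r b x"
proof (cases "q2 x = 0")
  case True
  obtain c where c: "c \<noteq> 0" "qnorm x = lconst c" using x by (auto simp: qunit_def)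
  have "q1 x \<noteq> 0" using qunit_nonzero[OF x] True by blast
  then obtain a where a: "vanish a (q1 x)" "co (q1 x) a \<noteq> 0" using lowest_exists by blast
  show ?thesis
  proof (cases "a = 0")
    case False
    then have "Up 0 x \<or> Lo 0 x" using True a vanish_mono[OF a(1), of 1] vanishD[of 0 "q1 x" a]
      by (cases "a < 0") (auto simp: Up_def Lo_def)
    then show ?thesis using qtype_def by metis
  next
    case a0: True
    obtain a' where a': "vanish a' (lbar (q1 x))" "co (lbar (q1 x)) a' \<noteq> 0"
      using lowest_exists[of "lbar (q1 x)"] \<open>q1 x \<noteq> 0\<close> by auto
    have "q1 x * lbar (q1 x) = lconst c" using c True by (simp add: qnorm_def)
    moreover have "co (q1 x * lbar (q1 x)) (a + a') \<noteq> 0" using vanish_mult(2)[OF a(1) a'(1)] a a' by simp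
    ultimately have "a' = 0" using a0 by (simp split: if_splits)
    have "q1 x = lconst (co (q1 x) 0)"
    proof (rule laurent_eqI)
      fix k show "co (q1 x) k = co (lconst (co (q1 x) 0)) k"
        using vanishD[OF a(1), of k] vanishD[OF a'(1), of "- k"] a0 \<open>a' = 0\<close>
        by (cases k "0 :: int" rule: linorder_cases) auto
    qed
    then have "x = qc (co (q1 x) 0)" using True by (intro qn_eqI) simp_all
    then show ?thesis using assms(2) a a0 by blast
  qed
next
  case False
  obtain m where m: "vanish m (q2 x)" "co (q2 x) m \<noteq> 0" using lowest_exists[OF False] by blast
  show ?thesis
  proof (cases "vanish m (q1 x)")
    case True
    then have "Up (- co (q1 x) m * inverse (co (q2 x) m)) x"
      unfolding Up_def using m by (intro disjI1 exI[of _ m]) simp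
    then show ?thesis using qtype_def by metis
  next
    case nv: False
    then have "q1 x \<noteq> 0" by auto
    then obtain a where a: "vanish a (q1 x)" "co (q1 x) a \<noteq> 0" using lowest_exists by blast
    have "a + 1 \<le> m" using nv vanish_mono[OF a(1), of m] by force
    then have "vanish (a + 1) (q2 x)" using vanish_mono[OF m(1)] by blast
    then have "Lo (- co (q2 x) (a + 1) * inverse (co (q1 x) a)) x"
      unfolding Lo_def using a False by (intro disjI1 conjI exI[of _ a]) simp_all
    then show ?thesis using qtype_def by metis
  qed
qed

section \<open>The width of a quaternion\<close>

definition width :: "'k::field qn \<Rightarrow> nat" where
  "width x = (if q2 x = 0 then 0 else nat (high_deg (q2 x) - low_deg (q2 x) + 1))"

lemma width_eq:
  assumes "vanish b (q2 x)" "co (q2 x) b \<noteq> 0" "vanish b' (lbar (q2 x))" "co (lbar (q2 x)) b' \<noteq> 0"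
  shows "int (width x) = 1 - b - b'" "width x > 0"
proof -
  have "q2 x \<noteq> 0" using assms by auto
  have "b' \<le> - b" using vanishD[OF assms(3), of "- b"] assms(2) by force
  then show "int (width x) = 1 - b - b'" "width x > 0"
    using low_deg_eqI[OF assms(1,2)] high_deg_eqI[OF assms(3,4)] \<open>q2 x \<noteq> 0\<close> by (simp_all add: width_def)
qed

lemma width_le:
  assumes "vanish i (q2 x)" "vanish j (lbar (q2 x))"
  shows "width x \<le> nat (1 - i - j)"
proof (cases "q2 x = 0")
  case False
  obtain b where b: "vanish b (q2 x)" "co (q2 x) b \<noteq> 0" using lowest_exists[OF False] by blast
  obtain b' where b': "vanish b' (lbar (q2 x))" "co (lbar (q2 x)) b' \<noteq> 0"
    using lowest_exists[of "lbar (q2 x)"] False by auto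
  have "i \<le> b" using vanishD[OF assms(1), of b] b(2) by linarith
  moreover have "j \<le> b'" using vanishD[OF assms(2), of b'] b'(2) by linarith
  ultimately show ?thesis using width_eq(1)[OF b b'] by linarith
qed (simp add: width_def)

lemma width_zero_iff: "width x = 0 \<longleftrightarrow> q2 x = 0"
proof (cases "q2 x = 0")
  case False
  obtain b where b: "vanish b (q2 x)" "co (q2 x) b \<noteq> 0" using lowest_exists[OF False] by blast
  obtain b' where b': "vanish b' (lbar (q2 x))" "co (lbar (q2 x)) b' \<noteq> 0"
    using lowest_exists[of "lbar (q2 x)"] False by auto
  then show ?thesis using width_eq(2)[OF b b'] False by simp
qed (simp add: width_def)

lemma width_cong:
  assumes "\<And>k. co (q2 y) k = c * co (q2 x) (k + d)" "c \<noteq> 0"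
  shows "width y = width x"
proof (cases "q2 x = 0")
  case True
  then have "q2 y = 0" using assms by (intro laurent_eqI) simp
  then show ?thesis using True by (simp add: width_def)
next
  case False
  obtain b where b: "vanish b (q2 x)" "co (q2 x) b \<noteq> 0" using lowest_exists[OF False] by blast
  obtain b' where b': "vanish b' (lbar (q2 x))" "co (lbar (q2 x)) b' \<noteq> 0"
    using lowest_exists[of "lbar (q2 x)"] False by auto
  have "vanish (b - d) (q2 y)" "co (q2 y) (b - d) \<noteq> 0"
    using b assms vanishD[OF b(1)] by (auto simp: vanish_def)
  moreover have "vanish (b' + d) (lbar (q2 y))"
    unfolding vanish_def
  proof (intro allI impI)
    fix k assume "k < b' + d"
    then have "co (lbar (q2 x)) (k - d) = 0" using vanishD[OF b'(1), of "k - d"] by linarith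
    then show "co (lbar (q2 y)) k = 0" using assms(1)[of "- k"] by (simp add: algebra_simps)
  qed
  moreover have "co (lbar (q2 y)) (b' + d) \<noteq> 0" using b'(2) assms(1)[of "- (b' + d)"] assms(2) by simp
  ultimately show ?thesis using width_eq(1)[OF b b'] width_eq(1)[of "b - d" y "b' + d"] by simp
qed

lemma width_flip: "width (qflip x) = width x"
proof (cases "q2 x = 0")
  case True
  then show ?thesis by (simp add: width_def)
next
  case False
  obtain b where b: "vanish b (q2 x)" "co (q2 x) b \<noteq> 0" using lowest_exists[OF False] by blast
  obtain b' where b': "vanish b' (lbar (q2 x))" "co (lbar (q2 x)) b' \<noteq> 0"
    using lowest_exists[of "lbar (q2 x)"] False by auto
  have "vanish b' (q2 (qflip x))" "co (q2 (qflip x)) b' \<noteq> 0" "vanish b (lbar (q2 (qflip x)))" "co (lbar (q2 (qflip x))) b \<noteq> 0"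
    using b b' by (simp_all add: vanish_def)
  then show ?thesis using width_eq(1)[OF b b'] width_eq(1)[of b' "qflip x" b] by simp
qed

text \<open>For a quaternion of type \<open>r\<close> the second row of its matrix starts, like the first one, with a
  multiple of \<open>(- r, 1)\<close>.\<close>

lemma Up_frame:
  assumes x: "qunit x" and "Up r x" "r \<noteq> 0"
  obtains m n where "vanish m (q1 x)" "vanish m (q2 x)" "co (q2 x) m \<noteq> 0" "co (q1 x) m = - r * co (q2 x) m"
    "vanish n (lbar (q1 x))" "vanish (n + 1) (lbar (q2 x))" "co (lbar (q1 x)) n \<noteq> 0"
    "co (lbar (q2 x)) (n + 1) = r * co (lbar (q1 x)) n" "int (width x) = - m - n" "width x > 0"
proof -
  have q2: "q2 x \<noteq> 0" using assms by (auto simp: Up_def)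
  obtain m where m: "vanish m (q2 x)" "co (q2 x) m \<noteq> 0" using lowest_exists[OF q2] by blast
  obtain m' where m': "vanish m' (lbar (q2 x))" "co (lbar (q2 x)) m' \<noteq> 0"
    using lowest_exists[of "lbar (q2 x)"] q2 by auto
  obtain a a' where a: "vanish a (q1 x)" "co (q1 x) a \<noteq> 0" "vanish a' (lbar (q1 x))" "co (lbar (q1 x)) a' \<noteq> 0"
      "a + a' = m + m' - 1" "co (q1 x) a * co (lbar (q1 x)) a' + co (q2 x) m * co (lbar (q2 x)) m' = 0"
    using qunit_lowest[OF x q2 m m'] by blast
  have U: "vanish m (q1 x)" "co (q1 x) m = - r * co (q2 x) m" using Up_level[OF assms(2) q2 m] by blast+
  then have "co (q1 x) m \<noteq> 0" using m assms(3) by simp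
  then have "a = m" using vanish_unique U(1) a by blast
  then have eq: "m' = a' + 1" using a(5) by simp
  have "co (q2 x) m * (co (lbar (q2 x)) m' - r * co (lbar (q1 x)) a') = 0"
    using a(6) U(2) \<open>a = m\<close> by (simp add: algebra_simps)
  then have "co (lbar (q2 x)) m' = r * co (lbar (q1 x)) a'" using m(2) by simp
  then show thesis using that[of m a'] U m m' a eq width_eq[OF m m'] by simp
qed

text \<open>The exponents of \<open>q2 x\<close> run from \<open>m\<close> to
  \<open>- (n + 1)\<close>, so the hypotheses say that the upper end has not moved while the lower
  end has lost its extreme term.\<close>

lemma width_less:
  assumes "int (width x) = - m - n" "width x > 0"
    and "vanish (m + 1) (q2 y)" "vanish (n + 1) (lbar (q2 y))"
  shows "width y < width x"
  using width_le[OF assms(3,4)] assms(1,2) by linarith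

lemma width_elem:
  assumes x: "qunit x" and "Up r x" "r \<noteq> 0"
  shows "width (x * dag (elem r)) < width x"
proof -
  obtain m n where f: "vanish m (q1 x)" "vanish m (q2 x)" "co (q2 x) m \<noteq> 0" "co (q1 x) m = - r * co (q2 x) m"
    "vanish n (lbar (q1 x))" "vanish (n + 1) (lbar (q2 x))" "co (lbar (q1 x)) n \<noteq> 0"
    "co (lbar (q2 x)) (n + 1) = r * co (lbar (q1 x)) n" "int (width x) = - m - n" "width x > 0"
    using Up_frame[OF assms] .
  define A B where "A = q1 x" and "B = q2 x"
  define D E where "D = lbar (q1 x)" and "E = lbar (q2 x)"
  have eq: "q2 (x * dag (elem r)) = - (A * lconst r) + B * lt - B * lconst (r ^ 2)"
    "lbar (q2 (x * dag (elem r))) = - (D * lconst r) + E * lti - E * lconst (r ^ 2)"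
    by (simp_all add: q2_mult algebra_simps A_def B_def D_def E_def)
  note f' = f[folded A_def B_def D_def E_def]
  have 1: "vanish (m + 1) (q2 (x * dag (elem r)))"
    unfolding vanish_def eq(1)
  proof (intro allI impI)
    fix k assume "k < m + 1"
    then consider "k = m" | "k < m" by linarith
    then show "co (- (A * lconst r) + B * lt - B * lconst (r ^ 2)) k = 0"
      using vanishD[OF f'(1), of k] vanishD[OF f'(2), of k] vanishD[OF f'(2), of "k - 1"] f'(4)
      by cases (simp_all add: power2_eq_square)
  qed
  \<comment> \<open>The factor t in \<open>B * lt\<close> would push the upper end up by one; the
    new extreme coefficient cancels against the contribution of the first entry by the ratio at the
    upper end.\<close>
  have 2: "vanish (n + 1) (lbar (q2 (x * dag (elem r))))"
    unfolding vanish_def eq(2)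
  proof (intro allI impI)
    fix k assume "k < n + 1"
    then consider "k = n" | "k < n" by linarith
    then show "co (- (D * lconst r) + E * lti - E * lconst (r ^ 2)) k = 0"
      using vanishD[OF f'(5), of k] vanishD[OF f'(6), of k] vanishD[OF f'(6), of "k + 1"] f'(8)
      by cases simp_all
  qed
  show ?thesis by (rule width_less[OF f(9,10) 1 2])
qed

subsection \<open>Reduction of unbalanced quaternions\<close>

text \<open>Multiplication by \<open>elem 0\<close>, which is \<open>diag(t, t\<inverse>)\<close>, preserves the width, so that type \<open>0\<close> needs a second
  measure: the distance of the lowest exponents from being balanced.\<close>

definition offset :: "'k::field qn \<Rightarrow> nat" where
  "offset x = (if q2 x = 0 then nat \<bar>low_deg (q1 x)\<bar> else nat \<bar>2 * (low_deg (q1 x) - low_deg (q2 x)) + 1\<bar>)"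

lemma qunit_q1_nonzero: "qunit x \<Longrightarrow> q1 x \<noteq> 0"
proof (cases "q2 x = 0")
  case False
  assume x: "qunit x"
  obtain m where m: "vanish m (q2 x)" "co (q2 x) m \<noteq> 0" using lowest_exists[OF False] by blast
  obtain m' where m': "vanish m' (lbar (q2 x))" "co (lbar (q2 x)) m' \<noteq> 0"
    using lowest_exists[of "lbar (q2 x)"] False by auto
  show ?thesis using qunit_lowest[OF x False m m'] by auto
qed (use qunit_nonzero in blast)

text \<open>If d is the difference of the lowest exponents, the balanced values are 0 and -1, and |2
  d + 1| is symmetric about their midpoint. The generator changes d by 2 towards the midpoint, which
  decreases the distance for every unbalanced d.\<close>

lemma offset_reduce:
  assumes x: "qunit x" and "qtype 0 b x"
  defines "g \<equiv> (if b then dag (elem 0) else elem 0 :: 'k::field qn)"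
  shows "width (x * g) = width x" "offset (x * g) < offset x"
proof -
  obtain a where a: "vanish a (q1 x)" "co (q1 x) a \<noteq> 0"
    using lowest_exists[OF qunit_q1_nonzero[OF x]] by blast
  define s :: int where "s = (if b then - 1 else 1)"
  have c: "co (q1 (x * g)) k = co (q1 x) (k - s)" "co (q2 (x * g)) k = co (q2 x) (k + s)" for k
    by (simp_all add: g_def s_def q1_mult q2_mult)
  show "width (x * g) = width x" using c(2) by (intro width_cong[of _ 1 _ s]) auto
  have z: "q2 (x * g) = 0 \<longleftrightarrow> q2 x = 0"
    using \<open>width (x * g) = width x\<close> width_zero_iff by metis
  have la: "low_deg (q1 x) = a" using low_deg_eqI[OF a] .
  have la': "low_deg (q1 (x * g)) = a + s"
    using a c(1) vanishD[OF a(1)] by (intro low_deg_eqI) (auto simp: vanish_def)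
  show "offset (x * g) < offset x"
  proof (cases "q2 x = 0")
    case True
    have "if b then a > 0 else a < 0"
    proof (cases b)
      case True
      then have "vanish 1 (q1 x)" using assms(2) \<open>q2 x = 0\<close> by (auto simp: qtype_def Up_def)
      then show ?thesis using True a(2) vanishD[of 1 "q1 x" a] by force
    next
      case False
      then have "\<not> vanish 0 (q1 x)" using assms(2) \<open>q2 x = 0\<close> by (auto simp: qtype_def Lo_def)
      then show ?thesis using False vanish_mono[OF a(1), of 0] by force
    qed
    then show ?thesis using True z la la' by (auto simp: offset_def s_def split: if_splits)
  next
    case False
    obtain m where m: "vanish m (q2 x)" "co (q2 x) m \<noteq> 0" using lowest_exists[OF False] by blast
    have lm: "low_deg (q2 x) = m" using low_deg_eqI[OF m] .
    have lm': "low_deg (q2 (x * g)) = m - s"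
      using m c(2) vanishD[OF m(1)] by (intro low_deg_eqI) (auto simp: vanish_def)
    have "if b then a > m else m > a + 1"
    proof (cases b)
      case True
      then have "Up 0 x" using assms(2) by (simp add: qtype_def)
      then have "vanish m (q1 x)" "co (q1 x) m = 0" using Up_level[OF _ False m] by auto
      then have "a > m" using a(2) vanishD[of m "q1 x" a] by (cases a m rule: linorder_cases) auto
      then show ?thesis using True by simp
    next
      case b: False
      then have "Lo 0 x" using assms(2) by (simp add: qtype_def)
      then have "vanish (a + 1) (q2 x)" "co (q2 x) (a + 1) = 0" using Lo_level[OF _ False a] by auto
      then have "m > a + 1" using m(2) vanishD[of "a + 1" "q2 x" m] by (cases m "a + 1" rule: linorder_cases) auto
      then show ?thesis using b by simp
    qed
    then show ?thesis using False z la la' lm lm' by (auto simp: offset_def s_def split: if_splits)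
  qed
qed

section \<open>Exceptional types\<close>

lemma lconst_expand:
  "lconst (a + b) = lconst a + lconst b" "lconst (a - b) = lconst a - lconst b"
  "lconst (- a) = - lconst a" "lconst (a * b) = lconst a * lconst b" "lconst (a ^ n) = lconst a ^ n"
  "lconst (numeral m) = (numeral m :: 'k laurent)" for a b :: "'k::field"
  by (simp_all add: lconst_hom lconst_power lconst_numeral)

lemma lt_lti_assoc: "lt * (lti * f) = f" "lti * (lt * f) = f" for f :: "'k::field laurent"
  by (simp_all flip: mult.assoc)

lemmas laurent_simps = algebra_simps lt_lti_assoc power2_eq_square power4_eq_xxxx

lemma lbar_numeral: "lbar (numeral m) = (numeral m :: 'k::field laurent)"
  unfolding lconst_numeral[symmetric] by simp

locale exceptional =
  fixes \<tau> :: "'k::field"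
  assumes tau: "\<tau> ^ 4 + \<tau> ^ 2 + 1 = 0"
begin

definition w :: 'k where "w = \<tau> ^ 2"
text \<open>Written as a polynomial in \<tau>, so that identities involving the inverse remain
  polynomial and can be decided modulo the relation for \<tau>.\<close>

definition tinv :: 'k where "tinv = - (\<tau> ^ 3) - \<tau>"
definition lam :: 'k where "lam = - \<tau> - 2 * \<tau> ^ 3"

lemma tau_tinv: "\<tau> * tinv = 1"
proof -
  have "\<tau> * tinv = - (\<tau> ^ 4 + \<tau> ^ 2 + 1) + 1" by (simp add: tinv_def algebra_simps power2_eq_square power3_eq_cube power4_eq_xxxx)
  then show ?thesis using tau by simp
qed

lemma tau_nonzero: "\<tau> \<noteq> 0"
  using tau_tinv by auto

lemma tinv_inverse: "tinv = inverse \<tau>"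
  using tau_tinv by (simp add: inverse_unique)

lemma lam_eq: "lam = \<tau> + 2 * tinv"
  by (simp add: lam_def tinv_def)

text \<open>Hence \<open>lam\<close> vanishes exactly in characteristic 3, where the eigenvalues of
  \<open>mu\<close> collapse and the multiplicative part disappears.\<close>

lemma lam_square: "lam ^ 2 = - 3 * w"
  unfolding lam_def w_def using tau by Groebner_Basis.algebra

lemma T_rel: "lconst \<tau> ^ 4 + lconst \<tau> ^ 2 + 1 = 0"
  using arg_cong[OF tau, of lconst] by (simp add: lconst_expand)

lemmas laurent_rels = T_rel lt_lti(1)[where 'k = 'k]

text \<open>The upper affine generators are the classes of \<open>\<alpha> + \<beta> mu + f(t + t\<inverse>) nu\<close>, where \<open>mu\<close> has the
  eigenvalues \<open>lam\<close> and \<open>- lam\<close> and \<open>nu\<close> is a nilpotent eigenvector of \<open>mu\<close>; the lower ones are the same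
  for \<open>ml\<close> and \<open>nl\<close>. The stable generator \<open>st a\<close> intertwines \<open>mu\<close> and \<open>ml\<close>, and \<open>kap\<close> vanishes at the
  excluded parameter.\<close>

definition mu :: "'k qn" where
  "mu = Qn (- (lconst \<tau> * lti) + lconst \<tau> * lt) (lti + lconst w)"
definition ml :: "'k qn" where
  "ml = Qn (- (lconst \<tau> * lti) + lconst \<tau> * lt) (lconst w + lt)"
definition nu :: "'k qn" where
  "nu = Qn (- (lconst w * ((lt - lti) * lPhi))) (lconst \<tau> * ((lt - lti) * (lti - lconst w)))"
definition nl :: "'k qn" where
  "nl = Qn (- (lconst w * ((lt - lti) * lPhi))) (- (lconst \<tau> * ((lt - lti) * (lt - lconst w))))"
definition st :: "'k \<Rightarrow> 'k qn" where
  "st a = Qn (- (lconst \<tau> * lti) + lconst (\<tau> * (3 - a * \<tau> + 6 * \<tau> ^ 2)) + lconst a * lt + lconst tinv * (lt * lt))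
     (lti + lconst (- 3 * \<tau> ^ 2 + \<tau> * a - 2) + lt)"

definition kap :: "'k \<Rightarrow> 'k" where "kap a = a - (3 * \<tau> + tinv)"
text \<open>A square root of -12: since w^2 + w + 1 = 0, the element 1 + 2 w is a square root of
  -3.\<close>

definition del :: 'k where "del = 2 + 4 * w"

lemmas expand = mu_def ml_def nu_def nl_def st_def elem_def w_def tinv_def lam_def kap_def del_def lPhi_def
  lconst_expand

lemmas qexpand = q1_mult q2_mult q_simps ql_simps q_ql_mult q_Qn lbar_simps lbar_mult lbar_power lbar_bar lbar_numeral expand

lemma st_mu: "st a * mu = ml * st a"
  using laurent_rels
  by - (rule qn_eqI; simp only: qexpand; (Groebner_Basis.algebra | simp add: laurent_simps))

text \<open>With the next two identities and \<open>dag_st_ml_minus\<close> this is the reason for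
  the exchange of coordinates: \<open>st a\<close> and its conjugate carry the quaternions that
  define one pair of coordinates to multiples of those that define the other pair.\<close>

lemma st_mu_plus: "st a * (mu + qc lam) = qc (2 * lam * kap a) * elem \<tau>"
  using laurent_rels
  by - (rule qn_eqI; simp only: qexpand; (Groebner_Basis.algebra | simp add: laurent_simps))

lemma st_dag_elem: "st a * dag (elem \<tau>) = - (qc del * (ml - qc lam))"
  using laurent_rels
  by - (rule qn_eqI; simp only: qexpand; (Groebner_Basis.algebra | simp add: laurent_simps))

lemma dag_st_elem: "dag (st a) * elem \<tau> = qc del * (mu + qc lam)"
  using laurent_rels
  by - (rule qn_eqI; simp only: qexpand; (Groebner_Basis.algebra | simp add: laurent_simps))

text \<open>The constant 12 and the factor \<open>kap a\<close> explain why the stable generator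
  exists only outside characteristic 2 and 3 and away from one parameter.\<close>

lemma qnorm_st: "qnorm (st a) = lconst (12 * \<tau> * kap a)"
  using laurent_rels
  by - (simp only: qnorm_def qexpand; (Groebner_Basis.algebra | simp add: laurent_simps))

text \<open>Inverts the change of coordinates: \<open>q2 x\<close> is recovered from the upper pair,
  up to the factor \<open>2 * lam\<close>.\<close>

lemma y_k_rel: "q2 (x * (mu + qc lam)) + lconst tinv * (lti + lconst w) * q2 (x * dag (elem \<tau>)) = lconst (2 * lam) * q2 x"
  using laurent_rels
  by - (simp only: qexpand; (Groebner_Basis.algebra | simp add: laurent_simps))

lemma kl_yl_rel: "lconst tinv * (lconst w + lt) * q2 (x * elem \<tau>) - q2 (x * (ml - qc lam)) = lconst (2 * lam) * q2 x"
  using laurent_rels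
  by - (simp only: qexpand; (Groebner_Basis.algebra | simp add: laurent_simps))

lemma q2_nu: "q2 (x * nu) = - ((lt - lti) * (lti - lconst w)) * q2 (x * dag (elem \<tau>))"
  using laurent_rels
  by - (simp only: qexpand; (Groebner_Basis.algebra | simp add: laurent_simps))

lemma q2_nl: "q2 (x * nl) = - ((lt - lti) * (lt - lconst w)) * q2 (x * elem \<tau>)"
  using laurent_rels
  by - (simp only: qexpand; (Groebner_Basis.algebra | simp add: laurent_simps))

text \<open>\<open>dag (elem \<tau>)\<close> has norm 0, so the columns of its matrix are
  proportional, and so are those of any left multiple. The identity \<open>q1_mu\<close> holds for
  the same reason, \<open>mu + lam\<close> being singular.\<close>

lemma q1_dag_elem: "q1 (x * dag (elem \<tau>)) = lconst \<tau> * (1 - lconst (w ^ 2) * lti) * q2 (x * dag (elem \<tau>))"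
  using laurent_rels
  by - (simp only: qexpand; (Groebner_Basis.algebra | simp add: laurent_simps))

lemma q1_mu: "q1 (x * (mu + qc lam)) * (lti + lconst w) = q2 (x * (mu + qc lam)) * (- (lconst \<tau> * lti) + lconst \<tau> * lt + lconst lam)"
  using laurent_rels
  by - (simp only: qexpand; (Groebner_Basis.algebra | simp add: laurent_simps))

lemma flips:
  "qflip mu = - ml" "qflip ml = - mu" "qflip nu = - nl" "qflip nl = - nu"
  "qflip (dag (st a)) = st a" "qflip (st a) = dag (st a)"
  "dag mu = - mu" "dag ml = - ml" "dag nu = - nu" "dag nl = - nl"
  using laurent_rels
  by - (rule qn_eqI, simp_all only: qexpand, simp_all add: algebra_simps)+

end

section \<open>Comparison of lowest exponents\<close>

definition dom_le :: "'k::field laurent \<Rightarrow> 'k laurent \<Rightarrow> bool" where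
  "dom_le f g \<longleftrightarrow> (\<exists>j. vanish j f \<and> co f j \<noteq> 0 \<and> vanish j g)"

definition dom_less :: "'k::field laurent \<Rightarrow> 'k laurent \<Rightarrow> bool" where
  "dom_less f g \<longleftrightarrow> (\<exists>j. vanish j f \<and> co f j \<noteq> 0 \<and> vanish (j + 1) g)"

text \<open>One comparison is strict and the other is not, so that together they cover all cases,
  ties included. This is why \<open>Zu\<close> and \<open>Zl\<close> are defined
  asymmetrically.\<close>

lemma dom_total:
  assumes "f \<noteq> 0 \<or> g \<noteq> 0"
  shows "dom_le f g \<or> dom_less g f"
proof -
  obtain i where i: "vanish i f" "vanish i g" "co f i \<noteq> 0 \<or> co g i \<noteq> 0"
    using level_exists[OF assms, of 0] by auto
  show ?thesis
  proof (cases "co f i = 0")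
    case True
    then have "dom_less g f" unfolding dom_less_def using i vanish_Suc[OF i(1) True] by blast
    then show ?thesis by blast
  qed (use i in \<open>auto simp: dom_le_def\<close>)
qed

lemma dom_le_scale: "a \<noteq> 0 \<Longrightarrow> b \<noteq> 0 \<Longrightarrow> dom_le (lconst a * f) (lconst b * g) \<longleftrightarrow> dom_le f g"
  by (simp add: dom_le_def vanish_def)

lemma dom_less_scale: "a \<noteq> 0 \<Longrightarrow> b \<noteq> 0 \<Longrightarrow> dom_less (lconst a * f) (lconst b * g) \<longleftrightarrow> dom_less f g"
  by (simp add: dom_less_def vanish_def)

lemma dom_uminus [simp]: "dom_le (- f) g = dom_le f g" "dom_le f (- g) = dom_le f g"
  "dom_less (- f) g = dom_less f g" "dom_less f (- g) = dom_less f g"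
  by (simp_all add: dom_le_def dom_less_def vanish_def)

lemma mult_ql_left: "lbar f = f \<Longrightarrow> x * (ql f * z) = ql f * (x * z)"
  by (metis ql_comm mult.assoc)

context exceptional
begin

text \<open>In the coordinates \<open>(yq, kq)\<close> right multiplication by an upper affine generator is triangular, likewise
  for \<open>(ylq, klq)\<close> and the lower ones; right multiplication by \<open>st a\<close> exchanges the two pairs up to
  constants. \<open>Zu\<close> and \<open>Zl\<close> hold after a right multiplication by the stable generator and by its inverse.\<close>

definition yq :: "'k qn \<Rightarrow> 'k laurent" where "yq x = q2 (x * (mu + qc lam))"
definition kq :: "'k qn \<Rightarrow> 'k laurent" where "kq x = q2 (x * dag (elem \<tau>))"
definition ylq :: "'k qn \<Rightarrow> 'k laurent" where "ylq x = q2 (x * (ml - qc lam))"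
definition klq :: "'k qn \<Rightarrow> 'k laurent" where "klq x = q2 (x * elem \<tau>)"

definition Zu :: "'k qn \<Rightarrow> bool" where "Zu x \<longleftrightarrow> dom_le (kq x) (yq x)"
definition Zl :: "'k qn \<Rightarrow> bool" where "Zl x \<longleftrightarrow> dom_less (klq x) (ylq x)"

definition au :: "'k \<Rightarrow> 'k \<Rightarrow> 'k poly \<Rightarrow> 'k qn" where
  "au \<alpha> \<beta> f = qc \<alpha> + qc \<beta> * mu + ql (lsubst f) * nu"
definition al :: "'k \<Rightarrow> 'k \<Rightarrow> 'k poly \<Rightarrow> 'k qn" where
  "al \<alpha> \<beta> f = qc \<alpha> + qc \<beta> * ml + ql (lsubst f) * nl"

lemma au_mu_plus: "au \<alpha> \<beta> f * (mu + qc lam) = qc (\<alpha> + \<beta> * lam) * (mu + qc lam) + ql (lconst (2 * lam) * lsubst f) * nu"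
  using laurent_rels
  by - (rule qn_eqI; simp only: qexpand au_def lbar_lsubst; (Groebner_Basis.algebra | simp add: laurent_simps))

lemma au_dag_elem: "au \<alpha> \<beta> f * dag (elem \<tau>) = qc (\<alpha> - \<beta> * lam) * dag (elem \<tau>)"
  using laurent_rels
  by - (rule qn_eqI; simp only: qexpand au_def lbar_lsubst; (Groebner_Basis.algebra | simp add: laurent_simps))

lemma al_elem: "al \<alpha> \<beta> f * elem \<tau> = qc (\<alpha> + \<beta> * lam) * elem \<tau>"
  using laurent_rels
  by - (rule qn_eqI; simp only: qexpand al_def lbar_lsubst; (Groebner_Basis.algebra | simp add: laurent_simps))

lemma al_ml_minus: "al \<alpha> \<beta> f * (ml - qc lam) = qc (\<alpha> - \<beta> * lam) * (ml - qc lam) - ql (lconst (2 * lam) * lsubst f) * nl"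
  using laurent_rels
  by - (rule qn_eqI; simp only: qexpand al_def lbar_lsubst; (Groebner_Basis.algebra | simp add: laurent_simps))

lemma dag_st_ml_minus: "dag (st a) * (ml - qc lam) = - (qc (2 * lam * kap a) * dag (elem \<tau>))"
  using laurent_rels
  by - (rule qn_eqI; simp only: qexpand; (Groebner_Basis.algebra | simp add: laurent_simps))

text \<open>The off-diagonal entry is the nilpotent part, which acts through \<open>kq\<close>
  because \<open>nu\<close> is tied to \<open>dag (elem \<tau>)\<close> by
  \<open>q2_nu\<close>.\<close>

lemma yq_au: "yq (x * au \<alpha> \<beta> f) = lconst (\<alpha> + \<beta> * lam) * yq x
    + lconst (2 * lam) * (lsubst f * (- ((lt - lti) * (lti - lconst w)) * kq x))"
proof -
  have "x * au \<alpha> \<beta> f * (mu + qc lam) = qc (\<alpha> + \<beta> * lam) * (x * (mu + qc lam)) + ql (lconst (2 * lam) * lsubst f) * (x * nu)"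
    unfolding mult.assoc au_mu_plus by (subst distrib_left) (simp only: mult_ql_left lbar_simps lbar_mult lbar_lsubst)
  then show ?thesis unfolding yq_def kq_def by (simp only: q_simps q_ql_mult q2_nu) (simp add: mult.assoc)
qed

lemma kq_au: "kq (x * au \<alpha> \<beta> f) = lconst (\<alpha> - \<beta> * lam) * kq x"
  unfolding kq_def mult.assoc au_dag_elem by (simp add: mult_ql_left)

lemma klq_al: "klq (x * al \<alpha> \<beta> f) = lconst (\<alpha> + \<beta> * lam) * klq x"
  unfolding klq_def mult.assoc al_elem by (simp add: mult_ql_left)

lemma ylq_al: "ylq (x * al \<alpha> \<beta> f) = lconst (\<alpha> - \<beta> * lam) * ylq x
    - lconst (2 * lam) * (lsubst f * (- ((lt - lti) * (lt - lconst w)) * klq x))"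
proof -
  have "x * al \<alpha> \<beta> f * (ml - qc lam) = qc (\<alpha> - \<beta> * lam) * (x * (ml - qc lam)) - ql (lconst (2 * lam) * lsubst f) * (x * nl)"
    unfolding mult.assoc al_ml_minus by (subst right_diff_distrib) (simp only: mult_ql_left lbar_simps lbar_mult lbar_lsubst)
  then show ?thesis unfolding ylq_def klq_def by (simp only: q_simps q_ql_mult q2_nl) (simp add: mult.assoc)
qed

lemma st_coordinates:
  "yq (x * st a) = lconst (2 * lam * kap a) * klq x" "kq (x * st a) = - (lconst del * ylq x)"
  "ylq (x * dag (st a)) = - (lconst (2 * lam * kap a) * kq x)" "klq (x * dag (st a)) = lconst del * yq x"
  unfolding yq_def kq_def ylq_def klq_def mult.assoc st_mu_plus st_dag_elem dag_st_ml_minus dag_st_elem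
  by (simp_all add: mult_ql_left)

lemma co_coordinates:
  "co (kq x) n = - \<tau> * co (q1 x) n + co (q2 x) (n - 1) - w * co (q2 x) n"
  "co (yq x) n = co (q1 x) (n + 1) + w * co (q1 x) n + \<tau> * co (q2 x) (n + 1) - \<tau> * co (q2 x) (n - 1) + lam * co (q2 x) n"
  "co (klq x) n = \<tau> * co (q1 x) n + co (q2 x) (n + 1) - w * co (q2 x) n"
  "co (ylq x) n = w * co (q1 x) n + co (q1 x) (n - 1) + \<tau> * co (q2 x) (n + 1) - \<tau> * co (q2 x) (n - 1) - lam * co (q2 x) n"
proof -
  have "kq x = - (lconst \<tau> * q1 x) + lt * q2 x - lconst w * q2 x"
    "yq x = lti * q1 x + lconst w * q1 x + lconst \<tau> * (lti * q2 x) - lconst \<tau> * (lt * q2 x) + lconst lam * q2 x"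
    "klq x = lconst \<tau> * q1 x + lti * q2 x - lconst w * q2 x"
    "ylq x = lconst w * q1 x + lt * q1 x + lconst \<tau> * (lti * q2 x) - lconst \<tau> * (lt * q2 x) - lconst lam * q2 x"
    unfolding kq_def yq_def klq_def ylq_def by (simp_all add: q2_mult mu_def ml_def w_def algebra_simps)
  then show
    "co (kq x) n = - \<tau> * co (q1 x) n + co (q2 x) (n - 1) - w * co (q2 x) n"
    "co (yq x) n = co (q1 x) (n + 1) + w * co (q1 x) n + \<tau> * co (q2 x) (n + 1) - \<tau> * co (q2 x) (n - 1) + lam * co (q2 x) n"
    "co (klq x) n = \<tau> * co (q1 x) n + co (q2 x) (n + 1) - w * co (q2 x) n"
    "co (ylq x) n = w * co (q1 x) n + co (q1 x) (n - 1) + \<tau> * co (q2 x) (n + 1) - \<tau> * co (q2 x) (n - 1) - lam * co (q2 x) n"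
    by simp_all
qed

lemma co_relations:
  "2 * lam * co (q2 x) n = co (yq x) n + tinv * (co (kq x) (n + 1) + w * co (kq x) n)"
  "2 * lam * co (q2 x) n = tinv * (w * co (klq x) n + co (klq x) (n - 1)) - co (ylq x) n"
proof -
  have "lconst (2 * lam) * q2 x = yq x + lconst tinv * (lti * kq x + lconst w * kq x)"
    using y_k_rel[of x] by (simp add: yq_def kq_def algebra_simps)
  from arg_cong[OF this, of "\<lambda>f. co f n"]
  show "2 * lam * co (q2 x) n = co (yq x) n + tinv * (co (kq x) (n + 1) + w * co (kq x) n)" by simp
  have "lconst (2 * lam) * q2 x = lconst tinv * (lconst w * klq x + lt * klq x) - ylq x"
    using kl_yl_rel[of x] by (simp add: ylq_def klq_def algebra_simps)
  from arg_cong[OF this, of "\<lambda>f. co f n"]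
  show "2 * lam * co (q2 x) n = tinv * (w * co (klq x) n + co (klq x) (n - 1)) - co (ylq x) n" by simp
qed

lemma w_nonzero: "w \<noteq> 0"
  using tau_nonzero by (simp add: w_def)

lemma tinv_nonzero: "tinv \<noteq> 0"
  using tau_tinv by auto

lemma tinv_w: "tinv * w = \<tau>"
proof -
  have "tinv * w = (\<tau> * tinv) * \<tau>" by (simp add: w_def power2_eq_square ac_simps)
  then show ?thesis by (simp add: tau_tinv)
qed

text \<open>Outside \<open>Up \<tau>\<close> a single nonzero number \<eta> controls the lowest
  coefficients of both coordinates. Their ratio is therefore fixed, and it is precisely the one that
  \<open>Up_crit\<close> excludes.\<close>

lemma not_Up_level:
  assumes "q1 x \<noteq> 0 \<or> q2 x \<noteq> 0" "\<not> Up \<tau> x"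
  obtains i where "vanish i (q1 x)" "vanish i (q2 x)" "vanish i (kq x)" "co (kq x) i \<noteq> 0" "vanish (i - 1) (yq x)"
    "co (yq x) (i - 1) = - tinv * co (kq x) i"
proof -
  obtain i where i: "vanish i (q1 x)" "vanish i (q2 x)" "co (q1 x) i \<noteq> 0 \<or> co (q2 x) i \<noteq> 0"
    using level_exists[OF assms(1), of 0] by auto
  define \<eta> where "\<eta> = co (q1 x) i + \<tau> * co (q2 x) i"
  have "\<eta> \<noteq> 0"
  proof
    assume "\<eta> = 0"
    then have "co (q1 x) i = - \<tau> * co (q2 x) i" by (simp add: \<eta>_def eq_neg_iff_add_eq_0)
    moreover from this have "co (q2 x) i \<noteq> 0" using i(3) by auto
    ultimately show False using assms(2) i by (auto simp: Up_def)
  qed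
  have v: "co (q1 x) k = 0" "co (q2 x) k = 0" if "k < i" for k
    using vanishD[OF i(1) that] vanishD[OF i(2) that] by auto
  have k: "co (kq x) i = - \<tau> * \<eta>" using v by (simp add: co_coordinates \<eta>_def w_def power2_eq_square algebra_simps)
  moreover have "co (yq x) (i - 1) = \<eta>" using v by (simp add: co_coordinates \<eta>_def)
  moreover have "- tinv * (- \<tau> * \<eta>) = (\<tau> * tinv) * \<eta>" by (simp add: ac_simps)
  then have "- tinv * (- \<tau> * \<eta>) = \<eta>" by (simp add: tau_tinv)
  moreover have "vanish i (kq x)" "vanish (i - 1) (yq x)" using v by (auto simp: vanish_def co_coordinates)
  ultimately show thesis using that[of i] \<open>\<eta> \<noteq> 0\<close> tau_nonzero i by simp
qed

lemma not_Lo_level: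
  assumes "q1 x \<noteq> 0 \<or> q2 x \<noteq> 0" "\<not> Lo \<tau> x"
  obtains i where "vanish i (q1 x)" "vanish (i + 1) (q2 x)" "vanish i (klq x)" "co (klq x) i \<noteq> 0" "vanish i (ylq x)"
    "co (ylq x) i = \<tau> * co (klq x) i"
proof -
  obtain i where i: "vanish i (q1 x)" "vanish (i + 1) (q2 x)" "co (q1 x) i \<noteq> 0 \<or> co (q2 x) (i + 1) \<noteq> 0"
    using level_exists[OF assms(1), of 1] by blast
  define \<eta> where "\<eta> = \<tau> * co (q1 x) i + co (q2 x) (i + 1)"
  have "\<eta> \<noteq> 0"
  proof
    assume "\<eta> = 0"
    then have *: "co (q2 x) (i + 1) = - \<tau> * co (q1 x) i" by (simp add: \<eta>_def eq_neg_iff_add_eq_0 add.commute)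
    then have "co (q1 x) i \<noteq> 0" using i(3) by auto
    moreover from this have "q2 x \<noteq> 0" using * tau_nonzero by auto
    ultimately show False using assms(2) i * by (auto simp: Lo_def)
  qed
  have v: "co (q1 x) k = 0" if "k < i" for k using vanishD[OF i(1) that] .
  have v': "co (q2 x) k = 0" if "k < i + 1" for k using vanishD[OF i(2) that] .
  have k: "co (klq x) i = \<eta>" using v v' by (simp add: co_coordinates \<eta>_def)
  moreover have "co (ylq x) i = \<tau> * \<eta>" using v v' by (simp add: co_coordinates \<eta>_def w_def power2_eq_square algebra_simps)
  moreover have "vanish i (klq x)" "vanish i (ylq x)" using v v' by (auto simp: vanish_def co_coordinates)
  ultimately show thesis using that[of i] \<open>\<eta> \<noteq> 0\<close> i by simp
qed

end

section \<open>Action of the affine and stable generators when 6 is invertible\<close>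

locale exceptional6 = exceptional \<tau> for \<tau> :: "'k::field" +
  assumes six: "(6 :: 'k) \<noteq> 0"
begin

lemma two: "(2 :: 'k) \<noteq> 0" and three: "(3 :: 'k) \<noteq> 0"
proof -
  have "(6 :: 'k) = 2 * 3" by simp
  then show "(2 :: 'k) \<noteq> 0" "(3 :: 'k) \<noteq> 0" using six by (metis mult_zero_left, metis mult_zero_right)
qed

lemma lam_nonzero: "lam \<noteq> 0"
  using lam_square w_nonzero three by auto

lemma del_nonzero: "del \<noteq> 0"
proof -
  have "del ^ 2 = - (2 * 6)" unfolding del_def w_def using tau by Groebner_Basis.algebra
  moreover have "- ((2 :: 'k) * 6) \<noteq> 0" using two six by (simp only: neg_equal_0_iff_equal mult_eq_0_iff) blast
  ultimately show ?thesis by force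
qed

text \<open>By the inversion formula, the lowest coefficient of \<open>q2 x\<close> is a combination
  of those of \<open>yq x\<close> and \<open>kq x\<close> that vanishes only for the excluded ratio.
  Once it is nonzero, the vanishing of \<open>kq x\<close> at the same exponent forces the ratio of
  type \<tau>.\<close>

lemma Up_crit:
  assumes "vanish m (yq x)" "vanish (m + 1) (kq x)" "co (yq x) m \<noteq> - tinv * co (kq x) (m + 1)"
  shows "Up \<tau> x"
proof -
  have v: "co (yq x) k = 0" if "k < m" for k using vanishD[OF assms(1) that] .
  have v': "co (kq x) k = 0" if "k < m + 1" for k using vanishD[OF assms(2) that] .
  have l2: "2 * lam \<noteq> 0" using two lam_nonzero by simp
  have B: "co (q2 x) k = 0" if "k < m" for k
    using co_relations(1)[of x k] v[OF that] v'[of k] v'[of "k + 1"] that l2 by simp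
  have "2 * lam * co (q2 x) m \<noteq> 0"
    using co_relations(1)[of x m] v'[of m] assms(3) by (simp add: eq_neg_iff_add_eq_0)
  then have Bm: "co (q2 x) m \<noteq> 0" by simp
  have A: "\<tau> * co (q1 x) k = co (q2 x) (k - 1) - w * co (q2 x) k - co (kq x) k" for k
    by (simp add: co_coordinates)
  have "co (q1 x) k = 0" if "k < m" for k using A[of k] B[of k] B[of "k - 1"] v'[of k] that tau_nonzero by simp
  moreover have "co (q1 x) m = - \<tau> * co (q2 x) m"
  proof -
    have "\<tau> * co (q1 x) m = \<tau> * (- \<tau> * co (q2 x) m)" using A[of m] B[of "m - 1"] v'[of m] by (simp add: w_def power2_eq_square)
    then show ?thesis using tau_nonzero by (metis mult_left_cancel)
  qed
  ultimately show ?thesis unfolding Up_def using B Bm by (intro disjI1 exI[of _ m]) (simp add: vanish_def)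
qed

lemma Lo_crit:
  assumes "vanish m (klq x)" "vanish m (ylq x)" "co (ylq x) m \<noteq> \<tau> * co (klq x) m"
  shows "Lo \<tau> x"
proof -
  have v: "co (klq x) k = 0" if "k < m" for k using vanishD[OF assms(1) that] .
  have v': "co (ylq x) k = 0" if "k < m" for k using vanishD[OF assms(2) that] .
  have l2: "2 * lam \<noteq> 0" using two lam_nonzero by simp
  have B: "co (q2 x) k = 0" if "k < m" for k
    using co_relations(2)[of x k] v[OF that] v'[of k] v[of "k - 1"] that l2 by simp
  have "2 * lam * co (q2 x) m \<noteq> 0"
    using co_relations(2)[of x m] v[of "m - 1"] assms(3) by (simp add: mult.assoc[symmetric] tinv_w)
  then have Bm: "co (q2 x) m \<noteq> 0" by simp
  have A: "\<tau> * co (q1 x) k = co (klq x) k - co (q2 x) (k + 1) + w * co (q2 x) k" for k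
    by (simp add: co_coordinates)
  have "co (q1 x) k = 0" if "k < m - 1" for k using A[of k] B[of k] B[of "k + 1"] v[of k] that tau_nonzero by simp
  moreover have *: "co (q2 x) m = - \<tau> * co (q1 x) (m - 1)"
    using A[of "m - 1"] B[of "m - 1"] v[of "m - 1"] by simp
  moreover have "co (q1 x) (m - 1) \<noteq> 0" "q2 x \<noteq> 0" using * Bm by auto
  ultimately show ?thesis unfolding Lo_def using B Bm by (intro disjI1 conjI exI[of _ "m - 1"]) (simp_all add: vanish_def)
qed

lemma Zu_imp_Up: "Zu x \<Longrightarrow> Up \<tau> x"
proof -
  assume "Zu x"
  then obtain j where "vanish j (kq x)" "co (kq x) j \<noteq> 0" "vanish j (yq x)" by (auto simp: Zu_def dom_le_def)
  then show ?thesis using vanish_mono[of j "yq x" "j - 1"] vanishD[of j "yq x" "j - 1"] tinv_nonzero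
    by (intro Up_crit[of "j - 1"]) auto
qed

lemma Zl_imp_Lo: "Zl x \<Longrightarrow> Lo \<tau> x"
proof -
  assume "Zl x"
  then obtain j where "vanish j (klq x)" "co (klq x) j \<noteq> 0" "vanish (j + 1) (ylq x)" by (auto simp: Zl_def dom_less_def)
  then show ?thesis using vanish_mono[of "j + 1" "ylq x" j] vanishD[of "j + 1" "ylq x" j] tau_nonzero
    by (intro Lo_crit[of j]) auto
qed

text \<open>A nonzero translation adds to \<open>yq\<close> a term of lowest exponent
  \<open>j - 2 - deg f\<close>, strictly below everything present in either coordinate. It decides
  the type, and it makes \<open>yq\<close> too low for the stable zone.\<close>

lemma cusp_u:
  assumes k: "vanish j (kq x)" "co (kq x) j \<noteq> 0" and y: "vanish (j - 1) (yq x)"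
    and f: "f \<noteq> 0" and c: "\<alpha> - \<beta> * lam \<noteq> 0"
  shows "Up \<tau> (x * au \<alpha> \<beta> f) \<and> \<not> Zu (x * au \<alpha> \<beta> f)"
proof -
  define e where "e = int (Polynomial.degree f)"
  define P where "P = - ((lt - lti) * (lti - lconst w) :: 'k laurent)"
  have P: "P = lt * lconst w - 1 + lti * lti - lti * lconst w" by (simp add: P_def algebra_simps)
  have "co P i = (if i = - 2 then 1 else 0)" if "i \<le> - 2" for i unfolding P using that by simp
  then have Pv: "vanish (- 2) P" "co P (- 2) = 1" by (simp_all add: vanish_def)
  define m where "m = j - 2 - e"
  have m: "m = - e + (- 2 + j)" by (simp add: m_def)
  have PK: "vanish (- 2 + j) (P * kq x)" "co (P * kq x) (- 2 + j) \<noteq> 0"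
    using vanish_mult[OF Pv(1) k(1)] Pv(2) k(2) by simp_all
  have F1: "vanish m (lsubst f * (P * kq x))"
    unfolding m e_def by (rule vanish_mult(1)[OF lsubst_lowest(1) PK(1)])
  have "co (lsubst f * (P * kq x)) m = Polynomial.lead_coeff f * co (P * kq x) (- 2 + j)"
    unfolding m e_def using vanish_mult(2)[OF lsubst_lowest(1) PK(1)] lsubst_lowest(2)[of f] by simp
  then have F2: "co (lsubst f * (P * kq x)) m \<noteq> 0" using PK(2) f by simp
  have ey: "yq (x * au \<alpha> \<beta> f) = lconst (\<alpha> + \<beta> * lam) * yq x + lconst (2 * lam) * (lsubst f * (P * kq x))"
    unfolding yq_au P_def by (simp add: mult.assoc)
  have e0: "e \<ge> 0" by (simp add: e_def)
  have ycong: "co (yq (x * au \<alpha> \<beta> f)) i = (2 * lam * co (lsubst f * (P * kq x)) i)" if "i \<le> m" for i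
    unfolding ey using vanishD[OF y, of i] that e0 by (simp add: m_def)
  have ym: "vanish m (yq (x * au \<alpha> \<beta> f))" "co (yq (x * au \<alpha> \<beta> f)) m \<noteq> 0"
    using F1 F2 ycong two lam_nonzero by (simp_all add: vanish_def)
  have km: "co (kq (x * au \<alpha> \<beta> f)) i = 0" if "i < j" for i
    unfolding kq_au using vanishD[OF k(1) that] by simp
  have "Up \<tau> (x * au \<alpha> \<beta> f)"
  proof (rule Up_crit[OF ym(1)])
    show "vanish (m + 1) (kq (x * au \<alpha> \<beta> f))" using km e0 by (simp add: vanish_def m_def)
    have "co (kq (x * au \<alpha> \<beta> f)) (m + 1) = 0" using km[of "m + 1"] e0 by (simp add: m_def)
    then show "co (yq (x * au \<alpha> \<beta> f)) m \<noteq> - tinv * co (kq (x * au \<alpha> \<beta> f)) (m + 1)" using ym(2) by simp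
  qed
  moreover have "\<not> Zu (x * au \<alpha> \<beta> f)"
  proof
    assume "Zu (x * au \<alpha> \<beta> f)"
    then obtain i where i: "co (kq (x * au \<alpha> \<beta> f)) i \<noteq> 0" "vanish i (yq (x * au \<alpha> \<beta> f))"
      by (auto simp: Zu_def dom_le_def)
    have "\<not> i < j" using i(1) km[of i] by blast
    then show False using vanishD[OF i(2), of m] ym(2) e0 by (simp add: m_def)
  qed
  ultimately show ?thesis by blast
qed

text \<open>As for the upper coordinates, except that the pole of \<open>P\<close> has order 1 only;
  correspondingly \<open>ylq x\<close> must not start below \<open>j\<close>.\<close>

lemma cusp_l:
  assumes k: "vanish j (klq x)" "co (klq x) j \<noteq> 0" and y: "vanish j (ylq x)"
    and f: "f \<noteq> 0" and c: "\<alpha> + \<beta> * lam \<noteq> 0"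
  shows "Lo \<tau> (x * al \<alpha> \<beta> f) \<and> \<not> Zl (x * al \<alpha> \<beta> f)"
proof -
  define e where "e = int (Polynomial.degree f)"
  define P where "P = - ((lt - lti) * (lt - lconst w) :: 'k laurent)"
  have P: "P = lt * lconst w + 1 - lt * lt - lti * lconst w" by (simp add: P_def algebra_simps)
  have "co P i = (if i = - 1 then - w else 0)" if "i \<le> - 1" for i unfolding P using that by simp
  then have Pv: "vanish (- 1) P" "co P (- 1) = - w" by (simp_all add: vanish_def)
  define m where "m = j - 1 - e"
  have m: "m = - e + (- 1 + j)" by (simp add: m_def)
  have PK: "vanish (- 1 + j) (P * klq x)" "co (P * klq x) (- 1 + j) \<noteq> 0"
    using vanish_mult[OF Pv(1) k(1)] Pv(2) k(2) w_nonzero by simp_all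
  have F1: "vanish m (lsubst f * (P * klq x))"
    unfolding m e_def by (rule vanish_mult(1)[OF lsubst_lowest(1) PK(1)])
  have "co (lsubst f * (P * klq x)) m = Polynomial.lead_coeff f * co (P * klq x) (- 1 + j)"
    unfolding m e_def using vanish_mult(2)[OF lsubst_lowest(1) PK(1)] lsubst_lowest(2)[of f] by simp
  then have F2: "co (lsubst f * (P * klq x)) m \<noteq> 0" using PK(2) f by simp
  have ey: "ylq (x * al \<alpha> \<beta> f) = lconst (\<alpha> - \<beta> * lam) * ylq x - lconst (2 * lam) * (lsubst f * (P * klq x))"
    unfolding ylq_al P_def by (simp add: mult.assoc)
  have e0: "e \<ge> 0" by (simp add: e_def)
  have ycong: "co (ylq (x * al \<alpha> \<beta> f)) i = - (2 * lam * co (lsubst f * (P * klq x)) i)" if "i \<le> m" for i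
    unfolding ey using vanishD[OF y, of i] that e0 by (simp add: m_def)
  have ym: "vanish m (ylq (x * al \<alpha> \<beta> f))" "co (ylq (x * al \<alpha> \<beta> f)) m \<noteq> 0"
    using F1 F2 ycong two lam_nonzero by (simp_all add: vanish_def)
  have km: "co (klq (x * al \<alpha> \<beta> f)) i = 0" if "i < j" for i
    unfolding klq_al using vanishD[OF k(1) that] by simp
  have "Lo \<tau> (x * al \<alpha> \<beta> f)"
  proof (rule Lo_crit[OF _ ym(1)])
    show "vanish m (klq (x * al \<alpha> \<beta> f))" using km e0 by (simp add: vanish_def m_def)
    have "co (klq (x * al \<alpha> \<beta> f)) m = 0" using km[of m] e0 by (simp add: m_def)
    then show "co (ylq (x * al \<alpha> \<beta> f)) m \<noteq> \<tau> * co (klq (x * al \<alpha> \<beta> f)) m" using ym(2) by simp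
  qed
  moreover have "\<not> Zl (x * al \<alpha> \<beta> f)"
  proof
    assume "Zl (x * al \<alpha> \<beta> f)"
    then obtain i where i: "co (klq (x * al \<alpha> \<beta> f)) i \<noteq> 0" "vanish (i + 1) (ylq (x * al \<alpha> \<beta> f))"
      by (auto simp: Zl_def dom_less_def)
    have "\<not> i < j" using i(1) km[of i] by blast
    then show False using vanishD[OF i(2), of m] ym(2) e0 by (simp add: m_def)
  qed
  ultimately show ?thesis by blast
qed

text \<open>With a translation part the new lowest term decides. Without one, the two coordinates
  are multiplied by distinct eigenvalues, which destroys the special ratio of
  \<open>not_Up_level\<close> but leaves \<open>yq\<close> lower than \<open>kq\<close>.\<close>

lemma not_Up_au:
  assumes "q1 x \<noteq> 0 \<or> q2 x \<noteq> 0" "\<not> Up \<tau> x" "\<beta> \<noteq> 0 \<or> f \<noteq> 0"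
    and c: "\<alpha> + \<beta> * lam \<noteq> 0" "\<alpha> - \<beta> * lam \<noteq> 0"
  shows "Up \<tau> (x * au \<alpha> \<beta> f) \<and> \<not> Zu (x * au \<alpha> \<beta> f)"
proof -
  obtain i where i: "vanish i (kq x)" "co (kq x) i \<noteq> 0" "vanish (i - 1) (yq x)"
    "co (yq x) (i - 1) = - tinv * co (kq x) i"
    using not_Up_level[OF assms(1,2)] by metis
  show ?thesis
  proof (cases "f = 0")
    case False
    then show ?thesis using cusp_u[OF i(1-3) False c(2)] by blast
  next
    case True
    then have ey: "yq (x * au \<alpha> \<beta> f) = lconst (\<alpha> + \<beta> * lam) * yq x" by (simp add: yq_au)
    have y0: "co (yq x) (i - 1) \<noteq> 0" using i tinv_nonzero by simp
    \<comment> \<open>The deviation from the excluded ratio is the difference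
      \<open>2 * \<beta> * lam\<close> of the eigenvalues times a nonzero coefficient.\<close>
    have "(\<alpha> + \<beta> * lam) * (tinv * co (kq x) i) - tinv * ((\<alpha> - \<beta> * lam) * co (kq x) i) = 2 * (\<beta> * (lam * (tinv * co (kq x) i)))"
      by (simp add: algebra_simps)
    also have "\<dots> \<noteq> 0" using True assms(3) two lam_nonzero tinv_nonzero i by simp
    finally have "Up \<tau> (x * au \<alpha> \<beta> f)"
      using i by (intro Up_crit[of "i - 1"]) (auto simp: vanish_def ey kq_au)
    moreover have "\<not> Zu (x * au \<alpha> \<beta> f)"
    proof
      assume "Zu (x * au \<alpha> \<beta> f)"
      then have "dom_le (kq x) (yq x)" using c by (simp add: Zu_def ey kq_au dom_le_scale)
      then obtain k where k: "co (kq x) k \<noteq> 0" "vanish k (yq x)" by (auto simp: dom_le_def)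
      have "k \<ge> i" using k(1) vanishD[OF i(1), of k] by force
      then show False using vanishD[OF k(2), of "i - 1"] y0 by simp
    qed
    ultimately show ?thesis by blast
  qed
qed

lemma not_Lo_al:
  assumes "q1 x \<noteq> 0 \<or> q2 x \<noteq> 0" "\<not> Lo \<tau> x" "\<beta> \<noteq> 0 \<or> f \<noteq> 0"
    and c: "\<alpha> + \<beta> * lam \<noteq> 0" "\<alpha> - \<beta> * lam \<noteq> 0"
  shows "Lo \<tau> (x * al \<alpha> \<beta> f) \<and> \<not> Zl (x * al \<alpha> \<beta> f)"
proof -
  obtain i where i: "vanish i (klq x)" "co (klq x) i \<noteq> 0" "vanish i (ylq x)"
    "co (ylq x) i = \<tau> * co (klq x) i"
    using not_Lo_level[OF assms(1,2)] by metis
  show ?thesis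
  proof (cases "f = 0")
    case False
    then show ?thesis using cusp_l[OF i(1-3) False c(1)] by blast
  next
    case True
    then have ey: "ylq (x * al \<alpha> \<beta> f) = lconst (\<alpha> - \<beta> * lam) * ylq x" by (simp add: ylq_al)
    have y0: "co (ylq x) i \<noteq> 0" using i tau_nonzero by simp
    have "\<tau> * ((\<alpha> + \<beta> * lam) * co (klq x) i) - (\<alpha> - \<beta> * lam) * (\<tau> * co (klq x) i) = 2 * (\<beta> * (lam * (\<tau> * co (klq x) i)))"
      by (simp add: algebra_simps)
    also have "\<dots> \<noteq> 0" using True assms(3) two lam_nonzero tau_nonzero i by simp
    finally have "Lo \<tau> (x * al \<alpha> \<beta> f)"
      using i by (intro Lo_crit[of i]) (auto simp: vanish_def ey klq_al)
    moreover have "\<not> Zl (x * al \<alpha> \<beta> f)"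
    proof
      assume "Zl (x * al \<alpha> \<beta> f)"
      then have "dom_less (klq x) (ylq x)" using c by (simp add: Zl_def ey klq_al dom_less_scale)
      then obtain k where k: "co (klq x) k \<noteq> 0" "vanish (k + 1) (ylq x)" by (auto simp: dom_less_def)
      have "k \<ge> i" using k(1) vanishD[OF i(1), of k] by force
      then show False using vanishD[OF k(2), of i] y0 by simp
    qed
    ultimately show ?thesis by blast
  qed
qed

text \<open>Scaling the coordinates by nonzero constants does not affect a comparison of exponents,
  so exactly the elements without translation part preserve the stable zone.\<close>

lemma Zu_au:
  assumes "Zu x" and c: "\<alpha> + \<beta> * lam \<noteq> 0" "\<alpha> - \<beta> * lam \<noteq> 0"
  shows "if f = 0 then Zu (x * au \<alpha> \<beta> f) else Up \<tau> (x * au \<alpha> \<beta> f) \<and> \<not> Zu (x * au \<alpha> \<beta> f)"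
proof (cases "f = 0")
  case True
  then show ?thesis using assms by (simp add: Zu_def yq_au kq_au dom_le_scale)
next
  case False
  obtain j where j: "vanish j (kq x)" "co (kq x) j \<noteq> 0" "vanish j (yq x)" using assms by (auto simp: Zu_def dom_le_def)
  then show ?thesis using cusp_u[OF j(1,2) vanish_mono[OF j(3)] False c(2)] False by simp
qed

lemma Zl_al:
  assumes "Zl x" and c: "\<alpha> + \<beta> * lam \<noteq> 0" "\<alpha> - \<beta> * lam \<noteq> 0"
  shows "if f = 0 then Zl (x * al \<alpha> \<beta> f) else Lo \<tau> (x * al \<alpha> \<beta> f) \<and> \<not> Zl (x * al \<alpha> \<beta> f)"
proof (cases "f = 0")
  case True
  then show ?thesis using assms by (simp add: Zl_def ylq_al klq_al dom_less_scale)
next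
  case False
  obtain j where j: "vanish j (klq x)" "co (klq x) j \<noteq> 0" "vanish (j + 1) (ylq x)" using assms by (auto simp: Zl_def dom_less_def)
  then show ?thesis using cusp_l[OF j(1,2) vanish_mono[OF j(3)] False c(1)] False by simp
qed

lemma coordinates_nonzero:
  assumes "q1 x \<noteq> 0 \<or> q2 x \<noteq> 0"
  shows "kq x \<noteq> 0 \<or> yq x \<noteq> 0" "klq x \<noteq> 0 \<or> ylq x \<noteq> 0"
proof -
  have l2: "2 * lam \<noteq> 0" using two lam_nonzero by simp
  show "kq x \<noteq> 0 \<or> yq x \<noteq> 0"
  proof (rule ccontr)
    assume "\<not> (kq x \<noteq> 0 \<or> yq x \<noteq> 0)"
    then have z: "kq x = 0" "yq x = 0" by auto
    have B: "co (q2 x) n = 0" for n using co_relations(1)[of x n] l2 by (simp add: z)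
    have "co (q1 x) n = 0" for n using co_coordinates(1)[of x n] B tau_nonzero by (simp add: z)
    then show False using assms B laurent_eqI[of "q1 x" 0] laurent_eqI[of "q2 x" 0] by simp
  qed
  show "klq x \<noteq> 0 \<or> ylq x \<noteq> 0"
  proof (rule ccontr)
    assume "\<not> (klq x \<noteq> 0 \<or> ylq x \<noteq> 0)"
    then have z: "klq x = 0" "ylq x = 0" by auto
    have B: "co (q2 x) n = 0" for n using co_relations(2)[of x n] l2 by (simp add: z)
    have "co (q1 x) n = 0" for n using co_coordinates(3)[of x n] B tau_nonzero by (simp add: z)
    then show False using assms B laurent_eqI[of "q1 x" 0] laurent_eqI[of "q2 x" 0] by simp
  qed
qed

text \<open>In the exchanged coordinates, being in the zone after the stable letter is the
  complementary comparison to being in the other zone before it; \<open>dom_total\<close> does the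
  rest.\<close>

lemma Z_st:
  assumes x: "q1 x \<noteq> 0 \<or> q2 x \<noteq> 0" and a: "kap a \<noteq> 0"
  shows "\<not> Zl x \<Longrightarrow> Zu (x * st a)" "\<not> Zu x \<Longrightarrow> Zl (x * dag (st a))"
proof -
  have n: "2 * lam * kap a \<noteq> 0" using two lam_nonzero a by simp
  show "Zu (x * st a)" if "\<not> Zl x"
    using dom_total[of "ylq x" "klq x"] coordinates_nonzero(2)[OF x] that
    by (auto simp only: Zu_def Zl_def st_coordinates dom_uminus dom_le_scale[OF del_nonzero n])
  show "Zl (x * dag (st a))" if "\<not> Zu x"
    using dom_total[of "kq x" "yq x"] coordinates_nonzero(1)[OF x] that
    by (auto simp only: Zu_def Zl_def st_coordinates dom_uminus dom_less_scale[OF del_nonzero n])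
qed

lemma Zu_scale: "c \<noteq> 0 \<Longrightarrow> Zu (qc c * x) \<longleftrightarrow> Zu x"
  by (simp add: Zu_def yq_def kq_def mult.assoc dom_le_scale)

lemma Zl_scale: "c \<noteq> 0 \<Longrightarrow> Zl (qc c * x) \<longleftrightarrow> Zl x"
  by (simp add: Zl_def ylq_def klq_def mult.assoc dom_less_scale)

end

section \<open>Upper ends of the coordinates and descent\<close>

lemma ql_one: "ql 1 = 1" "ql 0 = 0"
  by (simp_all add: qn_eq_iff)

lemma vanish_cancel:
  fixes f g :: "'k::field laurent"
  assumes "vanish m f" "co f m \<noteq> 0" "vanish (m + z) (f * g)"
  shows "vanish z g"
proof (cases "g = 0")
  case False
  then obtain i where i: "vanish i g" "co g i \<noteq> 0" using lowest_exists by blast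
  have "co (f * g) (m + i) \<noteq> 0" using vanish_mult(2)[OF assms(1) i(1)] assms(2) i(2) by simp
  then have "i \<ge> z" using vanishD[OF assms(3), of "m + i"] by linarith
  then show ?thesis using vanish_mono[OF i(1)] by blast
qed simp

context exceptional
begin

lemma dag_self_cancel: "qnorm x = lconst c \<Longrightarrow> dag x * (x * z) = qc c * z"
  by (simp add: mult.assoc[symmetric] dag_mult_self)

text \<open>If \<open>kq x\<close> vanished, then so would \<open>x * dag (elem \<tau>)\<close>, by
  proportionality of its columns; but \<open>x\<close> is invertible and
  \<open>dag (elem \<tau>)\<close> is not 0.\<close>

lemma kq_nonzero: "qunit x \<Longrightarrow> kq x \<noteq> 0"
proof
  assume "qunit x" "kq x = 0"
  then obtain c where c: "c \<noteq> 0" "qnorm x = lconst c" by (auto simp: qunit_def)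
  have "q1 (x * dag (elem \<tau>)) = 0" using q1_dag_elem[of x] \<open>kq x = 0\<close> by (simp add: kq_def)
  then have "x * dag (elem \<tau>) = 0" using \<open>kq x = 0\<close> by (intro qn_eqI) (simp_all add: kq_def)
  then have "qc c * dag (elem \<tau>) = 0" using dag_self_cancel[OF c(2), of "dag (elem \<tau>)"] by simp
  then have "q2 (qc c * dag (elem \<tau>)) = 0" by simp
  then show False using c(1) tau_nonzero by simp
qed

text \<open>The first bound is the cancellation at the upper end. The last one says that the higher
  the lower end of \<open>kq x\<close> starts, the shorter its upper end is; this is what keeps a
  translation of large degree from widening the quaternion.\<close>

lemma kq_bar:
  assumes x: "qunit x" and f: "vanish m (q2 x)" "co (q2 x) m \<noteq> 0" "vanish n (lbar (q1 x))" "vanish (n + 1) (lbar (q2 x))"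
      "co (lbar (q2 x)) (n + 1) = \<tau> * co (lbar (q1 x)) n"
    and k: "vanish j (kq x)" "co (kq x) j \<noteq> 0"
  shows "vanish (n + 1) (lbar (kq x))" "n + j + 1 \<le> 0" "vanish (n + j - m) (lbar (kq x))"
proof -
  have D: "co (q1 x) (- i) = 0" if "i < n" for i using vanishD[OF f(3) that] by simp
  have E: "co (q2 x) (- i) = 0" if "i < n + 1" for i using vanishD[OF f(4) that] by simp
  show 1: "vanish (n + 1) (lbar (kq x))"
    unfolding vanish_def
  proof (intro allI impI)
    fix i assume "i < n + 1"
    then consider "i = n" | "i < n" by linarith
    then show "co (lbar (kq x)) i = 0"
      using D[of i] E[of i] E[of "i + 1"] f(5) by cases (simp_all add: co_coordinates)
  qed
  have "co (lbar (kq x)) (- j) \<noteq> 0" using k(2) by simp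
  then have "\<not> - j < n + 1" using vanishD[OF 1, of "- j"] by blast
  then show 2: "n + j + 1 \<le> 0" by linarith
  obtain c where c: "c \<noteq> 0" "qnorm x = lconst c" using x by (auto simp: qunit_def)
  \<comment> \<open>Cancelling \<open>x\<close> leaves a constant multiple of
    \<open>dag (elem \<tau>)\<close>, whose second entry is constant; as \<open>n + j\<close> is
    negative, this constant does not disturb the estimate, and division by the lowest term of
    \<open>q2 x\<close> gives the bound.\<close>
  have "q2 (dag x * (x * dag (elem \<tau>))) = lbar (q1 x) * kq x - q2 x * lbar (q1 (x * dag (elem \<tau>)))"
    by (simp add: q2_mult[of "dag x"] kq_def)
  then have eq: "q2 x * lbar (q1 (x * dag (elem \<tau>))) = lbar (q1 x) * kq x + lconst (c * \<tau>)"
    unfolding dag_self_cancel[OF c(2)] by (simp add: lconst_hom(4) algebra_simps)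
  have "vanish (n + j) (lbar (q1 x) * kq x)" using vanish_mult(1)[OF f(3) k(1)] .
  moreover have "vanish (n + j) (lconst (c * \<tau>))" using 2 by (simp add: vanish_def)
  ultimately have "vanish (n + j) (q2 x * lbar (q1 (x * dag (elem \<tau>))))"
    unfolding eq by (rule vanish_add)
  moreover have "m + (n + j - m) = n + j" by simp
  ultimately have "vanish (m + (n + j - m)) (q2 x * lbar (q1 (x * dag (elem \<tau>))))"
    by (simp only:)
  then have 3: "vanish (n + j - m) (lbar (q1 (x * dag (elem \<tau>))))" by (rule vanish_cancel[OF f(1,2)])
  define P where "P = lconst \<tau> - lconst (\<tau> * w ^ 2) * lt"
  have P: "vanish 0 P" "co P 0 \<noteq> 0" using tau_nonzero by (simp_all add: vanish_def P_def)
  have "lbar (q1 (x * dag (elem \<tau>))) = P * lbar (kq x)"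
    by (simp add: q1_dag_elem[of x] kq_def[of x] lconst_hom(4) P_def algebra_simps)
  then have "vanish (0 + (n + j - m)) (P * lbar (kq x))" using 3 by simp
  then show "vanish (n + j - m) (lbar (kq x))" by (rule vanish_cancel[OF P])
qed

lemma kq_low:
  assumes "vanish m (q1 x)" "vanish m (q2 x)" "co (q1 x) m = - \<tau> * co (q2 x) m"
  shows "vanish (m + 1) (kq x)"
  unfolding vanish_def
proof (intro allI impI)
  fix i assume "i < m + 1"
  then consider "i = m" | "i < m" by linarith
  then show "co (kq x) i = 0"
    using vanishD[OF assms(1), of i] vanishD[OF assms(2), of i] vanishD[OF assms(2), of "i - 1"] assms(3)
    by cases (simp_all add: co_coordinates w_def power2_eq_square)
qed

lemma au_0: "au (- c) 1 0 = mu - qc c"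
  by (intro qn_eqI) (simp_all add: au_def lconst_hom)

end

context exceptional6
begin

text \<open>Multiplication by \<open>mu - c\<close> removes the lowest term of the second entry for
  one value of \<open>c\<close>. If that value is an eigenvalue, the factor is not invertible, but
  then one coordinate vanishes to higher order: \<open>kq\<close> for \<open>lam\<close>, which
  calls for a translation, and \<open>yq\<close> for \<open>- lam\<close>, which calls for the
  stable generator.\<close>

lemma descent_torus:
  assumes x: "qunit x" and U: "Up \<tau> x"
  shows "(\<exists>c. c \<noteq> lam \<and> c \<noteq> - lam \<and> width (x * au (- c) 1 0) < width x)
    \<or> (\<exists>m. vanish m (q2 x) \<and> co (q2 x) m \<noteq> 0 \<and> vanish (m + 2) (kq x)) \<or> Zu x"
proof -
  obtain m n where f: "vanish m (q1 x)" "vanish m (q2 x)" "co (q2 x) m \<noteq> 0" "co (q1 x) m = - \<tau> * co (q2 x) m"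
    "vanish n (lbar (q1 x))" "vanish (n + 1) (lbar (q2 x))" "co (lbar (q1 x)) n \<noteq> 0"
    "co (lbar (q2 x)) (n + 1) = \<tau> * co (lbar (q1 x)) n" "int (width x) = - m - n" "width x > 0"
    using Up_frame[OF x U tau_nonzero] .
  \<comment> \<open>The solution of the linear equation that the coefficient at \<open>m\<close> of
    the new second entry be 0; a coefficient at \<open>m - 1\<close> of \<open>q2 x\<close> does not
    occur in it because it vanishes.\<close>
  define c where "c = (co (q1 x) (m + 1) + w * co (q1 x) m + \<tau> * co (q2 x) (m + 1)) / co (q2 x) m"
  have c: "co (q1 x) (m + 1) + w * co (q1 x) m + \<tau> * co (q2 x) (m + 1) = c * co (q2 x) m"
    using f(3) by (simp add: c_def)
  have k: "vanish (m + 1) (kq x)" by (rule kq_low[OF f(1,2,4)])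
  have A: "co (q1 x) i = 0" if "i < m" for i using vanishD[OF f(1) that] .
  have B: "co (q2 x) i = 0" if "i < m" for i using vanishD[OF f(2) that] .
  have ym: "co (yq x) m = (c + lam) * co (q2 x) m"
    using c B[of "m - 1"] by (simp add: co_coordinates algebra_simps)
  have rel: "2 * lam * co (q2 x) m = (c + lam) * co (q2 x) m + tinv * co (kq x) (m + 1)"
    using co_relations(1)[of x m] vanishD[OF k, of m] ym by simp
  have ylow: "vanish m (yq x)"
    unfolding vanish_def
  proof (intro allI impI)
    fix i assume "i < m"
    then consider "i = m - 1" | "i < m - 1" by linarith
    then show "co (yq x) i = 0"
      using A[of i] A[of "i + 1"] B[of i] B[of "i - 1"] B[of "i + 1"] f(4) \<open>i < m\<close>
      by cases (simp_all add: co_coordinates)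
  qed
  consider "c = lam" | "c = - lam" | "c \<noteq> lam" "c \<noteq> - lam" by blast
  then show ?thesis
  proof cases
    case 1
    then have "tinv * co (kq x) (m + 1) = 0" using rel by simp
    then have "vanish (m + 1 + 1) (kq x)" using tinv_nonzero by (intro vanish_Suc[OF k]) simp
    then show ?thesis using f(2,3) by (auto simp: add.assoc)
  next
    case 2
    then have "co (yq x) m = 0" using ym by simp
    then have "vanish (m + 1) (yq x)" by (rule vanish_Suc[OF ylow])
    moreover have "co (kq x) (m + 1) \<noteq> 0" using rel 2 f(3) two lam_nonzero by auto
    ultimately have "Zu x" unfolding Zu_def dom_le_def using k by blast
    then show ?thesis by blast
  next
    case 3
    have co: "co (q2 (x * au (- c) 1 0)) i = co (q1 x) (i + 1) + w * co (q1 x) i + \<tau> * co (q2 x) (i + 1) - \<tau> * co (q2 x) (i - 1) - c * co (q2 x) i" for i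
    proof -
      have "x * au (- c) 1 0 = x * (mu + qc lam) - x * qc (c + lam)"
        unfolding au_0 right_diff_distrib[symmetric] by (rule arg_cong[of _ _ "(*) x"]) (intro qn_eqI, simp_all add: lconst_hom)
      then have "q2 (x * au (- c) 1 0) = yq x - lconst (c + lam) * q2 x"
        by (simp add: yq_def q2_mult mult.commute)
      then have "co (q2 (x * au (- c) 1 0)) i = co (yq x) i - (c + lam) * co (q2 x) i" by simp
      then show ?thesis by (simp add: co_coordinates algebra_simps)
    qed
    have "vanish (m + 1) (q2 (x * au (- c) 1 0))"
      unfolding vanish_def
    proof (intro allI impI)
      fix i assume "i < m + 1"
      then consider "i = m" | "i = m - 1" | "i < m - 1" by linarith
      then show "co (q2 (x * au (- c) 1 0)) i = 0"
        using A[of i] A[of "i + 1"] B[of i] B[of "i - 1"] B[of "i + 1"] f(4) c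
        by cases (simp_all add: co)
    qed
    moreover have "vanish (n + 1) (lbar (q2 (x * au (- c) 1 0)))"
      unfolding vanish_def
    proof (intro allI impI)
      fix i assume "i < n + 1"
      have D: "co (q1 x) (- l) = 0" if "l < n" for l using vanishD[OF f(5) that] by simp
      have E: "co (q2 x) (- l) = 0" if "l < n + 1" for l using vanishD[OF f(6) that] by simp
      consider "i = n" | "i < n" using \<open>i < n + 1\<close> by linarith
      then show "co (lbar (q2 (x * au (- c) 1 0))) i = 0"
        using D[of i] D[of "i - 1"] E[of i] E[of "i - 1"] E[of "i + 1"] f(8)
        by cases (simp_all add: co w_def power2_eq_square)
    qed
    ultimately show ?thesis using width_less[OF f(9,10)] 3 by blast
  qed
qed

text \<open>A monomial translation is adjusted in degree so that its contribution starts at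
  \<open>m\<close>, and in coefficient so that it cancels the lowest term of
  \<open>q2 x\<close>.\<close>

lemma descent_cusp:
  assumes x: "qunit x" and U: "Up \<tau> x" and m': "vanish m' (q2 x)" "co (q2 x) m' \<noteq> 0" "vanish (m' + 2) (kq x)"
  shows "\<exists>f. width (x * au 1 0 f) < width x"
proof -
  obtain m n where f: "vanish m (q1 x)" "vanish m (q2 x)" "co (q2 x) m \<noteq> 0" "co (q1 x) m = - \<tau> * co (q2 x) m"
    "vanish n (lbar (q1 x))" "vanish (n + 1) (lbar (q2 x))" "co (lbar (q1 x)) n \<noteq> 0"
    "co (lbar (q2 x)) (n + 1) = \<tau> * co (lbar (q1 x)) n" "int (width x) = - m - n" "width x > 0"
    using Up_frame[OF x U tau_nonzero] .
  have "m' = m" using vanish_unique m' f(2,3) by blast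
  obtain j where j: "vanish j (kq x)" "co (kq x) j \<noteq> 0" using lowest_exists[OF kq_nonzero[OF x]] by blast
  have jm: "j \<ge> m + 2" using vanishD[OF m'(3), of j] j(2) \<open>m' = m\<close> by linarith
  note kb = kq_bar[OF x f(2,3,5,6,8) j]
  \<comment> \<open>The degree solves \<open>j - 2 - e = m\<close>, with 2 the pole order of
    \<open>P\<close>; it is nonnegative by \<open>jm\<close>.\<close>
  define e where "e = nat (j - m - 2)"
  define c where "c = - co (q2 x) m / co (kq x) j"
  have c: "c \<noteq> 0" "c * co (kq x) j = - co (q2 x) m" using f(3) j(2) by (simp_all add: c_def)
  define p where "p = Polynomial.monom c e"
  have p: "Polynomial.degree p = e" "Polynomial.lead_coeff p = c" using c(1) by (simp_all add: p_def Polynomial.degree_monom_eq)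
  define P where "P = - ((lt - lti) * (lti - lconst w) :: 'k laurent)"
  have P: "P = lt * lconst w - 1 + lti * lti - lti * lconst w" by (simp add: P_def algebra_simps)
  have "co P i = (if i = - 2 then 1 else 0)" if "i \<le> - 2" for i unfolding P using that by simp
  then have Pv: "vanish (- 2) P" "co P (- 2) = 1" by (simp_all add: vanish_def)
  have "x * au 1 0 p = x + ql (lsubst p) * (x * nu)"
    by (simp add: au_def distrib_left mult_ql_left ql_one)
  then have q2: "q2 (x * au 1 0 p) = q2 x + lsubst p * (P * kq x)"
    by (simp add: q2_nu kq_def P_def mult.assoc)
  have m: "m = - int e + (- 2 + j)" using jm by (simp add: e_def)
  have PK: "vanish (- 2 + j) (P * kq x)" "co (P * kq x) (- 2 + j) = co (kq x) j"
    using vanish_mult[OF Pv(1) j(1)] Pv(2) by simp_all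
  have F: "vanish m (lsubst p * (P * kq x))" "co (lsubst p * (P * kq x)) m = - co (q2 x) m"
    using vanish_mult[OF lsubst_lowest(1)[of p] PK(1)] lsubst_lowest(2)[of p] PK(2) p c(2) unfolding m by simp_all
  have "vanish m (q2 (x * au 1 0 p))" "co (q2 (x * au 1 0 p)) m = 0"
    unfolding q2 using vanish_add[OF f(2) F(1)] F(2) by simp_all
  then have 1: "vanish (m + 1) (q2 (x * au 1 0 p))" by (rule vanish_Suc)
  have Pb: "vanish (- 1) (lbar P)" unfolding P vanish_def by simp
  \<comment> \<open>At the upper end the losses \<open>e\<close> from the polynomial and 1 from
    \<open>P\<close> are exactly compensated by the sharper bound for \<open>kq x\<close>.\<close>
  have "vanish (- int e + (- 1 + (n + j - m))) (lsubst p * (lbar P * lbar (kq x)))"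
    using vanish_mult(1)[OF lsubst_lowest(1)[of p] vanish_mult(1)[OF Pb kb(3)]] p by simp
  moreover have "- int e + (- 1 + (n + j - m)) = n + 1" using m by simp
  ultimately have "vanish (n + 1) (lsubst p * (lbar P * lbar (kq x)))" by (simp only:)
  then have 2: "vanish (n + 1) (lbar (q2 (x * au 1 0 p)))"
    unfolding q2 lbar_simps lbar_mult lbar_lsubst by (rule vanish_add[OF f(6)])
  show ?thesis using width_less[OF f(9,10) 1 2] by blast
qed

text \<open>The new second entry is expressed through \<open>yq x\<close> and \<open>kq x\<close> by
  the exchange of coordinates. In the stable zone both start at \<open>m + 1\<close> or later, so
  the lower end shrinks; the upper end needs a bound for \<open>lbar (yq x)\<close>.\<close>

lemma descent_stable:
  assumes x: "qunit x" and Z: "Zu x"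
  shows "width (x * dag (st a)) < width x"
proof -
  obtain m n where f: "vanish m (q1 x)" "vanish m (q2 x)" "co (q2 x) m \<noteq> 0" "co (q1 x) m = - \<tau> * co (q2 x) m"
    "vanish n (lbar (q1 x))" "vanish (n + 1) (lbar (q2 x))" "co (lbar (q1 x)) n \<noteq> 0"
    "co (lbar (q2 x)) (n + 1) = \<tau> * co (lbar (q1 x)) n" "int (width x) = - m - n" "width x > 0"
    using Up_frame[OF x Zu_imp_Up[OF Z] tau_nonzero] .
  obtain j where j: "vanish j (kq x)" "co (kq x) j \<noteq> 0" "vanish j (yq x)" using Z by (auto simp: Zu_def dom_le_def)
  have k: "vanish (m + 1) (kq x)" by (rule kq_low[OF f(1,2,4)])
  have jm: "j \<ge> m + 1" using vanishD[OF k, of j] j(2) by linarith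
  have y: "vanish (m + 1) (yq x)" using vanish_mono[OF j(3) jm] .
  note kb = kq_bar[OF x f(2,3,5,6,8) j(1,2)]
  have nm: "n + m \<le> - 2" using kb(2) jm by linarith
  obtain c where c: "c \<noteq> 0" "qnorm x = lconst c" using x by (auto simp: qunit_def)
  define P where "P = lbar (q1 (x * (mu + qc lam)))"
  \<comment> \<open>As for \<open>kq_bar\<close>: cancelling \<open>x\<close> and dividing by the
    lowest term of \<open>q2 x\<close> bounds one column of \<open>x * (mu + qc lam)\<close>, and
    proportionality of the columns transfers the bound to the other.\<close>
  have "q2 (dag x * (x * (mu + qc lam))) = lbar (q1 x) * yq x - q2 x * P"
    by (simp add: q2_mult[of "dag x"] yq_def P_def)
  then have "lbar (q1 x) * yq x - q2 x * P = lconst c * (lti + lconst w)"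
    unfolding dag_self_cancel[OF c(2)] by (simp add: mu_def)
  then have eq: "q2 x * P = lbar (q1 x) * yq x - lconst c * (lti + lconst w)" by (simp add: algebra_simps)
  have "vanish (n + (m + 1)) (lbar (q1 x) * yq x)" using vanish_mult(1)[OF f(5) y] .
  then have "vanish (m + (n + 1)) (q2 x * P)" unfolding eq using nm by (simp add: vanish_def algebra_simps)
  then have P: "vanish (n + 1) P" by (rule vanish_cancel[OF f(2,3)])
  have "(- (lconst \<tau> * lt) + lconst \<tau> * lti + lconst lam) * lbar (yq x) = P * (lt + lconst w)"
    using arg_cong[OF q1_mu[of x], of lbar] by (simp add: P_def yq_def mult.commute)
  moreover have "vanish (n + 1) (P * (lt + lconst w))" using P by (simp add: distrib_left vanish_def)
  moreover have "- 1 + (n + 2) = n + 1" by simp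
  ultimately have "vanish (- 1 + (n + 2)) ((- (lconst \<tau> * lt) + lconst \<tau> * lti + lconst lam) * lbar (yq x))" by (simp only:)
  then have yb: "vanish (n + 2) (lbar (yq x))"
    by (rule vanish_cancel[rotated 2]) (simp_all add: vanish_def tau_nonzero)
  have l2: "2 * lam \<noteq> 0" using two lam_nonzero by simp
  have co: "2 * lam * co (q2 (x * dag (st a))) i
      = tinv * (w * (del * co (yq x) i) + del * co (yq x) (i - 1)) + 2 * lam * kap a * co (kq x) i" for i
    using co_relations(2)[of "x * dag (st a)" i] by (simp add: st_coordinates)
  have "co (q2 (x * dag (st a))) i = 0" if "i < m + 1" for i
    using co[of i] vanishD[OF y, of i] vanishD[OF y, of "i - 1"] vanishD[OF k, of i] that l2 by simp
  then have 1: "vanish (m + 1) (q2 (x * dag (st a)))" by (simp add: vanish_def)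
  have "co (q2 (x * dag (st a))) (- i) = 0" if "i < n + 1" for i
    using co[of "- i"] vanishD[OF yb, of i] vanishD[OF yb, of "i + 1"] vanishD[OF kb(1), of i] that l2 by simp
  then have 2: "vanish (n + 1) (lbar (q2 (x * dag (st a))))" by (simp add: vanish_def)
  show ?thesis by (rule width_less[OF f(9,10) 1 2])
qed

lemma descent:
  assumes "qunit x" "Up \<tau> x"
  shows "(\<exists>\<alpha> \<beta> f. \<alpha> + \<beta> * lam \<noteq> 0 \<and> \<alpha> - \<beta> * lam \<noteq> 0 \<and> width (x * au \<alpha> \<beta> f) < width x) \<or> width (x * dag (st a)) < width x"
proof -
  consider c where "c \<noteq> lam" "c \<noteq> - lam" "width (x * au (- c) 1 0) < width x"
    | m where "vanish m (q2 x)" "co (q2 x) m \<noteq> 0" "vanish (m + 2) (kq x)" | "Zu x"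
    using descent_torus[OF assms] by blast
  then show ?thesis
  proof cases
    case (1 c)
    have "lam - c \<noteq> 0" "- (c + lam) \<noteq> 0" using 1(1,2) neg_equal_0_iff_equal[of "c + lam"] add_eq_0_iff2[of c lam] by auto
    then have "- c + 1 * lam \<noteq> 0" "- c - 1 * lam \<noteq> 0" by simp_all
    then show ?thesis using 1(3) by blast
  next
    case (2 m)
    then obtain f where "width (x * au 1 0 f) < width x" using descent_cusp[OF assms] by blast
    then show ?thesis by (intro disjI1 exI[of _ 1] exI[of _ 0] exI[of _ f]) simp
  next
    case 3
    then show ?thesis using descent_stable[OF assms(1)] by blast
  qed
qed

end

subsection \<open>Characteristic three\<close>

locale exceptional3 = exceptional \<tau> for \<tau> :: "'k::field" +
  assumes three: "(3 :: 'k) = 0"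
begin

lemma tau_square: "\<tau> ^ 2 = 1"
proof -
  \<comment> \<open>The discriminant of X^2 + X + 1 is -3, so in characteristic 3 the defining
    polynomial is a perfect square.\<close>
  have "(\<tau> ^ 2 - 1) ^ 2 = \<tau> ^ 4 + \<tau> ^ 2 + 1 - 3 * \<tau> ^ 2" by Groebner_Basis.algebra
  then show ?thesis using tau three by simp
qed

lemma three_laurent: "(3 :: 'k laurent) = 0"
  using lconst_numeral[where 'k = 'k, of "num.Bit1 num.One"] three by simp

lemma T_square: "lconst \<tau> ^ 2 = 1"
  using arg_cong[OF tau_square, of lconst] by (simp add: lconst_power)

text \<open>The diagonal factor turns the zero divisor \<open>elem \<tau>\<close> into a quaternion
  of trace 0; with norm 0 it is nilpotent.\<close>

definition n3u :: "'k qn" where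
  "n3u = Qn ((1 + lti) * (lt - lconst (\<tau> ^ 2))) ((1 + lti) * lconst \<tau>)"
definition n3l :: "'k qn" where
  "n3l = Qn ((1 + lt) * (lti - lconst (\<tau> ^ 2))) (- ((1 + lt) * lconst \<tau>))"
definition a3u :: "'k poly \<Rightarrow> 'k qn" where "a3u f = 1 + ql (lsubst f) * n3u"
definition a3l :: "'k poly \<Rightarrow> 'k qn" where "a3l f = 1 + ql (lsubst f) * n3l"

lemmas expand3 = n3u_def n3l_def kq_def klq_def

lemma q2_n3u: "q2 (x * n3u) = - (1 + lti) * kq x"
  using T_square lt_lti(1)[where 'k = 'k]
  by - (simp only: qexpand expand3; Groebner_Basis.algebra)

lemma q2_n3l: "q2 (x * n3l) = - (1 + lt) * klq x"
  using T_square lt_lti(1)[where 'k = 'k]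
  by - (simp only: qexpand expand3; Groebner_Basis.algebra)

lemma q1_n3u: "q1 (x * n3u) = lconst \<tau> * (lt - 1) * q2 (x * n3u)"
proof -
  have "q1 (x * n3u) = lconst \<tau> * (lt - 1) * q2 (x * n3u) - 3 * (lconst \<tau> * q2 x * (1 + lt))"
    using T_square lt_lti(1)[where 'k = 'k]
    by - (simp only: qexpand expand3; Groebner_Basis.algebra)
  then show ?thesis by (simp add: three_laurent)
qed

lemma q1_n3l: "q1 (x * n3l) = - (lconst \<tau> * (lti - 1)) * q2 (x * n3l)"
proof -
  have "q1 (x * n3l) = - (lconst \<tau> * (lti - 1)) * q2 (x * n3l) + 3 * (lconst \<tau> * q2 x * (1 + lti))"
    using T_square lt_lti(1)[where 'k = 'k]
    by - (simp only: qexpand expand3; Groebner_Basis.algebra)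
  then show ?thesis by (simp add: three_laurent)
qed

lemma kq_n3u: "kq n3u = 0" and klq_n3l: "klq n3l = 0"
  using T_square lt_lti(1)[where 'k = 'k]
  by - (simp only: qexpand expand3; (Groebner_Basis.algebra | simp add: algebra_simps lt_lti_assoc))+

lemma n3u_square: "n3u * n3u = 0"
  using q2_n3u[of n3u] q1_n3u[of n3u] kq_n3u by (intro qn_eqI) simp_all

lemma n3l_square: "n3l * n3l = 0"
  using q2_n3l[of n3l] q1_n3l[of n3l] klq_n3l by (intro qn_eqI) simp_all

lemma flip_n3: "qflip n3u = n3l" "qflip n3l = n3u"
  by (intro qn_eqI; simp add: n3u_def n3l_def)+

lemma dag_n3: "dag n3u = - n3u" "dag n3l = - n3l"
  using T_square by (intro qn_eqI; simp add: n3u_def n3l_def tau_square algebra_simps)+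

lemma flip_a3: "qflip (a3u f) = a3l f" "qflip (a3l f) = a3u f"
  by (simp_all add: a3u_def a3l_def qflip_mult flip_n3)

lemma a3_mult: "a3u f * a3u g = a3u (f + g)" "a3l f * a3l g = a3l (f + g)"
proof -
  have "ql (lsubst f) * n * (ql (lsubst g) * n) = 0" if "n * n = 0" for n
    using that by (metis lbar_lsubst mult.assoc mult_ql_left mult_zero_right)
  moreover have "ql (lsubst (f + g)) = ql (lsubst f) + ql (lsubst g)" by (intro qn_eqI) (simp_all add: lsubst_add)
  ultimately show "a3u f * a3u g = a3u (f + g)" "a3l f * a3l g = a3l (f + g)"
    using n3u_square n3l_square by (simp_all add: a3u_def a3l_def algebra_simps)
qed

lemma qnorm_a3: "qnorm (a3u f) = 1" "qnorm (a3l f) = 1"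
proof -
  have "dag (a3u f) = a3u (- f)"
    by (simp add: a3u_def dag_mult dag_n3 ql_comm) (simp add: qn_eq_iff lsubst_uminus)
  then have "ql (qnorm (a3u f)) = 1" by (simp add: mult_dag[symmetric] a3_mult) (simp add: a3u_def qn_eq_iff)
  then have "q1 (ql (qnorm (a3u f))) = 1" by simp
  then show "qnorm (a3u f) = 1" by simp
  then show "qnorm (a3l f) = 1" using qnorm_simps(4)[of "a3u f"] by (simp add: flip_a3)
qed

lemma qunit_a3: "qunit (a3u f)" "qunit (a3l f)"
  by (auto simp: qunit_def qnorm_a3 intro!: exI[of _ 1])

lemma q_a3u: "q2 (x * a3u f) = q2 x + lsubst f * (- (1 + lti) * kq x)"
  "q1 (x * a3u f) = q1 x + lconst \<tau> * (lt - 1) * (lsubst f * (- (1 + lti) * kq x))"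
  unfolding a3u_def distrib_left mult_1_right mult_ql_left[OF lbar_lsubst] q_simps q_ql_mult q1_n3u q2_n3u
  by (simp_all only: ac_simps)

lemma q_a3l: "q2 (x * a3l f) = q2 x + lsubst f * (- (1 + lt) * klq x)"
  "q1 (x * a3l f) = q1 x - lconst \<tau> * (lti - 1) * (lsubst f * (- (1 + lt) * klq x))"
  unfolding a3l_def distrib_left mult_1_right mult_ql_left[OF lbar_lsubst] q_simps q_ql_mult q1_n3l q2_n3l
  by (simp_all add: ac_simps)

text \<open>The translation adds \<open>S\<close> to the second entry and \<tau> (t - 1)
  \<open>S\<close> to the first. Since \<open>S\<close> starts strictly below both old entries, the
  lowest coefficients acquire the ratio - \<tau> automatically.\<close>

lemma not_Up_a3u:
  assumes "q1 x \<noteq> 0 \<or> q2 x \<noteq> 0" "\<not> Up \<tau> x" "f \<noteq> 0"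
  shows "Up \<tau> (x * a3u f)"
proof -
  obtain i where i: "vanish i (q1 x)" "vanish i (q2 x)" "vanish i (kq x)" "co (kq x) i \<noteq> 0"
    using not_Up_level[OF assms(1,2)] by metis
  define e where "e = int (Polynomial.degree f)"
  define S where "S = lsubst f * (- (1 + lti) * kq x)"
  define m where "m = i - 1 - e"
  have m: "m = - e + (- 1 + i)" and e0: "e \<ge> 0" by (simp_all add: m_def e_def)
  have "co (- (1 + lti) :: 'k laurent) k = (if k = - 1 then - 1 else 0)" if "k \<le> - 1" for k using that by simp
  then have P: "vanish (- 1) (- (1 + lti) :: 'k laurent)" "co (- (1 + lti) :: 'k laurent) (- 1) = - 1"
    by (simp_all add: vanish_def)
  have PK: "vanish (- 1 + i) (- (1 + lti) * kq x)" "co (- (1 + lti) * kq x) (- 1 + i) = - co (kq x) i"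
    using vanish_mult[OF P(1) i(3)] P(2) by simp_all
  have S: "vanish m S" "co S m \<noteq> 0"
    using vanish_mult[OF lsubst_lowest(1)[of f] PK(1)] lsubst_lowest(2)[of f] PK(2) assms(3) i(4)
    unfolding m S_def e_def by simp_all
  have q: "q2 (x * a3u f) = q2 x + S" "q1 (x * a3u f) = q1 x + lconst \<tau> * (lt * S) - lconst \<tau> * S"
    unfolding q_a3u S_def[symmetric] by (simp_all add: algebra_simps)
  have z: "co (q1 x) k = 0" "co (q2 x) k = 0" if "k \<le> m" for k
    using vanishD[OF i(1), of k] vanishD[OF i(2), of k] that e0 by (simp_all add: m_def)
  have "vanish m (q1 (x * a3u f))" "vanish m (q2 (x * a3u f))"
    using vanishD[OF S(1)] z by (simp_all add: vanish_def q)
  moreover have "co (q2 (x * a3u f)) m \<noteq> 0" "co (q1 (x * a3u f)) m = - \<tau> * co (q2 (x * a3u f)) m"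
    using S z[of m] vanishD[OF S(1), of "m - 1"] by (simp_all add: q)
  ultimately show ?thesis unfolding Up_def by blast
qed

lemma not_Lo_a3l:
  assumes "q1 x \<noteq> 0 \<or> q2 x \<noteq> 0" "\<not> Lo \<tau> x" "f \<noteq> 0"
  shows "Lo \<tau> (x * a3l f)"
proof -
  obtain i where i: "vanish i (q1 x)" "vanish (i + 1) (q2 x)" "vanish i (klq x)" "co (klq x) i \<noteq> 0"
    using not_Lo_level[OF assms(1,2)] by metis
  define e where "e = int (Polynomial.degree f)"
  define S where "S = lsubst f * (- (1 + lt) * klq x)"
  define m where "m = i - 1 - e"
  have m: "m + 1 = - e + (0 + i)" and e0: "e \<ge> 0" by (simp_all add: m_def e_def)
  have "co (- (1 + lt) :: 'k laurent) k = (if k = 0 then - 1 else 0)" if "k \<le> 0" for k using that by simp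
  then have P: "vanish 0 (- (1 + lt) :: 'k laurent)" "co (- (1 + lt) :: 'k laurent) 0 = - 1"
    by (simp_all add: vanish_def)
  have PK: "vanish (0 + i) (- (1 + lt) * klq x)" "co (- (1 + lt) * klq x) (0 + i) = - co (klq x) i"
    using vanish_mult[OF P(1) i(3)] P(2) by simp_all
  have S: "vanish (m + 1) S" "co S (m + 1) \<noteq> 0"
    using vanish_mult[OF lsubst_lowest(1)[of f] PK(1)] lsubst_lowest(2)[of f] PK(2) assms(3) i(4)
    unfolding m S_def e_def by simp_all
  have q: "q2 (x * a3l f) = q2 x + S" "q1 (x * a3l f) = q1 x - lconst \<tau> * (lti * S) + lconst \<tau> * S"
    unfolding q_a3l S_def[symmetric] by (simp_all add: algebra_simps)
  have z: "co (q1 x) k = 0" if "k \<le> m" for k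
    using vanishD[OF i(1), of k] that e0 by (simp add: m_def)
  have z': "co (q2 x) k = 0" if "k \<le> m + 1" for k
    using vanishD[OF i(2), of k] that e0 by (simp add: m_def)
  have "vanish m (q1 (x * a3l f))" "vanish (m + 1) (q2 (x * a3l f))"
    using vanishD[OF S(1)] z z' by (simp_all add: vanish_def q)
  moreover have c: "co (q1 (x * a3l f)) m = - \<tau> * co S (m + 1)" "co (q2 (x * a3l f)) (m + 1) = co S (m + 1)"
    using z[of m] z'[of "m + 1"] vanishD[OF S(1), of m] by (simp_all add: q)
  \<comment> \<open>The ratio required by \<open>Lo \<tau>\<close> is the inverse of the one that
    arises; they agree because \<tau> is its own inverse.\<close>
  moreover have "- \<tau> * (- \<tau> * co S (m + 1)) = co S (m + 1)"
    using tau_square by (simp add: power2_eq_square mult.assoc[symmetric])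
  moreover have "co (q1 (x * a3l f)) m \<noteq> 0" "q2 (x * a3l f) \<noteq> 0" using c S(2) tau_nonzero by auto
  ultimately show ?thesis unfolding Lo_def by (intro disjI1 conjI exI[of _ m]) simp_all
qed

text \<open>Without a torus the cancellation is always achieved by a monomial translation. Its
  degree is \<open>j - m - 1\<close>, since the nilpotent has a pole of order 1 only.\<close>

lemma descent3:
  assumes x: "qunit x" and U: "Up \<tau> x"
  shows "\<exists>f. width (x * a3u f) < width x"
proof -
  obtain m n where f: "vanish m (q1 x)" "vanish m (q2 x)" "co (q2 x) m \<noteq> 0" "co (q1 x) m = - \<tau> * co (q2 x) m"
    "vanish n (lbar (q1 x))" "vanish (n + 1) (lbar (q2 x))" "co (lbar (q1 x)) n \<noteq> 0"
    "co (lbar (q2 x)) (n + 1) = \<tau> * co (lbar (q1 x)) n" "int (width x) = - m - n" "width x > 0"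
    using Up_frame[OF x U tau_nonzero] .
  obtain j where j: "vanish j (kq x)" "co (kq x) j \<noteq> 0" using lowest_exists[OF kq_nonzero[OF x]] by blast
  have jm: "j \<ge> m + 1" using vanishD[OF kq_low[OF f(1,2,4)], of j] j(2) by linarith
  note kb = kq_bar[OF x f(2,3,5,6,8) j]
  define e where "e = nat (j - m - 1)"
  define c where "c = co (q2 x) m / co (kq x) j"
  have c: "c \<noteq> 0" "c * co (kq x) j = co (q2 x) m" using f(3) j(2) by (simp_all add: c_def)
  define p where "p = Polynomial.monom c e"
  have p: "Polynomial.degree p = e" "Polynomial.lead_coeff p = c" using c(1) by (simp_all add: p_def Polynomial.degree_monom_eq)
  define P where "P = - (1 + lti :: 'k laurent)"
  have "co P k = (if k = - 1 then - 1 else 0)" if "k \<le> - 1" for k using that by (simp add: P_def)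
  then have Pv: "vanish (- 1) P" "co P (- 1) = - 1" by (simp_all add: vanish_def)
  have q2: "q2 (x * a3u p) = q2 x + lsubst p * (P * kq x)"
    by (simp add: q_a3u P_def)
  have m: "m = - int e + (- 1 + j)" using jm by (simp add: e_def)
  have PK: "vanish (- 1 + j) (P * kq x)" "co (P * kq x) (- 1 + j) = - co (kq x) j"
    using vanish_mult[OF Pv(1) j(1)] Pv(2) by simp_all
  have F: "vanish m (lsubst p * (P * kq x))" "co (lsubst p * (P * kq x)) m = - co (q2 x) m"
    using vanish_mult[OF lsubst_lowest(1)[of p] PK(1)] lsubst_lowest(2)[of p] PK(2) p c(2) unfolding m by simp_all
  have "vanish m (q2 (x * a3u p))" "co (q2 (x * a3u p)) m = 0"
    unfolding q2 using vanish_add[OF f(2) F(1)] F(2) by simp_all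
  then have 1: "vanish (m + 1) (q2 (x * a3u p))" by (rule vanish_Suc)
  have Pb: "vanish 0 (lbar P)" unfolding P_def vanish_def by simp
  have "vanish (- int e + (0 + (n + j - m))) (lsubst p * (lbar P * lbar (kq x)))"
    using vanish_mult(1)[OF lsubst_lowest(1)[of p] vanish_mult(1)[OF Pb kb(3)]] p by simp
  moreover have "- int e + (0 + (n + j - m)) = n + 1" using m by simp
  ultimately have "vanish (n + 1) (lsubst p * (lbar P * lbar (kq x)))" by (simp only:)
  then have 2: "vanish (n + 1) (lbar (q2 (x * a3u p)))"
    unfolding q2 lbar_simps lbar_mult lbar_lsubst by (rule vanish_add[OF f(6)])
  show ?thesis using width_less[OF f(9,10) 1 2] by blast
qed

end

section \<open>Copies of the affine group\<close>

lemma group_aff: "group (aff_group :: ('k::field poly \<times> 'k) monoid)"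
proof (rule groupI)
  fix x :: "'k poly \<times> 'k"
  assume "x \<in> carrier aff_group"
  then show "\<exists>y\<in>carrier aff_group. y \<otimes>\<^bsub>aff_group\<^esub> x = \<one>\<^bsub>aff_group\<^esub>"
    by (intro bexI[of _ "(- Polynomial.smult (inverse (snd x)) (fst x), inverse (snd x))"])
      (auto simp: aff_group_def split: prod.splits)
qed (auto simp: aff_group_def smult_add_right algebra_simps split: prod.splits)

lemma aff_simps:
  "carrier (aff_group :: ('k::field poly \<times> 'k) monoid) = {z. snd z \<noteq> 0}"
  "(f, c) \<otimes>\<^bsub>aff_group\<^esub> (g, d) = (f + Polynomial.smult c g, c * d)"
  "\<one>\<^bsub>aff_group\<^esub> = (0 :: 'k poly, 1)"
  by (auto simp: aff_group_def)

lemma group_poly_add: "group (poly_add_group :: 'k::field poly monoid)"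
  by (rule groupI) (auto simp: poly_add_group_def add.assoc intro: exI[of _ "- x" for x])

lemma group_unit_group: "group (unit_group :: 'k::field monoid)"
proof (rule groupI)
  fix x :: 'k assume "x \<in> carrier unit_group"
  then show "\<exists>y\<in>carrier unit_group. y \<otimes>\<^bsub>unit_group\<^esub> x = \<one>\<^bsub>unit_group\<^esub>"
    by (intro bexI[of _ "inverse x"]) (auto simp: unit_group_def)
qed (auto simp: unit_group_def mult.assoc)

lemma subgroup_aff_translations: "subgroup aff_translations (aff_group :: ('k::field poly \<times> 'k) monoid)"
proof (rule group.subgroupI[OF group_aff])
  fix a :: "'k poly \<times> 'k" assume "a \<in> aff_translations"
  then obtain f where a: "a = (f, 1)" by (auto simp: aff_translations_def)
  have "inv\<^bsub>aff_group\<^esub> a = (- f, 1)"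
    by (rule group.inv_equality[OF group_aff]) (auto simp: a aff_simps)
  then show "inv\<^bsub>aff_group\<^esub> a \<in> aff_translations" by (auto simp: aff_translations_def)
qed (auto simp: aff_translations_def aff_simps)

lemma subgroup_aff_dilations: "subgroup aff_dilations (aff_group :: ('k::field poly \<times> 'k) monoid)"
proof (rule group.subgroupI[OF group_aff])
  show "aff_dilations \<noteq> ({} :: ('k poly \<times> 'k) set)" by (auto simp: aff_dilations_def intro: exI[of _ 1])
  fix a :: "'k poly \<times> 'k" assume "a \<in> aff_dilations"
  then obtain c where a: "a = (0, c)" "c \<noteq> 0" by (auto simp: aff_dilations_def)
  have "inv\<^bsub>aff_group\<^esub> a = (0, inverse c)"
    using a by (intro group.inv_equality[OF group_aff]) (auto simp: aff_simps)
  then show "inv\<^bsub>aff_group\<^esub> a \<in> aff_dilations" using a by (auto simp: aff_dilations_def)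
qed (auto simp: aff_dilations_def aff_simps)

interpretation Q: group "quat_group :: ('k::field laurent ^ 2 ^ 2) set monoid"
  by (rule group_quat_group)

lemma comm_group_of_iso:
  assumes "h \<in> hom H quat_group" "inj_on h S" "subgroup S H" "group H"
    and "\<And>x y. x \<in> S \<Longrightarrow> y \<in> S \<Longrightarrow> x \<otimes>\<^bsub>H\<^esub> y = y \<otimes>\<^bsub>H\<^esub> x"
  shows "comm_group (subgrp (h ` S))"
proof -
  interpret h: group_hom H quat_group h
    using assms by (intro group_hom.intro group_hom_axioms.intro) auto
  have sub: "subgroup (h ` S) quat_group" by (rule h.subgroup_img_is_subgroup[OF assms(3)])
  have S: "S \<subseteq> carrier H" using subgroup.subset[OF assms(3)] .
  show ?thesis
  proof (rule group.group_comm_groupI)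
    show "group (subgrp (h ` S))" by (rule subgroup.subgroup_is_group[OF sub]) simp
    fix x y assume "x \<in> carrier (subgrp (h ` S))" "y \<in> carrier (subgrp (h ` S))"
    then obtain a b where ab: "a \<in> S" "b \<in> S" "x = h a" "y = h b" by auto
    then have "h (a \<otimes>\<^bsub>H\<^esub> b) = h (b \<otimes>\<^bsub>H\<^esub> a)" using assms(5) by simp
    then show "x \<otimes>\<^bsub>subgrp (h ` S)\<^esub> y = y \<otimes>\<^bsub>subgrp (h ` S)\<^esub> x" using ab S by (auto simp: subset_eq)
  qed
qed

text \<open>All claims about one copy of the affine group follow from a faithful representation with
  prescribed images. The dilation by 1 is left out of \<open>H\<close> because a multiplicative
  generator is never the identity.\<close>

lemma aff_rep:
  fixes \<phi> :: "'k::field poly \<times> 'k \<Rightarrow> ('k laurent ^ 2 ^ 2) set"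
  assumes \<phi>: "\<phi> \<in> hom aff_group quat_group" "inj_on \<phi> (carrier aff_group)"
    and N: "N = \<phi> ` aff_translations" and H: "H = \<phi> ` (aff_dilations - {(0, 1)})"
  shows "gen N = \<phi> ` aff_translations" "gen H = \<phi> ` aff_dilations" "gen (N \<union> H) = \<phi> ` carrier aff_group"
    "aff_identification (N \<union> H) N H \<phi>"
    "comm_group (subgrp (gen N))" "subgrp (gen N) \<cong> (poly_add_group :: 'k poly monoid)"
    "comm_group (subgrp (gen H))" "subgrp (gen H) \<cong> (unit_group :: 'k monoid)"
proof -
  interpret h: group_hom "aff_group :: ('k poly \<times> 'k) monoid" quat_group \<phi>
    by (intro group_hom.intro group_hom_axioms.intro group_aff \<phi>(1)) unfold_locales
  have tc: "aff_translations \<subseteq> carrier (aff_group :: ('k poly \<times> 'k) monoid)"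
    and dc: "aff_dilations \<subseteq> carrier (aff_group :: ('k poly \<times> 'k) monoid)"
    by (auto simp: aff_translations_def aff_dilations_def aff_simps)
  show gN: "gen N = \<phi> ` aff_translations"
    using h.subgroup_img_is_subgroup[OF subgroup_aff_translations] unfolding N
    by (metis Q.generate_subgroup_incl equalityI generate.incl order_refl subsetI)
  have one: "\<phi> (0, 1) = \<one>\<^bsub>quat_group\<^esub>" using h.hom_one by (simp add: aff_simps)
  show gH: "gen H = \<phi> ` aff_dilations"
  proof
    show "gen H \<subseteq> \<phi> ` aff_dilations"
      using h.subgroup_img_is_subgroup[OF subgroup_aff_dilations] by (rule Q.generate_subgroup_incl[rotated]) (auto simp: H)
    show "\<phi> ` aff_dilations \<subseteq> gen H"
    proof
      fix y assume "y \<in> \<phi> ` aff_dilations"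
      then obtain x where x: "x \<in> aff_dilations" "y = \<phi> x" by blast
      show "y \<in> gen H"
      proof (cases "x = (0, 1)")
        case True
        then show ?thesis using one x generate.one by metis
      next
        case False
        then show ?thesis using x by (intro generate.incl) (auto simp: H)
      qed
    qed
  qed
  have img: "subgroup (\<phi> ` carrier aff_group) quat_group" by (rule h.img_is_subgroup)
  show gNH: "gen (N \<union> H) = \<phi> ` carrier aff_group"
  proof
    show "gen (N \<union> H) \<subseteq> \<phi> ` carrier aff_group"
      by (rule Q.generate_subgroup_incl[OF _ img]) (use tc dc in \<open>auto simp: N H\<close>)
    show "\<phi> ` carrier aff_group \<subseteq> gen (N \<union> H)"
    proof
      fix y assume "y \<in> \<phi> ` carrier aff_group"
      then obtain f c where x: "c \<noteq> 0" "y = \<phi> (f, c)" by (auto simp: aff_simps)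
      have "(f, c) = (f, 1) \<otimes>\<^bsub>aff_group\<^esub> (0, c)" by (simp add: aff_simps)
      then have "y = \<phi> (f, 1) \<otimes>\<^bsub>quat_group\<^esub> \<phi> (0, c)" using x h.hom_mult[of "(f, 1)" "(0, c)"] by (simp add: aff_simps)
      moreover have "\<phi> (f, 1) \<in> gen (N \<union> H)"
        by (rule generate.incl) (auto simp: N aff_translations_def)
      moreover have "\<phi> (0, c) \<in> gen (N \<union> H)"
      proof -
        have "\<phi> (0, c) \<in> gen H" unfolding gH using x by (auto simp: aff_dilations_def)
        then show ?thesis using Q.mono_generate[of H "N \<union> H"] by blast
      qed
      ultimately show "y \<in> gen (N \<union> H)" by (simp add: generate.eng)
    qed
  qed
  show "aff_identification (N \<union> H) N H \<phi>"
    unfolding aff_identification_def gN gH gNH iso_def bij_betw_def using \<phi> by (auto simp: hom_def)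
  show "comm_group (subgrp (gen N))" unfolding gN
    by (rule comm_group_of_iso[OF \<phi>(1) inj_on_subset[OF \<phi>(2) tc] subgroup_aff_translations group_aff])
      (auto simp: aff_translations_def aff_simps)
  show "comm_group (subgrp (gen H))" unfolding gH
    by (rule comm_group_of_iso[OF \<phi>(1) inj_on_subset[OF \<phi>(2) dc] subgroup_aff_dilations group_aff])
      (auto simp: aff_dilations_def aff_simps)
  have "(\<lambda>f. \<phi> (f, 1)) \<in> iso (poly_add_group :: 'k poly monoid) (subgrp (gen N))"
    unfolding iso_def bij_betw_def gN
  proof (intro CollectI conjI)
    show "(\<lambda>f. \<phi> (f, 1)) \<in> hom poly_add_group (subgrp (\<phi> ` aff_translations))"
      using h.hom_mult[of "(_, 1)" "(_, 1)"] by (auto simp: hom_def poly_add_group_def aff_translations_def aff_simps)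
    show "inj_on (\<lambda>f. \<phi> (f, 1)) (carrier (poly_add_group :: 'k poly monoid))"
    proof (rule inj_onI)
      fix f g :: "'k poly" assume "\<phi> (f, 1) = \<phi> (g, 1)"
      then show "f = g" using inj_onD[OF \<phi>(2), of "(f, 1)" "(g, 1)"] by (simp add: aff_simps)
    qed
    show "(\<lambda>f. \<phi> (f, 1)) ` carrier (poly_add_group :: 'k poly monoid) = carrier (subgrp (\<phi> ` aff_translations))"
      by (auto simp: poly_add_group_def aff_translations_def)
  qed
  then show "subgrp (gen N) \<cong> (poly_add_group :: 'k poly monoid)"
    using group.iso_sym[OF group_poly_add] by (auto simp: is_iso_def)
  have "(\<lambda>c. \<phi> (0, c)) \<in> iso (unit_group :: 'k monoid) (subgrp (gen H))"
    unfolding iso_def bij_betw_def gH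
  proof (intro CollectI conjI)
    show "(\<lambda>c. \<phi> (0, c)) \<in> hom unit_group (subgrp (\<phi> ` aff_dilations))"
      using h.hom_mult[of "(0, _)" "(0, _)"] by (auto simp: hom_def unit_group_def aff_dilations_def aff_simps)
    show "inj_on (\<lambda>c. \<phi> (0, c)) (carrier (unit_group :: 'k monoid))"
      using \<phi>(2) by (auto simp: inj_on_def aff_simps unit_group_def)
    show "(\<lambda>c. \<phi> (0, c)) ` carrier (unit_group :: 'k monoid) = carrier (subgrp (\<phi> ` aff_dilations))"
      by (auto simp: unit_group_def aff_dilations_def)
  qed
  then show "subgrp (gen H) \<cong> (unit_group :: 'k monoid)"
    using group.iso_sym[OF group_unit_group] by (auto simp: is_iso_def)
qed

section \<open>Types and ping-pong for classes\<close>

definition lift_cls :: "('k::field qn \<Rightarrow> bool) \<Rightarrow> ('k laurent ^ 2 ^ 2) set \<Rightarrow> bool" where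
  "lift_cls P M \<longleftrightarrow> (\<exists>x. qunit x \<and> M = cls x \<and> P x)"

lemma lift_cls_iff:
  assumes "\<And>c x. c \<noteq> 0 \<Longrightarrow> P (qc c * x) \<longleftrightarrow> P x" "qunit x"
  shows "lift_cls P (cls x) \<longleftrightarrow> P x"
proof
  assume "lift_cls P (cls x)"
  then obtain y where y: "qunit y" "cls x = cls y" "P y" by (auto simp: lift_cls_def)
  then obtain c where "c \<noteq> 0" "y = qc c * x" using cls_eq_iff[OF assms(2)] by blast
  then show "P x" using assms(1) y(3) by blast
qed (use assms(2) in \<open>auto simp: lift_cls_def\<close>)

definition ctype :: "'k::field \<Rightarrow> bool \<Rightarrow> ('k laurent ^ 2 ^ 2) set \<Rightarrow> bool" where
  "ctype r b = lift_cls (qtype r b)"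

lemma ctype_cls: "qunit x \<Longrightarrow> ctype r b (cls x) \<longleftrightarrow> qtype r b x"
  unfolding ctype_def by (rule lift_cls_iff) (rule qtype_scale)

lemma quat_cases:
  assumes "M \<in> carrier quat_group"
  obtains x where "qunit x" "M = cls x"
  using assms by (auto simp: quat_carrier)

lemma ctype_one: "\<not> ctype r b \<one>\<^bsub>quat_group\<^esub>"
  using qtype_const[of 1 r b] by (simp add: cls_one ctype_cls ql_one)

lemma ctype_unique: "M \<in> carrier quat_group \<Longrightarrow> ctype r b M \<Longrightarrow> ctype r' b' M \<Longrightarrow> r = r' \<and> b = b'"
  by (erule quat_cases) (metis ctype_cls qtype_unique)

lemma ctype_quat_type: "M \<in> carrier quat_group \<Longrightarrow> ctype r b M \<Longrightarrow> quat_type M = r"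
  by (erule quat_cases) (metis ctype_cls quat_type_qtype)

lemma elem_pingpong:
  assumes "\<And>r. r \<in> I \<Longrightarrow> r ^ 4 + r ^ 2 + 1 \<noteq> 0"
  shows "free_pingpong quat_group I (\<lambda>r. cls (elem r)) ctype"
proof (intro free_pingpong.intro free_pingpong_axioms.intro group_quat_group)
  show "cls (elem r) \<in> carrier quat_group" if "r \<in> I" for r
    using qunit_elem[OF assms[OF that]] by simp
  show "r = r' \<and> b = b'" if "M \<in> carrier quat_group" "ctype r b M" "ctype r' b' M" for r r' :: 'a and b b' M
    using ctype_unique that by blast
  show "\<not> ctype r b \<one>\<^bsub>quat_group\<^esub>" for r :: 'a and b by (rule ctype_one)
  show "ctype r b (M \<otimes>\<^bsub>quat_group\<^esub> (if b then cls (elem r) else inv\<^bsub>quat_group\<^esub> (cls (elem r))))"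
    if r: "r \<in> I" and M: "M \<in> carrier quat_group" "\<not> ctype r (\<not> b) M" for r b M
  proof -
    obtain x where x: "qunit x" "M = cls x" using M(1) by (rule quat_cases)
    have e: "qunit (elem r)" using qunit_elem[OF assms[OF r]] .
    have "qtype r b (x * (if b then elem r else dag (elem r)))"
      using qtype_step[OF qunit_nonzero[OF x(1)], of r b] M(2) x by (simp add: ctype_cls)
    then show ?thesis using x e by (cases b) (simp_all add: cls_inv cls_mult ctype_cls qunit_mult)
  qed
qed

section \<open>Exceptional type groups\<close>

context exceptional
begin

lemma au_mult: "au \<alpha> \<beta> f * au \<alpha>' \<beta>' f' = au (\<alpha> * \<alpha>' + \<beta> * \<beta>' * lam ^ 2) (\<alpha> * \<beta>' + \<beta> * \<alpha>')
    (Polynomial.smult (\<alpha>' + \<beta>' * lam) f + Polynomial.smult (\<alpha> - \<beta> * lam) f')"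
  using laurent_rels
  by - (rule qn_eqI; simp only: qexpand au_def lbar_lsubst lsubst_add lsubst_smult; (Groebner_Basis.algebra | simp add: laurent_simps))

lemma al_mult: "al \<alpha> \<beta> f * al \<alpha>' \<beta>' f' = al (\<alpha> * \<alpha>' + \<beta> * \<beta>' * lam ^ 2) (\<alpha> * \<beta>' + \<beta> * \<alpha>')
    (Polynomial.smult (\<alpha>' - \<beta>' * lam) f + Polynomial.smult (\<alpha> + \<beta> * lam) f')"
  using laurent_rels
  by - (rule qn_eqI; simp only: qexpand al_def lbar_lsubst lsubst_add lsubst_smult; (Groebner_Basis.algebra | simp add: laurent_simps))

lemma qnorm_au: "qnorm (au \<alpha> \<beta> f) = lconst ((\<alpha> + \<beta> * lam) * (\<alpha> - \<beta> * lam))"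
  using laurent_rels
  by - (simp only: qnorm_def qexpand au_def lbar_lsubst; Groebner_Basis.algebra)

lemma flip_au: "qflip (au \<alpha> \<beta> f) = al \<alpha> (- \<beta>) (- f)"
proof -
  have *: "qc (- \<beta>) * ml = - (qc \<beta> * ml)" "ql (lsubst (- f)) * nl = - (ql (lsubst f) * nl)"
    by (simp_all add: qn_eq_iff lconst_hom lsubst_uminus)
  show ?thesis by (simp add: au_def al_def qflip_mult flips *)
qed

lemma qunit_au: "\<alpha> + \<beta> * lam \<noteq> 0 \<Longrightarrow> \<alpha> - \<beta> * lam \<noteq> 0 \<Longrightarrow> qunit (au \<alpha> \<beta> f)"
  unfolding qunit_def qnorm_au by (intro exI[of _ "(\<alpha> + \<beta> * lam) * (\<alpha> - \<beta> * lam)"]) simp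

lemma qunit_al: "\<alpha> + \<beta> * lam \<noteq> 0 \<Longrightarrow> \<alpha> - \<beta> * lam \<noteq> 0 \<Longrightarrow> qunit (al \<alpha> \<beta> f)"
  using qunit_au[of \<alpha> "- \<beta>" "- f"] qunit_simps(2)[of "au \<alpha> (- \<beta>) (- f)"] by (simp add: flip_au)

lemma au_scale: "au (s * \<alpha>) (s * \<beta>) (Polynomial.smult s f) = qc s * au \<alpha> \<beta> f"
  "al (s * \<alpha>) (s * \<beta>) (Polynomial.smult s f) = qc s * al \<alpha> \<beta> f"
  by (simp_all add: au_def al_def qn_eq_iff lsubst_smult lconst_hom(4) algebra_simps)

text \<open>Multiplying a stable generator by an element of the torus changes it, up to a scalar, by
  a multiple of \<open>elem \<tau>\<close>; by \<open>st_diff\<close> this is a change of the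
  parameter.\<close>

lemma st_au: "st a * au \<alpha> \<beta> 0 = qc (\<alpha> - \<beta> * lam) * st a + qc (\<beta> * (2 * lam * kap a)) * elem \<tau>"
proof -
  have "st a * au \<alpha> \<beta> 0 = qc (\<alpha> - \<beta> * lam) * st a + qc \<beta> * (st a * (mu + qc lam))"
    by (simp add: au_def distrib_left mult_ql_left ql_one) (simp add: ql_comm qn_eq_iff lconst_hom algebra_simps)
  then show ?thesis unfolding st_mu_plus by (simp add: qn_eq_iff lconst_hom(4) algebra_simps)
qed

lemma st_diff: "st b = st a + qc (b - a) * elem \<tau>"
  by (rule qn_eqI) (simp_all add: st_def lconst_expand algebra_simps power2_eq_square)

lemma st_au_al: "st a * au \<alpha> \<beta> 0 = al \<alpha> \<beta> 0 * st a"
proof -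
  have "st a * (qc \<beta> * mu) = qc \<beta> * ml * st a" by (simp add: mult_ql_left st_mu mult.assoc)
  then show ?thesis by (simp add: au_def al_def distrib_left distrib_right ql_one ql_comm)
qed

lemma qmat_au: "qmat (au 1 0 f) = add_upper \<tau> f" "qmat (al 1 0 f) = add_lower \<tau> f"
  unfolding qmat_def quat_def add_upper_def add_lower_def elem_mat_def dagger_def mat22_nth mat_eq_mat22 mat22_mult mat22_add
  using laurent_rels
  by - (rule mat22_eqI; simp only: mat22_nth qexpand au_def al_def lbar_lsubst lconst_simps;
      (Groebner_Basis.algebra | simp add: laurent_simps))+

lemma qmat_mu: "qmat (au b 1 0) = mult_upper \<tau> b" "qmat (al b 1 0) = mult_lower \<tau> b"
  unfolding qmat_def quat_def mult_upper_def mult_lower_def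
  by (rule mat22_eqI; simp add: au_def al_def mu_def ml_def w_def ql_one algebra_simps lt_lti_assoc power2_eq_square)+

lemma qmat_st: "qmat (st a) = stable_mat \<tau> a"
  unfolding qmat_def quat_def stable_mat_def Let_def
  by (rule mat22_eqI; simp add: st_def tinv_inverse[symmetric] algebra_simps lt_lti_assoc power2_eq_square power3_eq_cube)

lemma qunit_st: "12 * \<tau> * kap a \<noteq> 0 \<Longrightarrow> qunit (st a)"
  unfolding qunit_def qnorm_st by blast

end

context exceptional6
begin

text \<open>The eigenvalues of \<open>\<alpha> + \<beta> mu\<close> are \<open>\<alpha> + \<beta> lam\<close> and \<open>\<alpha> - \<beta> lam\<close>; up to a scalar they are \<open>1\<close> and the
  dilation factor.\<close>

definition act :: "bool \<Rightarrow> 'k poly \<times> 'k \<Rightarrow> 'k qn" where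
  "act b z = (if b then au ((snd z + 1) / 2) ((1 - snd z) / (2 * lam)) (fst z)
     else al ((snd z + 1) / 2) ((snd z - 1) / (2 * lam)) (fst z))"

definition zone :: "bool \<Rightarrow> 'k qn \<Rightarrow> bool" where
  "zone b x = (if b then Zu x else Zl x)"

definition phi :: "bool \<Rightarrow> 'k poly \<times> 'k \<Rightarrow> ('k laurent ^ 2 ^ 2) set" where
  "phi b z = cls (act b z)"

text \<open>The rest of the zone of type \<tau> after removal of the stable part. It plays the role
  of \<open>T'\<close>, with the full zone as \<open>T\<close> and \<open>zZ\<close> as
  \<open>Z\<close>.\<close>

definition zT :: "bool \<Rightarrow> ('k laurent ^ 2 ^ 2) set \<Rightarrow> bool" where
  "zT b = lift_cls (\<lambda>x. qtype \<tau> b x \<and> \<not> zone b x)"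

definition zZ :: "bool \<Rightarrow> ('k laurent ^ 2 ^ 2) set \<Rightarrow> bool" where
  "zZ b = lift_cls (zone b)"

lemma four: "(4 :: 'k) \<noteq> 0"
proof -
  have "(4 :: 'k) = 2 * 2" by simp
  then show ?thesis using two by (metis mult_eq_0_iff)
qed

lemma sixteen: "(16 :: 'k) \<noteq> 0"
proof -
  have "(16 :: 'k) = 4 * 4" by simp
  then show ?thesis using four by (metis mult_eq_0_iff)
qed

lemma eigenvalues:
  "(c + 1) / 2 + (1 - c) / (2 * lam) * lam = 1" "(c + 1) / 2 - (1 - c) / (2 * lam) * lam = c"
  "(c + 1) / 2 + (c - 1) / (2 * lam) * lam = c" "(c + 1) / 2 - (c - 1) / (2 * lam) * lam = 1"
  using two four sixteen lam_nonzero by (simp_all add: field_simps)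

lemma act_mult: "act b (f, c) * act b (g, d) = act b (f + Polynomial.smult c g, c * d)"
proof -
  have 1: "(c + 1) / 2 * ((d + 1) / 2) + (1 - c) / (2 * lam) * ((1 - d) / (2 * lam)) * lam ^ 2 = (c * d + 1) / 2"
    "(c + 1) / 2 * ((1 - d) / (2 * lam)) + (1 - c) / (2 * lam) * ((d + 1) / 2) = (1 - c * d) / (2 * lam)"
    using two four sixteen lam_nonzero by (simp_all add: field_simps power2_eq_square)
  have 2: "(c + 1) / 2 * ((d + 1) / 2) + (c - 1) / (2 * lam) * ((d - 1) / (2 * lam)) * lam ^ 2 = (c * d + 1) / 2"
    "(c + 1) / 2 * ((d - 1) / (2 * lam)) + (c - 1) / (2 * lam) * ((d + 1) / 2) = (c * d - 1) / (2 * lam)"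
    using two four sixteen lam_nonzero by (simp_all add: field_simps power2_eq_square)
  show ?thesis by (simp only: act_def au_mult al_mult eigenvalues fst_conv snd_conv 1 2 smult_1_left split: if_split) simp
qed

lemma qunit_act: "snd z \<noteq> 0 \<Longrightarrow> qunit (act b z)"
  unfolding act_def using qunit_au[of "(snd z + 1) / 2" "(1 - snd z) / (2 * lam)"]
    qunit_al[of "(snd z + 1) / 2" "(snd z - 1) / (2 * lam)"] by (simp only: eigenvalues split: if_split) simp

lemma phi_hom: "phi b \<in> hom aff_group quat_group"
proof (rule homI)
  fix z z' :: "'k poly \<times> 'k" assume "z \<in> carrier aff_group" "z' \<in> carrier aff_group"
  then show "phi b (z \<otimes>\<^bsub>aff_group\<^esub> z') = phi b z \<otimes>\<^bsub>quat_group\<^esub> phi b z'"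
    by (cases z, cases z') (simp add: aff_simps phi_def cls_mult qunit_act act_mult)
qed (simp add: phi_def aff_simps qunit_act)

lemma zone_qtype: "zone b x \<Longrightarrow> qtype \<tau> b x"
  using Zu_imp_Up Zl_imp_Lo by (auto simp: zone_def qtype_def split: if_splits)

lemma zone_scale: "c \<noteq> 0 \<Longrightarrow> zone b (qc c * x) \<longleftrightarrow> zone b x"
  by (simp add: zone_def Zu_scale Zl_scale)

lemma act_step:
  assumes "q1 x \<noteq> 0 \<or> q2 x \<noteq> 0" "\<not> qtype \<tau> b x" "z \<noteq> (0, 1)" "snd z \<noteq> 0"
  shows "qtype \<tau> b (x * act b z) \<and> \<not> zone b (x * act b z)"
proof -
  have ne: "(1 - snd z) / (2 * lam) \<noteq> 0 \<or> fst z \<noteq> 0" "(snd z - 1) / (2 * lam) \<noteq> 0 \<or> fst z \<noteq> 0"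
    using assms(3) two lam_nonzero by (cases z, auto)+
  show ?thesis
    using not_Up_au[OF assms(1) _ ne(1), of "(snd z + 1) / 2"] not_Lo_al[OF assms(1) _ ne(2), of "(snd z + 1) / 2"] assms(2,4)
    unfolding eigenvalues by (cases b) (simp_all add: qtype_def zone_def act_def)
qed

lemma act_zone:
  assumes "zone b x" "snd z \<noteq> 0"
  shows "if fst z = 0 then zone b (x * act b z) else qtype \<tau> b (x * act b z) \<and> \<not> zone b (x * act b z)"
  using Zu_au[of x "(snd z + 1) / 2" "(1 - snd z) / (2 * lam)" "fst z"]
    Zl_al[of x "(snd z + 1) / 2" "(snd z - 1) / (2 * lam)" "fst z"] assms
  unfolding eigenvalues by (cases b; cases "fst z = 0"; simp add: qtype_def zone_def act_def)

lemma zT_cls: "qunit x \<Longrightarrow> zT b (cls x) \<longleftrightarrow> qtype \<tau> b x \<and> \<not> zone b x"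
  unfolding zT_def by (rule lift_cls_iff) (simp add: qtype_scale zone_scale)

lemma zZ_cls: "qunit x \<Longrightarrow> zZ b (cls x) \<longleftrightarrow> zone b x"
  unfolding zZ_def by (rule lift_cls_iff) (simp add: zone_scale)

lemma phi_one: "phi b (0, 1) = \<one>\<^bsub>quat_group\<^esub>"
proof -
  interpret h: group_hom aff_group quat_group "phi b"
    by (intro group_hom.intro group_hom_axioms.intro group_aff phi_hom) unfold_locales
  show ?thesis using h.hom_one by (simp add: aff_simps)
qed

text \<open>Faithfulness comes from ping-pong: a nontrivial affine element gives the identity a
  type.\<close>

lemma phi_inj: "inj_on (phi b) (carrier aff_group)"
proof -
  interpret h: group_hom aff_group quat_group "phi b"
    by (intro group_hom.intro group_hom_axioms.intro group_aff phi_hom) unfold_locales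
  have "z = (0, 1)" if z: "snd z \<noteq> 0" "phi b z = \<one>\<^bsub>quat_group\<^esub>" for z
  proof (rule ccontr)
    assume "z \<noteq> (0, 1)"
    then have "qtype \<tau> b (1 * act b z)"
      using act_step[of 1 b z] qtype_const[of 1 \<tau> b] z by (simp add: ql_one)
    then have "ctype \<tau> b (phi b z)" using qunit_act[OF z(1)] by (simp add: phi_def ctype_cls)
    then show False using z ctype_one by metis
  qed
  then show ?thesis unfolding h.inj_on_one_iff by (auto simp: aff_simps)
qed

text \<open>The factors \<open>Gs\<close> are left open because the same zones are used twice: with
  abstract affine groups for the external isomorphism, and with subgroups of the quaternionic group
  for the internal statements.\<close>

lemma zones:
  fixes Gs :: "bool \<Rightarrow> ('b, 'd) monoid_scheme" and \<iota> :: "bool \<Rightarrow> 'b \<Rightarrow> ('k laurent ^ 2 ^ 2) set"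
  assumes Gs: "\<And>b. group (Gs b)" "\<And>b. \<iota> b \<in> hom (Gs b) quat_group"
    and D: "\<And>b. D b \<subseteq> carrier (Gs b)" "\<And>b. \<one>\<^bsub>Gs b\<^esub> \<in> D b"
    and rep: "\<And>b x. x \<in> carrier (Gs b) \<Longrightarrow>
      \<exists>z. snd z \<noteq> 0 \<and> \<iota> b x = phi b z \<and> (x = \<one>\<^bsub>Gs b\<^esub> \<longleftrightarrow> z = (0, 1)) \<and> (x \<in> D b \<longleftrightarrow> fst z = 0)"
  shows "fp_zones quat_group Gs \<iota> (ctype \<tau>) zT zZ D"
proof (intro fp_zones.intro fp_pingpong.intro fp_pingpong_axioms.intro fp_zones_axioms.intro group_quat_group Gs D)
  show "ctype \<tau> b M" if "zT b M" for b M using that by (auto simp: zT_def lift_cls_def ctype_def)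
  show "b = b'" if "M \<in> carrier quat_group" "ctype \<tau> b M" "ctype \<tau> b' M" for b b' M
    using ctype_unique that by blast
  show "\<not> ctype \<tau> b \<one>\<^bsub>quat_group\<^esub>" for b by (rule ctype_one)
  show "ctype \<tau> b M" if "zZ b M" for b M
    using that zone_qtype by (auto simp: zZ_def lift_cls_def ctype_def)
  show "\<not> zZ b M" if M: "zT b M" for b M
  proof -
    obtain x where "qunit x" "M = cls x" "\<not> zone b x" using M by (auto simp: zT_def lift_cls_def)
    then show ?thesis by (simp add: zZ_cls)
  qed
  fix b x and M :: "('k laurent ^ 2 ^ 2) set" assume M: "M \<in> carrier quat_group" and x: "x \<in> carrier (Gs b)"
  obtain y where y: "qunit y" "M = cls y" using M by (rule quat_cases)
  obtain z where z: "snd z \<noteq> 0" "\<iota> b x = phi b z" "x = \<one>\<^bsub>Gs b\<^esub> \<longleftrightarrow> z = (0, 1)" "x \<in> D b \<longleftrightarrow> fst z = 0"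
    using rep[OF x] by blast
  have Mx: "M \<otimes>\<^bsub>quat_group\<^esub> \<iota> b x = cls (y * act b z)" and u: "qunit (y * act b z)"
    using y z qunit_act by (simp_all add: phi_def cls_mult qunit_mult)
  show "zT b (M \<otimes>\<^bsub>quat_group\<^esub> \<iota> b x)" if "\<not> ctype \<tau> b M" "x \<noteq> \<one>\<^bsub>Gs b\<^esub>"
    unfolding Mx zT_cls[OF u]
    using act_step[OF qunit_nonzero[OF y(1)], of b z] that z(1,3) ctype_cls[OF y(1)] y(2) by auto
  show "zZ b (M \<otimes>\<^bsub>quat_group\<^esub> \<iota> b x)" if "zZ b M" "x \<in> D b"
    unfolding Mx zZ_cls[OF u] using act_zone[of b y z] that z(1,4) zZ_cls[OF y(1)] y(2) by auto
  show "zT b (M \<otimes>\<^bsub>quat_group\<^esub> \<iota> b x)" if "zZ b M" "x \<notin> D b"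
    unfolding Mx zT_cls[OF u] using act_zone[of b y z] that z(1,4) zZ_cls[OF y(1)] y(2) by auto
qed

lemma zones_external: "fp_zones quat_group (\<lambda>_. aff_group) phi (ctype \<tau>) zT zZ (\<lambda>_. aff_dilations)"
proof (rule zones)
  show "\<exists>z. snd z \<noteq> 0 \<and> phi b x = phi b z \<and> (x = \<one>\<^bsub>aff_group\<^esub> \<longleftrightarrow> z = (0, 1)) \<and> (x \<in> aff_dilations \<longleftrightarrow> fst z = 0)"
    if "x \<in> carrier aff_group" for b x
    using that by (intro exI[of _ x]) (auto simp: aff_simps aff_dilations_def prod_eq_iff)
qed (auto simp: group_aff phi_hom aff_dilations_def aff_simps)

lemma subgroup_phi: "subgroup (phi b ` carrier aff_group) quat_group" "subgroup (phi b ` aff_dilations) quat_group"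
proof -
  interpret h: group_hom aff_group quat_group "phi b"
    by (intro group_hom.intro group_hom_axioms.intro group_aff phi_hom) unfold_locales
  show "subgroup (phi b ` carrier aff_group) quat_group" "subgroup (phi b ` aff_dilations) quat_group"
    by (rule h.img_is_subgroup) (rule h.subgroup_img_is_subgroup[OF subgroup_aff_dilations])
qed

lemma zones_internal:
  "fp_zones quat_group (\<lambda>b. subgrp (phi b ` carrier aff_group)) (\<lambda>_ x. x) (ctype \<tau>) zT zZ (\<lambda>b. phi b ` aff_dilations)"
proof (rule zones)
  show "group (subgrp (phi b ` carrier aff_group))" for b
    by (rule subgroup.subgroup_is_group[OF subgroup_phi(1)]) (rule group_quat_group)
  show "(\<lambda>x. x) \<in> hom (subgrp (phi b ` carrier aff_group)) quat_group" for b
    using subgroup.subset[OF subgroup_phi(1)] by (auto simp: hom_def)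
  show "phi b ` aff_dilations \<subseteq> carrier (subgrp (phi b ` carrier aff_group))" for b
    by (auto simp: aff_dilations_def aff_simps)
  show "\<one>\<^bsub>subgrp (phi b ` carrier aff_group)\<^esub> \<in> phi b ` aff_dilations" for b
    using subgroup.one_closed[OF subgroup_phi(2)] by simp
  fix b x assume "x \<in> carrier (subgrp (phi b ` carrier aff_group))"
  then obtain z where z: "snd z \<noteq> 0" "x = phi b z" by (auto simp: aff_simps)
  have eq: "z = z'" if "snd z' \<noteq> 0" "phi b z = phi b z'" for z'
    by (rule inj_onD[OF phi_inj that(2)]) (use z that in \<open>simp_all add: aff_simps\<close>)
  have "x = \<one>\<^bsub>quat_group\<^esub> \<longleftrightarrow> z = (0, 1)"
    using eq[of "(0, 1)"] phi_one[of b] z(2) by auto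
  moreover have "x \<in> phi b ` aff_dilations \<longleftrightarrow> fst z = 0"
  proof
    assume "x \<in> phi b ` aff_dilations"
    then obtain c where "c \<noteq> 0" "phi b z = phi b (0, c)" using z(2) by (auto simp: aff_dilations_def)
    then show "fst z = 0" using eq[of "(0, c)"] by simp
  next
    assume "fst z = 0"
    then have "z = (0, snd z)" by (simp add: prod_eq_iff)
    then have "z \<in> aff_dilations" using z(1) unfolding aff_dilations_def by blast
    then show "x \<in> phi b ` aff_dilations" unfolding z(2) by (rule imageI)
  qed
  ultimately have fin: "x = \<one>\<^bsub>quat_group\<^esub> \<longleftrightarrow> z = (0, 1)" "x \<in> phi b ` aff_dilations \<longleftrightarrow> fst z = 0" .
  show "\<exists>z. snd z \<noteq> 0 \<and> x = phi b z \<and> (x = \<one>\<^bsub>subgrp (phi b ` carrier aff_group)\<^esub> \<longleftrightarrow> z = (0, 1))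
      \<and> (x \<in> phi b ` aff_dilations \<longleftrightarrow> fst z = 0)"
    using z(1,2) fin by (intro exI[of _ z]) simp
qed

end

text \<open>The dilation factor is inverted because the upper and the lower copy normalise different
  eigenvalues to 1, as the multiplication law of the affine group requires, while the stable
  generator keeps the eigenvalues in place.\<close>

definition dil_swap :: "('k::field poly \<times> 'k \<Rightarrow> 'a) \<Rightarrow> ('k poly \<times> 'k \<Rightarrow> 'a) \<Rightarrow> 'a \<Rightarrow> 'a" where
  "dil_swap f g y = g (0, inverse (snd (inv_into (carrier aff_group) f y)))"

lemma dil_swap: "inj_on f (carrier aff_group) \<Longrightarrow> c \<noteq> 0 \<Longrightarrow> dil_swap f g (f (0, c)) = g (0, inverse c)"
  by (simp add: dil_swap_def inv_into_f_f aff_simps)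

lemma dil_swap_image:
  fixes f g :: "'k::field poly \<times> 'k \<Rightarrow> 'a"
  assumes "inj_on f (carrier aff_group)"
  shows "dil_swap f g ` f ` aff_dilations = g ` aff_dilations"
proof
  show "dil_swap f g ` f ` aff_dilations \<subseteq> g ` aff_dilations"
    by (auto simp: aff_dilations_def dil_swap[OF assms])
  have "g (0, c) \<in> dil_swap f g ` f ` aff_dilations" if "c \<noteq> 0" for c
    using that dil_swap[OF assms, of "inverse c" g] by (intro image_eqI[of _ _ "f (0, inverse c)"]) (auto simp: aff_dilations_def)
  then show "g ` aff_dilations \<subseteq> dil_swap f g ` f ` aff_dilations" by (auto simp: aff_dilations_def)
qed

lemma dil_swap_iso:
  fixes f g :: "'k::field poly \<times> 'k \<Rightarrow> 'a" and G :: "('a, 'c) monoid_scheme"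
  assumes f: "f \<in> hom aff_group G" "inj_on f (carrier aff_group)"
    and g: "g \<in> hom aff_group G" "inj_on g (carrier aff_group)"
  shows "dil_swap f g \<in> iso (G\<lparr>carrier := f ` aff_dilations\<rparr>) (G\<lparr>carrier := g ` aff_dilations\<rparr>)"
proof -
  have mult: "h (0, c) \<otimes>\<^bsub>G\<^esub> h (0, d) = h (0, c * d)" if "h \<in> hom aff_group G" "c \<noteq> 0" "d \<noteq> 0" for h c d
    using hom_mult[OF that(1), of "(0, c)" "(0, d)"] that by (simp add: aff_simps)
  have inj: "c = d" if "g (0, c) = g (0, d)" "c \<noteq> 0" "d \<noteq> 0" for c d
    using inj_onD[OF g(2) that(1)] that(2,3) by (simp add: aff_simps)
  show ?thesis unfolding iso_def bij_betw_def
  proof (intro CollectI conjI homI)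
    fix x y assume "x \<in> carrier (G\<lparr>carrier := f ` aff_dilations\<rparr>)" "y \<in> carrier (G\<lparr>carrier := f ` aff_dilations\<rparr>)"
    then obtain c d where "c \<noteq> 0" "d \<noteq> 0" "x = f (0, c)" "y = f (0, d)" by (auto simp: aff_dilations_def)
    then show "dil_swap f g (x \<otimes>\<^bsub>G\<lparr>carrier := f ` aff_dilations\<rparr>\<^esub> y)
        = dil_swap f g x \<otimes>\<^bsub>G\<lparr>carrier := g ` aff_dilations\<rparr>\<^esub> dil_swap f g y"
      by (simp add: mult[OF f(1)] mult[OF g(1)] dil_swap[OF f(2)])
  next
    show "inj_on (dil_swap f g) (carrier (G\<lparr>carrier := f ` aff_dilations\<rparr>))"
    proof (rule inj_onI)
      fix x y assume "x \<in> carrier (G\<lparr>carrier := f ` aff_dilations\<rparr>)" "y \<in> carrier (G\<lparr>carrier := f ` aff_dilations\<rparr>)"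
        and eq: "dil_swap f g x = dil_swap f g y"
      then obtain c d where cd: "c \<noteq> 0" "d \<noteq> 0" "x = f (0, c)" "y = f (0, d)" by (auto simp: aff_dilations_def)
      then show "x = y" using eq inj[of "inverse c" "inverse d"] by (simp add: dil_swap[OF f(2)])
    qed
  next
    show "dil_swap f g ` carrier (G\<lparr>carrier := f ` aff_dilations\<rparr>) = carrier (G\<lparr>carrier := g ` aff_dilations\<rparr>)"
      using dil_swap_image[OF f(2), of g] by simp
    then show "dil_swap f g x \<in> carrier (G\<lparr>carrier := g ` aff_dilations\<rparr>)"
      if "x \<in> carrier (G\<lparr>carrier := f ` aff_dilations\<rparr>)" for x using that by blast
  qed
qed

abbreviation aff_product :: "(bool \<times> 'k::field poly \<times> 'k) list set monoid" where
  "aff_product \<equiv> free_product UNIV (\<lambda>_. aff_group)"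

abbreviation incl :: "bool \<Rightarrow> 'k::field poly \<times> 'k \<Rightarrow> (bool \<times> 'k poly \<times> 'k) list set" where
  "incl \<equiv> free_product_incl UNIV (\<lambda>_. aff_group)"

abbreviation dil_incl :: "bool \<Rightarrow> (bool \<times> 'k::field poly \<times> 'k) list set set" where
  "dil_incl b \<equiv> incl b ` aff_dilations"

abbreviation incl_swap :: "(bool \<times> 'k::field poly \<times> 'k) list set \<Rightarrow> (bool \<times> 'k poly \<times> 'k) list set" where
  "incl_swap \<equiv> dil_swap (incl True) (incl False)"

section \<open>The generators as affine maps and the HNN structure\<close>

context exceptional6
begin

lemma stable_params: "a \<in> stable_params \<tau> \<longleftrightarrow> kap a \<noteq> 0"
  by (simp add: stable_params_def kap_def tinv_inverse)

lemma mult_params: "b \<in> mult_params \<tau> \<longleftrightarrow> b + lam \<noteq> 0 \<and> b - lam \<noteq> 0"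
  unfolding mult_params_def tinv_inverse[symmetric] lam_eq[symmetric] by (auto simp: add_eq_0_iff2)

lemma cls_au: "\<alpha> + \<beta> * lam \<noteq> 0 \<Longrightarrow>
    cls (au \<alpha> \<beta> f) = phi True (Polynomial.smult (inverse (\<alpha> + \<beta> * lam)) f, (\<alpha> - \<beta> * lam) / (\<alpha> + \<beta> * lam))"
proof -
  define s where "s = \<alpha> + \<beta> * lam"
  assume "\<alpha> + \<beta> * lam \<noteq> 0"
  then have s: "s \<noteq> 0" by (simp add: s_def)
  have n: "s * (((\<alpha> - \<beta> * lam) / s + 1) / 2) = \<alpha>" "s * ((1 - (\<alpha> - \<beta> * lam) / s) / (2 * lam)) = \<beta>"
    using s two lam_nonzero by (simp_all add: field_simps) (simp_all add: s_def algebra_simps)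
  have "au \<alpha> \<beta> f = qc s * act True (Polynomial.smult (inverse s) f, (\<alpha> - \<beta> * lam) / s)"
    using au_scale(1)[of s "((\<alpha> - \<beta> * lam) / s + 1) / 2" "(1 - (\<alpha> - \<beta> * lam) / s) / (2 * lam)" "Polynomial.smult (inverse s) f"] s
    by (simp only: n act_def fst_conv snd_conv if_True smult_smult right_inverse[OF s] smult_1_left)
  then show ?thesis using s by (simp add: phi_def cls_scale s_def)
qed

lemma cls_al: "\<alpha> - \<beta> * lam \<noteq> 0 \<Longrightarrow>
    cls (al \<alpha> \<beta> f) = phi False (Polynomial.smult (inverse (\<alpha> - \<beta> * lam)) f, (\<alpha> + \<beta> * lam) / (\<alpha> - \<beta> * lam))"
proof -
  define s where "s = \<alpha> - \<beta> * lam"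
  assume "\<alpha> - \<beta> * lam \<noteq> 0"
  then have s: "s \<noteq> 0" by (simp add: s_def)
  have n: "s * (((\<alpha> + \<beta> * lam) / s + 1) / 2) = \<alpha>" "s * (((\<alpha> + \<beta> * lam) / s - 1) / (2 * lam)) = \<beta>"
    using s two lam_nonzero by (simp_all add: field_simps) (simp_all add: s_def algebra_simps)
  have "al \<alpha> \<beta> f = qc s * act False (Polynomial.smult (inverse s) f, (\<alpha> + \<beta> * lam) / s)"
    using au_scale(2)[of s "((\<alpha> + \<beta> * lam) / s + 1) / 2" "((\<alpha> + \<beta> * lam) / s - 1) / (2 * lam)" "Polynomial.smult (inverse s) f"] s
    by (simp only: n act_def fst_conv snd_conv if_False simp_thms smult_smult right_inverse[OF s] smult_1_left)
  then show ?thesis using s by (simp add: phi_def cls_scale s_def)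
qed

lemma pclass_gens:
  "pclass (stable_mat \<tau> a) = cls (st a)"
  "pclass (add_upper \<tau> f) = phi True (f, 1)" "pclass (add_lower \<tau> f) = phi False (f, 1)"
  "b + lam \<noteq> 0 \<Longrightarrow> pclass (mult_upper \<tau> b) = phi True (0, (b - lam) / (b + lam))"
  "b - lam \<noteq> 0 \<Longrightarrow> pclass (mult_lower \<tau> b) = phi False (0, (b + lam) / (b - lam))"
  using cls_au[of 1 0 f] cls_al[of 1 0 f] cls_au[of b 1 0] cls_al[of b 1 0]
  by (simp_all add: cls_def qmat_st qmat_au qmat_mu)

lemma add_gens: "add_upper_gens \<tau> = phi True ` aff_translations" "add_lower_gens \<tau> = phi False ` aff_translations"
  unfolding add_upper_gens_def add_lower_gens_def pclass_gens aff_translations_def by auto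

text \<open>The dilation factor as a function of \<open>b\<close> is a Moebius map, taking the
  parameters bijectively to the factors other than 0 and 1; the value 1 would need an infinite
  \<open>b\<close>, for which \<open>mu + b\<close> degenerates to a scalar.\<close>

lemma mult_gens:
  "mult_upper_gens \<tau> = phi True ` (aff_dilations - {(0, 1)})" "mult_lower_gens \<tau> = phi False ` (aff_dilations - {(0, 1)})"
proof -
  have 1: "(b - lam) / (b + lam) \<noteq> 0 \<and> (b - lam) / (b + lam) \<noteq> 1 \<and> (b + lam) / (b - lam) \<noteq> 0 \<and> (b + lam) / (b - lam) \<noteq> 1"
    if "b + lam \<noteq> 0" "b - lam \<noteq> 0" for b
  proof -
    have "b - lam \<noteq> b + lam"
    proof
      assume "b - lam = b + lam"
      moreover have "b + lam - (b - lam) = 2 * lam" by simp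
      ultimately have "2 * lam = 0" by simp
      then show False using two lam_nonzero by simp
    qed
    then show ?thesis using that by (simp add: divide_eq_eq)
  qed
  have 2: "\<exists>b. b + lam \<noteq> 0 \<and> b - lam \<noteq> 0 \<and> (b - lam) / (b + lam) = c" if "c \<noteq> 0" "c \<noteq> 1" for c
  proof -
    \<comment> \<open>The inverse of the Moebius map.\<close>
    define b where "b = lam * (1 + c) / (1 - c)"
    have "1 - c \<noteq> 0" using that by simp
    then have "b + lam = 2 * lam / (1 - c)" "b - lam = c * (2 * lam / (1 - c))"
      by (simp_all add: b_def field_simps)
    then show ?thesis using that two lam_nonzero \<open>1 - c \<noteq> 0\<close> by (intro exI[of _ b]) simp
  qed
  have 3: "\<exists>b. b + lam \<noteq> 0 \<and> b - lam \<noteq> 0 \<and> (b + lam) / (b - lam) = c" if "c \<noteq> 0" "c \<noteq> 1" for c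
  proof -
    have "inverse c \<noteq> 0" "inverse c \<noteq> 1" using that by (simp_all add: inverse_eq_1_iff)
    then obtain b where "b + lam \<noteq> 0" "b - lam \<noteq> 0" "(b - lam) / (b + lam) = inverse c" using 2 by blast
    then show ?thesis by (intro exI[of _ b]) (metis inverse_divide inverse_inverse_eq)
  qed
  show "mult_upper_gens \<tau> = phi True ` (aff_dilations - {(0, 1)})"
  proof
    show "mult_upper_gens \<tau> \<subseteq> phi True ` (aff_dilations - {(0, 1)})"
      using 1 by (auto simp: mult_upper_gens_def mult_params pclass_gens aff_dilations_def)
    show "phi True ` (aff_dilations - {(0, 1)}) \<subseteq> mult_upper_gens \<tau>"
    proof
      fix y assume "y \<in> phi True ` (aff_dilations - {(0, 1)})"
      then obtain c where c: "c \<noteq> 0" "c \<noteq> 1" "y = phi True (0, c)" by (auto simp: aff_dilations_def)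
      then obtain b where "b + lam \<noteq> 0" "b - lam \<noteq> 0" "(b - lam) / (b + lam) = c" using 2 by blast
      then show "y \<in> mult_upper_gens \<tau>" unfolding mult_upper_gens_def
        using c by (intro CollectI exI[of _ b]) (simp add: mult_params pclass_gens)
    qed
  qed
  show "mult_lower_gens \<tau> = phi False ` (aff_dilations - {(0, 1)})"
  proof
    show "mult_lower_gens \<tau> \<subseteq> phi False ` (aff_dilations - {(0, 1)})"
      using 1 by (auto simp: mult_lower_gens_def mult_params pclass_gens aff_dilations_def)
    show "phi False ` (aff_dilations - {(0, 1)}) \<subseteq> mult_lower_gens \<tau>"
    proof
      fix y assume "y \<in> phi False ` (aff_dilations - {(0, 1)})"
      then obtain c where c: "c \<noteq> 0" "c \<noteq> 1" "y = phi False (0, c)" by (auto simp: aff_dilations_def)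
      then obtain b where "b + lam \<noteq> 0" "b - lam \<noteq> 0" "(b + lam) / (b - lam) = c" using 3 by blast
      then show "y \<in> mult_lower_gens \<tau>" unfolding mult_lower_gens_def
        using c by (intro CollectI exI[of _ b]) (simp add: mult_params pclass_gens)
    qed
  qed
qed

lemmas upper_rep = aff_rep[OF phi_hom phi_inj add_gens(1) mult_gens(1), folded aff_upper_gens_def]
lemmas lower_rep = aff_rep[OF phi_hom phi_inj add_gens(2) mult_gens(2), folded aff_lower_gens_def]

lemma aff_gens_carrier: "aff_upper_gens \<tau> \<subseteq> carrier quat_group" "aff_lower_gens \<tau> \<subseteq> carrier quat_group"
  using generate.incl[of _ "aff_upper_gens \<tau>" quat_group] generate.incl[of _ "aff_lower_gens \<tau>" quat_group]
    subgroup.subset[OF subgroup_phi(1)] unfolding upper_rep(3) lower_rep(3) by blast+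

lemma qunit_stable: "kap a \<noteq> 0 \<Longrightarrow> qunit (st a)"
proof -
  have "(12 :: 'k) = 4 * 3" by simp
  then have "(12 :: 'k) \<noteq> 0" using four three by (metis mult_eq_0_iff)
  then show "kap a \<noteq> 0 \<Longrightarrow> qunit (st a)" using tau_nonzero by (intro qunit_st) simp
qed

text \<open>Conjugation keeps \<open>\<alpha>\<close> and \<open>\<beta>\<close>. Upstairs
  \<open>\<alpha> + \<beta> * lam\<close> is 1 and \<open>\<alpha> - \<beta> * lam\<close> is
  \<open>c\<close>; rescaling to make the latter 1, as the lower copy demands, turns
  \<open>c\<close> into its inverse.\<close>

lemma stable_conj:
  assumes "c \<noteq> 0" "kap a \<noteq> 0"
  shows "cls (st a) \<otimes>\<^bsub>quat_group\<^esub> phi True (0, c) = phi False (0, inverse c) \<otimes>\<^bsub>quat_group\<^esub> cls (st a)"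
proof -
  have n: "(c + 1) / 2 - (1 - c) / (2 * lam) * lam = c" "(c + 1) / 2 + (1 - c) / (2 * lam) * lam = 1"
    by (rule eigenvalues)+
  have u: "qunit (st a)" using assms(2) by (rule qunit_stable)
  have "cls (st a) \<otimes>\<^bsub>quat_group\<^esub> phi True (0, c) = cls (st a * act True (0, c))"
    using u qunit_act[of "(0, c)" True] assms by (simp add: phi_def cls_mult)
  also have "\<dots> = cls (al ((c + 1) / 2) ((1 - c) / (2 * lam)) 0) \<otimes>\<^bsub>quat_group\<^esub> cls (st a)"
    using u qunit_al[of "(c + 1) / 2" "(1 - c) / (2 * lam)" 0, unfolded n] assms by (simp add: act_def st_au_al cls_mult)
  also have "cls (al ((c + 1) / 2) ((1 - c) / (2 * lam)) 0) = phi False (0, inverse c)"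
    using cls_al[of "(c + 1) / 2" "(1 - c) / (2 * lam)" 0, unfolded n] assms by (simp add: inverse_eq_divide)
  finally show ?thesis .
qed

abbreviation base :: "('k laurent ^ 2 ^ 2) set set" where
  "base \<equiv> gen (aff_upper_gens \<tau> \<union> aff_lower_gens \<tau>)"

lemma subgroup_base: "subgroup base quat_group"
  using aff_gens_carrier by (intro Q.generate_is_subgroup) blast

lemma base_eq: "base = gen (\<Union>b\<in>UNIV. phi b ` carrier aff_group)"
proof -
  have "(\<Union>b\<in>UNIV. phi b ` carrier aff_group) = gen (aff_upper_gens \<tau>) \<union> gen (aff_lower_gens \<tau>)"
    unfolding upper_rep(3) lower_rep(3) by (auto simp: UNIV_bool)
  then show ?thesis
    using Q.generate_Un_generate[of "gen (aff_upper_gens \<tau>)" "aff_lower_gens \<tau>"]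
      Q.generate_Un_generate[of "aff_lower_gens \<tau>" "aff_upper_gens \<tau>"] aff_gens_carrier
      Q.generate_incl[OF aff_gens_carrier(1)] by (simp add: Un_commute)
qed

lemma base_external: "fp_pingpong.K quat_group UNIV (\<lambda>_. aff_group) phi = base"
  and base_internal: "fp_pingpong.K quat_group UNIV (\<lambda>b. subgrp (phi b ` carrier aff_group)) (\<lambda>_ x. x) = base"
proof -
  interpret e: fp_zones quat_group "\<lambda>_. aff_group" phi "ctype \<tau>" zT zZ "\<lambda>_. aff_dilations"
    by (rule zones_external)
  interpret i: fp_zones quat_group "\<lambda>b. subgrp (phi b ` carrier aff_group)" "\<lambda>_ x. x" "ctype \<tau>" zT zZ "\<lambda>b. phi b ` aff_dilations"
    by (rule zones_internal)
  show "e.K = base" "i.K = base" unfolding e.K_def i.K_def base_eq by auto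
qed

lemma zZ_step:
  assumes W: "W \<in> carrier quat_group" "\<not> zZ (\<not> \<delta>) W" and a: "kap a \<noteq> 0"
  shows "zZ \<delta> (W \<otimes>\<^bsub>quat_group\<^esub> (if \<delta> then cls (st a) else inv\<^bsub>quat_group\<^esub> (cls (st a))))"
proof -
  obtain x where x: "qunit x" "W = cls x" using W(1) by (rule quat_cases)
  have u: "qunit (st a)" using a by (rule qunit_stable)
  show ?thesis
    using W(2) Z_st[OF qunit_nonzero[OF x(1)] a] x u
    by (cases \<delta>) (simp_all add: cls_inv cls_mult zZ_cls qunit_mult zone_def)
qed

lemma hnn_internal:
  assumes a: "kap a \<noteq> 0"
  shows "hnn_pingpong quat_group (subgrp base) (\<lambda>x. x) (\<lambda>b. phi b ` aff_dilations) (dil_swap (phi True) (phi False)) (cls (st a)) zZ"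
proof (rule fp_zones.hnn_pingpong[OF zones_internal, unfolded base_internal])
  show "group (subgrp base)" by (rule subgroup.subgroup_is_group[OF subgroup_base]) (rule group_quat_group)
  show "(\<lambda>x. x) \<in> iso (subgrp base) (subgrp base)"
    by (auto simp: iso_def hom_def bij_betw_def)
  show "phi b ` aff_dilations \<subseteq> carrier (subgrp base)" for b
  proof -
    have "aff_dilations \<subseteq> carrier (aff_group :: ('k poly \<times> 'k) monoid)"
      by (auto simp: aff_dilations_def aff_simps)
    then have "phi b ` aff_dilations \<subseteq> (\<Union>b\<in>UNIV. phi b ` carrier aff_group)" by blast
    also have "\<dots> \<subseteq> base" unfolding base_eq by (rule subsetI, rule generate.incl)
    finally show ?thesis by simp
  qed
  show "dil_swap (phi True) (phi False) ` phi True ` aff_dilations = phi False ` aff_dilations"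
    by (rule dil_swap_image[OF phi_inj])
  show "cls (st a) \<in> carrier quat_group" using qunit_stable[OF a] by simp
  show "cls (st a) \<otimes>\<^bsub>quat_group\<^esub> x = dil_swap (phi True) (phi False) x \<otimes>\<^bsub>quat_group\<^esub> cls (st a)"
    if "x \<in> phi True ` aff_dilations" for x
    using that stable_conj[OF _ a] by (auto simp: aff_dilations_def dil_swap[OF phi_inj])
  show "(\<lambda>x. x) ` phi b ` aff_dilations = (\<lambda>x. x) ` phi b ` aff_dilations" for b by (rule HOL.refl)
qed (rule zZ_step[OF _ _ a])

lemma hnn_external:
  assumes a: "kap a \<noteq> 0" and \<psi>: "\<psi> \<in> iso aff_product (subgrp base)"
    "\<And>b z. snd z \<noteq> 0 \<Longrightarrow> \<psi> (incl b z) = phi b z"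
  shows "hnn_pingpong quat_group aff_product \<psi> dil_incl incl_swap (cls (st a)) zZ"
proof -
  interpret e: fp_zones quat_group "\<lambda>_. aff_group" phi "ctype \<tau>" zT zZ "\<lambda>_. aff_dilations"
    by (rule zones_external)
  show ?thesis
  proof (rule e.hnn_pingpong[unfolded base_external])
    show "dil_incl b \<subseteq> carrier (aff_product :: (bool \<times> 'k poly \<times> 'k) list set monoid)" for b
      using e.incl_closed by (auto simp: aff_dilations_def aff_simps)
    show "\<psi> ` dil_incl b = phi b ` aff_dilations" for b
      unfolding image_image by (rule image_cong) (auto simp: aff_dilations_def \<psi>(2))
    show "incl_swap ` dil_incl True = (dil_incl False :: (bool \<times> 'k poly \<times> 'k) list set set)"
      by (rule dil_swap_image[OF e.incl_inj]) simp
    show "cls (st a) \<in> carrier quat_group" using qunit_stable[OF a] by simp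
    show "cls (st a) \<otimes>\<^bsub>quat_group\<^esub> \<psi> x = \<psi> (incl_swap x) \<otimes>\<^bsub>quat_group\<^esub> cls (st a)"
      if "x \<in> dil_incl True" for x
      using that stable_conj[OF _ a] by (auto simp: aff_dilations_def dil_swap[OF e.incl_inj] \<psi>(2))
  qed (use \<psi>(1) e.group_free_product zZ_step[OF _ _ a] in auto)
qed

definition tgroup :: "'k \<Rightarrow> ('k laurent ^ 2 ^ 2) set set" where
  "tgroup a = gen ({cls (st a)} \<union> aff_upper_gens \<tau> \<union> aff_lower_gens \<tau>)"

lemma tgroup_base: "kap a \<noteq> 0 \<Longrightarrow> gen (insert (cls (st a)) base) = tgroup a"
  using Q.generate_Un_generate[of "{cls (st a)}" "aff_upper_gens \<tau> \<union> aff_lower_gens \<tau>"] aff_gens_carrier qunit_stable[of a]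
  by (simp add: tgroup_def)

lemma subgroup_tgroup: "kap a \<noteq> 0 \<Longrightarrow> subgroup (tgroup a) quat_group"
  unfolding tgroup_def using aff_gens_carrier qunit_stable[of a] by (intro Q.generate_is_subgroup) auto

lemma base_tgroup: "base \<subseteq> tgroup a"
  unfolding tgroup_def by (rule Q.mono_generate) blast

lemma phi_tgroup: "snd z \<noteq> 0 \<Longrightarrow> phi b z \<in> tgroup a"
  using base_tgroup[of a] unfolding base_eq by (auto simp: aff_simps intro!: generate.incl)

lemma st_tgroup: "cls (st a) \<in> tgroup a"
  unfolding tgroup_def by (rule generate.incl) blast

lemma base_free_product:
  "internal_free_product (subgrp base) UNIV (\<lambda>up. if up then gen (aff_upper_gens \<tau>) else gen (aff_lower_gens \<tau>))"
proof -
  have H: "(\<lambda>up. if up then gen (aff_upper_gens \<tau>) else gen (aff_lower_gens \<tau>)) = (\<lambda>b. phi b ` carrier aff_group)"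
    unfolding upper_rep(3) lower_rep(3)
  proof
    fix b :: bool
    show "(if b then phi True ` carrier aff_group else phi False ` carrier aff_group) = phi b ` carrier aff_group"
      by (cases b) simp_all
  qed
  show ?thesis unfolding base_eq H
    using Q.internal_free_product_generate[OF fp_zones.axioms(1)[OF zones_internal]] subgroup_phi by simp
qed

lemma tgroup_hnn:
  assumes a: "kap a \<noteq> 0"
  shows "internal_hnn_extension (subgrp (tgroup a)) base (gen (mult_upper_gens \<tau>)) (gen (mult_lower_gens \<tau>))
    (dil_swap (phi True) (phi False)) (cls (st a))"
proof -
  interpret h: hnn_pingpong quat_group "subgrp base" "\<lambda>x. x" "\<lambda>b. phi b ` aff_dilations"
      "dil_swap (phi True) (phi False)" "cls (st a)" zZ
    by (rule hnn_internal[OF a])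
  have K: "h.K = tgroup a" using tgroup_base[OF a] by (simp add: h.K_def)
  have sub: "phi b ` aff_dilations \<subseteq> base" for b using h.A_sub[of b] by simp
  have "subgroup base (subgrp (tgroup a))"
    by (rule Q.subgroup_incl[OF subgroup_base subgroup_tgroup[OF a] base_tgroup])
  moreover have "subgroup (phi b ` aff_dilations) (subgrp base)" for b
    by (rule Q.subgroup_incl[OF subgroup_phi(2) subgroup_base sub])
  ultimately show ?thesis
    unfolding internal_hnn_extension_def upper_rep(2) lower_rep(2)
    using dil_swap_iso[OF phi_hom phi_inj phi_hom phi_inj, of True False] h.hnn_iso unfolding K by simp
qed

lemma incl_swap:
  "incl_swap \<in> iso (aff_product\<lparr>carrier := dil_incl True\<rparr>) (aff_product\<lparr>carrier := dil_incl False :: (bool \<times> 'k poly \<times> 'k) list set set\<rparr>)"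
  "c \<noteq> 0 \<Longrightarrow> incl_swap (incl True (0, c)) = incl False (0 :: 'k poly, inverse c)"
proof -
  interpret e: fp_zones quat_group "\<lambda>_. aff_group" phi "ctype \<tau>" zT zZ "\<lambda>_. aff_dilations"
    by (rule zones_external)
  show "incl_swap \<in> iso (aff_product\<lparr>carrier := dil_incl True\<rparr>) (aff_product\<lparr>carrier := dil_incl False :: (bool \<times> 'k poly \<times> 'k) list set set\<rparr>)"
    by (rule dil_swap_iso) (simp_all add: e.incl_hom e.incl_inj)
  show "incl_swap (incl True (0, c)) = incl False (0 :: 'k poly, inverse c)" if "c \<noteq> 0"
    using that by (simp add: dil_swap[OF e.incl_inj])
qed

lemma tgroup_iso:
  assumes a: "kap a \<noteq> 0"
  shows "\<exists>\<psi> \<in> iso (hnn_extension aff_product (dil_incl True) incl_swap) (subgrp (tgroup a)).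
      (\<forall>b. \<forall>x\<in>carrier aff_group. \<psi> (hnn_incl aff_product (dil_incl True) incl_swap (incl b x)) = phi b x)
      \<and> \<psi> (hnn_stable aff_product (dil_incl True) incl_swap) = cls (st a)"
    and "group (hnn_extension aff_product (dil_incl True) (incl_swap :: (bool \<times> 'k poly \<times> 'k) list set \<Rightarrow> _))"
proof -
  interpret e: fp_zones quat_group "\<lambda>_. aff_group" phi "ctype \<tau>" zT zZ "\<lambda>_. aff_dilations"
    by (rule zones_external)
  obtain \<psi> where \<psi>: "\<psi> \<in> iso aff_product (subgrp base)" "\<And>b z. snd z \<noteq> 0 \<Longrightarrow> \<psi> (incl b z) = phi b z"
    using e.fp_iso unfolding base_external by (auto simp: aff_simps)
  interpret h: hnn_pingpong quat_group aff_product \<psi> dil_incl incl_swap "cls (st a)" zZ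
    by (rule hnn_external[OF a \<psi>])
  show "group (hnn_extension aff_product (dil_incl True) (incl_swap :: (bool \<times> 'k poly \<times> 'k) list set \<Rightarrow> _))"
    by (rule h.group_hnn_extension)
  have "\<psi> ` carrier aff_product = base" using \<psi>(1) by (simp add: iso_def bij_betw_def)
  then have K: "h.K = tgroup a" using tgroup_base[OF a] by (simp add: h.K_def)
  obtain \<eta> where \<eta>: "\<eta> \<in> iso (hnn_extension aff_product (dil_incl True) incl_swap) (subgrp (tgroup a))"
      "\<And>b. b \<in> carrier aff_product \<Longrightarrow> \<eta> (hnn_incl aff_product (dil_incl True) incl_swap b) = \<psi> b"
      "\<eta> (hnn_stable aff_product (dil_incl True) incl_swap) = cls (st a)"
    using h.hnn_iso unfolding K by blast
  have "\<eta> (hnn_incl aff_product (dil_incl True) incl_swap (incl b x)) = phi b x" if "x \<in> carrier aff_group" for b x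
    using that \<eta>(2)[OF e.incl_closed] \<psi>(2) by (simp add: aff_simps)
  then show "\<exists>\<psi> \<in> iso (hnn_extension aff_product (dil_incl True) incl_swap) (subgrp (tgroup a)).
      (\<forall>b. \<forall>x\<in>carrier aff_group. \<psi> (hnn_incl aff_product (dil_incl True) incl_swap (incl b x)) = phi b x)
      \<and> \<psi> (hnn_stable aff_product (dil_incl True) incl_swap) = cls (st a)"
    using \<eta>(1,3) by blast
qed

text \<open>Two stable generators differ by a factor from the upper torus.\<close>

lemma tgroup_independent:
  assumes a: "kap a \<noteq> 0" and b: "kap b \<noteq> 0"
  shows "tgroup a = tgroup b"
proof -
  have *: "tgroup b \<subseteq> tgroup a" if a: "kap a \<noteq> 0" and b: "kap b \<noteq> 0" for a b
  proof -
    \<comment> \<open>Determined by \<open>\<beta> * (2 * lam * kap a) = b - a\<close>; then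
      \<open>\<alpha> = 1 + \<beta> * lam\<close> gives \<open>st a\<close> the coefficient 1 in
      \<open>st_au\<close>. The factor is a unit because its other eigenvalue is
      \<open>kap b / kap a\<close>.\<close>
    define \<beta> where "\<beta> = (b - a) / (2 * lam * kap a)"
    have "kap a * (2 * \<beta> * lam) = b - a" using a two lam_nonzero by (simp add: \<beta>_def)
    then have "kap a * (1 + \<beta> * lam + \<beta> * lam) = kap b" by (simp add: kap_def algebra_simps)
    then have ne: "1 + \<beta> * lam + \<beta> * lam \<noteq> 0" using b by force
    have "st b = st a * au (1 + \<beta> * lam) \<beta> 0"
      unfolding st_au st_diff[of b a] using a two lam_nonzero by (simp add: \<beta>_def ql_one)
    moreover have "qunit (au (1 + \<beta> * lam) \<beta> 0)" using ne by (intro qunit_au) simp_all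
    ultimately have "cls (st b) = cls (st a) \<otimes>\<^bsub>quat_group\<^esub> cls (au (1 + \<beta> * lam) \<beta> 0)"
      using qunit_stable[OF a] by (simp add: cls_mult)
    moreover have "cls (au (1 + \<beta> * lam) \<beta> 0) \<in> tgroup a"
      unfolding cls_au[OF ne] using ne by (intro phi_tgroup) simp
    ultimately have "cls (st b) \<in> tgroup a"
      using st_tgroup[of a] subgroup.m_closed[OF subgroup_tgroup[OF a]] by metis
    moreover have "aff_upper_gens \<tau> \<union> aff_lower_gens \<tau> \<subseteq> tgroup a"
      unfolding tgroup_def by (auto intro: generate.incl)
    ultimately show ?thesis
      unfolding tgroup_def[of b] by (intro Q.generate_subgroup_incl[OF _ subgroup_tgroup[OF a]]) blast
  qed
  show ?thesis using *[OF a b] *[OF b a] by blast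
qed

lemma tgroup_type:
  assumes a: "kap a \<noteq> 0" and M: "M \<in> carrier quat_group" "\<And>b. \<not> ctype \<tau> b M" and g: "g \<in> tgroup a" "g \<noteq> \<one>\<^bsub>quat_group\<^esub>"
  shows "\<exists>b. ctype \<tau> b (M \<otimes>\<^bsub>quat_group\<^esub> g)"
proof (rule fp_zones.T_hnn[OF zones_internal hnn_internal[OF a] _ M _ g(2)])
  show "(\<lambda>x. x) ` carrier (subgrp base) = fp_pingpong.K quat_group UNIV (\<lambda>b. subgrp (phi b ` carrier aff_group)) (\<lambda>_ x. x)"
    unfolding base_internal by simp
  show "g \<in> hnn_pingpong.K quat_group (subgrp base) (\<lambda>x. x) (cls (st a))"
    using g(1) tgroup_base[OF a] by (simp add: hnn_pingpong.K_def[OF hnn_internal[OF a]])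
qed

lemma tgroup_descent:
  assumes a: "kap a \<noteq> 0" and x: "qunit x" "qtype \<tau> b x"
  shows "\<exists>u. qunit u \<and> cls u \<in> tgroup a \<and> width (x * u) < width x"
proof (cases b)
  case True
  then have "Up \<tau> x" using x(2) by (simp add: qtype_def)
  from descent[OF x(1) this, of a] show ?thesis
  proof
    assume "\<exists>\<alpha> \<beta> f. \<alpha> + \<beta> * lam \<noteq> 0 \<and> \<alpha> - \<beta> * lam \<noteq> 0 \<and> width (x * au \<alpha> \<beta> f) < width x"
    then obtain \<alpha> \<beta> f where *: "\<alpha> + \<beta> * lam \<noteq> 0" "\<alpha> - \<beta> * lam \<noteq> 0" "width (x * au \<alpha> \<beta> f) < width x" by blast
    then have "cls (au \<alpha> \<beta> f) \<in> tgroup a" unfolding cls_au[OF *(1)] by (intro phi_tgroup) simp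
    then show ?thesis using * qunit_au by blast
  next
    assume "width (x * dag (st a)) < width x"
    moreover have "cls (dag (st a)) \<in> tgroup a"
      using subgroup.m_inv_closed[OF subgroup_tgroup[OF a] st_tgroup] qunit_stable[OF a] by (simp add: cls_inv)
    ultimately show ?thesis using qunit_stable[OF a] by (intro exI[of _ "dag (st a)"]) simp
  qed
next
  case False
  \<comment> \<open>The lower case is the upper case of the flipped quaternion; flipping back turns
    an upper affine factor into a lower one and \<open>dag (st a)\<close> into
    \<open>st a\<close>.\<close>
  then have U: "Up \<tau> (qflip x)" using x by (intro Lo_flip[OF x(1) tau_nonzero]) (simp add: qtype_def)
  have flip: "width (x * qflip u) < width x" if "width (qflip x * u) < width (qflip x)" for u
    using that width_flip[of "qflip x * u"] width_flip[of x] by (simp add: qflip_mult)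
  from U x(1) consider \<alpha> \<beta> f where "\<alpha> + \<beta> * lam \<noteq> 0" "\<alpha> - \<beta> * lam \<noteq> 0" "width (qflip x * au \<alpha> \<beta> f) < width (qflip x)"
    | "width (qflip x * dag (st a)) < width (qflip x)"
    using descent[of "qflip x" a] by auto
  then show ?thesis
  proof cases
    case (1 \<alpha> \<beta> f)
    then have ne: "\<alpha> - - \<beta> * lam \<noteq> 0" "\<alpha> + - \<beta> * lam \<noteq> 0" by simp_all
    then have "cls (al \<alpha> (- \<beta>) (- f)) \<in> tgroup a" unfolding cls_al[OF ne(1)] by (intro phi_tgroup) simp
    moreover have "width (x * al \<alpha> (- \<beta>) (- f)) < width x" using flip[OF 1(3)] by (simp add: flip_au)
    ultimately show ?thesis using qunit_al[OF ne(2,1)] by blast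
  next
    case 2
    then have "width (x * st a) < width x" using flip[of "dag (st a)"] flips(5)[of a] by simp
    then show ?thesis using st_tgroup qunit_stable[OF a] by blast
  qed
qed

lemma stable_cyclic:
  assumes a: "kap a \<noteq> 0"
  shows "subgrp (gen {cls (st a)}) \<cong> integer_group"
proof (rule Q.cyclic_iso_integer_group)
  show c: "cls (st a) \<in> carrier quat_group" using qunit_stable[OF a] by simp
  have zz: "ctype \<tau> b M" if "zZ b M" for b M
    using that zone_qtype by (auto simp: zZ_def lift_cls_def ctype_def)
  show "cls (st a) [^]\<^bsub>quat_group\<^esub> Suc n \<noteq> \<one>\<^bsub>quat_group\<^esub>" for n
  proof (rule Q.power_nontrivial[OF c, of "zZ True" "zZ False"])
    show "\<not> zZ True \<one>\<^bsub>quat_group\<^esub>" "\<not> zZ False \<one>\<^bsub>quat_group\<^esub>" using zz ctype_one by blast+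
    show "zZ True (M \<otimes>\<^bsub>quat_group\<^esub> cls (st a))" if "M \<in> carrier quat_group" "\<not> zZ False M" for M
      using zZ_step[of M True a] that a by simp
    show "\<not> zZ False M" if "M \<in> carrier quat_group" "zZ True M" for M
      using that zz ctype_unique by blast
  qed
qed

end

section \<open>Type groups in characteristic three\<close>

context exceptional3
begin

definition a3 :: "bool \<Rightarrow> 'k poly \<Rightarrow> ('k laurent ^ 2 ^ 2) set" where
  "a3 b f = cls (if b then a3u f else a3l f)"

lemma qmat_a3: "qmat (a3u f) = add3_upper \<tau> f" "qmat (a3l f) = add3_lower \<tau> f"
  unfolding qmat_def quat_def add3_upper_def add3_lower_def elem_mat_def dagger_def mat22_nth mat_eq_mat22 mat22_mult mat22_add
  by (rule mat22_eqI; simp add: a3u_def a3l_def n3u_def n3l_def lPhi_def lbar_lsubst algebra_simps lt_lti_assoc)+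

lemma add3_gens: "add3_upper_gens \<tau> = range (a3 True)" "add3_lower_gens \<tau> = range (a3 False)"
  by (auto simp: add3_upper_gens_def add3_lower_gens_def a3_def cls_def qmat_a3)

lemma a3_hom: "a3 b \<in> hom poly_add_group quat_group"
  by (auto simp: hom_def poly_add_group_def a3_def cls_mult qunit_a3 a3_mult)

lemma a3_step:
  assumes "M \<in> carrier quat_group" "\<not> ctype \<tau> b M" "f \<noteq> 0"
  shows "ctype \<tau> b (M \<otimes>\<^bsub>quat_group\<^esub> a3 b f)"
proof -
  obtain x where x: "qunit x" "M = cls x" using assms(1) by (rule quat_cases)
  show ?thesis
    using assms(2,3) not_Up_a3u[OF qunit_nonzero[OF x(1)], of f] not_Lo_a3l[OF qunit_nonzero[OF x(1)], of f] x
    by (cases b) (simp_all add: a3_def cls_mult qunit_a3 qunit_mult ctype_cls qtype_def)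
qed

lemma a3_inj: "inj (a3 b)"
proof -
  interpret h: group_hom poly_add_group quat_group "a3 b"
    by (intro group_hom.intro group_hom_axioms.intro group_poly_add a3_hom) unfold_locales
  have "f = 0" if "a3 b f = \<one>\<^bsub>quat_group\<^esub>" for f
    using a3_step[of "\<one>\<^bsub>quat_group\<^esub>" b f] ctype_one[of \<tau> b] that by auto
  then have "inj_on (a3 b) (carrier poly_add_group)" unfolding h.inj_on_one_iff by (auto simp: poly_add_group_def)
  then show ?thesis by (simp add: poly_add_group_def)
qed

lemma gen_add3: "gen (range (a3 b)) = range (a3 b)" "subgroup (range (a3 b)) quat_group"
  "comm_group (subgrp (range (a3 b)))" "subgrp (range (a3 b)) \<cong> (poly_add_group :: 'k poly monoid)"
proof -
  interpret h: group_hom poly_add_group quat_group "a3 b"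
    by (intro group_hom.intro group_hom_axioms.intro group_poly_add a3_hom) unfold_locales
  have c: "carrier (poly_add_group :: 'k poly monoid) = UNIV" by (simp add: poly_add_group_def)
  show s: "subgroup (range (a3 b)) quat_group" using h.img_is_subgroup unfolding c .
  show "gen (range (a3 b)) = range (a3 b)"
    by (rule subset_antisym) (auto intro: generate.incl dest: subsetD[OF Q.generate_subgroup_incl[OF subset_refl s]])
  show "comm_group (subgrp (range (a3 b)))"
    using comm_group_of_iso[OF a3_hom a3_inj h.G.subgroup_self[unfolded c] group_poly_add]
    by (simp add: poly_add_group_def add.commute)
  have "a3 b \<in> iso poly_add_group (subgrp (range (a3 b)))"
    using a3_inj a3_hom by (auto simp: iso_def bij_betw_def hom_def c)
  then show "subgrp (range (a3 b)) \<cong> (poly_add_group :: 'k poly monoid)"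
    using group.iso_sym[OF group_poly_add] by (auto simp: is_iso_def)
qed

lemma a3_pingpong:
  fixes Gs :: "bool \<Rightarrow> ('b, 'd) monoid_scheme"
  assumes Gs: "\<And>b. group (Gs b)" "\<And>b. \<iota> b \<in> hom (Gs b) quat_group"
    and rep: "\<And>b x. x \<in> carrier (Gs b) \<Longrightarrow> x \<noteq> \<one>\<^bsub>Gs b\<^esub> \<Longrightarrow> \<exists>f. f \<noteq> 0 \<and> \<iota> b x = a3 b f"
  shows "fp_pingpong quat_group UNIV Gs \<iota> (ctype \<tau>) (ctype \<tau>)"
proof (intro fp_pingpong.intro fp_pingpong_axioms.intro group_quat_group Gs)
  show "b = b'" if "M \<in> carrier quat_group" "ctype \<tau> b M" "ctype \<tau> b' M" for b b' M
    using ctype_unique that by blast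
  show "ctype \<tau> b (M \<otimes>\<^bsub>quat_group\<^esub> \<iota> b x)"
    if "M \<in> carrier quat_group" "\<not> ctype \<tau> b M" "x \<in> carrier (Gs b)" "x \<noteq> \<one>\<^bsub>Gs b\<^esub>" for b x M
    using rep[OF that(3,4)] a3_step[OF that(1,2)] by auto
qed (assumption | rule ctype_one)+

definition tgroup3 :: "('k laurent ^ 2 ^ 2) set set" where
  "tgroup3 = gen (add3_upper_gens \<tau> \<union> add3_lower_gens \<tau>)"

lemma a3_internal: "fp_pingpong quat_group UNIV (\<lambda>b. subgrp (range (a3 b))) (\<lambda>_ x. x) (ctype \<tau>) (ctype \<tau>)"
proof (rule a3_pingpong)
  show "group (subgrp (range (a3 b)))" for b
    by (rule subgroup.subgroup_is_group[OF gen_add3(2)]) (rule group_quat_group)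
  show "(\<lambda>x. x) \<in> hom (subgrp (range (a3 b))) quat_group" for b
    using subgroup.subset[OF gen_add3(2), of b] by (auto simp: hom_def)
  have one: "a3 b 0 = \<one>\<^bsub>quat_group\<^esub>" for b
  proof -
    have "a3u 0 = 1" "a3l 0 = 1" by (simp_all add: a3u_def a3l_def qn_eq_iff lsubst_def)
    then show ?thesis by (simp add: a3_def cls_one)
  qed
  show "\<exists>f. f \<noteq> 0 \<and> x = a3 b f" if "x \<in> carrier (subgrp (range (a3 b)))" "x \<noteq> \<one>\<^bsub>subgrp (range (a3 b))\<^esub>" for b x
  proof -
    obtain f where "x = a3 b f" using \<open>x \<in> carrier (subgrp (range (a3 b)))\<close> by auto
    then show ?thesis using that(2) one[of b] by (intro exI[of _ f]) auto
  qed
qed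

lemma a3_external: "fp_pingpong quat_group UNIV (\<lambda>_. poly_add_group) a3 (ctype \<tau>) (ctype \<tau>)"
proof (rule a3_pingpong)
  show "\<exists>f. f \<noteq> 0 \<and> a3 b x = a3 b f" if "x \<noteq> \<one>\<^bsub>poly_add_group\<^esub>" for b x
    using that by (intro exI[of _ x]) (simp add: poly_add_group_def)
qed (rule group_poly_add a3_hom)+

lemma tgroup3_eq: "tgroup3 = gen (\<Union>b\<in>UNIV. range (a3 b))"
  unfolding tgroup3_def add3_gens by (rule arg_cong[of _ _ gen]) (auto simp: UNIV_bool)

lemma subgroup_tgroup3: "subgroup tgroup3 quat_group"
  unfolding tgroup3_eq using subgroup.subset[OF gen_add3(2)] by (intro Q.generate_is_subgroup) blast

lemma tgroup3_type:
  assumes "M \<in> carrier quat_group" "\<And>b. \<not> ctype \<tau> b M" "g \<in> tgroup3" "g \<noteq> \<one>\<^bsub>quat_group\<^esub>"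
  shows "\<exists>b. ctype \<tau> b (M \<otimes>\<^bsub>quat_group\<^esub> g)"
proof -
  interpret i: fp_pingpong quat_group UNIV "\<lambda>b. subgrp (range (a3 b))" "\<lambda>_ x. x" "ctype \<tau>" "ctype \<tau>"
    by (rule a3_internal)
  show ?thesis using i.T_generate[OF assms(1,2) _ assms(4)] assms(3) by (simp add: i.K_def tgroup3_eq)
qed

lemma tgroup3_free_product:
  "internal_free_product (subgrp tgroup3) UNIV (\<lambda>up. if up then gen (add3_upper_gens \<tau>) else gen (add3_lower_gens \<tau>))"
proof -
  have H: "(\<lambda>up. if up then gen (add3_upper_gens \<tau>) else gen (add3_lower_gens \<tau>)) = (\<lambda>b. range (a3 b))"
  proof
    fix b :: bool
    show "(if b then gen (add3_upper_gens \<tau>) else gen (add3_lower_gens \<tau>)) = range (a3 b)"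
      by (cases b) (simp_all add: add3_gens gen_add3)
  qed
  show ?thesis unfolding tgroup3_eq H
    using Q.internal_free_product_generate[OF a3_internal] gen_add3(2) by simp
qed

lemma tgroup3_iso: "subgrp tgroup3 \<cong> free_product (UNIV :: bool set) (\<lambda>_. poly_add_group :: 'k poly monoid)"
proof -
  interpret e: fp_pingpong quat_group UNIV "\<lambda>_. poly_add_group" a3 "ctype \<tau>" "ctype \<tau>"
    by (rule a3_external)
  have "carrier (poly_add_group :: 'k poly monoid) = UNIV" by (simp add: poly_add_group_def)
  then have "e.K = tgroup3" by (simp add: e.K_def tgroup3_eq)
  then show ?thesis using e.fp_iso group.iso_sym[OF e.group_free_product] by (auto simp: is_iso_def)
qed

lemma tgroup3_descent:
  assumes x: "qunit x" "qtype \<tau> b x"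
  shows "\<exists>u. qunit u \<and> cls u \<in> tgroup3 \<and> width (x * u) < width x"
proof -
  have mem: "cls (a3u f) \<in> tgroup3" "cls (a3l f) \<in> tgroup3" for f
    unfolding tgroup3_def add3_gens using rangeI[of "a3 True" f] rangeI[of "a3 False" f]
    by (auto simp: a3_def intro: generate.incl)
  show ?thesis
  proof (cases b)
    case True
    then show ?thesis using descent3[OF x(1)] x(2) mem qunit_a3 unfolding qtype_def by metis
  next
    case False
    then have "Up \<tau> (qflip x)" using x by (intro Lo_flip[OF x(1) tau_nonzero]) (simp add: qtype_def)
    then obtain f where "width (qflip x * a3u f) < width (qflip x)" using descent3[of "qflip x"] x(1) by auto
    then have "width (x * a3l f) < width x"
      using width_flip[of "qflip x * a3u f"] width_flip[of x] by (simp add: qflip_mult flip_a3)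
    then show ?thesis using mem qunit_a3 by blast
  qed
qed

end

section \<open>Prime fields\<close>

lemma mod_ring_fermat: "x \<noteq> 0 \<Longrightarrow> x ^ (CARD('p) - 1) = (1 :: 'p::prime_card mod_ring)"
proof -
  assume "x \<noteq> 0"
  then have inv: "inverse x = x ^ (CARD('p) - 2)" by (simp add: inverse_mod_ring_def)
  have "x ^ Suc (CARD('p) - 2) = 1" using left_inverse[OF \<open>x \<noteq> 0\<close>] unfolding power_Suc2 inv .
  moreover have "CARD('p) - 1 = Suc (CARD('p) - 2)" using nontriv[where 'a = 'p] by simp
  ultimately show ?thesis by (simp only:)
qed

lemma mod_ring_numeral: "(numeral m :: 'p::prime_card mod_ring) = 0 \<longleftrightarrow> CARD('p) dvd numeral m"
proof -
  have "(numeral m :: 'p mod_ring) = of_nat (numeral m)" by simp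
  then show ?thesis using of_nat_0_mod_ring_dvd[of "numeral m", where 'a = 'p] of_nat_card_eq_0[where 'a = 'p]
    by (metis dvd_def mult_zero_left of_nat_mult)
qed

lemma exceptional_sixth: "r ^ 4 + r ^ 2 + 1 = 0 \<Longrightarrow> r ^ 6 = (1 :: 'k::field)"
proof -
  assume "r ^ 4 + r ^ 2 + 1 = 0"
  moreover have "r ^ 6 - 1 = (r ^ 2 - 1) * (r ^ 4 + r ^ 2 + 1)" by (simp add: algebra_simps flip: power_add)
  ultimately show ?thesis by simp
qed

text \<open>A root has sixth power 1 and also (p - 1)-st power 1; together these force its square to
  be 1, which is possible only in characteristic 3.\<close>

lemma not_exceptional_prime:
  fixes r :: "'p::prime_card mod_ring"
  assumes p: "CARD('p) mod 6 = 2 \<or> CARD('p) mod 6 = 5"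
  shows "r ^ 4 + r ^ 2 + 1 \<noteq> 0"
proof
  assume r: "r ^ 4 + r ^ 2 + 1 = 0"
  have r6: "r ^ 6 = 1" by (rule exceptional_sixth[OF r])
  have "r \<noteq> 0" using r by auto
  then have f: "r ^ (CARD('p) - 1) = 1" by (rule mod_ring_fermat)
  define q where "q = CARD('p) div 6"
  have "CARD('p) = 6 * q + CARD('p) mod 6" by (simp add: q_def)
  then consider "CARD('p) - 1 = 6 * q + 1" | "CARD('p) - 1 = 6 * q + 4" using p by fastforce
  then have r4: "r ^ 4 = 1" using f r6 by cases (simp_all add: power_add power_mult)
  have "r ^ 6 = r ^ 4 * r ^ 2" by (simp flip: power_add)
  then have "r ^ 2 = 1" using r6 r4 by simp
  then have "(3 :: 'p mod_ring) = 0" using r r4 by simp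
  then have "CARD('p) dvd 3" using mod_ring_numeral by blast
  then have "CARD('p) \<le> 3" by (rule dvd_imp_le) simp
  then consider "CARD('p) = 1" | "CARD('p) = 2" | "CARD('p) = 3" using prime_card[where 'a = 'p] by (metis One_nat_def le_SucE le_zero_eq not_prime_0 numeral_2_eq_2 numeral_3_eq_3)
  then show False using p \<open>CARD('p) dvd 3\<close> by cases simp_all
qed

lemma exceptional_odd:
  fixes r :: "'p::prime_card mod_ring"
  assumes "r ^ 4 + r ^ 2 + 1 = 0" 
  shows "(2 :: 'p mod_ring) \<noteq> 0"
proof
  assume "(2 :: 'p mod_ring) = 0"
  then have "CARD('p) dvd 2" using mod_ring_numeral by blast
  then have "CARD('p) \<le> 2" by (rule dvd_imp_le) simp
  then have "CARD('p) = 2" using nontriv[where 'a = 'p] by simp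
  then show False using not_exceptional_prime[of r] assms by simp
qed

text \<open>For a primitive cube root of unity y the four roots are y, its conjugate -1 - y, and
  their negatives.\<close>

lemma card_exceptional:
  assumes p: "CARD('p::prime_card) mod 6 = 1"
  shows "(6 :: 'p mod_ring) \<noteq> 0" "card {r :: 'p mod_ring. r ^ 4 + r ^ 2 + 1 = 0} = 4"
proof -
  show six: "(6 :: 'p mod_ring) \<noteq> 0"
  proof
    assume "(6 :: 'p mod_ring) = 0"
    then have d: "CARD('p) dvd 6" using mod_ring_numeral by blast
    then have "CARD('p) \<le> 6" by (rule dvd_imp_le) simp
    then have "CARD('p) \<in> {2, 3, 4, 5, 6}" using nontriv[where 'a = 'p] by auto
    then show False using p by auto
  qed
  have "(6 :: 'p mod_ring) = 2 * 3" by simp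
  then have two: "(2 :: 'p mod_ring) \<noteq> 0" and three: "(3 :: 'p mod_ring) \<noteq> 0" using six by (metis mult_zero_left, metis mult_zero_right)
  define k where "k = CARD('p) div 6"
  have card: "CARD('p) - 1 = 6 * k" using p by (simp add: k_def minus_mod_eq_mult_div[symmetric])
  have k: "k > 0" using card nontriv[where 'a = 'p] by (cases k) auto
  \<comment> \<open>At most 2k of the 6k nonzero elements have 2k-th power 1; for any other x, the
    power x^(2k) is a primitive cube root of unity.\<close>
  define P :: "'p mod_ring poly" where "P = Polynomial.monom 1 (2 * k) - 1"
  have "Polynomial.coeff P (2 * k) = 1" using k by (simp add: P_def)
  then have "P \<noteq> 0" by auto
  have "Polynomial.degree P \<le> 2 * k" unfolding P_def by (rule degree_diff_le) (simp_all add: degree_monom_le)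
  then have "card {x. poly P x = 0} \<le> 2 * k" using card_poly_roots_bound[OF \<open>P \<noteq> 0\<close>] by linarith
  moreover have "card (UNIV - {0 :: 'p mod_ring}) = 6 * k" using card by (simp add: card_Diff_singleton)
  ultimately have "\<not> UNIV - {0} \<subseteq> {x. poly P x = 0}"
    using k card_mono[of "{x. poly P x = 0}" "UNIV - {0}"] by auto
  then obtain x :: "'p mod_ring" where x: "x \<noteq> 0" "x ^ (2 * k) \<noteq> 1" by (auto simp: P_def poly_monom)
  define y where "y = x ^ (2 * k)"
  have "y ^ 3 = x ^ (6 * k)" by (simp add: y_def flip: power_mult)
  then have "y ^ 3 = 1" using mod_ring_fermat[OF x(1)] card by simp
  moreover have "y ^ 3 - 1 = (y - 1) * (y ^ 2 + y + 1)" by (simp add: algebra_simps power2_eq_square power3_eq_cube)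
  ultimately have y: "y ^ 2 + y + 1 = 0" using x(2) by (simp add: y_def)
  have fac: "r ^ 4 + r ^ 2 + 1 = (r - y) * (r - (- 1 - y)) * (r + y) * (r - (1 + y))" for r
    using y by Groebner_Basis.algebra
  have roots: "{r. r ^ 4 + r ^ 2 + 1 = 0} = {y, - 1 - y, - y, 1 + y}"
    unfolding fac by (auto simp: add_eq_0_iff2)
  have "2 * y + 1 \<noteq> 0"
  proof
    assume "2 * y + 1 = 0"
    moreover have "4 * (y ^ 2 + y + 1) - (2 * y + 1) ^ 2 = 3" by (simp add: algebra_simps power2_eq_square)
    ultimately have "(3 :: 'p mod_ring) = 0" using y by simp
    then show False using three by simp
  qed
  moreover have "y \<noteq> 0" "y \<noteq> - 1" using y by auto
  moreover have "y - (- 1 - y) = 2 * y + 1" "y - (- y) = 2 * y" "- 1 - y - (1 + y) = - (2 * (y + 1))" "- y - (1 + y) = - (2 * y + 1)"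
    by simp_all
  ultimately have "y \<noteq> - 1 - y" "y \<noteq> - y" "- 1 - y \<noteq> 1 + y" "- y \<noteq> 1 + y"
    using two by (metis right_minus_eq, metis right_minus_eq mult_eq_0_iff,
      metis right_minus_eq mult_eq_0_iff neg_equal_0_iff_equal add_eq_0_iff2, metis right_minus_eq neg_equal_0_iff_equal)
  then have "card {y, - 1 - y, - y, 1 + y} = 4" by simp
  then show "card {r :: 'p mod_ring. r ^ 4 + r ^ 2 + 1 = 0} = 4" unfolding roots .
qed

lemma exceptional_char3:
  fixes r :: "'p::prime_card mod_ring"
  assumes "CARD('p) = 3" "r \<noteq> 0"
  shows "(3 :: 'p mod_ring) = 0" "r ^ 4 + r ^ 2 + 1 = 0"
proof -
  show three: "(3 :: 'p mod_ring) = 0" unfolding mod_ring_numeral using assms(1) by simp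
  have "r ^ 2 = 1" using mod_ring_fermat[OF assms(2)] assms(1) by simp
  moreover have "r ^ 4 = (r ^ 2) ^ 2" by simp
  ultimately show "r ^ 4 + r ^ 2 + 1 = 0" using three by simp
qed

lemma card_nonzero: "card {r :: 'p::prime_card mod_ring. r \<noteq> 0} = CARD('p) - 1"
proof -
  have "{r :: 'p mod_ring. r \<noteq> 0} = UNIV - {0}" by auto
  then show ?thesis by (simp add: card_Diff_singleton)
qed

section \<open>Type groups\<close>

text \<open>In the last case any admissible stable parameter gives the same group; the one chosen
  here has \<open>kap\<close> equal to 1.\<close>

definition type_group :: "'k::field \<Rightarrow> ('k laurent ^ 2 ^ 2) set set" where
  "type_group r =
     (if r ^ 4 + r ^ 2 + 1 \<noteq> 0 then gen {pclass (elem_mat r)}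
      else if (3 :: 'k) = 0 then gen (add3_upper_gens r \<union> add3_lower_gens r)
      else gen ({pclass (stable_mat r (3 * r + inverse r + 1))} \<union> aff_upper_gens r \<union> aff_lower_gens r))"

lemma pclass_elem: "pclass (elem_mat r) = cls (elem r)"
  by (simp add: cls_def qmat_elem)

lemma type_group_elementary: "r ^ 4 + r ^ 2 + 1 \<noteq> 0 \<Longrightarrow> type_group r = gen {cls (elem r)}"
  by (simp add: type_group_def pclass_elem)

lemma (in exceptional3) type_group_3: "type_group \<tau> = tgroup3"
  by (simp add: type_group_def tau three tgroup3_def)

lemma (in exceptional6) type_group_6: "kap a \<noteq> 0 \<Longrightarrow> type_group \<tau> = tgroup a"
proof -
  define b where "b = 3 * \<tau> + inverse \<tau> + 1"
  have "kap b \<noteq> 0" by (simp add: b_def kap_def tinv_inverse)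
  then show "kap a \<noteq> 0 \<Longrightarrow> type_group \<tau> = tgroup a"
    using tgroup_independent[of a b] three by (simp add: type_group_def tau tgroup_def pclass_gens b_def)
qed

lemma exceptional_cases:
  fixes r :: "'p::prime_card mod_ring"
  obtains "r ^ 4 + r ^ 2 + 1 \<noteq> 0" | "exceptional3 r" | "exceptional6 r"
proof (cases "r ^ 4 + r ^ 2 + 1 = 0")
  case True
  have "(6 :: 'p mod_ring) = 2 * 3" by simp
  then have "(3 :: 'p mod_ring) = 0 \<or> (6 :: 'p mod_ring) \<noteq> 0" using exceptional_odd[OF True] by (metis mult_eq_0_iff)
  then show ?thesis using that(2,3) True
    by (auto simp: exceptional3_def exceptional3_axioms_def exceptional6_def exceptional6_axioms_def exceptional_def)
qed (rule that(1))

lemma (in exceptional6) stable_exists: obtains a where "kap a \<noteq> 0"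
  by (rule that[of "3 * \<tau> + tinv + 1"]) (simp add: kap_def)

lemma subgroup_type_group: "subgroup (type_group r) quat_group" for r :: "'p::prime_card mod_ring"
proof (rule exceptional_cases[of r])
  assume r: "r ^ 4 + r ^ 2 + 1 \<noteq> 0"
  then show ?thesis unfolding type_group_elementary[OF r] using qunit_elem[OF r] by (intro Q.generate_is_subgroup) simp
next
  assume "exceptional3 r"
  then interpret exceptional3 r .
  show ?thesis unfolding type_group_3 by (rule subgroup_tgroup3)
next
  assume "exceptional6 r"
  then interpret exceptional6 r .
  obtain a where a: "kap a \<noteq> 0" by (rule stable_exists)
  show ?thesis unfolding type_group_6[OF a] by (rule subgroup_tgroup[OF a])
qed

lemma type_group_type:
  fixes r :: "'p::prime_card mod_ring"
  assumes M: "M \<in> carrier quat_group" "\<And>b. \<not> ctype r b M" and g: "g \<in> type_group r" "g \<noteq> \<one>\<^bsub>quat_group\<^esub>"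
  shows "\<exists>b. ctype r b (M \<otimes>\<^bsub>quat_group\<^esub> g)"
proof (rule exceptional_cases[of r])
  assume r: "r ^ 4 + r ^ 2 + 1 \<noteq> 0"
  interpret free_pingpong quat_group "{r}" "\<lambda>r. cls (elem r)" ctype
    by (rule elem_pingpong) (use r in simp)
  show ?thesis using T_generate[OF M(1) _ _ g(2)] M(2) g(1) type_group_elementary[OF r] by simp
next
  assume "exceptional3 r"
  then interpret exceptional3 r .
  show ?thesis using tgroup3_type[OF M _ g(2)] g(1) by (simp add: type_group_3)
next
  assume "exceptional6 r"
  then interpret exceptional6 r .
  obtain a where a: "kap a \<noteq> 0" by (rule stable_exists)
  show ?thesis using tgroup_type[OF a M _ g(2)] g(1) by (simp add: type_group_6[OF a])
qed

lemma type_group_descent: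
  fixes r :: "'p::prime_card mod_ring"
  assumes x: "qunit x" "qtype r b x"
  shows "\<exists>u. qunit u \<and> cls u \<in> type_group r \<and> ((width (x * u), offset (x * u)), (width x, offset x)) \<in> less_than <*lex*> less_than"
proof (rule exceptional_cases[of r])
  assume r: "r ^ 4 + r ^ 2 + 1 \<noteq> 0"
  have u: "qunit (elem r)" by (rule qunit_elem[OF r])
  have mem: "cls (elem r) \<in> type_group r" unfolding type_group_elementary[OF r] by (rule generate.incl) simp
  then have mem': "cls (dag (elem r)) \<in> type_group r"
    using subgroup.m_inv_closed[OF subgroup_type_group mem] u by (simp add: cls_inv)
  show ?thesis
  proof (cases "r = 0")
    case True
    then show ?thesis using offset_reduce[OF x(1), of b] x(2) u mem mem'
      by (intro exI[of _ "if b then dag (elem 0) else elem 0"]) auto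
  next
    case False
    show ?thesis
    proof (cases b)
      case True
      then show ?thesis using width_elem[OF x(1) _ False] x(2) u mem' by (intro exI[of _ "dag (elem r)"]) (simp add: qtype_def)
    next
      case b: False
      then have "Up r (qflip x)" using x by (intro Lo_flip[OF x(1) False]) (simp add: qtype_def)
      then have "width (qflip x * dag (elem r)) < width (qflip x)" using x(1) by (intro width_elem[OF _ _ False]) simp_all
      moreover have "qflip (dag (elem r)) = elem r" by (intro qn_eqI) simp_all
      ultimately have "width (x * elem r) < width x"
        using width_flip[of "qflip x * dag (elem r)"] width_flip[of x] by (simp add: qflip_mult)
      then show ?thesis using u mem by (intro exI[of _ "elem r"]) simp
    qed
  qed
next
  assume "exceptional3 r"
  then interpret exceptional3 r .
  show ?thesis using tgroup3_descent[OF x] by (auto simp: type_group_3)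
next
  assume "exceptional6 r"
  then interpret exceptional6 r .
  obtain a where a: "kap a \<noteq> 0" by (rule stable_exists)
  show ?thesis using tgroup_descent[OF a x] by (auto simp: type_group_6[OF a])
qed

text \<open>Lexicographic descent on width and offset. A minimal element has no type at all, hence
  is a constant and represents the identity.\<close>

lemma type_groups_generate: "gen (\<Union>r. type_group r) = carrier (quat_group :: ('p::prime_card mod_ring laurent ^ 2 ^ 2) set monoid)"
proof
  have sub: "(\<Union>r. type_group r) \<subseteq> carrier (quat_group :: ('p mod_ring laurent ^ 2 ^ 2) set monoid)"
    using subgroup.subset[OF subgroup_type_group] by blast
  then show "gen (\<Union>r. type_group r) \<subseteq> carrier (quat_group :: ('p mod_ring laurent ^ 2 ^ 2) set monoid)"
    by (rule Q.generate_incl)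
  have "cls x \<in> gen (\<Union>r. type_group r)" if "qunit x" for x :: "'p mod_ring qn"
    using that
  proof (induction "(width x, offset x)" arbitrary: x rule: wf_induct_rule[OF wf_lex_prod[OF wf_less_than wf_less_than]])
    case 1
    show ?case
    proof (cases "\<exists>c. c \<noteq> 0 \<and> x = qc c")
      case True
      then have "cls x = \<one>\<^bsub>quat_group\<^esub>" using cls_eq_one_iff[OF 1(2)] by blast
      then show ?thesis by (simp add: generate.one)
    next
      case False
      then obtain r b where "qtype r b x" using qtype_exists[OF 1(2)] by blast
      then obtain u where u: "qunit u" "cls u \<in> type_group r"
          "((width (x * u), offset (x * u)), (width x, offset x)) \<in> less_than <*lex*> less_than"
        using type_group_descent[OF 1(2)] by blast
      have "cls (x * u) \<in> gen (\<Union>r. type_group r)" using 1(1)[OF u(3)] 1(2) u(1) by (simp add: qunit_mult)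
      moreover have "inv\<^bsub>quat_group\<^esub> cls u \<in> gen (\<Union>r. type_group r)" using u(2) by (intro generate.inv) blast
      moreover have "cls x = cls (x * u) \<otimes>\<^bsub>quat_group\<^esub> inv\<^bsub>quat_group\<^esub> cls u"
        using u(1) 1(2) by (simp flip: cls_mult add: Q.m_assoc)
      ultimately show ?thesis by (simp only: generate.eng)
    qed
  qed
  then show "carrier quat_group \<subseteq> gen (\<Union>r. type_group (r :: 'p mod_ring))" by (auto simp: quat_carrier)
qed

lemma type_groups_free_product: "internal_free_product quat_group UNIV (type_group :: 'p::prime_card mod_ring \<Rightarrow> _)"
proof -
  have "fp_pingpong quat_group UNIV (\<lambda>r :: 'p mod_ring. subgrp (type_group r)) (\<lambda>_ x. x) (\<lambda>r M. \<exists>b. ctype r b M) (\<lambda>r M. \<exists>b. ctype r b M)"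
  proof (intro fp_pingpong.intro fp_pingpong_axioms.intro group_quat_group)
    show "group (subgrp (type_group r))" for r :: "'p mod_ring"
      by (rule subgroup.subgroup_is_group[OF subgroup_type_group]) (rule group_quat_group)
    show "(\<lambda>x. x) \<in> hom (subgrp (type_group r)) quat_group" for r :: "'p mod_ring"
      using subgroup.subset[OF subgroup_type_group, of r] by (auto simp: hom_def)
    show "r = r'" if "M \<in> carrier quat_group" "\<exists>b. ctype r b M" "\<exists>b. ctype r' b M" for r r' :: "'p mod_ring" and M
      using ctype_unique that by blast
    show "\<exists>b. ctype r b (M \<otimes>\<^bsub>quat_group\<^esub> x)"
      if "M \<in> carrier quat_group" "\<not> (\<exists>b. ctype r b M)" "x \<in> carrier (subgrp (type_group r))" "x \<noteq> \<one>\<^bsub>subgrp (type_group r)\<^esub>"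
      for r :: "'p mod_ring" and M x
      using type_group_type[of M r x] that by simp
    show "\<not> (\<exists>b. ctype r b \<one>\<^bsub>quat_group\<^esub>)" for r :: "'p mod_ring" using ctype_one by blast
  qed assumption
  then have "internal_free_product (subgrp (gen (\<Union>r::'p mod_ring. type_group r))) UNIV (type_group :: 'p mod_ring \<Rightarrow> _)"
    by (rule Q.internal_free_product_generate) (rule subgroup_type_group)
  then show ?thesis unfolding type_groups_generate by simp
qed

lemma quat_type_type_group:
  fixes r :: "'p::prime_card mod_ring"
  assumes "M \<in> type_group r" "M \<noteq> \<one>\<^bsub>quat_group\<^esub>"
  shows "quat_type M = r"
proof -
  have M: "M \<in> carrier quat_group" using subgroup.subset[OF subgroup_type_group] assms(1) by blast
  then show ?thesis using type_group_type[OF Q.one_closed ctype_one assms] ctype_quat_type[OF M] by auto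
qed

lemma elementary_cyclic:
  assumes r: "r ^ 4 + r ^ 2 + 1 \<noteq> 0"
  shows "subgrp (gen {cls (elem r)}) \<cong> integer_group"
proof (rule Q.cyclic_iso_integer_group)
  show c: "cls (elem r) \<in> carrier quat_group" using qunit_elem[OF r] by simp
  interpret free_pingpong quat_group "{r}" "\<lambda>r. cls (elem r)" ctype
    by (rule elem_pingpong) (use r in simp)
  show "cls (elem r) [^]\<^bsub>quat_group\<^esub> Suc n \<noteq> \<one>\<^bsub>quat_group\<^esub>" for n
  proof (rule Q.power_nontrivial[OF c, of "ctype r True" "ctype r False"])
    show "ctype r True (M \<otimes>\<^bsub>quat_group\<^esub> cls (elem r))" if "M \<in> carrier quat_group" "\<not> ctype r False M" for M
      using T_step[of r M True] that by simp
    show "\<not> ctype r False M" if "M \<in> carrier quat_group" "ctype r True M" for M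
      using that ctype_unique by blast
  qed (rule ctype_one)+
qed

text \<open>Freeness is ping-pong with all the elementary generators at once; they generate because
  each type group is cyclic.\<close>

lemma elementary_free:
  assumes r: "\<And>r :: 'p::prime_card mod_ring. r ^ 4 + r ^ 2 + 1 \<noteq> 0"
  shows "freely_generated_by quat_group UNIV (\<lambda>r :: 'p mod_ring. cls (elem r))"
proof -
  interpret free_pingpong quat_group UNIV "\<lambda>r :: 'p mod_ring. cls (elem r)" ctype
    by (rule elem_pingpong) (rule r)
  have sub: "range (\<lambda>r :: 'p mod_ring. cls (elem r)) \<subseteq> carrier quat_group" using x_closed by auto
  have "(\<Union>r :: 'p mod_ring. type_group r) \<subseteq> gen (range (\<lambda>r :: 'p mod_ring. cls (elem r)))"
    unfolding type_group_elementary[OF r] using Q.mono_generate[of "{cls (elem _)}" "range (\<lambda>r :: 'p mod_ring. cls (elem r))"] by blast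
  then have "carrier quat_group \<subseteq> gen (range (\<lambda>r :: 'p mod_ring. cls (elem r)))"
    unfolding type_groups_generate[symmetric] by (rule Q.generate_subgroup_incl) (rule Q.generate_is_subgroup[OF sub])
  then show ?thesis using Q.generate_incl[OF sub] by (intro freely_generated) blast
qed

lemma (in exceptional6) type_group_iso:
  "subgrp (type_group \<tau>) \<cong> hnn_extension aff_product (dil_incl True) (incl_swap :: (bool \<times> 'k poly \<times> 'k) list set \<Rightarrow> _)"
  "hnn_extension aff_product (dil_incl True) (incl_swap :: (bool \<times> 'k poly \<times> 'k) list set \<Rightarrow> _) \<cong> subgrp (type_group \<tau>)"
proof -
  obtain a where a: "kap a \<noteq> 0" by (rule stable_exists)
  show "hnn_extension aff_product (dil_incl True) (incl_swap :: (bool \<times> 'k poly \<times> 'k) list set \<Rightarrow> _) \<cong> subgrp (type_group \<tau>)"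
    unfolding type_group_6[OF a] is_iso_def using tgroup_iso(1)[OF a] by blast
  then show "subgrp (type_group \<tau>) \<cong> hnn_extension aff_product (dil_incl True) (incl_swap :: (bool \<times> 'k poly \<times> 'k) list set \<Rightarrow> _)"
    using group.iso_sym[OF tgroup_iso(2)[OF a]] by blast
qed

lemma type_group_char3:
  fixes \<tau> :: "'p::prime_card mod_ring"
  assumes p: "CARD('p) = 3" and "\<tau> \<noteq> 0"
  shows "comm_group (subgrp (gen (add3_upper_gens \<tau>)))
       \<and> subgrp (gen (add3_upper_gens \<tau>)) \<cong> (poly_add_group :: 'p mod_ring poly monoid)
       \<and> comm_group (subgrp (gen (add3_lower_gens \<tau>)))
       \<and> subgrp (gen (add3_lower_gens \<tau>)) \<cong> (poly_add_group :: 'p mod_ring poly monoid)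
       \<and> internal_free_product (subgrp (type_group \<tau>)) (UNIV :: bool set)
           (\<lambda>up. if up then gen (add3_upper_gens \<tau>) else gen (add3_lower_gens \<tau>))
       \<and> subgrp (type_group \<tau>) \<cong>
           free_product (UNIV :: bool set) (\<lambda>_. poly_add_group :: 'p mod_ring poly monoid)"
    and "free_product (UNIV :: bool set) (\<lambda>_. poly_add_group :: 'p mod_ring poly monoid) \<cong> subgrp (type_group \<tau>)"
proof -
  interpret exceptional3 \<tau> using exceptional_char3[OF p] assms(2) by unfold_locales simp_all
  show "free_product (UNIV :: bool set) (\<lambda>_. poly_add_group :: 'p mod_ring poly monoid) \<cong> subgrp (type_group \<tau>)"
    unfolding type_group_3
    by (rule group.iso_sym[OF subgroup.subgroup_is_group[OF subgroup_tgroup3 group_quat_group] tgroup3_iso])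
  show "comm_group (subgrp (gen (add3_upper_gens \<tau>)))
       \<and> subgrp (gen (add3_upper_gens \<tau>)) \<cong> (poly_add_group :: 'p mod_ring poly monoid)
       \<and> comm_group (subgrp (gen (add3_lower_gens \<tau>)))
       \<and> subgrp (gen (add3_lower_gens \<tau>)) \<cong> (poly_add_group :: 'p mod_ring poly monoid)
       \<and> internal_free_product (subgrp (type_group \<tau>)) (UNIV :: bool set)
           (\<lambda>up. if up then gen (add3_upper_gens \<tau>) else gen (add3_lower_gens \<tau>))
       \<and> subgrp (type_group \<tau>) \<cong>
           free_product (UNIV :: bool set) (\<lambda>_. poly_add_group :: 'p mod_ring poly monoid)"
    using tgroup3_free_product tgroup3_iso by (simp add: type_group_3 add3_gens gen_add3)
qed

context exceptional6
begin

definition beta :: "('k laurent ^ 2 ^ 2) set \<Rightarrow> ('k laurent ^ 2 ^ 2) set" where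
  "beta = dil_swap (phi True) (phi False)"

lemma beta_iso: "beta \<in> iso (subgrp (gen (mult_upper_gens \<tau>))) (subgrp (gen (mult_lower_gens \<tau>)))"
  unfolding beta_def upper_rep(2) lower_rep(2) by (rule dil_swap_iso[OF phi_hom phi_inj phi_hom phi_inj])

lemma beta_phi: "c \<noteq> 0 \<Longrightarrow> beta (phi True (0, c)) = phi False (0, inverse c)"
  unfolding beta_def by (rule dil_swap[OF phi_inj])

lemma beta_mult: "b \<in> mult_params \<tau> \<Longrightarrow> beta (pclass (mult_upper \<tau> b)) = pclass (mult_lower \<tau> b)"
  using beta_phi[of "(b - lam) / (b + lam)"] by (simp add: mult_params pclass_gens)

lemma incl_swap_beta:
  assumes "x \<in> aff_dilations" "y \<in> aff_dilations" "phi False y = beta (phi True x)"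
  shows "incl_swap (incl True x) = incl False y"
proof -
  obtain c d where cd: "c \<noteq> 0" "x = (0, c)" "d \<noteq> 0" "y = (0, d)" using assms(1,2) by (auto simp: aff_dilations_def)
  then have "phi False (0, d) = phi False (0, inverse c)" using assms(3) beta_phi by simp
  then have "(0 :: 'k poly, d) = (0, inverse c)" by (rule inj_onD[OF phi_inj]) (use cd in \<open>simp_all add: aff_simps\<close>)
  then show ?thesis using cd incl_swap(2)[of c] by simp
qed

end

theorem theorem3p11:
  fixes p :: nat
  assumes p: "p = CARD('p::prime_card)"
  shows "\<exists>\<G> :: 'p mod_ring \<Rightarrow> ('p mod_ring laurent ^ 2 ^ 2) set set.
    (\<forall>r. subgroup (\<G> r) quat_group)
    \<and> \<comment> \<open>(1)\<close>
    (\<forall>r. \<forall>M \<in> \<G> r. M \<noteq> \<one>\<^bsub>quat_group\<^esub> \<longrightarrow> quat_type M = r)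
    \<and> \<comment> \<open>(2)\<close>
    internal_free_product quat_group UNIV \<G>
    \<and> \<comment> \<open>(3)\<close>
    (\<forall>r. r ^ 4 + r ^ 2 + 1 \<noteq> 0 \<longrightarrow>
       \<G> r = gen {pclass (elem_mat r)} \<and> subgrp (\<G> r) \<cong> integer_group)
    \<and> (p mod 6 = 2 \<or> p mod 6 = 5 \<longrightarrow>
       freely_generated_by quat_group UNIV (\<lambda>r :: 'p mod_ring. pclass (elem_mat r)))
    \<and> \<comment> \<open>(4)\<close>
    (p = 3 \<longrightarrow> (\<forall>\<tau> :: 'p mod_ring. \<tau> \<noteq> 0 \<longrightarrow>
       comm_group (subgrp (gen (add3_upper_gens \<tau>)))
       \<and> subgrp (gen (add3_upper_gens \<tau>)) \<cong> (poly_add_group :: 'p mod_ring poly monoid)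
       \<and> comm_group (subgrp (gen (add3_lower_gens \<tau>)))
       \<and> subgrp (gen (add3_lower_gens \<tau>)) \<cong> (poly_add_group :: 'p mod_ring poly monoid)
       \<and> internal_free_product (subgrp (\<G> \<tau>)) (UNIV :: bool set)
           (\<lambda>up. if up then gen (add3_upper_gens \<tau>) else gen (add3_lower_gens \<tau>))
       \<and> subgrp (\<G> \<tau>) \<cong>
           free_product (UNIV :: bool set) (\<lambda>_. poly_add_group :: 'p mod_ring poly monoid)))
    \<and> \<comment> \<open>(5)\<close>
    (p mod 6 = 1 \<longrightarrow> (\<forall>\<tau> :: 'p mod_ring. \<tau> ^ 4 + \<tau> ^ 2 + 1 = 0 \<longrightarrow>
       \<comment> \<open>(a)\<close>
       comm_group (subgrp (gen (add_upper_gens \<tau>)))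
       \<and> subgrp (gen (add_upper_gens \<tau>)) \<cong> (poly_add_group :: 'p mod_ring poly monoid)
       \<and> comm_group (subgrp (gen (add_lower_gens \<tau>)))
       \<and> subgrp (gen (add_lower_gens \<tau>)) \<cong> (poly_add_group :: 'p mod_ring poly monoid)
       \<and> \<comment> \<open>(b)\<close>
       comm_group (subgrp (gen (mult_upper_gens \<tau>)))
       \<and> subgrp (gen (mult_upper_gens \<tau>)) \<cong> (unit_group :: 'p mod_ring monoid)
       \<and> comm_group (subgrp (gen (mult_lower_gens \<tau>)))
       \<and> subgrp (gen (mult_lower_gens \<tau>)) \<cong> (unit_group :: 'p mod_ring monoid)
       \<and> \<comment> \<open>(c)\<close>
       (\<exists>\<phi>. aff_identification (aff_upper_gens \<tau>) (add_upper_gens \<tau>) (mult_upper_gens \<tau>) \<phi>)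
       \<and> (\<exists>\<phi>. aff_identification (aff_lower_gens \<tau>) (add_lower_gens \<tau>) (mult_lower_gens \<tau>) \<phi>)
       \<and> \<comment> \<open>(d)\<close>
       (\<forall>a \<in> stable_params \<tau>. subgrp (gen {pclass (stable_mat \<tau> a)}) \<cong> integer_group)
       \<and> \<comment> \<open>(e)\<close>
       (\<forall>a \<in> stable_params \<tau>.
          \<G> \<tau> = gen ({pclass (stable_mat \<tau> a)} \<union> aff_upper_gens \<tau> \<union> aff_lower_gens \<tau>))
       \<and> internal_free_product (subgrp (gen (aff_upper_gens \<tau> \<union> aff_lower_gens \<tau>))) (UNIV :: bool set)
           (\<lambda>up. if up then gen (aff_upper_gens \<tau>) else gen (aff_lower_gens \<tau>))
       \<and> (\<exists>\<beta> \<in> iso (subgrp (gen (mult_upper_gens \<tau>))) (subgrp (gen (mult_lower_gens \<tau>))).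
            (\<forall>b \<in> mult_params \<tau>. \<beta> (pclass (mult_upper \<tau> b)) = pclass (mult_lower \<tau> b))
            \<and> (\<forall>a \<in> stable_params \<tau>.
                 internal_hnn_extension (subgrp (\<G> \<tau>)) (gen (aff_upper_gens \<tau> \<union> aff_lower_gens \<tau>))
                   (gen (mult_upper_gens \<tau>)) (gen (mult_lower_gens \<tau>)) \<beta> (pclass (stable_mat \<tau> a)))
            \<and> (\<exists>\<phi>u \<phi>l \<alpha>.
                 let P = free_product (UNIV :: bool set) (\<lambda>_. aff_group :: ('p mod_ring poly \<times> 'p mod_ring) monoid);
                     iu = free_product_incl (UNIV :: bool set) (\<lambda>_. aff_group) True;
                     il = free_product_incl (UNIV :: bool set) (\<lambda>_. aff_group) False;
                     Du = iu ` aff_dilations;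
                     Dl = il ` aff_dilations
                 in
                 aff_identification (aff_upper_gens \<tau>) (add_upper_gens \<tau>) (mult_upper_gens \<tau>) \<phi>u
                 \<and> aff_identification (aff_lower_gens \<tau>) (add_lower_gens \<tau>) (mult_lower_gens \<tau>) \<phi>l
                 \<and> \<alpha> \<in> iso (P\<lparr>carrier := Du\<rparr>) (P\<lparr>carrier := Dl\<rparr>)
                 \<and> (\<forall>x \<in> aff_dilations. \<forall>y \<in> aff_dilations. \<phi>l y = \<beta> (\<phi>u x) \<longrightarrow> \<alpha> (iu x) = il y)
                 \<and> (\<forall>a \<in> stable_params \<tau>. \<exists>\<psi> \<in> iso (hnn_extension P Du \<alpha>) (subgrp (\<G> \<tau>)).
                      (\<forall>x \<in> carrier aff_group. \<psi> (hnn_incl P Du \<alpha> (iu x)) = \<phi>u x)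
                      \<and> (\<forall>x \<in> carrier aff_group. \<psi> (hnn_incl P Du \<alpha> (il x)) = \<phi>l x)
                      \<and> \<psi> (hnn_stable P Du \<alpha>) = pclass (stable_mat \<tau> a))))))
    \<and> (p = 3 \<longrightarrow>
         card {\<tau> :: 'p mod_ring. \<tau> \<noteq> 0} = 2
         \<and> (\<forall>\<tau> \<tau>'. \<tau> \<noteq> 0 \<and> \<tau>' \<noteq> 0 \<longrightarrow> subgrp (\<G> \<tau>) \<cong> subgrp (\<G> \<tau>')))
    \<and> (p mod 6 = 1 \<longrightarrow>
         card {\<tau> :: 'p mod_ring. \<tau> ^ 4 + \<tau> ^ 2 + 1 = 0} = 4
         \<and> (\<forall>\<tau> \<tau>'. \<tau> ^ 4 + \<tau> ^ 2 + 1 = 0 \<and> \<tau>' ^ 4 + \<tau>' ^ 2 + 1 = 0 \<longrightarrow>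
              subgrp (\<G> \<tau>) \<cong> subgrp (\<G> \<tau>')))"
proof (intro exI[of _ type_group] conjI allI impI ballI)
  show "subgroup (type_group r) quat_group" for r :: "'p mod_ring" by (rule subgroup_type_group)
  show "quat_type M = r" if "M \<in> type_group r" "M \<noteq> \<one>\<^bsub>quat_group\<^esub>" for r :: "'p mod_ring" and M
    using that by (rule quat_type_type_group)
  show "internal_free_product quat_group UNIV (type_group :: 'p mod_ring \<Rightarrow> _)" by (rule type_groups_free_product)
  show "type_group r = gen {pclass (elem_mat r)}" "subgrp (type_group r) \<cong> integer_group"
    if "r ^ 4 + r ^ 2 + 1 \<noteq> 0" for r :: "'p mod_ring"
    using elementary_cyclic[OF that] type_group_elementary[OF that] by (simp_all add: pclass_elem)
  show "freely_generated_by quat_group UNIV (\<lambda>r :: 'p mod_ring. pclass (elem_mat r))" if "p mod 6 = 2 \<or> p mod 6 = 5"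
    unfolding pclass_elem using that unfolding p by (intro elementary_free not_exceptional_prime)
  show "card {\<tau> :: 'p mod_ring. \<tau> \<noteq> 0} = 2" if "p = 3"
    using card_nonzero[where 'p = 'p] that p by simp
  show "card {\<tau> :: 'p mod_ring. \<tau> ^ 4 + \<tau> ^ 2 + 1 = 0} = 4" if "p mod 6 = 1"
    using card_exceptional(2) that unfolding p .
  show "subgrp (type_group \<tau>) \<cong> subgrp (type_group \<tau>')" if "p = 3" "\<tau> \<noteq> 0 \<and> \<tau>' \<noteq> 0" for \<tau> \<tau>' :: "'p mod_ring"
  proof -
    have "CARD('p) = 3" using that(1) p by simp
    then show ?thesis
      using type_group_char3(1)[of \<tau>] type_group_char3(2)[of \<tau>'] that(2) by (blast intro: iso_trans)
  qed
  show "subgrp (type_group \<tau>) \<cong> subgrp (type_group \<tau>')"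
    if "p mod 6 = 1" "\<tau> ^ 4 + \<tau> ^ 2 + 1 = 0 \<and> \<tau>' ^ 4 + \<tau>' ^ 2 + 1 = 0" for \<tau> \<tau>' :: "'p mod_ring"
  proof -
    have six: "(6 :: 'p mod_ring) \<noteq> 0" using card_exceptional(1)[where 'p = 'p] that(1) p by simp
    interpret t: exceptional6 \<tau> using six that(2) by unfold_locales simp_all
    interpret t': exceptional6 \<tau>' using six that(2) by unfold_locales simp_all
    \<comment> \<open>Both groups are isomorphic to the same abstract HNN extension, in which \<tau>
      does not occur.\<close>
    show ?thesis using t.type_group_iso(1) t'.type_group_iso(2) by (rule iso_trans)
  qed
next
  fix \<tau> :: "'p mod_ring"
  assume "p = 3" "\<tau> \<noteq> 0"
  then have p3: "CARD('p) = 3" and \<tau>: "\<tau> \<noteq> 0" using p by simp_all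
  note facts = type_group_char3(1)[OF p3 \<tau>]
  show "comm_group (subgrp (gen (add3_upper_gens \<tau>)))"
    "subgrp (gen (add3_upper_gens \<tau>)) \<cong> (poly_add_group :: 'p mod_ring poly monoid)"
    "comm_group (subgrp (gen (add3_lower_gens \<tau>)))"
    "subgrp (gen (add3_lower_gens \<tau>)) \<cong> (poly_add_group :: 'p mod_ring poly monoid)"
    "internal_free_product (subgrp (type_group \<tau>)) (UNIV :: bool set)
      (\<lambda>up. if up then gen (add3_upper_gens \<tau>) else gen (add3_lower_gens \<tau>))"
    "subgrp (type_group \<tau>) \<cong> free_product (UNIV :: bool set) (\<lambda>_. poly_add_group :: 'p mod_ring poly monoid)"
    using facts by blast+
next
  fix \<tau> :: "'p mod_ring"
  assume p1: "p mod 6 = 1" and tau: "\<tau> ^ 4 + \<tau> ^ 2 + 1 = 0"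
  interpret exceptional6 \<tau> using card_exceptional(1)[where 'p = 'p] p1 tau p by unfold_locales simp_all
  show "comm_group (subgrp (gen (add_upper_gens \<tau>)))"
    "subgrp (gen (add_upper_gens \<tau>)) \<cong> (poly_add_group :: 'p mod_ring poly monoid)"
    "comm_group (subgrp (gen (mult_upper_gens \<tau>)))"
    "subgrp (gen (mult_upper_gens \<tau>)) \<cong> (unit_group :: 'p mod_ring monoid)"
    by (rule upper_rep)+
  show "comm_group (subgrp (gen (add_lower_gens \<tau>)))"
    "subgrp (gen (add_lower_gens \<tau>)) \<cong> (poly_add_group :: 'p mod_ring poly monoid)"
    "comm_group (subgrp (gen (mult_lower_gens \<tau>)))"
    "subgrp (gen (mult_lower_gens \<tau>)) \<cong> (unit_group :: 'p mod_ring monoid)"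
    by (rule lower_rep)+
  show "\<exists>\<phi>. aff_identification (aff_upper_gens \<tau>) (add_upper_gens \<tau>) (mult_upper_gens \<tau>) \<phi>"
    "\<exists>\<phi>. aff_identification (aff_lower_gens \<tau>) (add_lower_gens \<tau>) (mult_lower_gens \<tau>) \<phi>"
    using upper_rep(4) lower_rep(4) by blast+
  show "subgrp (gen {pclass (stable_mat \<tau> a)}) \<cong> integer_group" if "a \<in> stable_params \<tau>" for a
    using stable_cyclic that by (simp add: stable_params pclass_gens)
  show "type_group \<tau> = gen ({pclass (stable_mat \<tau> a)} \<union> aff_upper_gens \<tau> \<union> aff_lower_gens \<tau>)"
    if "a \<in> stable_params \<tau>" for a
    using type_group_6[of a] that unfolding stable_params pclass_gens tgroup_def .
  show "internal_free_product (subgrp base) (UNIV :: bool set)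
      (\<lambda>up. if up then gen (aff_upper_gens \<tau>) else gen (aff_lower_gens \<tau>))"
    by (rule base_free_product)
  \<comment> \<open>Introduces the three witnesses in a single step with their types fixed, so that
    \<open>intro\<close> below can instantiate them explicitly.\<close>
  have ex3: "P \<phi>u \<phi>l \<alpha> \<Longrightarrow> \<exists>\<phi>u \<phi>l \<alpha>. P \<phi>u \<phi>l \<alpha>"
    for P :: "('p mod_ring poly \<times> 'p mod_ring \<Rightarrow> ('p mod_ring laurent ^ 2 ^ 2) set) \<Rightarrow>
      ('p mod_ring poly \<times> 'p mod_ring \<Rightarrow> ('p mod_ring laurent ^ 2 ^ 2) set) \<Rightarrow>
      ((bool \<times> 'p mod_ring poly \<times> 'p mod_ring) list set \<Rightarrow> (bool \<times> 'p mod_ring poly \<times> 'p mod_ring) list set) \<Rightarrow> bool"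
      and \<phi>u \<phi>l \<alpha> by blast
  show "\<exists>\<beta> \<in> iso (subgrp (gen (mult_upper_gens \<tau>))) (subgrp (gen (mult_lower_gens \<tau>))).
      (\<forall>b \<in> mult_params \<tau>. \<beta> (pclass (mult_upper \<tau> b)) = pclass (mult_lower \<tau> b))
      \<and> (\<forall>a \<in> stable_params \<tau>.
           internal_hnn_extension (subgrp (type_group \<tau>)) base
             (gen (mult_upper_gens \<tau>)) (gen (mult_lower_gens \<tau>)) \<beta> (pclass (stable_mat \<tau> a)))
      \<and> (\<exists>\<phi>u \<phi>l \<alpha>.
           let P = free_product (UNIV :: bool set) (\<lambda>_. aff_group :: ('p mod_ring poly \<times> 'p mod_ring) monoid);
               iu = free_product_incl (UNIV :: bool set) (\<lambda>_. aff_group) True;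
               il = free_product_incl (UNIV :: bool set) (\<lambda>_. aff_group) False;
               Du = iu ` aff_dilations;
               Dl = il ` aff_dilations
           in
           aff_identification (aff_upper_gens \<tau>) (add_upper_gens \<tau>) (mult_upper_gens \<tau>) \<phi>u
           \<and> aff_identification (aff_lower_gens \<tau>) (add_lower_gens \<tau>) (mult_lower_gens \<tau>) \<phi>l
           \<and> \<alpha> \<in> iso (P\<lparr>carrier := Du\<rparr>) (P\<lparr>carrier := Dl\<rparr>)
           \<and> (\<forall>x \<in> aff_dilations. \<forall>y \<in> aff_dilations. \<phi>l y = \<beta> (\<phi>u x) \<longrightarrow> \<alpha> (iu x) = il y)
           \<and> (\<forall>a \<in> stable_params \<tau>. \<exists>\<psi> \<in> iso (hnn_extension P Du \<alpha>) (subgrp (type_group \<tau>)).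
                (\<forall>x \<in> carrier aff_group. \<psi> (hnn_incl P Du \<alpha> (iu x)) = \<phi>u x)
                \<and> (\<forall>x \<in> carrier aff_group. \<psi> (hnn_incl P Du \<alpha> (il x)) = \<phi>l x)
                \<and> \<psi> (hnn_stable P Du \<alpha>) = pclass (stable_mat \<tau> a)))"
    unfolding Let_def
  proof (intro bexI[OF _ beta_iso] conjI ballI impI ex3[of _ "phi True" "phi False" incl_swap])
    show "internal_hnn_extension (subgrp (type_group \<tau>)) base (gen (mult_upper_gens \<tau>)) (gen (mult_lower_gens \<tau>))
        beta (pclass (stable_mat \<tau> a))" if "a \<in> stable_params \<tau>" for a
      using tgroup_hnn type_group_6 that by (simp add: stable_params pclass_gens beta_def)
    show "\<exists>\<psi> \<in> iso (hnn_extension aff_product (dil_incl True) incl_swap) (subgrp (type_group \<tau>)).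
        (\<forall>x \<in> carrier aff_group. \<psi> (hnn_incl aff_product (dil_incl True) incl_swap (incl True x)) = phi True x)
        \<and> (\<forall>x \<in> carrier aff_group. \<psi> (hnn_incl aff_product (dil_incl True) incl_swap (incl False x)) = phi False x)
        \<and> \<psi> (hnn_stable aff_product (dil_incl True) incl_swap) = pclass (stable_mat \<tau> a)"
      if "a \<in> stable_params \<tau>" for a
    proof -
      have a: "kap a \<noteq> 0" using that by (simp add: stable_params)
      show ?thesis using tgroup_iso(1)[OF a] unfolding type_group_6[OF a] pclass_gens by blast
    qed
  qed (rule beta_mult upper_rep lower_rep incl_swap(1) incl_swap_beta; assumption)+
qed

end
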